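(* Let $d\ge2$ and let $\Omega\subset\mathbb R^d$ be compact and connected with nonempty interior $\Omega^{\mathrm o}$ and smooth connected boundary $\partial\Omega$. Fix $a\in(0,1]$, and let $$d_i(x,y)=\sup\{f(x)-f(y):\ f\in\mathcal D_0\},\qquad x,y\in\Omega,$$ be the intrinsic distance on $\Omega$ induced by the Dirichlet form $$\mathcal E(f)=\int_{\Omega^{\mathrm o}}|\nabla f|^2\,c\,d\lambda+a\int_{\partial\Omega}|\nabla^\tau f|^2\,c\,d\sigma ,$$ where $$\mathcal D_0=\big\{f\in\mathcal D^c_b:\ 2\mathcal E(fh,f)-\mathcal E(f^2,h)\le \|h\|_{L^1(\mu)}\ \text{for any }h\in\mathcal D^c_b\big\},\qquad \mathcal D^c_b=\mathcal D(\mathcal E)\cap C_b(\Omega).$$ Then $d_i$ coincides with the distance $d_\Omega$ on $\Omega$: $$d_i(x,y)=d_\Omega(x,y):=\min\Big\{\int_0^1|\dot X_t|\,dt:\ X_0=x,\ X_1=y,\ X_t\in\Omega\ \forall t\in[0,1]\Big\},$$ which for convex $\Omega$ is just the Euclidean distance.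
   Context: $\lambda$ is the Lebesgue measure restricted to $\Omega$, $\sigma$ the Hausdorff (surface) measure on $\partial\Omega$, $\mu=c(\lambda+\sigma)$ with $c=1/(\lambda(\Omega)+\sigma(\partial\Omega))$, $\nabla^\tau$ the tangential gradient along $\partial\Omega$. The domain $\mathcal D(\mathcal E)$ is the closure of $C^1(\Omega)$ under the norm $(\mathcal E(\cdot)+\|\cdot\|^2_{L^2(\mu)})^{1/2}$. $\mathcal E(\cdot,\cdot)$ is the symmetric bilinear form associated with $\mathcal E$, with the multiplicative normalization for which $$2\mathcal E(fh,f)-\mathcal E(f^2,h)=\int_{\Omega^{\mathrm o}}|\nabla f|^2h\,c\,d\lambda+a\int_{\partial\Omega}|\nabla^\tau f|^2h\,c\,d\sigma .$$ *)

theory Defs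
  imports "HOL-Analysis.Analysis"
begin

section \<open>Smooth boundaries and gradients\<close>

text \<open>Meant for open \<open>S\<close>, where it says that all partial derivatives of order up to \<open>k\<close>
  exist and are continuous.\<close>

primrec Ck_on :: "nat \<Rightarrow> 'a::euclidean_space set \<Rightarrow> ('a \<Rightarrow> real) \<Rightarrow> bool" where
  "Ck_on 0 S f \<longleftrightarrow> continuous_on S f"
| "Ck_on (Suc k) S f \<longleftrightarrow>
     (\<forall>x\<in>S. f differentiable (at x)) \<and> (\<forall>v. Ck_on k S (\<lambda>x. frechet_derivative f (at x) v))"

definition smooth_on :: "'a::euclidean_space set \<Rightarrow> ('a \<Rightarrow> real) \<Rightarrow> bool" where
  "smooth_on S f \<longleftrightarrow> (\<forall>k. Ck_on k S f)"

definition gradient :: "('a::euclidean_space \<Rightarrow> real) \<Rightarrow> 'a \<Rightarrow> 'a" where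
  "gradient f x = (THE v. GDERIV f x :> v)"

text \<open>The domain lies locally on one side of its boundary and is the sublevel set of a smooth
  defining function with nonvanishing gradient.\<close>

definition smooth_boundary :: "'a::euclidean_space set \<Rightarrow> bool" where
  "smooth_boundary \<Omega> \<longleftrightarrow>
     (\<forall>p\<in>frontier \<Omega>. \<exists>U \<rho>. open U \<and> p \<in> U \<and> smooth_on U \<rho> \<and>
        (\<forall>x\<in>U. gradient \<rho> x \<noteq> 0) \<and> \<Omega> \<inter> U = {x\<in>U. \<rho> x \<le> 0})"

text \<open>The velocities at time \<open>0\<close> of curves in \<open>M\<close> through \<open>x\<close>.\<close>

definition tangent_space :: "'a::euclidean_space set \<Rightarrow> 'a \<Rightarrow> 'a set" where
  "tangent_space M x =
     {v. \<exists>\<gamma> \<epsilon>. 0 < \<epsilon> \<and> \<gamma> 0 = x \<and> (\<forall>t::real. \<bar>t\<bar> < \<epsilon> \<longrightarrow> \<gamma> t \<in> M) \<and>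
              (\<gamma> has_vector_derivative v) (at 0)}"

text \<open>Differentiation within \<open>M\<close> involves only the values of \<open>f\<close> on \<open>M\<close> and determines the
  representing vector only up to normal components; the tangency condition makes it unique.\<close>

definition tangential_gradient ::
    "'a::euclidean_space set \<Rightarrow> ('a \<Rightarrow> real) \<Rightarrow> 'a \<Rightarrow> 'a" where
  "tangential_gradient M f x =
     (THE v. v \<in> tangent_space M x \<and> (f has_derivative (\<lambda>h. v \<bullet> h)) (at x within M))"

section \<open>The reference measure\<close>

text \<open>The Hausdorff measure of dimension \<open>s > 0\<close>. The factor \<open>unit_ball_vol s\<close> is the usual
  normalization, under which the measure of dimension \<open>DIM('a) - 1\<close> is the surface measure.\<close>

definition hausdorff_content :: "real \<Rightarrow> real \<Rightarrow> 'a::euclidean_space set \<Rightarrow> ennreal" where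
  "hausdorff_content s \<delta> A =
     (INF C \<in> {C :: nat \<Rightarrow> 'a set. A \<subseteq> (\<Union>i. C i) \<and> (\<forall>i. bounded (C i) \<and> diameter (C i) \<le> \<delta>)}.
        \<Sum>i. ennreal (unit_ball_vol s * (diameter (C i) / 2) powr s))"

definition hausdorff_measure :: "real \<Rightarrow> 'a::euclidean_space measure" where
  "hausdorff_measure s = measure_of UNIV (sets borel) (\<lambda>A. SUP \<delta>\<in>{0<..}. hausdorff_content s \<delta> A)"

definition surface_measure :: "'a::euclidean_space set \<Rightarrow> 'a measure" where
  "surface_measure \<Omega> = restrict_space (hausdorff_measure (real DIM('a) - 1)) (frontier \<Omega>)"

definition norm_const :: "'a::euclidean_space set \<Rightarrow> real" where
  "norm_const \<Omega> = 1 / (measure lborel \<Omega> + measure (surface_measure \<Omega>) (frontier \<Omega>))"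

definition ref_measure :: "'a::euclidean_space set \<Rightarrow> 'a measure" where
  "ref_measure \<Omega> = measure_of \<Omega> (sets (restrict_space borel \<Omega>))
     (\<lambda>A. ennreal (norm_const \<Omega>) *
           (emeasure lborel A + emeasure (surface_measure \<Omega>) (A \<inter> frontier \<Omega>)))"

section \<open>The Dirichlet form\<close>

text \<open>Functions on \<open>\<Omega>\<close> are represented by functions on the whole space, whose values
  outside \<open>\<Omega>\<close> never matter.\<close>

definition C1_fun :: "'a::euclidean_space set \<Rightarrow> ('a \<Rightarrow> real) set" where
  "C1_fun \<Omega> = {f. \<exists>g. Ck_on 1 UNIV g \<and> (\<forall>x\<in>\<Omega>. f x = g x)}"

definition pre_energy :: "'a::euclidean_space set \<Rightarrow> real \<Rightarrow> ('a \<Rightarrow> real) \<Rightarrow> real" where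
  "pre_energy \<Omega> a f =
     (LINT x:interior \<Omega>|lborel. (norm (gradient f x))\<^sup>2 * norm_const \<Omega>)
     + a * (LINT x|surface_measure \<Omega>. (norm (tangential_gradient (frontier \<Omega>) f x))\<^sup>2 * norm_const \<Omega>)"

text \<open>A sequence in \<open>C1_fun \<Omega>\<close> that is Cauchy for the energy and converges to \<open>f\<close> in
  \<open>L\<^sup>2\<close> of the reference measure, that is, one that represents \<open>f\<close> in the completion.\<close>

definition approximates ::
    "'a::euclidean_space set \<Rightarrow> real \<Rightarrow> (nat \<Rightarrow> 'a \<Rightarrow> real) \<Rightarrow> ('a \<Rightarrow> real) \<Rightarrow> bool" where
  "approximates \<Omega> a F f \<longleftrightarrow>
     (\<forall>n. F n \<in> C1_fun \<Omega>) \<and>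
     (\<forall>\<epsilon>>0. \<exists>N. \<forall>m\<ge>N. \<forall>n\<ge>N. pre_energy \<Omega> a (\<lambda>x. F m x - F n x) < \<epsilon>) \<and>
     (\<lambda>n. LINT x|ref_measure \<Omega>. (F n x - f x)\<^sup>2) \<longlonglongrightarrow> 0"

definition form_domain :: "'a::euclidean_space set \<Rightarrow> real \<Rightarrow> ('a \<Rightarrow> real) set" where
  "form_domain \<Omega> a =
     {f. f \<in> borel_measurable (ref_measure \<Omega>) \<and> integrable (ref_measure \<Omega>) (\<lambda>x. (f x)\<^sup>2) \<and>
         (\<exists>F. approximates \<Omega> a F f)}"

text \<open>The limit does not depend on the approximating sequence because the form is closable.\<close>

definition energy :: "'a::euclidean_space set \<Rightarrow> real \<Rightarrow> ('a \<Rightarrow> real) \<Rightarrow> real" where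
  "energy \<Omega> a f =
     (THE e. \<exists>F. approximates \<Omega> a F f \<and> (\<lambda>n. pre_energy \<Omega> a (F n)) \<longlonglongrightarrow> e)"

text \<open>Polarization would give \<open>1/4\<close>. The further factor \<open>1/2\<close> is the normalization for which
  \<open>2 E(fh, f) - E(f\<^sup>2, h)\<close> is the integral of \<open>h\<close> against \<open>\<bar>\<nabla>f\<bar>\<^sup>2 c d\<lambda> + a \<bar>\<nabla>\<^sup>\<tau>f\<bar>\<^sup>2 c d\<sigma>\<close>:
  the integrand is then \<open>\<nabla>(fh) \<bullet> \<nabla>f - (\<nabla>(f\<^sup>2) \<bullet> \<nabla>h) / 2 = h \<bar>\<nabla>f\<bar>\<^sup>2\<close>,
  and likewise on the boundary. Hence \<open>E(f, f)\<close> is half of \<open>energy \<Omega> a f\<close>.\<close>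

definition dirichlet_form ::
    "'a::euclidean_space set \<Rightarrow> real \<Rightarrow> ('a \<Rightarrow> real) \<Rightarrow> ('a \<Rightarrow> real) \<Rightarrow> real" where
  "dirichlet_form \<Omega> a f g =
     (energy \<Omega> a (\<lambda>x. f x + g x) - energy \<Omega> a (\<lambda>x. f x - g x)) / 8"

section \<open>The two distances\<close>

definition D_bc :: "'a::euclidean_space set \<Rightarrow> real \<Rightarrow> ('a \<Rightarrow> real) set" where
  "D_bc \<Omega> a = {f \<in> form_domain \<Omega> a. continuous_on \<Omega> f \<and> bounded (f ` \<Omega>)}"

definition D_0 :: "'a::euclidean_space set \<Rightarrow> real \<Rightarrow> ('a \<Rightarrow> real) set" where
  "D_0 \<Omega> a =
     {f \<in> D_bc \<Omega> a. \<forall>h \<in> D_bc \<Omega> a.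
        2 * dirichlet_form \<Omega> a (\<lambda>x. f x * h x) f - dirichlet_form \<Omega> a (\<lambda>x. (f x)\<^sup>2) h
          \<le> (LINT x|ref_measure \<Omega>. \<bar>h x\<bar>)}"

definition intrinsic_dist :: "'a::euclidean_space set \<Rightarrow> real \<Rightarrow> 'a \<Rightarrow> 'a \<Rightarrow> ereal" where
  "intrinsic_dist \<Omega> a x y = (SUP f \<in> D_0 \<Omega> a. ereal (f x - f y))"

text \<open>Absolute continuity on \<open>[0,1]\<close>, stated as the fundamental theorem of calculus: the
  derivative exists almost everywhere, is integrable, and integrates back to the curve.\<close>

definition abs_continuous_curve :: "(real \<Rightarrow> 'a::euclidean_space) \<Rightarrow> bool" where
  "abs_continuous_curve X \<longleftrightarrow>
     (\<exists>N. negligible N \<and> (\<forall>t\<in>{0..1} - N. X differentiable (at t))) \<and>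
     (\<lambda>t. vector_derivative X (at t)) absolutely_integrable_on {0..1} \<and>
     (\<forall>t\<in>{0..1}. ((\<lambda>s. vector_derivative X (at s)) has_integral (X t - X 0)) {0..t})"

definition curves :: "'a::euclidean_space set \<Rightarrow> 'a \<Rightarrow> 'a \<Rightarrow> (real \<Rightarrow> 'a) set" where
  "curves \<Omega> x y =
     {X. abs_continuous_curve X \<and> X 0 = x \<and> X 1 = y \<and> (\<forall>t\<in>{0..1}. X t \<in> \<Omega>)}"

definition curve_length :: "(real \<Rightarrow> 'a::euclidean_space) \<Rightarrow> real" where
  "curve_length X = integral {0..1} (\<lambda>t. norm (vector_derivative X (at t)))"

definition domain_dist :: "'a::euclidean_space set \<Rightarrow> 'a \<Rightarrow> 'a \<Rightarrow> real" where
  "domain_dist \<Omega> x y = (INF X \<in> curves \<Omega> x y. curve_length X)"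

end

theory Submission
  imports Defs "HOL-Complex_Analysis.Great_Picard"
begin

text \<open>With \<open>\<nabla>\<close> the gradient in the interior and the tangential gradient on the boundary, the combination
  \<open>2 E(fh, f) - E(f\<^sup>2, h)\<close> is the integral of \<open>h \<bar>\<nabla>f\<bar>\<^sup>2\<close>, with the additional weight \<open>a\<close> on the boundary. So
  \<open>D_0\<close> should consist of the functions with \<open>\<bar>\<nabla>f\<bar> \<le> 1\<close> inside and \<open>a \<bar>\<nabla>f\<bar>\<^sup>2 \<le> 1\<close> on the boundary.
  A tangential gradient is the projection of a gradient and \<open>a \<le> 1\<close>, so for smooth functions the
  first condition implies the second, and the first one is what the length distance sees.

  Upper bound: testing against a mollifier shows that the mollifications of \<open>f \<in> D_0\<close> have gradient at most \<open>1\<close>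
  (\<open>D_0_mollified_gradient\<close>), so \<open>f\<close> is 1-Lipschitz along curves in the interior. The smooth boundary allows
  one to push any curve in \<open>\<Omega>\<close> into the interior while its length hardly grows (\<open>push_into_interior\<close>), and
  continuity of \<open>f\<close> then gives \<open>f x - f y \<le> L\<close> for every curve of length \<open>L\<close> from \<open>x\<close> to \<open>y\<close>.

  Lower bound: for a push \<open>T\<close>, the distance from \<open>T y\<close> to \<open>T z\<close> makes sense for all \<open>z\<close> near \<open>\<Omega>\<close>. A mollification of
  it, divided by a number near \<open>1\<close>, is smooth with gradient at most \<open>1\<close> and hence in \<open>D_0\<close>
  (\<open>near_distance_in_D_0\<close>). As the pushes tend to the identity, compactness of sets of Lipschitz curves (\<open>reachable_limit\<close>)
  shows that the supremum reaches the distance from \<open>x\<close> to \<open>y\<close>. The same compactness provides the minimizing curve, because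
  absolutely continuous curves become Lipschitz when parametrized by arc length and Lipschitz curves are
  differentiable almost everywhere.

  All this needs the form on functions of \<open>D_0\<close> as a limit of integrals over smooth functions, which rests on closability
  (\<open>form_closable\<close>). In the interior it follows from integration by parts. On the boundary it follows in charts on
  which the Hausdorff measure is comparable with Lebesgue measure (\<open>lebesgue_le_surface\<close> and
  \<open>surface_le_lebesgue\<close>).\<close>

section \<open>Hausdorff measure\<close>

lemma hausdorff_content_mono: "A \<subseteq> B \<Longrightarrow> hausdorff_content s \<delta> A \<le> hausdorff_content s \<delta> B"
  unfolding hausdorff_content_def by (rule INF_superset_mono) auto

lemma hausdorff_content_antimono: "\<delta>' \<le> \<delta> \<Longrightarrow> hausdorff_content s \<delta> A \<le> hausdorff_content s \<delta>' A"
  unfolding hausdorff_content_def by (rule INF_superset_mono) (use order_trans in blast)+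

lemma hausdorff_content_le:
  assumes "A \<subseteq> (\<Union>i. C i)" "\<And>i. bounded (C i)" "\<And>i. diameter (C i) \<le> \<delta>"
  shows "hausdorff_content s \<delta> A \<le> (\<Sum>i. ennreal (unit_ball_vol s * (diameter (C i) / 2) powr s))"
  unfolding hausdorff_content_def using assms by (intro INF_lower) auto

lemma hausdorff_content_empty: "0 \<le> \<delta> \<Longrightarrow> hausdorff_content s \<delta> {} = 0"
  using hausdorff_content_le[of "{}" "\<lambda>_. {}" \<delta> s] by simp

lemma hausdorff_content_subadditive:
  fixes A :: "nat \<Rightarrow> 'a::euclidean_space set"
  shows "hausdorff_content s \<delta> (\<Union>i. A i) \<le> (\<Sum>i. hausdorff_content s \<delta> (A i))"
proof (rule ennreal_le_epsilon)
  let ?v = "\<lambda>C::'a set. ennreal (unit_ball_vol s * (diameter C / 2) powr s)"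
  fix e :: real assume e: "0 < e" and fin: "(\<Sum>n. hausdorff_content s \<delta> (A n)) < top"
  have lt: "hausdorff_content s \<delta> (A n) < hausdorff_content s \<delta> (A n) + e * (1/2)^Suc n" for n
    using e fin by (auto simp: less_top dest!: ennreal_suminf_lessD)
  have "\<exists>C. A n \<subseteq> (\<Union>i. C i) \<and> (\<forall>i. bounded (C i) \<and> diameter (C i) \<le> \<delta>) \<and>
      (\<Sum>i. ?v (C i)) \<le> hausdorff_content s \<delta> (A n) + e * (1/2)^Suc n" for n
    using lt[of n, unfolded hausdorff_content_def[of s \<delta> "A n"] INF_less_iff]
    by (auto simp flip: hausdorff_content_def intro: less_imp_le)
  then obtain C where C: "\<And>n. A n \<subseteq> (\<Union>i. C n i)" "\<And>n i. bounded (C n i)"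
      "\<And>n i. diameter (C n i) \<le> \<delta>"
      "\<And>n. (\<Sum>i. ?v (C n i)) \<le> hausdorff_content s \<delta> (A n) + e * (1/2)^Suc n"
    by metis
  define D where "D = case_prod C \<circ> prod_decode"
  have cov: "(\<Union>i. A i) \<subseteq> (\<Union>i. D i)"
    using C(1) by (auto simp: D_def subset_eq) (metis prod.case prod_encode_inverse)
  have "hausdorff_content s \<delta> (\<Union>i. A i) \<le> (\<Sum>i. ?v (D i))"
    using C(2,3) by (intro hausdorff_content_le[OF cov]) (auto simp: D_def split: prod.split)
  also have "\<dots> = (\<Sum>i. (\<lambda>(m, n). ?v (C m n)) (prod_decode i))"
    by (intro suminf_cong) (simp add: D_def split: prod.split)
  also have "\<dots> = (\<Sum>n. \<Sum>i. ?v (C n i))"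
    by (rule suminf_ennreal_2dimen) simp
  also have "\<dots> \<le> (\<Sum>n. hausdorff_content s \<delta> (A n) + e * (1/2) ^ Suc n)"
    by (intro suminf_le allI C(4)) auto
  also have "\<dots> = (\<Sum>n. hausdorff_content s \<delta> (A n)) + (\<Sum>n. ennreal e * ennreal ((1/2) ^ Suc n))"
    using e by (subst suminf_add[symmetric])
               (auto simp del: ennreal_suminf_cmult simp add: ennreal_mult[symmetric])
  also have "\<dots> = (\<Sum>n. hausdorff_content s \<delta> (A n)) + e"
    unfolding ennreal_suminf_cmult
    by (subst suminf_ennreal_eq[OF zero_le_power power_half_series]) auto
  finally show "hausdorff_content s \<delta> (\<Union>i. A i) \<le> (\<Sum>n. hausdorff_content s \<delta> (A n)) + e" .
qed

definition hausdorff_outer :: "real \<Rightarrow> 'a::euclidean_space set \<Rightarrow> ennreal" where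
  "hausdorff_outer s A = (SUP \<delta>\<in>{0<..}. hausdorff_content s \<delta> A)"

lemma hausdorff_outer_mono: "A \<subseteq> B \<Longrightarrow> hausdorff_outer s A \<le> hausdorff_outer s B"
  unfolding hausdorff_outer_def by (intro SUP_mono) (auto intro: hausdorff_content_mono)

lemma hausdorff_content_le_outer: "0 < \<delta> \<Longrightarrow> hausdorff_content s \<delta> A \<le> hausdorff_outer s A"
  unfolding hausdorff_outer_def by (intro SUP_upper) auto

lemma hausdorff_outer_subadditive:
  fixes A :: "nat \<Rightarrow> 'a::euclidean_space set"
  shows "hausdorff_outer s (\<Union>i. A i) \<le> (\<Sum>i. hausdorff_outer s (A i))"
  unfolding hausdorff_outer_def[of s "\<Union>i. A i"]
proof (rule SUP_least)
  fix \<delta> :: real assume "\<delta> \<in> {0<..}"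
  then have "(\<Sum>i. hausdorff_content s \<delta> (A i)) \<le> (\<Sum>i. hausdorff_outer s (A i))"
    by (intro suminf_le hausdorff_content_le_outer) auto
  then show "hausdorff_content s \<delta> (\<Union>i. A i) \<le> (\<Sum>i. hausdorff_outer s (A i))"
    using hausdorff_content_subadditive order_trans by blast
qed

lemma outer_measure_space_hausdorff_outer:
  "outer_measure_space (Pow UNIV) (hausdorff_outer s :: 'a::euclidean_space set \<Rightarrow> ennreal)"
  unfolding outer_measure_space_def
proof (intro conjI)
  show "positive (Pow UNIV) (hausdorff_outer s :: 'a set \<Rightarrow> ennreal)"
    by (simp add: positive_def hausdorff_outer_def hausdorff_content_empty less_imp_le)
  show "increasing (Pow UNIV) (hausdorff_outer s :: 'a set \<Rightarrow> ennreal)"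
    by (auto simp: increasing_def intro: hausdorff_outer_mono)
  show "countably_subadditive (Pow UNIV) (hausdorff_outer s :: 'a set \<Rightarrow> ennreal)"
    by (auto simp: countably_subadditive_def intro: hausdorff_outer_subadditive)
qed

lemma hausdorff_outer_empty [simp]: "hausdorff_outer s {} = 0"
  using outer_measure_space_hausdorff_outer[of s] by (auto simp: outer_measure_space_def positive_def)

lemma hausdorff_outer_Un: "hausdorff_outer s (A \<union> B) \<le> hausdorff_outer s A + hausdorff_outer s B"
proof -
  define C where "C i = (if i = (0::nat) then A else if i = 1 then B else {})" for i
  have "A \<union> B = (\<Union>i. C i)"
    by (fastforce simp: C_def split: if_splits)
  then have "hausdorff_outer s (A \<union> B) \<le> (\<Sum>i. hausdorff_outer s (C i))"
    using hausdorff_outer_subadditive[of s C] by simp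
  also have "\<dots> = (\<Sum>i\<in>{0,1}. hausdorff_outer s (C i))"
    by (rule suminf_finite) (auto simp: C_def)
  finally show ?thesis by (simp add: C_def)
qed

text \<open>A covering set of diameter below the gap meets at most one of the two sets.\<close>

lemma hausdorff_outer_Un_separated:
  fixes A B :: "'a::euclidean_space set"
  assumes gap: "0 < g" "\<And>x y. x \<in> A \<Longrightarrow> y \<in> B \<Longrightarrow> g \<le> dist x y"
  shows "hausdorff_outer s A + hausdorff_outer s B \<le> hausdorff_outer s (A \<union> B)"
proof -
  let ?v = "\<lambda>C::'a set. ennreal (unit_ball_vol s * (diameter C / 2) powr s)"
  have main: "hausdorff_content s \<delta> A + hausdorff_content s \<delta> B \<le> hausdorff_content s \<delta> (A \<union> B)"
    if \<delta>: "0 < \<delta>" "\<delta> < g" for \<delta>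
    unfolding hausdorff_content_def[of s \<delta> "A \<union> B"]
  proof (rule INF_greatest, clarsimp)
    fix C :: "nat \<Rightarrow> 'a set"
    assume C: "A \<subseteq> (\<Union>i. C i)" "B \<subseteq> (\<Union>i. C i)" "\<forall>i. bounded (C i) \<and> diameter (C i) \<le> \<delta>"
    define CA where "CA i = (if C i \<inter> A = {} then {} else C i)" for i
    define CB where "CB i = (if C i \<inter> B = {} then {} else C i)" for i
    have one: "C i \<inter> A = {} \<or> C i \<inter> B = {}" for i
    proof (rule ccontr)
      assume "\<not> ?thesis"
      then obtain x y where "x \<in> C i" "x \<in> A" "y \<in> C i" "y \<in> B" by blast
      then have "g \<le> diameter (C i)"
        using gap(2)[of x y] diameter_bounded_bound[of "C i" x y] C(3) by force
      then show False using C(3) \<delta> by (metis linorder_not_le order_trans order_le_less_trans)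
    qed
    have "hausdorff_content s \<delta> A \<le> (\<Sum>i. ?v (CA i))" "hausdorff_content s \<delta> B \<le> (\<Sum>i. ?v (CB i))"
      using C \<delta> by (intro hausdorff_content_le; fastforce simp: CA_def CB_def)+
    then have "hausdorff_content s \<delta> A + hausdorff_content s \<delta> B \<le> (\<Sum>i. ?v (CA i)) + (\<Sum>i. ?v (CB i))"
      by (rule add_mono)
    also have "\<dots> = (\<Sum>i. ?v (CA i) + ?v (CB i))"
      by (rule suminf_add) auto
    also have "\<dots> \<le> (\<Sum>i. ?v (C i))"
      using one by (intro suminf_le) (auto simp: CA_def CB_def)
    finally show "hausdorff_content s \<delta> A + hausdorff_content s \<delta> B \<le> (\<Sum>i. ?v (C i))" .
  qed
  have "hausdorff_outer s A + hausdorff_outer s B =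
      (SUP \<delta>\<in>{0<..}. hausdorff_content s \<delta> A) + (SUP \<delta>\<in>{0<..}. hausdorff_content s \<delta> B)"
    by (simp add: hausdorff_outer_def)
  also have "\<dots> = (SUP \<delta>\<in>{0<..}. hausdorff_content s \<delta> A + hausdorff_content s \<delta> B)"
  proof (rule SUP_add_directed_ennreal[symmetric])
    fix i j :: real assume "i \<in> {0<..}" "j \<in> {0<..}"
    then show "\<exists>k\<in>{0<..}. hausdorff_content s i A + hausdorff_content s j B
        \<le> hausdorff_content s k A + hausdorff_content s k B"
      by (intro bexI[of _ "min i j"] add_mono hausdorff_content_antimono) auto
  qed
  also have "\<dots> \<le> hausdorff_outer s (A \<union> B)"
  proof (rule SUP_least)
    fix \<delta> :: real assume "\<delta> \<in> {0<..}"
    then have p: "0 < min \<delta> (g/2)" "min \<delta> (g/2) < g" using gap(1) by auto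
    have "hausdorff_content s \<delta> A + hausdorff_content s \<delta> B
      \<le> hausdorff_content s (min \<delta> (g/2)) A + hausdorff_content s (min \<delta> (g/2)) B"
      by (intro add_mono hausdorff_content_antimono) auto
    also have "\<dots> \<le> hausdorff_outer s (A \<union> B)"
      using main[OF p] hausdorff_content_le_outer[OF p(1)] order_trans by blast
    finally show "hausdorff_content s \<delta> A + hausdorff_content s \<delta> B \<le> hausdorff_outer s (A \<union> B)" .
  qed
  finally show ?thesis .
qed

text \<open>Caratheodory's criterion: the part of a test set off the closed set \<open>K\<close> is exhausted by the
  shells on which \<open>1/(n+2) < infdist \<le> 1/(n+1)\<close>. Every other shell is
  separated, so the measures of the shells are summable when the test set has finite measure.\<close>

lemma hausdorff_outer_closed_caratheodory:
  fixes K :: "'a::euclidean_space set"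
  assumes K: "closed K"
  shows "hausdorff_outer s (X \<inter> K) + hausdorff_outer s (X - K) \<le> hausdorff_outer s X"
proof (cases "K = {} \<or> hausdorff_outer s X = top")
  case True
  then show ?thesis
  proof
    assume "K = {}"
    then show ?thesis by simp
  qed auto
next
  case False
  let ?h = "hausdorff_outer s :: 'a set \<Rightarrow> ennreal"
  define E where "E n = {x \<in> X. 1 / real (Suc n) < infdist x K}" for n :: nat
  define S where "S n = E (Suc n) - E n" for n
  have ne: "K \<noteq> {}" and fin: "?h X < top" using False by (auto simp: less_top)
  have Emono: "E m \<subseteq> E n" if "m \<le> n" for m n
  proof -
    have "1 / real (Suc n) \<le> 1 / real (Suc m)" using that by (simp add: field_simps)
    then show ?thesis unfolding E_def by auto
  qed
  have lip: "\<bar>infdist x K - infdist y K\<bar> \<le> dist x y" for x y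
    by (smt (verit) dist_commute infdist_triangle)
  have KE: "?h (X \<inter> K) + ?h (E n) \<le> ?h X" for n
  proof -
    have "?h (X \<inter> K) + ?h (E n) \<le> ?h ((X \<inter> K) \<union> E n)"
    proof (rule hausdorff_outer_Un_separated)
      show "0 < 1 / real (Suc n)" by simp
      fix x y assume "x \<in> X \<inter> K" "y \<in> E n"
      then show "1 / real (Suc n) \<le> dist x y"
        using lip[of y x] by (auto simp: E_def dist_commute)
    qed
    also have "\<dots> \<le> ?h X" by (rule hausdorff_outer_mono) (auto simp: E_def)
    finally show ?thesis .
  qed
  have step: "?h (S (Suc n)) + ?h (E n) \<le> ?h (E (Suc (Suc n)))" for n
  proof -
    have pos: "0 < 1 / real (Suc n) - 1 / real (Suc (Suc n))" by (simp add: frac_less2)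
    have "?h (S (Suc n)) + ?h (E n) \<le> ?h (S (Suc n) \<union> E n)"
    proof (rule hausdorff_outer_Un_separated[OF pos])
      fix x y assume "x \<in> S (Suc n)" "y \<in> E n"
      then show "1 / real (Suc n) - 1 / real (Suc (Suc n)) \<le> dist x y"
        using lip[of x y] by (auto simp: E_def S_def)
    qed
    also have "\<dots> \<le> ?h (E (Suc (Suc n)))"
      by (rule hausdorff_outer_mono) (use Emono[of n "Suc (Suc n)"] in \<open>auto simp: S_def\<close>)
    finally show ?thesis .
  qed
  \<comment> \<open>Shells whose indices have the same parity are separated from each other.\<close>
  have parity: "(\<Sum>i<m. ?h (S (2 * i + k))) \<le> ?h (E (2 * m + k - 1))" for k m
  proof (induction m)
    case (Suc m)
    show ?case
    proof (cases "2 * m + k")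
      case 0
      then show ?thesis by (auto simp: S_def intro: hausdorff_outer_mono)
    next
      case (Suc j)
      have "(\<Sum>i<Suc m. ?h (S (2 * i + k))) \<le> ?h (E j) + ?h (S (Suc j))"
        using Suc.IH Suc by (simp add: add_mono)
      also have "\<dots> \<le> ?h (E (Suc (Suc j)))" using step[of j] by (simp add: add.commute)
      finally show ?thesis using Suc by simp
    qed
  qed simp
  have EX: "?h (E n) \<le> ?h X" for n by (rule hausdorff_outer_mono) (auto simp: E_def)
  have "(\<Sum>i<N. ?h (S i)) \<le> 2 * ?h X" for N
  proof -
    have "(\<Sum>i<N. ?h (S i)) \<le> (\<Sum>i<2 * N. ?h (S i))" by (rule sum_mono2) auto
    also have "\<dots> = (\<Sum>i<N. ?h (S (2 * i + 0))) + (\<Sum>i<N. ?h (S (2 * i + 1)))"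
      by (induction N) (auto simp: algebra_simps)
    also have "\<dots> \<le> ?h X + ?h X" by (intro add_mono order_trans[OF parity EX])
    finally show ?thesis by (simp add: mult_2)
  qed
  then have "(\<Sum>i. ?h (S i)) \<le> 2 * ?h X" by (intro suminf_le_const) auto
  moreover have "2 * ?h X < top" using fin by (simp add: ennreal_mult_less_top)
  ultimately have "(\<Sum>i. ?h (S i)) \<noteq> top" by (metis leD)
  then have tail: "(\<lambda>n. \<Sum>i. ?h (S (i + n))) \<longlonglongrightarrow> 0"
  proof -
    have fin': "(\<Sum>i<n. ?h (S i)) \<noteq> top" for n
      using \<open>(\<Sum>i. ?h (S i)) \<noteq> top\<close> sum_le_suminf[of "\<lambda>i. ?h (S i)" "{..<n}"]
      by (metis finite_lessThan neq_top_trans summableI zero_le)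
    have "(\<lambda>n. (\<Sum>i. ?h (S i)) - (\<Sum>i<n. ?h (S i))) \<longlonglongrightarrow> (\<Sum>i. ?h (S i)) - (\<Sum>i. ?h (S i))"
      using \<open>(\<Sum>i. ?h (S i)) \<noteq> top\<close>
      by (intro tendsto_diff_ennreal tendsto_const summable_LIMSEQ) auto
    moreover have "(\<Sum>i. ?h (S i)) - (\<Sum>i<n. ?h (S i)) = (\<Sum>i. ?h (S (i + n)))" for n
      using fin' suminf_offset[of "\<lambda>i. ?h (S i)" n] by simp
    ultimately show ?thesis
      using \<open>(\<Sum>i. ?h (S i)) \<noteq> top\<close> by simp
  qed
  have split: "X - K \<subseteq> E n \<union> (\<Union>i. S (i + n))" for n
  proof
    fix x assume x: "x \<in> X - K"
    then have "0 < infdist x K" using K ne by (simp add: infdist_pos_not_in_closed)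
    then obtain m where m: "1 / real (Suc m) < infdist x K"
      using reals_Archimedean[of "infdist x K"] by (auto simp: inverse_eq_divide)
    define l where "l = (LEAST m. x \<in> E m)"
    have ex: "x \<in> E m" using m x by (auto simp: E_def)
    have l: "x \<in> E l" unfolding l_def by (rule LeastI[of _ m]) (rule ex)
    show "x \<in> E n \<union> (\<Union>i. S (i + n))"
    proof (cases "l \<le> n")
      case True then show ?thesis using Emono[OF True] l by auto
    next
      case False
      then obtain i where i: "l = Suc (i + n)" by (metis add.commute less_imp_Suc_add not_le)
      have "x \<notin> E (i + n)" using not_less_Least[of "i + n" "\<lambda>m. x \<in> E m"] i l_def by auto
      then show ?thesis using l i by (auto simp: S_def)
    qed
  qed
  have "?h (X \<inter> K) + ?h (X - K) \<le> ?h X + (\<Sum>i. ?h (S (i + n)))" for n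
  proof -
    have "?h (X - K) \<le> ?h (E n \<union> (\<Union>i. S (i + n)))" by (rule hausdorff_outer_mono[OF split])
    also have "\<dots> \<le> ?h (E n) + ?h (\<Union>i. S (i + n))" by (rule hausdorff_outer_Un)
    also have "\<dots> \<le> ?h (E n) + (\<Sum>i. ?h (S (i + n)))"
      by (intro add_left_mono hausdorff_outer_subadditive)
    finally have "?h (X \<inter> K) + ?h (X - K) \<le> (?h (X \<inter> K) + ?h (E n)) + (\<Sum>i. ?h (S (i + n)))"
      by (simp add: add_left_mono add.assoc)
    also have "\<dots> \<le> ?h X + (\<Sum>i. ?h (S (i + n)))" by (intro add_right_mono KE)
    finally show ?thesis .
  qed
  moreover have "(\<lambda>n. ?h X + (\<Sum>i. ?h (S (i + n)))) \<longlonglongrightarrow> ?h X + 0"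
    by (intro tendsto_add tendsto_const tail)
  ultimately show ?thesis using LIMSEQ_le_const[of _ "?h X + 0"] by auto
qed

lemma measure_space_hausdorff_outer:
  "measure_space UNIV (sets borel) (hausdorff_outer s :: 'a::euclidean_space set \<Rightarrow> ennreal)"
proof -
  interpret P: sigma_algebra UNIV "Pow (UNIV :: 'a set)" by (rule sigma_algebra_Pow)
  let ?L = "lambda_system UNIV (Pow UNIV) (hausdorff_outer s :: 'a set \<Rightarrow> ennreal)"
  have ms: "measure_space UNIV ?L (hausdorff_outer s)"
    by (rule P.caratheodory_lemma[OF outer_measure_space_hausdorff_outer])
  have cl: "K \<in> ?L" if "closed K" for K :: "'a set"
  proof -
    have "hausdorff_outer s (X \<inter> K) + hausdorff_outer s (X - K) = hausdorff_outer s X" for X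
      using hausdorff_outer_closed_caratheodory[OF that, of s X]
        hausdorff_outer_Un[of s "X \<inter> K" "X - K"] by (simp add: Int_Diff_Un antisym)
    then show ?thesis using P.lambda_system_eq[of "hausdorff_outer s"] by auto
  qed
  have "sets (borel :: 'a measure) \<subseteq> ?L"
    unfolding borel_eq_closed
    using sigma_algebra.sigma_sets_subset[of UNIV ?L "Collect closed"] ms cl
    by (auto simp: measure_space_def)
  with ms show ?thesis
    by (auto simp: measure_space_def countably_additive_def positive_def sets.sigma_algebra_axioms[of borel, simplified])
qed

lemma sets_hausdorff_measure [measurable_cong, simp]:
    "sets (hausdorff_measure s :: 'a::euclidean_space measure) = sets borel"
  and space_hausdorff_measure [simp]: "space (hausdorff_measure s :: 'a measure) = UNIV"
  using sets.sigma_sets_eq[of "borel :: 'a measure"]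
  by (auto simp: hausdorff_measure_def sets_measure_of space_measure_of)

lemma emeasure_hausdorff_measure:
  assumes "A \<in> sets borel"
  shows "emeasure (hausdorff_measure s) A = hausdorff_outer s (A :: 'a::euclidean_space set)"
proof -
  have "hausdorff_measure s = measure_of UNIV (sets borel) (hausdorff_outer s :: 'a set \<Rightarrow> ennreal)"
    by (simp add: hausdorff_measure_def hausdorff_outer_def[abs_def])
  then show ?thesis
    using measure_space_hausdorff_outer[of s, where 'a='a] assms
    unfolding measure_space_def by (metis emeasure_measure_of_sigma)
qed

section \<open>Continuously differentiable functions\<close>

abbreviation lborel_on :: "'a::euclidean_space set \<Rightarrow> 'a measure" where
  "lborel_on U \<equiv> restrict_space lborel U"

definition C1_grad :: "'a::euclidean_space set \<Rightarrow> ('a \<Rightarrow> real) \<Rightarrow> ('a \<Rightarrow> 'a) \<Rightarrow> bool" where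
  "C1_grad U f g \<longleftrightarrow> (\<forall>x\<in>U. (f has_derivative (\<lambda>h. g x \<bullet> h)) (at x)) \<and> continuous_on U g"

lemma C1_gradD:
  assumes "C1_grad U f g"
  shows "x \<in> U \<Longrightarrow> (f has_derivative (\<lambda>h. g x \<bullet> h)) (at x)" "continuous_on U g" "continuous_on U f"
proof -
  show d: "(f has_derivative (\<lambda>h. g x \<bullet> h)) (at x)" if "x \<in> U" for x
    using assms that unfolding C1_grad_def by blast
  show "continuous_on U g" using assms unfolding C1_grad_def by blast
  show "continuous_on U f"
    by (rule has_derivative_continuous_on[OF has_derivative_at_withinI[OF d]])
qed

lemma C1_grad_imp_Ck_on: "C1_grad S f g \<Longrightarrow> Ck_on 1 S f"
proof -
  assume f: "C1_grad S f g"
  have "frechet_derivative f (at x) v = g x \<bullet> v" if "x \<in> S" for x v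
    by (simp flip: frechet_derivative_at[OF C1_gradD(1)[OF f that]])
  then have "continuous_on S (\<lambda>x. frechet_derivative f (at x) v)" for v
    using C1_gradD(2)[OF f] by (subst continuous_on_cong[OF refl]) (auto intro!: continuous_intros)
  moreover have "\<forall>x\<in>S. f differentiable (at x)"
    using C1_gradD(1)[OF f] unfolding differentiable_def by blast
  ultimately show "Ck_on 1 S f" by simp
qed

lemma Ck_on_imp_C1_grad:
  assumes "Ck_on 1 S f"
  shows "\<exists>g. C1_grad S f (g :: 'a::euclidean_space \<Rightarrow> 'a)"
proof -
  have d: "f differentiable (at x)" if "x \<in> S" for x using assms that by simp
  have c: "continuous_on S (\<lambda>x. frechet_derivative f (at x) v)" for v using assms by simp
  define g where "g x = (\<Sum>b\<in>Basis. frechet_derivative f (at x) b *\<^sub>R b)" for x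
  have lin: "linear (frechet_derivative f (at x))" if "x \<in> S" for x
    using d[OF that] by (rule linear_frechet_derivative)
  have eq: "frechet_derivative f (at x) h = g x \<bullet> h" if "x \<in> S" for x h
  proof -
    interpret linear "frechet_derivative f (at x)" by (rule lin[OF that])
    have "frechet_derivative f (at x) h = frechet_derivative f (at x) (\<Sum>b\<in>Basis. (h \<bullet> b) *\<^sub>R b)"
      by (simp add: euclidean_representation)
    also have "\<dots> = g x \<bullet> h"
      by (simp add: sum scale g_def inner_sum_left mult.commute inner_commute[of h])
    finally show ?thesis .
  qed
  have "C1_grad S f g"
    unfolding C1_grad_def
  proof (intro conjI ballI)
    show "(f has_derivative (\<lambda>h. g x \<bullet> h)) (at x)" if "x \<in> S" for x
    proof -
      have "(\<lambda>h. g x \<bullet> h) = frechet_derivative f (at x)" using eq[OF that] by auto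
      then show ?thesis using d[OF that] by (simp add: frechet_derivative_works)
    qed
    show "continuous_on S g" unfolding g_def by (intro continuous_intros c)
  qed
  then show ?thesis by blast
qed

section \<open>Integral inequalities\<close>

lemma norm_integral_le_integral:
  fixes f :: "'a \<Rightarrow> 'b::{banach, second_countable_topology}"
  assumes "integrable M f" "integrable M g" "\<And>x. norm (f x) \<le> g x"
  shows "norm (\<integral>x. f x \<partial>M) \<le> (\<integral>x. g x \<partial>M)"
  using assms by (intro order_trans[OF integral_norm_bound integral_mono]) auto

lemma integrable_mult_of_squares:
  fixes f g :: "'a \<Rightarrow> real"
  assumes [measurable]: "f \<in> borel_measurable M" "g \<in> borel_measurable M"
    and "integrable M (\<lambda>x. (f x)\<^sup>2)" "integrable M (\<lambda>x. (g x)\<^sup>2)"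
  shows "integrable M (\<lambda>x. f x * g x)"
proof (rule Bochner_Integration.integrable_bound)
  show "integrable M (\<lambda>x. (f x)\<^sup>2 + (g x)\<^sup>2)" using assms by simp
  show "AE x in M. norm (f x * g x) \<le> norm ((f x)\<^sup>2 + (g x)\<^sup>2)"
  proof (rule AE_I2)
    fix x
    have "2 * \<bar>f x * g x\<bar> \<le> (f x)\<^sup>2 + (g x)\<^sup>2"
      using zero_le_power2[of "\<bar>f x\<bar> - \<bar>g x\<bar>"] by (simp add: power2_eq_square algebra_simps abs_mult)
    then show "norm (f x * g x) \<le> norm ((f x)\<^sup>2 + (g x)\<^sup>2)" by auto
  qed
qed simp

lemma Cauchy_Schwarz_integral:
  fixes f g :: "'a \<Rightarrow> real"
  assumes [measurable]: "f \<in> borel_measurable M" "g \<in> borel_measurable M"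
    and f: "integrable M (\<lambda>x. (f x)\<^sup>2)" and g: "integrable M (\<lambda>x. (g x)\<^sup>2)"
  shows "(\<integral>x. f x * g x \<partial>M)\<^sup>2 \<le> (\<integral>x. (f x)\<^sup>2 \<partial>M) * (\<integral>x. (g x)\<^sup>2 \<partial>M)"
proof -
  let ?A = "\<integral>x. (f x)\<^sup>2 \<partial>M" and ?B = "\<integral>x. (g x)\<^sup>2 \<partial>M" and ?C = "\<integral>x. f x * g x \<partial>M"
  have fg: "integrable M (\<lambda>x. f x * g x)" by (rule integrable_mult_of_squares) (use f g in auto)
  have key: "0 \<le> s\<^sup>2 * ?A - 2 * s * t * ?C + t\<^sup>2 * ?B" for s t :: real
  proof -
    have "0 \<le> (\<integral>x. (s * f x - t * g x)\<^sup>2 \<partial>M)" by simp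
    also have "\<dots> = (\<integral>x. s\<^sup>2 * (f x)\<^sup>2 - 2 * s * t * (f x * g x) + t\<^sup>2 * (g x)\<^sup>2 \<partial>M)"
      by (simp add: power2_diff power_mult_distrib algebra_simps)
    also have "\<dots> = s\<^sup>2 * ?A - 2 * s * t * ?C + t\<^sup>2 * ?B"
      using f g fg by simp
    finally show ?thesis .
  qed
  have A0: "0 \<le> ?A" "0 \<le> ?B" by simp_all
  show ?thesis
  proof (cases "?B = 0")
    case True
    have "?C = 0"
    proof (rule ccontr)
      assume c: "?C \<noteq> 0"
      have "0 \<le> ?A - 2 * ((?A + 1) / ?C) * ?C" using key[of 1 "(?A + 1) / ?C"] True by simp
      then show False using c A0 by simp
    qed
    then show ?thesis using True by simp
  next
    case False
    then have "0 < ?B" using A0(2) by (simp add: less_le)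
    moreover have "0 \<le> ?B * (?B * ?A - ?C\<^sup>2)"
      using key[of ?B ?C] by (simp add: power2_eq_square algebra_simps)
    ultimately show ?thesis by (simp add: zero_le_mult_iff mult.commute)
  qed
qed

lemma tendsto_zero_integral_mult:
  fixes f :: "nat \<Rightarrow> 'a \<Rightarrow> real"
  assumes [measurable]: "\<And>n. f n \<in> borel_measurable M" "g \<in> borel_measurable M"
    and f: "\<And>n. integrable M (\<lambda>x. (f n x)\<^sup>2)" and g: "integrable M (\<lambda>x. (g x)\<^sup>2)"
    and lim: "(\<lambda>n. \<integral>x. (f n x)\<^sup>2 \<partial>M) \<longlonglongrightarrow> 0"
  shows "(\<lambda>n. \<integral>x. f n x * g x \<partial>M) \<longlonglongrightarrow> 0"
proof -
  have "(\<lambda>n. (\<integral>x. (f n x)\<^sup>2 \<partial>M) * (\<integral>x. (g x)\<^sup>2 \<partial>M)) \<longlonglongrightarrow> 0"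
    using lim by (auto intro!: tendsto_mult_left_zero)
  then have "(\<lambda>n. (\<integral>x. f n x * g x \<partial>M)\<^sup>2) \<longlonglongrightarrow> 0"
    by (rule tendsto_sandwich[OF _ _ tendsto_const, rotated 2])
       (auto intro!: always_eventually Cauchy_Schwarz_integral f g)
  then show ?thesis by simp
qed

section \<open>Convolution with a continuously differentiable kernel\<close>

lemma integrable_continuous_compact_support:
  fixes f :: "'a::euclidean_space \<Rightarrow> 'b::euclidean_space"
  assumes "continuous_on UNIV f" "\<And>x. r \<le> norm x \<Longrightarrow> f x = 0"
  shows "integrable lborel f"
proof -
  have "integrable lborel (\<lambda>x. indicator (cball 0 r) x *\<^sub>R f x)"
    by (rule borel_integrable_compact) (auto intro: continuous_on_subset[OF assms(1)])
  moreover have "(\<lambda>x. indicator (cball 0 r) x *\<^sub>R f x) = f"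
    using assms(2) by (auto simp: indicator_def fun_eq_iff)
  ultimately show ?thesis by simp
qed

lemma uniformly_continuous_compact_support:
  fixes f :: "'a::euclidean_space \<Rightarrow> 'b::real_normed_vector"
  assumes c: "continuous_on UNIV f" and z: "\<And>x. r \<le> norm x \<Longrightarrow> f x = 0"
  shows "uniformly_continuous_on UNIV f"
  unfolding uniformly_continuous_on_def
proof (intro allI impI)
  fix e :: real assume e: "0 < e"
  have "uniformly_continuous_on (cball 0 (r + 2)) f"
    by (intro compact_uniformly_continuous continuous_on_subset[OF c]) auto
  then obtain d where d: "0 < d"
      "\<And>x y. x \<in> cball 0 (r + 2) \<Longrightarrow> y \<in> cball 0 (r + 2) \<Longrightarrow> dist y x < d \<Longrightarrow> dist (f y) (f x) < e"
    using e unfolding uniformly_continuous_on_def by metis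
  show "\<exists>d>0. \<forall>x\<in>UNIV. \<forall>x'\<in>UNIV. dist x' x < d \<longrightarrow> dist (f x') (f x) < e"
  proof (intro exI[of _ "min d 1"] conjI ballI impI)
    fix x y :: 'a assume xy: "dist y x < min d 1"
    have ny: "norm y \<le> norm x + 1" "norm x \<le> norm y + 1"
      using xy norm_triangle_ineq2[of y x] norm_triangle_ineq2[of x y] by (auto simp: dist_norm norm_minus_commute)
    show "dist (f y) (f x) < e"
    proof (cases "norm x \<le> r + 1")
      case True then show ?thesis using d(2)[of x y] xy ny by auto
    next
      case False then show ?thesis using z[of x] z[of y] ny e by auto
    qed
  qed (use d in auto)
qed

lemma bounded_compact_support:
  fixes f :: "'a::euclidean_space \<Rightarrow> 'b::real_normed_vector"
  assumes c: "continuous_on UNIV f" and z: "\<And>x. r \<le> norm x \<Longrightarrow> f x = 0"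
  shows "\<exists>B\<ge>0. \<forall>x. norm (f x) \<le> B"
proof -
  have "bounded (f ` cball 0 r)"
    by (intro compact_imp_bounded compact_continuous_image continuous_on_subset[OF c]) auto
  then obtain B where B: "\<And>x. x \<in> cball 0 r \<Longrightarrow> norm (f x) \<le> B" by (metis bounded_iff image_eqI)
  have "norm (f x) \<le> max B 0" for x
    using B[of x] z[of x] by (cases "norm x \<le> r") (simp_all add: le_max_iff_disj)
  then show ?thesis by (intro exI[of _ "max B 0"]) auto
qed

lemma C1_grad_remainder:
  assumes f: "C1_grad UNIV f g" and close: "\<And>z. dist z x < d \<Longrightarrow> norm (g z - g x) \<le> e" and y: "dist y x < d"
  shows "\<bar>f y - f x - g x \<bullet> (y - x)\<bar> \<le> e * norm (y - x)"
proof -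
  let ?p = "\<lambda>z. f z - g x \<bullet> z"
  have "norm (?p y - ?p x) \<le> e * norm (y - x)"
  proof (rule differentiable_bound[of "ball x d" ?p "\<lambda>z h. (g z - g x) \<bullet> h"])
    fix z assume z: "z \<in> ball x d"
    show "(?p has_derivative (\<lambda>h. (g z - g x) \<bullet> h)) (at z within ball x d)"
      by (auto intro!: derivative_eq_intros has_derivative_at_withinI[OF C1_gradD(1)[OF f]]
               simp: inner_diff_left)
    show "onorm (\<lambda>h. (g z - g x) \<bullet> h) \<le> e"
    proof (rule onorm_le)
      fix h
      have "norm ((g z - g x) \<bullet> h) \<le> norm (g z - g x) * norm h" by (rule Cauchy_Schwarz_ineq2[folded real_norm_def])
      also have "\<dots> \<le> e * norm h" using close[of z] z by (intro mult_right_mono) (auto simp: dist_commute)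
      finally show "norm ((g z - g x) \<bullet> h) \<le> e * norm h" .
    qed
  qed (use y in \<open>auto simp: dist_commute intro: order.strict_trans1[OF zero_le_dist]\<close>)
  then show ?thesis by (simp add: inner_diff_right algebra_simps)
qed

text \<open>The remainder of the first-order expansion of the kernel is uniformly small because its
  gradient is uniformly continuous, so it survives integration against \<open>f\<close>.\<close>

lemma C1_grad_convolution:
  fixes k f :: "'a::euclidean_space \<Rightarrow> real" and k' :: "'a \<Rightarrow> 'a"
  assumes k: "C1_grad UNIV k k'" and k0: "\<And>x. r \<le> norm x \<Longrightarrow> k x = 0" and k'0: "\<And>x. r \<le> norm x \<Longrightarrow> k' x = 0"
    and f: "integrable lborel f"
  shows "C1_grad UNIV (\<lambda>x. LINT z|lborel. k (x - z) * f z) (\<lambda>x. LINT z|lborel. f z *\<^sub>R k' (x - z))"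
proof -
  have uc: "uniformly_continuous_on UNIV k'"
    by (rule uniformly_continuous_compact_support[OF C1_gradD(2)[OF k] k'0])
  have [measurable]: "k \<in> borel_measurable borel" "k' \<in> borel_measurable borel" "f \<in> borel_measurable borel"
    using borel_measurable_integrable[OF f]
    by (simp_all add: borel_measurable_continuous_onI[OF C1_gradD(2)[OF k]]
        borel_measurable_continuous_onI[OF C1_gradD(3)[OF k]])
  obtain B where B: "0 \<le> B" "\<And>x. norm (k x) \<le> B"
    using bounded_compact_support[OF C1_gradD(3)[OF k] k0] by metis
  obtain B' where B': "0 \<le> B'" "\<And>x. norm (k' x) \<le> B'"
    using bounded_compact_support[OF C1_gradD(2)[OF k] k'0] by metis
  have i1: "integrable lborel (\<lambda>z. k (x - z) * f z)" for x
    by (rule Bochner_Integration.integrable_bound[of _ "\<lambda>z. B * \<bar>f z\<bar>"])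
       (use f B in \<open>auto simp: abs_mult intro!: mult_right_mono\<close>)
  have i2: "integrable lborel (\<lambda>z. f z *\<^sub>R k' (x - z))" for x
    by (rule Bochner_Integration.integrable_bound[of _ "\<lambda>z. \<bar>f z\<bar> * B'"])
       (use f B' in \<open>auto simp: abs_mult intro!: mult_left_mono\<close>)
  let ?I = "\<integral>z. \<bar>f z\<bar> \<partial>lborel"
  have small: "\<exists>d>0. \<forall>a b. dist a b < d \<longrightarrow> norm (k' a - k' b) * (?I + 1) \<le> e" if "0 < e" for e
  proof -
    have I: "0 < ?I + 1" by (intro add_nonneg_pos Bochner_Integration.integral_nonneg) auto
    then have "0 < e / (?I + 1)" using that by simp
    then obtain d where d: "0 < d" "\<And>a b. dist a b < d \<Longrightarrow> dist (k' a) (k' b) < e / (?I + 1)"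
      using uc unfolding uniformly_continuous_on_def by (metis UNIV_I)
    show ?thesis
      using d I by (intro exI[of _ d]) (auto simp: dist_norm pos_less_divide_eq less_imp_le)
  qed
  show ?thesis
    unfolding C1_grad_def
  proof (intro conjI ballI)
    fix x
    let ?g = "LINT z|lborel. f z *\<^sub>R k' (x - z)"
    show "((\<lambda>x. LINT z|lborel. k (x - z) * f z) has_derivative (\<lambda>h. ?g \<bullet> h)) (at x)"
      unfolding has_derivative_at_alt
    proof (intro conjI allI impI)
      show "bounded_linear (\<lambda>h. ?g \<bullet> h)" by (rule bounded_linear_inner_right)
      fix e :: real assume "0 < e"
      then obtain d where d: "0 < d" "\<And>a b. dist a b < d \<Longrightarrow> norm (k' a - k' b) * (?I + 1) \<le> e" using small by blast
      have "norm ((LINT z|lborel. k (y - z) * f z) - (LINT z|lborel. k (x - z) * f z) - ?g \<bullet> (y - x)) \<le> e * norm (y - x)"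
        if y: "norm (y - x) < d" for y
      proof -
        have I: "0 < ?I + 1" by (intro add_nonneg_pos Bochner_Integration.integral_nonneg) auto
        have ptw: "norm (k (y - z) * f z - k (x - z) * f z - (f z *\<^sub>R k' (x - z)) \<bullet> (y - x))
            \<le> \<bar>f z\<bar> * (e / (?I + 1) * norm (y - x))" for z
        proof -
          have "\<bar>k (y - z) - k (x - z) - k' (x - z) \<bullet> ((y - z) - (x - z))\<bar> \<le> e / (?I + 1) * norm ((y - z) - (x - z))"
            by (rule C1_grad_remainder[OF k, where d=d])
               (use y d(2) I in \<open>auto simp: dist_norm pos_le_divide_eq\<close>)
          then have "\<bar>f z\<bar> * \<bar>k (y - z) - k (x - z) - k' (x - z) \<bullet> (y - x)\<bar> \<le> \<bar>f z\<bar> * (e / (?I + 1) * norm (y - x))"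
            by (intro mult_left_mono) auto
          then show ?thesis by (simp add: abs_mult[symmetric] algebra_simps)
        qed
        have i3: "integrable lborel (\<lambda>z. (f z *\<^sub>R k' (x - z)) \<bullet> (y - x))"
          using i2 by (rule integrable_inner_left)
        have "norm ((LINT z|lborel. k (y - z) * f z) - (LINT z|lborel. k (x - z) * f z) - ?g \<bullet> (y - x))
          = norm (LINT z|lborel. k (y - z) * f z - k (x - z) * f z - (f z *\<^sub>R k' (x - z)) \<bullet> (y - x))"
          using i1 i2 i3 by (simp del: inner_scaleR_left)
        also have "\<dots> \<le> (LINT z|lborel. \<bar>f z\<bar> * (e / (?I + 1) * norm (y - x)))"
          using i1 i3 f by (intro norm_integral_le_integral ptw) auto
        also have "\<dots> = (?I / (?I + 1)) * (e * norm (y - x))" by simp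
        also have "\<dots> \<le> 1 * (e * norm (y - x))"
          using I \<open>0 < e\<close> by (intro mult_right_mono) auto
        finally show ?thesis by simp
      qed
      then show "\<exists>d>0. \<forall>y. norm (y - x) < d \<longrightarrow>
         norm ((LINT z|lborel. k (y - z) * f z) - (LINT z|lborel. k (x - z) * f z) - ?g \<bullet> (y - x)) \<le> e * norm (y - x)"
        using d(1) by (intro exI[of _ d] conjI) auto
    qed
  next
    have "uniformly_continuous_on UNIV (\<lambda>x. LINT z|lborel. f z *\<^sub>R k' (x - z))"
      unfolding uniformly_continuous_on_def
    proof (intro allI impI)
      fix e :: real assume "0 < e"
      then obtain d where d: "0 < d" "\<And>a b. dist a b < d \<Longrightarrow> norm (k' a - k' b) * (?I + 1) \<le> e / 2" using small[of "e/2"] by auto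
      have I: "0 < ?I + 1" by (intro add_nonneg_pos Bochner_Integration.integral_nonneg) auto
      have "dist (LINT z|lborel. f z *\<^sub>R k' (y - z)) (LINT z|lborel. f z *\<^sub>R k' (x - z)) < e" if "dist y x < d" for x y
      proof -
        have ptw: "norm (f z *\<^sub>R k' (y - z) - f z *\<^sub>R k' (x - z)) \<le> \<bar>f z\<bar> * (e / 2 / (?I + 1))" for z
        proof -
          have "norm (k' (y - z) - k' (x - z)) \<le> e / 2 / (?I + 1)"
            unfolding pos_le_divide_eq[OF I] using d(2)[of "y - z" "x - z"] that by (simp add: dist_norm)
          then have "\<bar>f z\<bar> * norm (k' (y - z) - k' (x - z)) \<le> \<bar>f z\<bar> * (e / 2 / (?I + 1))"
            by (rule mult_left_mono) simp
          then show ?thesis by (simp only: scaleR_diff_right[symmetric] norm_scaleR)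
        qed
        have "dist (LINT z|lborel. f z *\<^sub>R k' (y - z)) (LINT z|lborel. f z *\<^sub>R k' (x - z))
          = norm (LINT z|lborel. f z *\<^sub>R k' (y - z) - f z *\<^sub>R k' (x - z))"
          using i2 by (simp add: dist_norm)
        also have "\<dots> \<le> (LINT z|lborel. \<bar>f z\<bar> * (e / 2 / (?I + 1)))"
          using i2 f by (intro norm_integral_le_integral ptw) auto
        also have "\<dots> = (?I / (?I + 1)) * (e / 2)" by simp
        also have "\<dots> \<le> 1 * (e / 2)" using I \<open>0 < e\<close> by (intro mult_right_mono) auto
        finally show ?thesis using \<open>0 < e\<close> by simp
      qed
      then show "\<exists>d>0. \<forall>x\<in>UNIV. \<forall>x'\<in>UNIV. dist x' x < d \<longrightarrow>
          dist (LINT z|lborel. f z *\<^sub>R k' (x' - z)) (LINT z|lborel. f z *\<^sub>R k' (x - z)) < e"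
        using d(1) by (intro exI[of _ d] conjI) auto
    qed
    then show "continuous_on UNIV (\<lambda>x. LINT z|lborel. f z *\<^sub>R k' (x - z))"
      by (rule uniformly_continuous_imp_continuous)
  qed
qed

section \<open>Integration by parts\<close>

text \<open>Translations preserve the integral, so the integral of a difference quotient vanishes.\<close>

lemma integral_gradient_compact_support:
  fixes w :: "'a::euclidean_space \<Rightarrow> real"
  assumes w: "C1_grad UNIV w w'" and w0: "\<And>x. r \<le> norm x \<Longrightarrow> w x = 0" and w'0: "\<And>x. r \<le> norm x \<Longrightarrow> w' x = 0"
  shows "(LINT x|lborel. w' x \<bullet> v) = 0"
proof -
  obtain B where B: "0 \<le> B" "\<And>x. norm (w' x) \<le> B"
    using bounded_compact_support[OF C1_gradD(2)[OF w] w'0] by metis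
  have [measurable]: "w \<in> borel_measurable borel" "w' \<in> borel_measurable borel"
    by (simp_all add: borel_measurable_continuous_onI[OF C1_gradD(2)[OF w]]
        borel_measurable_continuous_onI[OF C1_gradD(3)[OF w]])
  have iw: "integrable lborel w" by (rule integrable_continuous_compact_support[OF C1_gradD(3)[OF w] w0])
  define t where "t n = 1 / real (Suc n)" for n
  have t: "0 < t n" "t n \<le> 1" for n by (auto simp: t_def)
  define q where "q n x = (w (t n *\<^sub>R v + x) - w x) / t n" for n x
  have tr: "integrable lborel (\<lambda>x. w (c + x))" "(LINT x|lborel. w (c + x)) = (LINT x|lborel. w x)" for c
    using integrable_distr_eq[of "(+) c" lborel borel w] integral_distr[of "(+) c" lborel borel w] iw
    by (simp_all add: lborel_distr_plus[of c])
  have q0: "(LINT x|lborel. q n x) = 0" for n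
    using tr[of "t n *\<^sub>R v"] iw by (simp add: q_def)
  have "(\<lambda>n. LINT x|lborel. q n x) \<longlonglongrightarrow> (LINT x|lborel. w' x \<bullet> v)"
  proof (rule integral_dominated_convergence)
    show "integrable lborel (\<lambda>x. indicator (cball 0 (r + norm v)) x *\<^sub>R (B * norm v) :: real)"
      by (intro borel_integrable_compact) auto
    show "AE x in lborel. (\<lambda>n. q n x) \<longlonglongrightarrow> w' x \<bullet> v"
    proof (rule AE_I2)
      fix x
      have "((\<lambda>s. w (s *\<^sub>R v + x)) has_derivative (\<lambda>s. w' x \<bullet> (s *\<^sub>R v))) (at 0)"
        by (rule has_derivative_compose[where g=w and f="\<lambda>s. s *\<^sub>R v + x", of "\<lambda>s. s *\<^sub>R v"])
           (auto intro!: derivative_eq_intros C1_gradD(1)[OF w])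
      then have "((\<lambda>s. w (s *\<^sub>R v + x)) has_field_derivative (w' x \<bullet> v)) (at 0)"
        by (simp add: has_field_derivative_def mult.commute[of _ "w' x \<bullet> v"] has_derivative_eq_rhs)
      then have "(\<lambda>s. (w (s *\<^sub>R v + x) - w x) / s) \<midarrow>0\<rightarrow> w' x \<bullet> v"
        by (simp add: DERIV_def)
      moreover have "filterlim t (at 0) sequentially"
      proof (rule filterlim_atI)
        show "t \<longlonglongrightarrow> 0" using LIMSEQ_Suc[OF lim_1_over_n[where 'a=real]] by (simp add: t_def[abs_def])
      qed (use t(1) in \<open>auto intro!: always_eventually simp: less_imp_neq[symmetric]\<close>)
      ultimately show "(\<lambda>n. q n x) \<longlonglongrightarrow> w' x \<bullet> v"
        unfolding q_def by (rule filterlim_compose)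
    qed
    fix n
    show "AE x in lborel. norm (q n x) \<le> indicator (cball 0 (r + norm v)) x *\<^sub>R (B * norm v)"
    proof (rule AE_I2)
      fix x
      have "norm (w (t n *\<^sub>R v + x) - w x) \<le> B * norm ((t n *\<^sub>R v + x) - x)"
      proof (rule differentiable_bound[of UNIV w "\<lambda>z h. w' z \<bullet> h"])
        fix z
        show "onorm (\<lambda>h. w' z \<bullet> h) \<le> B"
        proof (rule onorm_le)
          fix h
          have "norm (w' z \<bullet> h) \<le> norm (w' z) * norm h" by (rule Cauchy_Schwarz_ineq2[folded real_norm_def])
          also have "\<dots> \<le> B * norm h" using B by (intro mult_right_mono) auto
          finally show "norm (w' z \<bullet> h) \<le> B * norm h" .
        qed
      qed (use C1_gradD(1)[OF w] in auto)
      then have a: "norm (q n x) \<le> B * norm v"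
        using t[of n] by (simp add: q_def divide_simps mult.commute mult.left_commute)
      show "norm (q n x) \<le> indicator (cball 0 (r + norm v)) x *\<^sub>R (B * norm v)"
      proof (cases "x \<in> cball 0 (r + norm v)")
        case False
        have "norm (t n *\<^sub>R v) \<le> norm v" using t[of n] by (simp add: mult_left_le_one_le)
        moreover have "norm x \<le> norm (t n *\<^sub>R v + x) + norm (t n *\<^sub>R v)"
          using norm_triangle_ineq4[of "t n *\<^sub>R v + x" "t n *\<^sub>R v"] by simp
        ultimately have "r \<le> norm (t n *\<^sub>R v + x)" "r \<le> norm x"
          using False norm_ge_zero[of v] unfolding mem_cball dist_0_norm by linarith+
        then show ?thesis using w0 False by (simp add: q_def)
      qed (use a in simp)
    qed
  qed (auto simp: q_def)
  then show ?thesis using q0 by (simp add: LIMSEQ_const_iff)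
qed

text \<open>The product \<open>F * \<phi>\<close>, extended by zero, is continuously differentiable on the whole space, so that its
  gradient integrates to zero.\<close>

lemma integration_by_parts_test_function:
  fixes F \<phi> :: "'a::euclidean_space \<Rightarrow> real"
  assumes U: "open U" and F: "C1_grad U F u" and \<phi>: "C1_grad UNIV \<phi> \<phi>'"
    and K: "compact K" "K \<subseteq> U" and out: "\<And>x. x \<notin> K \<Longrightarrow> \<phi> x = 0" "\<And>x. x \<notin> K \<Longrightarrow> \<phi>' x = 0"
  shows "(LINT x|lborel_on U. \<phi> x * (u x \<bullet> v)) = - (LINT x|lborel_on U. F x * (\<phi>' x \<bullet> v))"
    and "integrable (lborel_on U) (\<lambda>x. \<phi> x * (u x \<bullet> v))"
    and "integrable (lborel_on U) (\<lambda>x. F x * (\<phi>' x \<bullet> v))"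
proof -
  define w where "w x = (if x \<in> U then F x * \<phi> x else 0)" for x
  define p where "p x = (if x \<in> U then \<phi> x *\<^sub>R u x else 0)" for x
  define q where "q x = (if x \<in> U then F x *\<^sub>R \<phi>' x else 0)" for x
  have oK: "open (- K)" using K(1) by (simp add: open_Compl compact_imp_closed)
  have UK: "U \<union> - K = UNIV" using K(2) by blast
  have z: "w x = 0" "p x = 0" "q x = 0" if "x \<notin> K" for x using out that by (auto simp: w_def p_def q_def)
  have "continuous_on (U \<union> - K) p" "continuous_on (U \<union> - K) q"
  proof -
    have "continuous_on U p \<longleftrightarrow> continuous_on U (\<lambda>x. \<phi> x *\<^sub>R u x)"
      "continuous_on U q \<longleftrightarrow> continuous_on U (\<lambda>x. F x *\<^sub>R \<phi>' x)"
      by (rule continuous_on_cong; simp add: p_def q_def)+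
    moreover have "continuous_on U (\<lambda>x. \<phi> x *\<^sub>R u x)" "continuous_on U (\<lambda>x. F x *\<^sub>R \<phi>' x)"
      by (intro continuous_intros C1_gradD(2,3)[OF F] continuous_on_subset[OF C1_gradD(2)[OF \<phi>]]
          continuous_on_subset[OF C1_gradD(3)[OF \<phi>]] subset_UNIV)+
    moreover have "continuous_on (- K) p \<longleftrightarrow> continuous_on (- K) (\<lambda>x. 0 :: 'a)"
      "continuous_on (- K) q \<longleftrightarrow> continuous_on (- K) (\<lambda>x. 0 :: 'a)"
      by (rule continuous_on_cong; simp add: z)+
    ultimately show "continuous_on (U \<union> - K) p" "continuous_on (U \<union> - K) q"
      by (auto intro: continuous_on_open_Un[OF U oK])
  qed
  then have cpq: "continuous_on UNIV p" "continuous_on UNIV q" by (simp_all add: UK)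
  have w: "C1_grad UNIV w (\<lambda>x. p x + q x)"
    unfolding C1_grad_def
  proof (intro conjI ballI)
    fix x
    show "(w has_derivative (\<lambda>h. (p x + q x) \<bullet> h)) (at x)"
    proof (cases "x \<in> U")
      case True
      have "((\<lambda>x. F x * \<phi> x) has_derivative (\<lambda>h. F x * (\<phi>' x \<bullet> h) + (u x \<bullet> h) * \<phi> x)) (at x)"
        by (rule has_derivative_mult[OF C1_gradD(1)[OF F True] C1_gradD(1)[OF \<phi> UNIV_I]])
      then have "((\<lambda>x. F x * \<phi> x) has_derivative (\<lambda>h. (p x + q x) \<bullet> h)) (at x)"
        by (rule has_derivative_eq_rhs) (simp add: p_def q_def True inner_add_left algebra_simps)
      then show ?thesis
        by (rule has_derivative_transform_within_open[OF _ U True]) (simp add: w_def)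
    next
      case False
      then have xK: "x \<in> - K" using K by blast
      have "((\<lambda>x. 0) has_derivative (\<lambda>h. (p x + q x) \<bullet> h)) (at x)"
        using xK by (simp add: z)
      then show ?thesis
        by (rule has_derivative_transform_within_open[OF _ oK xK]) (simp add: z)
    qed
  qed (intro continuous_intros cpq)
  obtain r where r: "\<And>x. x \<in> K \<Longrightarrow> norm x \<le> r" using compact_imp_bounded[OF K(1)] by (auto simp: bounded_iff)
  have rK: "x \<notin> K" if "r + 1 \<le> norm x" for x using r[of x] that by force
  have ip: "integrable lborel p" "integrable lborel q"
    by (rule integrable_continuous_compact_support[where r="r+1"]; use cpq z rK in auto)+
  have "0 = (LINT x|lborel. (p x + q x) \<bullet> v)"
    by (rule integral_gradient_compact_support[OF w, symmetric, where r="r+1"]) (use z rK in auto)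
  also have "\<dots> = (LINT x|lborel. p x \<bullet> v) + (LINT x|lborel. q x \<bullet> v)"
    using ip by (simp add: inner_add_left)
  finally have e: "(LINT x|lborel. p x \<bullet> v) = - (LINT x|lborel. q x \<bullet> v)" by simp
  have Um: "U \<inter> space lborel \<in> sets lborel" using U by simp
  have ind: "(\<lambda>x. indicator U x *\<^sub>R (\<phi> x * (u x \<bullet> v))) = (\<lambda>x. p x \<bullet> v)"
     "(\<lambda>x. indicator U x *\<^sub>R (F x * (\<phi>' x \<bullet> v))) = (\<lambda>x. q x \<bullet> v)"
    by (auto simp: p_def q_def indicator_def fun_eq_iff)
  show "(LINT x|lborel_on U. \<phi> x * (u x \<bullet> v)) = - (LINT x|lborel_on U. F x * (\<phi>' x \<bullet> v))"
    by (simp only: integral_restrict_space[OF Um] ind e)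
  show "integrable (lborel_on U) (\<lambda>x. \<phi> x * (u x \<bullet> v))"
    "integrable (lborel_on U) (\<lambda>x. F x * (\<phi>' x \<bullet> v))"
    using ip by (simp_all only: integrable_restrict_space[OF Um] ind integrable_inner_left)
qed

section \<open>Mollification\<close>

text \<open>The square makes the positive part continuously differentiable.\<close>

definition bump :: "real \<Rightarrow> 'a::euclidean_space \<Rightarrow> real" where
  "bump r x = (max 0 (r\<^sup>2 - x \<bullet> x))\<^sup>2"

definition moll :: "real \<Rightarrow> 'a::euclidean_space \<Rightarrow> real" where
  "moll r x = bump r x / (LINT z|lborel. bump r (z::'a))"

definition moll_grad :: "real \<Rightarrow> 'a::euclidean_space \<Rightarrow> 'a" where
  "moll_grad r x = (- 4 * max 0 (r\<^sup>2 - x \<bullet> x) / (LINT z|lborel. bump r (z::'a))) *\<^sub>R x"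

lemma continuous_on_bump: "continuous_on S (bump r)"
  unfolding bump_def by (intro continuous_intros)

lemma bump_eq_0: "0 \<le> r \<Longrightarrow> r \<le> norm x \<Longrightarrow> bump r x = 0"
  and max_bump_eq_0: "0 \<le> r \<Longrightarrow> r \<le> norm x \<Longrightarrow> max 0 (r\<^sup>2 - x \<bullet> x) = 0"
  by (auto simp: bump_def dot_square_norm max_def power_mono intro: antisym)

lemma integrable_bump: "0 \<le> r \<Longrightarrow> integrable lborel (bump r :: 'a::euclidean_space \<Rightarrow> real)"
  by (rule integrable_continuous_compact_support[OF continuous_on_bump bump_eq_0])

lemma integral_bump_pos:
  assumes "0 < r"
  shows "0 < (LINT z|lborel. bump r (z::'a::euclidean_space))"
proof -
  let ?B = "ball (0::'a) (r / 2)"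
  have "0 < ((3/4) * r\<^sup>2)\<^sup>2 * measure lborel ?B"
    using assms content_ball_pos[of "r/2" "0::'a"] by simp
  also have "\<dots> = (LINT z|lborel. ((3/4) * r\<^sup>2)\<^sup>2 * indicator ?B z)" by simp
  also have "\<dots> \<le> (LINT z|lborel. bump r (z::'a))"
  proof (rule integral_mono)
    show "integrable lborel (\<lambda>z. ((3/4) * r\<^sup>2)\<^sup>2 * indicator ?B z)"
      using emeasure_lborel_ball_finite[of "0::'a" "r/2"]
      by (intro integrable_mult_right integrable_real_indicator) auto
    fix z :: 'a
    show "((3/4) * r\<^sup>2)\<^sup>2 * indicator ?B z \<le> bump r z"
    proof (cases "z \<in> ?B")
      case True
      then have "(norm z)\<^sup>2 \<le> (r/2)\<^sup>2" by (intro power_mono) auto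
      then have "(3/4) * r\<^sup>2 \<le> max 0 (r\<^sup>2 - z \<bullet> z)"
        by (simp add: dot_square_norm power2_eq_square le_max_iff_disj)
      then have "((3/4) * r\<^sup>2)\<^sup>2 \<le> bump r z" unfolding bump_def by (intro power_mono) auto
      then show ?thesis using True by simp
    qed (simp add: bump_def)
  qed (rule integrable_bump, use assms in simp)
  finally show ?thesis .
qed

lemma has_derivative_max_square:
  "((\<lambda>t::real. (max 0 t)\<^sup>2) has_field_derivative (2 * max 0 t)) (at t)"
proof -
  consider "t < 0" | "t = 0" | "0 < t" by linarith
  then show ?thesis
  proof cases
    case 1
    have "((\<lambda>t::real. 0) has_field_derivative (2 * max 0 t)) (at t)" using 1 by simp
    then show ?thesis
      by (rule has_field_derivative_transform_within_open[of _ _ _ "{..<0}"]) (use 1 in auto)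
  next
    case 3
    have "((\<lambda>t::real. t\<^sup>2) has_field_derivative (2 * max 0 t)) (at t)"
      using 3 by (auto intro!: derivative_eq_intros)
    then show ?thesis
      by (rule has_field_derivative_transform_within_open[of _ _ _ "{0<..}"]) (use 3 in auto)
  next
    case 2
    have "((\<lambda>s::real. (max 0 s)\<^sup>2 / s) \<longlongrightarrow> 0) (at 0)"
    proof (rule Lim_null_comparison)
      show "\<forall>\<^sub>F s in at 0. norm ((max 0 s)\<^sup>2 / s) \<le> \<bar>s::real\<bar>"
        by (rule always_eventually) (auto simp: max_def power2_eq_square)
    qed (auto intro!: tendsto_eq_intros)
    then show ?thesis using 2 by (simp add: DERIV_def)
  qed
qed

lemma C1_grad_moll: "C1_grad UNIV (moll r) (moll_grad r :: 'a::euclidean_space \<Rightarrow> 'a)"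
  unfolding C1_grad_def
proof (intro conjI ballI)
  fix x :: 'a
  let ?Z = "LINT z|lborel. bump r (z::'a)"
  have "((\<lambda>x::'a. r\<^sup>2 - x \<bullet> x) has_derivative (\<lambda>h. - 2 * (x \<bullet> h))) (at x)"
    by (auto intro!: derivative_eq_intros simp: inner_commute)
  from DERIV_compose_FDERIV[OF has_derivative_max_square this]
  have "(bump r has_derivative (\<lambda>h. - 2 * (x \<bullet> h) * (2 * max 0 (r\<^sup>2 - x \<bullet> x)))) (at x)"
    unfolding bump_def[abs_def] .
  then have "((\<lambda>x. bump r x / ?Z) has_derivative (\<lambda>h. - 2 * (x \<bullet> h) * (2 * max 0 (r\<^sup>2 - x \<bullet> x)) / ?Z)) (at x)"
    unfolding divide_inverse by (rule has_derivative_mult_left)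
  then show "(moll r has_derivative (\<lambda>h. moll_grad r x \<bullet> h)) (at x)"
    unfolding moll_def[abs_def] by (rule has_derivative_eq_rhs) (simp add: moll_grad_def fun_eq_iff)
next
  show "continuous_on UNIV (moll_grad r :: 'a \<Rightarrow> 'a)"
  proof -
    have "moll_grad r = (\<lambda>x::'a. (- 4 / (LINT z|lborel. bump r (z::'a))) *\<^sub>R (max 0 (r\<^sup>2 - x \<bullet> x) *\<^sub>R x))"
      by (simp add: moll_grad_def fun_eq_iff)
    moreover have "continuous_on UNIV (\<lambda>x::'a. max 0 (r\<^sup>2 - x \<bullet> x) *\<^sub>R x)"
      by (intro continuous_intros)
    ultimately show ?thesis by (simp only: continuous_on_scaleR continuous_on_const)
  qed
qed

lemma moll_eq_0: "0 \<le> r \<Longrightarrow> r \<le> norm x \<Longrightarrow> moll r x = 0"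
  and moll_grad_eq_0: "0 \<le> r \<Longrightarrow> r \<le> norm x \<Longrightarrow> moll_grad r x = 0"
  by (simp_all add: moll_def bump_eq_0 moll_grad_def max_bump_eq_0)

lemma moll_nonneg: "0 \<le> moll r x"
  by (simp add: moll_def bump_def Bochner_Integration.integral_nonneg)

lemma lborel_integral_reflect:
  fixes f :: "'a::euclidean_space \<Rightarrow> 'b::{banach, second_countable_topology}"
  assumes "f \<in> borel_measurable borel"
  shows "(LINT z|lborel. f (x - z)) = (LINT z|lborel. f z)" and "integrable lborel f \<Longrightarrow> integrable lborel (\<lambda>z. f (x - z))"
proof -
  have eq: "lborel = density (distr lborel borel (\<lambda>z. x - z)) (\<lambda>_. 1) "
    using lborel_affine[of "-1" x] by simp
  then have d: "distr lborel borel (\<lambda>z. x - z) = lborel" by (simp add: density_1)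
  show "(LINT z|lborel. f (x - z)) = (LINT z|lborel. f z)"
    using integral_distr[of "\<lambda>z. x - z" lborel borel f] assms by (simp add: d)
  show "integrable lborel f \<Longrightarrow> integrable lborel (\<lambda>z. f (x - z))"
    using integrable_distr_eq[of "\<lambda>z. x - z" lborel borel f] assms by (simp add: d)
qed

lemma moll_measurable [measurable]: "moll r \<in> borel_measurable borel" "moll_grad r \<in> borel_measurable borel"
  by (rule borel_measurable_continuous_onI[OF C1_gradD(3)[OF C1_grad_moll]]
           borel_measurable_continuous_onI[OF C1_gradD(2)[OF C1_grad_moll]])+

lemma integrable_moll: "0 \<le> r \<Longrightarrow> integrable lborel (\<lambda>z. moll r (x - z :: 'a::euclidean_space))"
  by (intro lborel_integral_reflect(2) moll_measurable) (simp add: moll_def[abs_def] integrable_bump)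

lemma integral_moll: "0 < r \<Longrightarrow> (LINT z|lborel. moll r (x - z :: 'a::euclidean_space)) = 1"
  by (subst lborel_integral_reflect(1)[OF moll_measurable(1)]) (use integral_bump_pos[of r, where 'a='a] in \<open>auto simp: moll_def[abs_def]\<close>)

definition mollify :: "real \<Rightarrow> ('a::euclidean_space \<Rightarrow> real) \<Rightarrow> 'a \<Rightarrow> real" where
  "mollify r f x = (LINT z|lborel. moll r (x - z) * f z)"

lemma C1_grad_mollify:
  assumes "0 \<le> r" "integrable lborel f"
  shows "C1_grad UNIV (mollify r f) (\<lambda>x. LINT z|lborel. f z *\<^sub>R moll_grad r (x - z))"
  using C1_grad_convolution[OF C1_grad_moll moll_eq_0 moll_grad_eq_0 assms(2)] assms(1)
  by (simp add: mollify_def[abs_def])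

lemma mollify_eq_0:
  assumes "0 \<le> r" "\<And>z. dist x z < r \<Longrightarrow> f z = 0"
  shows "mollify r f x = 0" "(LINT z|lborel. f z *\<^sub>R moll_grad r (x - z)) = 0"
proof -
  have "moll r (x - z) * f z = 0" "f z *\<^sub>R moll_grad r (x - z) = 0" for z
    using assms moll_eq_0[of r "x - z"] moll_grad_eq_0[of r "x - z"]
    by (cases "dist x z < r"; simp add: dist_norm)+
  then show "mollify r f x = 0" "(LINT z|lborel. f z *\<^sub>R moll_grad r (x - z)) = 0"
    by (simp_all only: mollify_def Bochner_Integration.integral_zero)
qed

lemma mollify_close:
  assumes r: "0 < r" and [measurable]: "f \<in> borel_measurable borel"
    and close: "\<And>z. dist x z < r \<Longrightarrow> \<bar>f z - c\<bar> \<le> e"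
  shows "\<bar>mollify r f x - c\<bar> \<le> e"
proof -
  have e: "0 \<le> e" using close[of x] r by auto
  have b: "norm (moll r (x - z) * (f z - c)) \<le> moll r (x - z) * e" for z
  proof (cases "dist x z < r")
    case True
    then show ?thesis using close[OF True] by (simp add: abs_mult moll_nonneg mult_left_mono)
  next
    case False
    then show ?thesis using r moll_eq_0[of r "x - z"] by (simp add: dist_norm)
  qed
  have i0: "integrable lborel (\<lambda>z. moll r (x - z))" using r by (intro integrable_moll) simp
  have i1: "integrable lborel (\<lambda>z. moll r (x - z) * e)" using i0 by simp
  have i2: "integrable lborel (\<lambda>z. moll r (x - z) * (f z - c))"
  proof (rule Bochner_Integration.integrable_bound[OF i1])
    show "AE z in lborel. norm (moll r (x - z) * (f z - c)) \<le> norm (moll r (x - z) * e)"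
      using b e by (auto simp: moll_nonneg)
  qed simp
  have "mollify r f x = (LINT z|lborel. moll r (x - z) * (f z - c) + moll r (x - z) * c)"
    by (simp add: mollify_def algebra_simps)
  also have "\<dots> = (LINT z|lborel. moll r (x - z) * (f z - c)) + c"
    using i0 i2 integral_moll[OF r, of x] by simp
  finally have "mollify r f x - c = (LINT z|lborel. moll r (x - z) * (f z - c))" by simp
  also have "norm \<dots> \<le> (LINT z|lborel. moll r (x - z) * e)"
    by (rule norm_integral_le_integral[OF i2 i1 b])
  also have "\<dots> = e" using integral_moll[OF r, of x] i0 by simp
  finally show ?thesis by simp
qed

section \<open>Closability of the gradient on open sets\<close>

lemma norm_power2_le: "\<bar>t\<bar> \<le> C \<Longrightarrow> norm (t\<^sup>2) \<le> (C::real)\<^sup>2"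
  using abs_le_square_iff[of t C] by simp

lemma infdist_Compl_pos_iff:
  assumes "open U" "- U \<noteq> {}"
  shows "0 < infdist x (- U) \<longleftrightarrow> x \<in> U"
proof
  assume "0 < infdist x (- U)"
  then show "x \<in> U" by (metis ComplI infdist_zero less_irrefl)
next
  assume "x \<in> U"
  then show "0 < infdist x (- U)"
    using assms by (intro infdist_pos_not_in_closed) (auto simp: closed_Compl)
qed

lemma infdist_ge_diff_dist: "infdist x A - dist x y \<le> infdist y A"
  using infdist_triangle[of x A y] by (simp add: dist_commute)

lemma measurable_continuous_restrict_lborel:
  assumes "continuous_on U f" "U \<in> sets borel"
  shows "f \<in> borel_measurable (lborel_on U)"
  using borel_measurable_continuous_on_restrict[OF assms(1)]
  by (simp add: measurable_cong_sets[OF sets_restrict_space_cong[OF sets_lborel] refl])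

lemma finite_measure_restrict_bounded:
  assumes "bounded U" "U \<in> sets borel"
  shows "finite_measure (lborel_on (U::'a::euclidean_space set))"
  using assms emeasure_bounded_finite[OF assms(1)]
  by (intro finite_measureI) (simp add: emeasure_restrict_space space_restrict_space less_top)

text \<open>Cut \<open>g\<close> off near the complement of \<open>U\<close> and mollify at half the scale of the cut. The results are
  bounded by \<open>B\<close> and converge to \<open>g\<close> pointwise on \<open>U\<close>.\<close>

lemma dense_test_functions:
  fixes g :: "'a::euclidean_space \<Rightarrow> real"
  assumes U: "open U" "bounded U" and g: "continuous_on U g" "\<And>x. x \<in> U \<Longrightarrow> \<bar>g x\<bar> \<le> B" and e: "0 < e"
  shows "\<exists>\<phi> \<phi>' K. C1_grad UNIV \<phi> \<phi>' \<and> compact K \<and> K \<subseteq> U \<and> (\<forall>x. x \<notin> K \<longrightarrow> \<phi> x = 0 \<and> \<phi>' x = (0::'a)) \<and>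
     (LINT x|lborel_on U. (g x - \<phi> x)\<^sup>2) < e"
proof (cases "U = {}")
  case True
  then show ?thesis using e
    by (intro exI[of _ "\<lambda>_. 0"] exI[of _ "{}"]) (auto simp: C1_grad_def integral_restrict_space)
next
  case False
  have ne: "- U \<noteq> {}" using U(2) not_bounded_UNIV[where 'a='a] by (metis double_compl Compl_empty_eq)
  note pos = infdist_Compl_pos_iff[OF U(1) ne]
  have B: "0 \<le> B" using g(2) False by force
  define r where "r j = 1 / real (Suc j)" for j
  have r: "0 < r j" for j by (simp add: r_def)
  have r0: "r \<longlonglongrightarrow> 0" using LIMSEQ_Suc[OF lim_1_over_n[where 'a=real]] by (simp add: r_def[abs_def])
  define f where "f j z = (if 2 * r j \<le> infdist z (- U) then g z else 0)" for j z
  have cl: "closed {z. s \<le> infdist z (- U)}" for s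
    by (intro closed_Collect_le continuous_intros)
  have sub: "{z. s \<le> infdist z (- U)} \<subseteq> U" if "0 < s" for s using that pos by force
  have [measurable]: "f j \<in> borel_measurable borel" for j
  proof -
    have "(\<lambda>z. if z \<in> {z. 2 * r j \<le> infdist z (- U)} then g z else 0) \<in> borel_measurable borel"
    proof (rule borel_measurable_continuous_on_if)
    show "{z. 2 * r j \<le> infdist z (- U)} \<in> sets borel" using cl by simp
    show "continuous_on {z. 2 * r j \<le> infdist z (- U)} g"
      using sub[of "2 * r j"] r by (intro continuous_on_subset[OF g(1)]) auto
    qed auto
    then show ?thesis by (simp add: f_def[abs_def])
  qed
  have fB: "\<bar>f j z\<bar> \<le> B" for j z
    using g(2)[of z] B sub[of "2 * r j"] r[of j] by (auto simp: f_def)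
  have fi: "integrable lborel (f j)" for j
  proof -
    have cb: "bounded U" "U \<in> sets borel" using U by auto
    have "integrable lborel (\<lambda>z. B * indicator U z)"
      using emeasure_bounded_finite[OF U(2)] U(1) by (intro integrable_mult_right integrable_real_indicator) auto
    moreover have "norm (f j z) \<le> norm (B * indicator U z)" for z
    proof (cases "z \<in> U")
      case True
      then show ?thesis using fB[of j z] B by simp
    next
      case False
      then have "f j z = 0" using sub[of "2 * r j"] r[of j] by (auto simp: f_def)
      then show ?thesis by simp
    qed
    ultimately show ?thesis
      by (intro Bochner_Integration.integrable_bound[of lborel "\<lambda>z. B * indicator U z" "f j"]) auto
  qed
  define \<phi> where "\<phi> j = mollify (r j) (f j)" for j
  define \<phi>' where "\<phi>' j x = (LINT z|lborel. f j z *\<^sub>R moll_grad (r j) (x - z))" for j x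
  define K where "K j = {z. r j \<le> infdist z (- U)}" for j
  have C: "C1_grad UNIV (\<phi> j) (\<phi>' j)" for j
    using C1_grad_mollify[OF _ fi, of "r j"] r[of j] by (simp add: \<phi>_def \<phi>'_def[abs_def])
  have K: "compact (K j)" "K j \<subseteq> U" for j
    using cl[of "r j"] sub[OF r, of j] bounded_subset[OF U(2)] by (auto simp: K_def compact_eq_bounded_closed)
  have out: "\<phi> j x = 0 \<and> \<phi>' j x = 0" if "x \<notin> K j" for j x
  proof -
    have "f j z = 0" if "dist x z < r j" for z
      using infdist_ge_diff_dist[of z "- U" x] that \<open>x \<notin> K j\<close> by (auto simp: f_def K_def dist_commute)
    then show ?thesis
      using mollify_eq_0[of "r j" x "f j"] r[of j] by (simp add: \<phi>_def \<phi>'_def)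
  qed
  have \<phi>B: "\<bar>\<phi> j x\<bar> \<le> B" for j x
    using mollify_close[OF r, of "f j" x j 0 B] fB by (simp add: \<phi>_def)
  interpret finite_measure "lborel_on U" by (rule finite_measure_restrict_bounded) (use U in auto)
  have mg: "g \<in> borel_measurable (lborel_on U)"
    by (rule measurable_continuous_restrict_lborel) (use g U in auto)
  have m\<phi>: "\<phi> j \<in> borel_measurable (lborel_on U)" for j
    using continuous_on_subset[OF C1_gradD(3)[OF C]] U by (intro measurable_continuous_restrict_lborel) auto
  have "(\<lambda>j. LINT x|lborel_on U. (g x - \<phi> j x)\<^sup>2) \<longlonglongrightarrow> (LINT x|lborel_on U. 0)"
  proof (rule integral_dominated_convergence[where w="\<lambda>_. (2 * B)\<^sup>2"])
    show "AE x in lborel_on U. (\<lambda>j. (g x - \<phi> j x)\<^sup>2) \<longlonglongrightarrow> 0"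
    proof (rule AE_I2)
      fix x assume "x \<in> space (lborel_on U)"
      then have x: "x \<in> U" by (simp add: space_restrict_space)
      have "(\<lambda>j. \<phi> j x) \<longlonglongrightarrow> g x"
        unfolding tendsto_iff
      proof (intro allI impI)
        fix e :: real assume e: "0 < e"
        have "isCont g x" using g(1) U(1) x by (simp add: continuous_on_eq_continuous_at)
        then obtain d where d: "0 < d" "\<And>z. dist z x < d \<Longrightarrow> dist (g z) (g x) < e / 2"
          using e unfolding continuous_at_eps_delta by (metis half_gt_zero)
        have D: "0 < infdist x (- U)" using pos x by blast
        have "\<forall>\<^sub>F j in sequentially. r j < min d (infdist x (- U) / 3)"
          using order_tendstoD(2)[OF r0, of "min d (infdist x (- U) / 3)"] d D by simp
        then show "\<forall>\<^sub>F j in sequentially. dist (\<phi> j x) (g x) < e"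
        proof eventually_elim
          case (elim j)
          have "\<bar>mollify (r j) (f j) x - g x\<bar> \<le> e / 2"
          proof (rule mollify_close[OF r])
            fix z assume z: "dist x z < r j"
            then have "2 * r j \<le> infdist z (- U)" using infdist_ge_diff_dist[of x "- U" z] elim by simp
            then show "\<bar>f j z - g x\<bar> \<le> e / 2"
              using d(2)[of z] z elim by (auto simp: f_def dist_real_def dist_commute)
          qed simp
          then show ?case using e by (simp add: \<phi>_def dist_real_def)
        qed
      qed
      then have "(\<lambda>j. (g x - \<phi> j x)\<^sup>2) \<longlonglongrightarrow> (g x - g x)\<^sup>2" by (intro tendsto_intros)
      then show "(\<lambda>j. (g x - \<phi> j x)\<^sup>2) \<longlonglongrightarrow> 0" by simp
    qed
    show "AE x in lborel_on U. norm ((g x - \<phi> j x)\<^sup>2) \<le> (2 * B)\<^sup>2" for j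
    proof (rule AE_I2)
      fix x assume "x \<in> space (lborel_on U)"
      then have "\<bar>g x\<bar> \<le> B" using g(2) by (simp add: space_restrict_space)
      then have "\<bar>g x - \<phi> j x\<bar> \<le> 2 * B" using \<phi>B[of j x] by linarith
      then show "norm ((g x - \<phi> j x)\<^sup>2) \<le> (2 * B)\<^sup>2" by (rule norm_power2_le)
    qed
  qed (use mg m\<phi> in simp_all)
  then have "\<forall>\<^sub>F j in sequentially. (LINT x|lborel_on U. (g x - \<phi> j x)\<^sup>2) < e"
    using e by (intro order_tendstoD(2)) auto
  then obtain j where "(LINT x|lborel_on U. (g x - \<phi> j x)\<^sup>2) < e"
    by (auto simp: eventually_sequentially)
  with C K out show ?thesis
    by (intro exI[of _ "\<phi> j"] exI[of _ "\<phi>' j"] exI[of _ "K j"] conjI allI impI) simp_all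
qed

lemma integral_norm_power2_eq_sum:
  fixes w :: "'a \<Rightarrow> 'b::euclidean_space"
  assumes [measurable]: "w \<in> borel_measurable M" and "integrable M (\<lambda>x. (norm (w x))\<^sup>2)"
  shows "(LINT x|M. (norm (w x))\<^sup>2) = (\<Sum>b\<in>Basis. LINT x|M. (w x \<bullet> b)\<^sup>2)"
    and "b \<in> Basis \<Longrightarrow> integrable M (\<lambda>x. (w x \<bullet> b)\<^sup>2)"
proof -
  have sq: "(norm (w x))\<^sup>2 = (\<Sum>b\<in>Basis. (w x \<bullet> b)\<^sup>2)" for x
  proof -
    have "(\<Sum>b\<in>Basis. (w x \<bullet> b)\<^sup>2) = w x \<bullet> w x"
      unfolding power2_eq_square by (rule euclidean_inner[symmetric])
    then show ?thesis by (simp only: power2_norm_eq_inner)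
  qed
  have i: "integrable M (\<lambda>x. (w x \<bullet> b)\<^sup>2)" if "b \<in> Basis" for b
  proof (rule Bochner_Integration.integrable_bound[OF assms(2)])
    show "AE x in M. norm ((w x \<bullet> b)\<^sup>2) \<le> norm ((norm (w x))\<^sup>2)"
      by (intro AE_I2 order_trans[OF norm_power2_le[OF Basis_le_norm[OF that]]]) simp
  qed simp
  show "(LINT x|M. (norm (w x))\<^sup>2) = (\<Sum>b\<in>Basis. LINT x|M. (w x \<bullet> b)\<^sup>2)"
    unfolding sq using i by (rule Bochner_Integration.integral_sum)
  show "b \<in> Basis \<Longrightarrow> integrable M (\<lambda>x. (w x \<bullet> b)\<^sup>2)" by (rule i)
qed

text \<open>For a test function \<open>\<phi>\<close> the integral of \<open>\<phi> * (u n \<bullet> b)\<close> is minus that of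
  \<open>F n * (\<phi>' \<bullet> b)\<close>, which tends to zero. Taking \<open>\<phi>\<close> close to \<open>u N \<bullet> b\<close> for a large \<open>N\<close>,
  to which all later \<open>u n \<bullet> b\<close> are close, bounds the square integral of \<open>u n \<bullet> b\<close>.\<close>

lemma gradient_closable:
  fixes F :: "nat \<Rightarrow> 'a::euclidean_space \<Rightarrow> real"
  assumes U: "open U" "bounded U" and F: "\<And>n. C1_grad U (F n) (u n)"
    and bF: "\<And>n. bounded (F n ` U)" and bu: "\<And>n. bounded (u n ` U)"
    and F0: "(\<lambda>n. LINT x|lborel_on U. (F n x)\<^sup>2) \<longlonglongrightarrow> 0"
    and cauchy: "\<And>e. 0 < e \<Longrightarrow> \<exists>N. \<forall>m\<ge>N. \<forall>n\<ge>N. (LINT x|lborel_on U. (norm (u m x - u n x))\<^sup>2) < e"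
  shows "(\<lambda>n. LINT x|lborel_on U. (norm (u n x))\<^sup>2) \<longlonglongrightarrow> 0"
proof -
  let ?M = "lborel_on U"
  interpret finite_measure ?M by (rule finite_measure_restrict_bounded) (use U in auto)
  have Ub: "U \<in> sets borel" using U by simp
  have [measurable]: "F n \<in> borel_measurable ?M" "u n \<in> borel_measurable ?M" for n
    by (auto intro!: measurable_continuous_restrict_lborel[OF _ Ub] C1_gradD(2,3)[OF F])
  have bint: "integrable ?M f" if "f \<in> borel_measurable ?M" "\<And>x. x \<in> U \<Longrightarrow> norm (f x) \<le> C" for f :: "'a \<Rightarrow> real" and C
    by (rule integrable_const_bound[OF AE_I2 that(1)]) (use that(2) in \<open>simp add: space_restrict_space\<close>)
  have iF: "integrable ?M (\<lambda>x. (F n x)\<^sup>2)" for n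
  proof -
    obtain C where "\<And>x. x \<in> U \<Longrightarrow> \<bar>F n x\<bar> \<le> C" using bF[of n] by (auto simp: bounded_iff)
    then show ?thesis by (intro bint[of _ "C\<^sup>2"] norm_power2_le) auto
  qed
  obtain C where C: "\<And>n x. x \<in> U \<Longrightarrow> norm (u n x) \<le> C n"
    using bu unfolding bounded_iff by (metis image_eqI)
  have iu: "integrable ?M (\<lambda>x. (norm (u n x))\<^sup>2)" for n
    by (rule bint[of _ "(C n)\<^sup>2"], simp, rule norm_power2_le) (simp add: C)
  have idu: "integrable ?M (\<lambda>x. (norm (u m x - u n x))\<^sup>2)" for m n
    by (rule bint[of _ "(C m + C n)\<^sup>2"], simp, rule norm_power2_le)
       (simp add: C order_trans[OF norm_triangle_ineq4 add_mono])
  have comp: "(\<lambda>n. LINT x|?M. (u n x \<bullet> b)\<^sup>2) \<longlonglongrightarrow> 0" if b: "b \<in> Basis" for b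
    unfolding LIMSEQ_def
  proof (intro allI impI)
    fix e :: real assume e: "0 < e"
    define v where "v n x = u n x \<bullet> b" for n x
    have [measurable]: "v n \<in> borel_measurable ?M" for n unfolding v_def by simp
    have iv: "integrable ?M (\<lambda>x. (v n x)\<^sup>2)" for n
      unfolding v_def by (rule integral_norm_power2_eq_sum(2)[OF _ iu b]) simp
    have idv: "integrable ?M (\<lambda>x. (v m x - v n x)\<^sup>2)" for m n
      unfolding v_def inner_diff_left[symmetric] by (rule integral_norm_power2_eq_sum(2)[OF _ idu b]) simp
    have dv: "(LINT x|?M. (v m x - v n x)\<^sup>2) \<le> (LINT x|?M. (norm (u m x - u n x))\<^sup>2)" for m n
    proof (rule integral_mono[OF idv idu])
      fix x
      have "\<bar>(u m x - u n x) \<bullet> b\<bar> \<le> norm (u m x - u n x)" by (rule Basis_le_norm[OF b])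
      then show "(v m x - v n x)\<^sup>2 \<le> (norm (u m x - u n x))\<^sup>2"
        unfolding v_def inner_diff_left[symmetric] using norm_power2_le by simp
    qed
    obtain N where N: "\<And>m n. N \<le> m \<Longrightarrow> N \<le> n \<Longrightarrow> (LINT x|?M. (norm (u m x - u n x))\<^sup>2) < e / 8"
      using cauchy[of "e/8"] e by auto
    have vc: "continuous_on U (v N)" unfolding v_def by (intro continuous_intros C1_gradD(2)[OF F])
    have vB: "\<bar>v N x\<bar> \<le> C N" if "x \<in> U" for x
      using Basis_le_norm[OF b, of "u N x"] C[OF that, of N] by (simp add: v_def)
    have "\<exists>\<phi> \<phi>' K. C1_grad UNIV \<phi> \<phi>' \<and> compact K \<and> K \<subseteq> U \<and>
        (\<forall>x. x \<notin> K \<longrightarrow> \<phi> x = 0 \<and> \<phi>' x = (0::'a)) \<and> (LINT x|?M. (v N x - \<phi> x)\<^sup>2) < e / 16"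
      by (rule dense_test_functions[OF U vc vB]) (use e in simp_all)
    then obtain \<phi> \<phi>' K
      where \<phi>0: "C1_grad UNIV \<phi> \<phi>'" "compact K" "K \<subseteq> U"
        "\<forall>x. x \<notin> K \<longrightarrow> \<phi> x = 0 \<and> \<phi>' x = 0" "(LINT x|?M. (v N x - \<phi> x)\<^sup>2) < e / 16"
      by (elim exE conjE) (rule that)
    then have \<phi>: "C1_grad UNIV \<phi> \<phi>'" "compact K" "K \<subseteq> U" "\<And>x. x \<notin> K \<Longrightarrow> \<phi> x = 0" "\<And>x. x \<notin> K \<Longrightarrow> \<phi>' x = 0"
      "(LINT x|?M. (v N x - \<phi> x)\<^sup>2) < e / 16" by simp_all
    have [measurable]: "\<phi> \<in> borel_measurable ?M" "\<phi>' \<in> borel_measurable ?M"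
      by (rule measurable_continuous_restrict_lborel[OF continuous_on_subset[OF C1_gradD(3)[OF \<phi>(1)]] Ub]
          measurable_continuous_restrict_lborel[OF continuous_on_subset[OF C1_gradD(2)[OF \<phi>(1)]] Ub], simp)+
    obtain r where "\<And>x. x \<in> K \<Longrightarrow> norm x \<le> r" using compact_imp_bounded[OF \<phi>(2)] by (auto simp: bounded_iff)
    then have rK: "x \<notin> K" if "r + 1 \<le> norm x" for x using that by force
    obtain D where D: "\<And>x. norm (\<phi> x) \<le> D"
      using bounded_compact_support[OF C1_gradD(3)[OF \<phi>(1)], of "r+1"] \<phi>(4) rK by metis
    obtain D' where D': "0 \<le> D'" "\<And>x. norm (\<phi>' x) \<le> D'"
      using bounded_compact_support[OF C1_gradD(2)[OF \<phi>(1)], of "r+1"] \<phi>(5) rK by metis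
    have "(\<lambda>n. LINT x|?M. F n x * (\<phi>' x \<bullet> b)) \<longlonglongrightarrow> 0"
    proof (rule tendsto_zero_integral_mult[OF _ _ iF _ F0])
      show "integrable ?M (\<lambda>x. (\<phi>' x \<bullet> b)\<^sup>2)"
      proof (rule bint[of _ "D'\<^sup>2"])
        fix x
        have "\<bar>\<phi>' x \<bullet> b\<bar> \<le> D'" using Basis_le_norm[OF b, of "\<phi>' x"] D'(2)[of x] by simp
        then show "norm ((\<phi>' x \<bullet> b)\<^sup>2) \<le> D'\<^sup>2" by (rule norm_power2_le)
      qed simp
    qed simp_all
    moreover have "(LINT x|?M. \<phi> x * v n x) = - (LINT x|?M. F n x * (\<phi>' x \<bullet> b))" for n
      unfolding v_def by (rule integration_by_parts_test_function(1)[OF U(1) F \<phi>(1,2,3)]) (fact \<phi>(4,5))+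
    ultimately have lim: "(\<lambda>n. LINT x|?M. \<phi> x * v n x) \<longlonglongrightarrow> 0"
      by (auto dest: tendsto_minus)
    have i\<phi>v: "integrable ?M (\<lambda>x. \<phi> x * v n x)" for n
      unfolding v_def by (rule integration_by_parts_test_function(2)[OF U(1) F \<phi>(1,2,3)]) (fact \<phi>(4,5))+
    have iNd: "integrable ?M (\<lambda>x. (v N x - \<phi> x)\<^sup>2)"
    proof (rule bint[of _ "(C N + D)\<^sup>2"])
      fix x assume "x \<in> U"
      then have "\<bar>v N x - \<phi> x\<bar> \<le> C N + D" using vB[of x] D[of x] by simp
      then show "norm ((v N x - \<phi> x)\<^sup>2) \<le> (C N + D)\<^sup>2"
        by (rule norm_power2_le)
    qed simp
    obtain N' where N': "\<And>n. N' \<le> n \<Longrightarrow> \<bar>LINT x|?M. \<phi> x * v n x\<bar> < e / 16"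
      using LIMSEQ_D[OF lim, of "e/16"] e by auto
    have "(LINT x|?M. (v n x)\<^sup>2) < e" if n: "max N N' \<le> n" for n
    proof -
      have "(LINT x|?M. (v n x)\<^sup>2) \<le> (LINT x|?M. 2 * (v n x - v N x)\<^sup>2 + 2 * (\<phi> x * v n x) + 2 * (v N x - \<phi> x)\<^sup>2)"
      proof (rule integral_mono)
        fix x
        \<comment> \<open>The terms \<open>(v n x)\<^sup>2\<close> on the right add up to half of the left-hand side and are absorbed.\<close>
        have young: "4 * (p * q) \<le> 4 * p\<^sup>2 + q\<^sup>2" for p q :: real
          using zero_le_power2[of "2 * p - q"] by (simp add: power2_eq_square algebra_simps)
        have "(v n x)\<^sup>2 = (v n x - v N x) * v n x + (v N x - \<phi> x) * v n x + \<phi> x * v n x"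
          by (simp add: power2_eq_square algebra_simps)
        moreover have "4 * ((v n x - v N x) * v n x) \<le> 4 * (v n x - v N x)\<^sup>2 + (v n x)\<^sup>2"
          by (rule young)
        moreover have "4 * ((v N x - \<phi> x) * v n x) \<le> 4 * (v N x - \<phi> x)\<^sup>2 + (v n x)\<^sup>2"
          by (rule young)
        ultimately show "(v n x)\<^sup>2 \<le> 2 * (v n x - v N x)\<^sup>2 + 2 * (\<phi> x * v n x) + 2 * (v N x - \<phi> x)\<^sup>2"
          by linarith
      qed (use iv idv i\<phi>v iNd in auto)
      also have "\<dots> = 2 * (LINT x|?M. (v n x - v N x)\<^sup>2) + 2 * (LINT x|?M. \<phi> x * v n x) + 2 * (LINT x|?M. (v N x - \<phi> x)\<^sup>2)"
        using idv i\<phi>v iNd by simp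
      also have "\<dots> < 2 * (e / 8) + 2 * (e / 16) + 2 * (e / 16)"
        using dv[of n N] N[of n N] N'[of n] n \<phi>(6) by auto
      also have "\<dots> < e" using e by simp
      finally show ?thesis .
    qed
    then show "\<exists>no. \<forall>n\<ge>no. dist (LINT x|?M. (u n x \<bullet> b)\<^sup>2) 0 < e"
      by (intro exI[of _ "max N N'"]) (simp add: v_def)
  qed
  have "(\<lambda>n. \<Sum>b\<in>Basis. LINT x|?M. (u n x \<bullet> b)\<^sup>2) \<longlonglongrightarrow> (\<Sum>b\<in>(Basis::'a set). 0)"
    by (intro tendsto_sum comp)
  then show ?thesis
    by (simp add: integral_norm_power2_eq_sum(1)[OF _ iu])
qed

section \<open>Lipschitz curves are differentiable almost everywhere\<close>

lemma negligible_countable: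
  assumes "countable (S :: 'a::euclidean_space set)" shows "negligible S"
  using countable_imp_null_set_lborel[OF assms] by (simp add: negligible_iff_null_sets null_sets_completionI)

text \<open>Half-open intervals are disjoint in a way that suits every interval measure, and passing from the closed to
  the open intervals loses only countably many end points.\<close>

lemma Vitali_covering_intervals:
  fixes E :: "real set"
  assumes "open U" "E \<subseteq> U"
    and fine: "\<And>x d. x \<in> E \<Longrightarrow> 0 < d \<Longrightarrow> \<exists>u v. u \<le> x \<and> x \<le> v \<and> u < v \<and> v - u < d \<and> Q u v"
  obtains C where "countable C" "\<And>u v. (u, v) \<in> C \<Longrightarrow> u < v \<and> Q u v \<and> {u..v} \<subseteq> U"
    "disjoint_family_on (\<lambda>(u, v). {u<..v}) C" "negligible (E - (\<Union>(u, v)\<in>C. {u<..<v}))"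
proof -
  define K where "K = {(u, v). u < v \<and> Q u v \<and> {u..v} \<subseteq> U}"
  define a where "a = (\<lambda>(u::real, v). (u + v) / 2)"
  define r where "r = (\<lambda>(u::real, v). (v - u) / 2)"
  have cb: "cball (a (u, v)) (r (u, v)) = {u..v}" for u v
    unfolding a_def r_def cball_eq_atLeastAtMost by (simp add: field_simps)
  have rpos: "0 < r i" if "i \<in> K" for i using that by (auto simp: K_def r_def)
  have Vit: "\<exists>i. i \<in> K \<and> x \<in> cball (a i) (r i) \<and> r i < d" if x: "x \<in> E" and d: "0 < d" for x d
  proof -
    obtain e where e: "0 < e" "ball x e \<subseteq> U" using assms(1,2) x by (metis open_contains_ball subsetD)
    obtain u v where uv: "u \<le> x" "x \<le> v" "u < v" "v - u < min d e" "Q u v"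
      using fine[OF x, of "min d e"] d e by (metis min_less_iff_conj)
    have "{u..v} \<subseteq> ball x e" using uv by (auto simp: dist_real_def)
    then have "(u, v) \<in> K" using uv e by (auto simp: K_def)
    moreover have "x \<in> cball (a (u, v)) (r (u, v))" using uv by (simp only: cb) simp
    moreover have "r (u, v) < d" using uv by (simp add: r_def)
    ultimately show ?thesis by blast
  qed
  obtain C where C: "countable C" "C \<subseteq> K"
    "pairwise (\<lambda>i j. disjnt (cball (a i) (r i)) (cball (a j) (r j))) C"
    "negligible (E - (\<Union>i\<in>C. cball (a i) (r i)))"
    by (rule Vitali_covering_theorem_cballs[of K r E a]) (use rpos Vit in auto)
  have "disjoint_family_on (\<lambda>(u, v). {u<..v}) C"
    unfolding disjoint_family_on_def
  proof (intro ballI impI)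
    fix i j assume "i \<in> C" "j \<in> C" "i \<noteq> j"
    then have d: "disjnt (cball (a i) (r i)) (cball (a j) (r j))" using C(3) by (auto simp: pairwise_def)
    obtain u v where i: "i = (u, v)" by (cases i)
    obtain u' v' where j: "j = (u', v')" by (cases j)
    show "(case i of (u, v) \<Rightarrow> {u<..v}) \<inter> (case j of (u, v) \<Rightarrow> {u<..v}) = {}"
      using d unfolding i j cb by (auto simp: disjnt_def)
  qed
  moreover have "negligible (E - (\<Union>(u, v)\<in>C. {u<..<v}))"
  proof (rule negligible_subset)
    show "negligible ((E - (\<Union>i\<in>C. cball (a i) (r i))) \<union> (fst ` C \<union> snd ` C))"
      by (intro negligible_Un C(4) negligible_countable countable_Un countable_image C(1))
    show "E - (\<Union>(u, v)\<in>C. {u<..<v}) \<subseteq> (E - (\<Union>i\<in>C. cball (a i) (r i))) \<union> (fst ` C \<union> snd ` C)"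
    proof
      fix x assume x: "x \<in> E - (\<Union>(u, v)\<in>C. {u<..<v})"
      show "x \<in> (E - (\<Union>i\<in>C. cball (a i) (r i))) \<union> (fst ` C \<union> snd ` C)"
      proof (cases "\<exists>i\<in>C. x \<in> cball (a i) (r i)")
        case True
        then obtain u v where "(u, v) \<in> C" "x \<in> {u..v}" using cb by (metis surj_pair)
        moreover have "x \<notin> {u<..<v}" using x \<open>(u, v) \<in> C\<close> by auto
        ultimately have "(u, v) \<in> C \<and> (x = u \<or> x = v)" by auto
        then show ?thesis by force
      qed (use x in auto)
    qed
  qed
  moreover have "u < v \<and> Q u v \<and> {u..v} \<subseteq> U" if "(u, v) \<in> C" for u v using C(2) that by (auto simp: K_def)
  ultimately show thesis using C(1) that by blast
qed

text \<open>The points at which a monotone \<open>F\<close> has difference quotients below \<open>p\<close> and above \<open>q > p\<close> at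
  all scales. A Vitali cover by slow intervals inside an open cover \<open>U\<close> of them, followed by a Vitali cover
  by fast intervals, is again a cover, and its measure is at most \<open>p / q\<close> times that of \<open>U\<close>. Hence
  the outer measure is zero.\<close>

lemma negligible_oscillating_slopes:
  fixes F :: "real \<Rightarrow> real"
  assumes mono: "mono F" and cont: "continuous_on UNIV F" and pq: "0 < p" "p < q" and "bounded E"
    and slow: "\<And>x d. x \<in> E \<Longrightarrow> 0 < d \<Longrightarrow> \<exists>u v. u \<le> x \<and> x \<le> v \<and> u < v \<and> v - u < d \<and> F v - F u \<le> p * (v - u)"
    and fast: "\<And>x d. x \<in> E \<Longrightarrow> 0 < d \<Longrightarrow> \<exists>u v. u \<le> x \<and> x \<le> v \<and> u < v \<and> v - u < d \<and> q * (v - u) \<le> F v - F u"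
  shows "negligible E"
proof -
  let ?\<mu> = "interval_measure F"
  have Ioc: "emeasure ?\<mu> {u<..v} = ennreal (F v - F u)" if "u \<le> v" for u v
    using that mono cont
    by (intro emeasure_interval_measure_Ioc) (auto simp: mono_def continuous_on_eq_continuous_within intro: continuous_within_subset)
  have UN: "emeasure M (\<Union>(u, v)\<in>C. {u<..v}) = (\<integral>\<^sup>+i. emeasure M ((\<lambda>(u, v). {u<..v}) i) \<partial>count_space C)"
    if "countable C" "disjoint_family_on (\<lambda>(u, v). {u<..v}) C" "sets M = sets borel" for M :: "real measure" and C
    using that by (intro emeasure_UN_countable) (auto split: prod.splits)
  have subI: "(\<Union>(u, v)\<in>C. {u<..<v}) \<subseteq> (\<Union>(u, v)\<in>C. {u<..v})" for C :: "(real \<times> real) set"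
    by (rule UN_mono) auto
  have subU: "(\<Union>(u, v)\<in>C. {u<..v}) \<subseteq> U" if "\<And>u v. (u, v) \<in> C \<Longrightarrow> {u..v} \<subseteq> U" for C and U :: "real set"
  proof (rule UN_least)
    fix i assume "i \<in> C"
    then show "(case i of (u, v) \<Rightarrow> {u<..v}) \<subseteq> U" using that[of "fst i" "snd i"] by (cases i) force
  qed
  have slow_cover: "\<exists>O1. open O1 \<and> negligible (E - O1) \<and> emeasure ?\<mu> O1 \<le> ennreal p * emeasure lborel U"
    if U: "open U" "E \<subseteq> U" for U
  proof -
    obtain C where C: "countable C" "\<And>u v. (u, v) \<in> C \<Longrightarrow> u < v \<and> F v - F u \<le> p * (v - u) \<and> {u..v} \<subseteq> U"
      "disjoint_family_on (\<lambda>(u, v). {u<..v}) C" "negligible (E - (\<Union>(u, v)\<in>C. {u<..<v}))"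
      by (rule Vitali_covering_intervals[OF U, where Q="\<lambda>u v. F v - F u \<le> p * (v - u)"]) (use slow in auto)
    let ?W = "\<Union>(u, v)\<in>C. {u<..v}"
    have W: "?W \<in> sets borel" using C(1) by (intro sets.countable_UN'') (auto split: prod.splits)
    have "emeasure ?\<mu> (\<Union>(u, v)\<in>C. {u<..<v}) \<le> emeasure ?\<mu> ?W"
      using W by (intro emeasure_mono subI) simp
    also have "\<dots> = (\<integral>\<^sup>+i. emeasure ?\<mu> ((\<lambda>(u, v). {u<..v}) i) \<partial>count_space C)" by (rule UN) (use C in auto)
    also have "\<dots> \<le> (\<integral>\<^sup>+i. ennreal p * emeasure lborel ((\<lambda>(u, v). {u<..v}) i) \<partial>count_space C)"
    proof (rule nn_integral_mono, clarsimp)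
      fix u v assume "(u, v) \<in> C"
      from C(2)[OF this] show "emeasure ?\<mu> {u<..v} \<le> ennreal p * emeasure lborel {u<..v}"
        using Ioc[of u v] pq by (simp add: ennreal_mult[symmetric] ennreal_leI)
    qed
    also have "\<dots> = ennreal p * emeasure lborel ?W"
      using UN[OF C(1,3), of lborel] by (simp add: nn_integral_cmult)
    also have "\<dots> \<le> ennreal p * emeasure lborel U"
      using C(2) U by (intro mult_left_mono emeasure_mono subU) simp_all
    finally show ?thesis using C(4) by (intro exI[of _ "\<Union>(u, v)\<in>C. {u<..<v}"]) auto
  qed
  have fast_cover: "\<exists>W\<in>sets borel. negligible (E - W) \<and> ennreal q * emeasure lborel W \<le> emeasure ?\<mu> U"
    if U: "open U" "negligible (E - U)" for U
  proof -
    obtain C where C: "countable C" "\<And>u v. (u, v) \<in> C \<Longrightarrow> u < v \<and> q * (v - u) \<le> F v - F u \<and> {u..v} \<subseteq> U"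
      "disjoint_family_on (\<lambda>(u, v). {u<..v}) C" "negligible (E \<inter> U - (\<Union>(u, v)\<in>C. {u<..<v}))"
      by (rule Vitali_covering_intervals[of U "E \<inter> U", where Q="\<lambda>u v. q * (v - u) \<le> F v - F u"]) (use fast U in auto)
    let ?W = "\<Union>(u, v)\<in>C. {u<..v}"
    have W: "?W \<in> sets borel" using C(1) by (intro sets.countable_UN'') (auto split: prod.splits)
    have "ennreal q * emeasure lborel ?W = (\<integral>\<^sup>+i. ennreal q * emeasure lborel ((\<lambda>(u, v). {u<..v}) i) \<partial>count_space C)"
      using UN[OF C(1,3), of lborel] by (simp add: nn_integral_cmult)
    also have "\<dots> \<le> (\<integral>\<^sup>+i. emeasure ?\<mu> ((\<lambda>(u, v). {u<..v}) i) \<partial>count_space C)"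
    proof (rule nn_integral_mono, clarsimp)
      fix u v assume "(u, v) \<in> C"
      from C(2)[OF this] show "ennreal q * emeasure lborel {u<..v} \<le> emeasure ?\<mu> {u<..v}"
        using Ioc[of u v] pq by (simp add: ennreal_mult[symmetric] ennreal_leI)
    qed
    also have "\<dots> = emeasure ?\<mu> ?W" by (rule UN[symmetric]) (use C in auto)
    also have "\<dots> \<le> emeasure ?\<mu> U"
      using C(2) U by (intro emeasure_mono subU) simp_all
    finally have "ennreal q * emeasure lborel ?W \<le> emeasure ?\<mu> U" .
    moreover have "negligible (E - ?W)"
      by (rule negligible_subset[OF negligible_Un[OF U(2) C(4)]]) (use subI[of C] in blast)
    ultimately show ?thesis using W by blast
  qed
  define m where "m = (INF U\<in>{U. open U \<and> E \<subseteq> U}. emeasure lborel U)"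
  obtain b where "E \<subseteq> ball 0 b" using \<open>bounded E\<close> by (metis bounded_subset_ballD)
  then have "ball (0::real) b \<in> {U. open U \<and> E \<subseteq> U}" by simp
  then have "m \<le> emeasure lborel (ball (0::real) b)" unfolding m_def by (rule INF_lower)
  then have mfin: "m < top" using emeasure_lborel_ball_finite[of "0::real" b] by (metis infinity_ennreal_def order_le_less_trans)
  have "m = 0"
  proof (rule ccontr)
    assume "m \<noteq> 0"
    then obtain m' where m': "m = ennreal m'" "0 < m'" using mfin
      by (cases m) (auto simp: less_le)
    have "m < ennreal (q / p) * m"
      using m' pq by (simp add: ennreal_mult[symmetric] ennreal_lessI field_simps)
    then obtain U where U: "open U" "E \<subseteq> U" "emeasure lborel U < ennreal (q / p) * m"
      unfolding m_def INF_less_iff by blast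
    obtain O1 where O1: "open O1" "negligible (E - O1)" "emeasure ?\<mu> O1 \<le> ennreal p * emeasure lborel U"
      using slow_cover[OF U(1,2)] by blast
    obtain W where W: "W \<in> sets borel" "negligible (E - W)" "ennreal q * emeasure lborel W \<le> emeasure ?\<mu> O1"
      using fast_cover[OF O1(1,2)] by blast
    obtain o' where o': "emeasure lborel U = ennreal o'" "0 \<le> o'"
      using U(3) by (cases "emeasure lborel U") auto
    have "ennreal q * emeasure lborel W \<le> ennreal (p * o')"
      using W(3) O1(3) o' pq by (simp add: ennreal_mult order_trans)
    moreover obtain w where w: "emeasure lborel W = ennreal w" "0 \<le> w"
    proof (cases "emeasure lborel W")
      case top
      then have "ennreal q * emeasure lborel W = top" using pq by (simp add: ennreal_mult_top)
      with calculation show ?thesis by (simp add: top_unique)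
    qed (use that in auto)
    ultimately have "q * w \<le> p * o'" using pq o' by (simp add: ennreal_mult[symmetric])
    moreover have "o' < q / p * m'"
      using U(3) o' m' pq by (simp add: ennreal_mult[symmetric] ennreal_less_iff)
    then have "p * o' < q * m'" using pq by (simp add: field_simps)
    ultimately have "q * w < q * m'" by linarith
    then have wm: "w < m'" using pq by simp
    have meas: "W \<union> (E - W) \<in> sets lebesgue" using W by (intro sets.Un) (auto simp: negligible_iff_null_sets)
    have em: "emeasure lebesgue (W \<union> (E - W)) = ennreal w"
      using W w emeasure_Un_null_set[of W lebesgue "E - W"] by (auto simp: negligible_iff_null_sets)
    obtain T where T: "open T" "W \<union> (E - W) \<subseteq> T" "T - (W \<union> (E - W)) \<in> lmeasurable"
        "emeasure lebesgue (T - (W \<union> (E - W))) < ennreal (m' - w)"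
      using sets_lebesgue_outer_open[OF meas, of "m' - w"] wm by auto
    have "m \<le> emeasure lborel T" unfolding m_def using T by (intro INF_lower) auto
    also have "\<dots> = emeasure lebesgue T" using T(1) by simp
    also have "\<dots> = emeasure lebesgue ((W \<union> (E - W)) \<union> (T - (W \<union> (E - W))))" using T(2) by (simp add: Un_absorb1 Un_Diff_cancel)
    also have "\<dots> \<le> emeasure lebesgue (W \<union> (E - W)) + emeasure lebesgue (T - (W \<union> (E - W)))"
      using meas T(3) by (intro emeasure_subadditive) auto
    also have "\<dots> < ennreal w + ennreal (m' - w)"
      using T(4) em by (simp add: ennreal_add_left_cancel_less)
    also have "\<dots> = m" using m' wm w by (simp flip: ennreal_plus)
    finally show False by simp
  qed
  show ?thesis
    unfolding negligible_outer_le
  proof (intro allI impI)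
    fix e :: real assume "0 < e"
    then have "m < ennreal e" using \<open>m = 0\<close> by simp
    then obtain U where U: "open U" "E \<subseteq> U" "emeasure lborel U < ennreal e"
      unfolding m_def INF_less_iff by blast
    then have "U \<in> lmeasurable" "measure lebesgue U \<le> e"
      using \<open>0 < e\<close> enn2real_leI[of e "emeasure lborel U"]
      by (auto simp: fmeasurable_def measure_def less_top intro: less_trans)
    then show "\<exists>T. E \<subseteq> T \<and> T \<in> lmeasurable \<and> measure lebesgue T \<le> e" using U by blast
  qed
qed

lemma bounded_function_limit_or_oscillates:
  fixes Q :: "'a \<Rightarrow> real"
  assumes bd: "\<forall>\<^sub>F y in G. c < Q y" "\<forall>\<^sub>F y in G. Q y \<le> B" and nt: "G \<noteq> bot" and nolim: "\<nexists>l. (Q \<longlongrightarrow> l) G"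
  obtains p q where "p \<in> \<rat>" "q \<in> \<rat>" "c < p" "p < q" "\<exists>\<^sub>F y in G. Q y < p" "\<exists>\<^sub>F y in G. q < Q y"
proof -
  define S where "S = {s. \<forall>\<^sub>F y in G. Q y \<le> s}"
  define s where "s = Inf S"
  have below: "c \<le> t" if "t \<in> S" for t
  proof -
    have "\<forall>\<^sub>F y in G. c < t" using that bd(1) unfolding S_def mem_Collect_eq by eventually_elim simp
    then show ?thesis using nt by (simp add: eventually_const)
  qed
  have S: "B \<in> S" "bdd_below S" using bd(2) below by (simp add: S_def) (rule bdd_belowI[OF below])
  have up: "\<forall>\<^sub>F y in G. Q y < s + e" if "0 < e" for e
  proof -
    have "s < s + e" using that by simp
    then obtain t where "t \<in> S" "t < s + e" using S(1) cInf_lessD[of S "s + e"] unfolding s_def by blast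
    then have "\<forall>\<^sub>F y in G. Q y \<le> t" by (simp add: S_def)
    then show ?thesis by eventually_elim (use \<open>t < s + e\<close> in simp)
  qed
  have "\<not> (Q \<longlongrightarrow> s) G" using nolim by blast
  then obtain e where e: "0 < e" "\<not> (\<forall>\<^sub>F y in G. dist (Q y) s < e)" unfolding tendsto_iff by blast
  have fr: "\<exists>\<^sub>F y in G. Q y \<le> s - e"
  proof (rule ccontr)
    assume "\<not> ?thesis"
    then have "\<forall>\<^sub>F y in G. s - e < Q y" by (simp add: not_frequently not_le)
    with up[OF e(1)] have "\<forall>\<^sub>F y in G. dist (Q y) s < e"
      by eventually_elim (auto simp: dist_real_def)
    then show False using e by simp
  qed
  obtain p where p: "p \<in> \<rat>" "s - e < p" "p < s - e / 2" using e Rats_dense_in_real[of "s - e" "s - e / 2"] by auto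
  obtain q where q: "q \<in> \<rat>" "s - e / 2 < q" "q < s" using e Rats_dense_in_real[of "s - e / 2" s] by auto
  have fp: "\<exists>\<^sub>F y in G. Q y < p" using fr by (rule frequently_elim1) (use p in simp)
  have "\<exists>\<^sub>F y in G. q < Q y"
  proof (rule ccontr)
    assume "\<not> ?thesis"
    then have "q \<in> S" by (simp add: not_frequently not_less S_def)
    then have "s \<le> q" unfolding s_def using S by (intro cInf_lower) auto
    then show False using q by simp
  qed
  moreover have "c < p"
  proof -
    obtain y where "c < Q y" "Q y < p"
      using frequently_ex[OF frequently_eventually_conj[OF fp bd(1)]] by blast
    then show ?thesis by simp
  qed
  moreover have "p < q" using p q by linarith
  ultimately show thesis using that p(1) q(1) fp by blast
qed

text \<open>Adding \<open>(L + 1) * t\<close> makes \<open>f\<close> increasing with slopes between \<open>1\<close> and \<open>2 * L + 1\<close>. Where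
  it is not differentiable, its difference quotients oscillate across an interval with positive rational ends.\<close>

lemma negligible_not_differentiable_lipschitz_real:
  fixes f :: "real \<Rightarrow> real"
  assumes L: "L-lipschitz_on UNIV f"
  shows "negligible {x. \<not> f differentiable (at x)}"
proof -
  \<comment> \<open>The increasing function to which the covering argument applies.\<close>
  define F where "F t = f t + (L + 1) * t" for t
  have lip: "\<bar>f u - f v\<bar> \<le> L * \<bar>u - v\<bar>" for u v using lipschitz_onD[OF L, of u v] by (simp add: dist_real_def)
  have inc: "F v - F u = (f v - f u) + (L * (v - u) + (v - u))" for u v by (simp add: F_def algebra_simps)
  have slope: "v - u \<le> F v - F u" if "u \<le> v" for u v
    using lip[of v u] that unfolding inc abs_le_iff by simp
  have slope': "F v - F u \<le> (2 * L + 1) * (v - u)" if "u \<le> v" for u v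
  proof -
    have "(2 * L + 1) * (v - u) = L * (v - u) + (L * (v - u) + (v - u))" by (simp add: algebra_simps)
    then show ?thesis using lip[of v u] that unfolding inc abs_le_iff by simp
  qed
  have mono: "mono F"
  proof (rule monoI)
    fix u v :: real assume "u \<le> v" then show "F u \<le> F v" using slope[of u v] by linarith
  qed
  have cont: "continuous_on UNIV F"
    unfolding F_def by (intro continuous_intros lipschitz_on_continuous_on[OF L])
  define E where "E p q n = {x \<in> ball 0 (real n).
     (\<forall>d>0. \<exists>u v. u \<le> x \<and> x \<le> v \<and> u < v \<and> v - u < d \<and> F v - F u \<le> p * (v - u)) \<and>
     (\<forall>d>0. \<exists>u v. u \<le> x \<and> x \<le> v \<and> u < v \<and> v - u < d \<and> q * (v - u) \<le> F v - F u)}" for p q n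
  have neg: "negligible (E p q n)" if "0 < p" "p < q" for p q n
  proof (rule negligible_oscillating_slopes[OF mono cont that])
    show "bounded (E p q n)" by (rule bounded_subset[of "ball 0 (real n)"]) (auto simp: E_def)
  qed (simp_all only: E_def mem_Collect_eq)
  have "negligible (\<Union>(p, q, n)\<in>{(p, q, n). p \<in> \<rat> \<and> q \<in> \<rat> \<and> 0 < p \<and> p < q}. E p q n)"
  proof (rule negligible_countable_Union)
    have "countable ((\<lambda>(p, q, n). E p q n) ` (\<rat> \<times> \<rat> \<times> UNIV))"
      by (intro countable_image countable_SIGMA countable_rat) auto
    then show "countable ((\<lambda>(p, q, n). E p q n) ` {(p, q, n). p \<in> \<rat> \<and> q \<in> \<rat> \<and> 0 < p \<and> p < q})"
      by (rule countable_subset[rotated]) auto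
  qed (use neg in auto)
  then show ?thesis
  proof (rule negligible_subset)
    show "{x. \<not> f differentiable (at x)} \<subseteq> (\<Union>(p, q, n)\<in>{(p, q, n). p \<in> \<rat> \<and> q \<in> \<rat> \<and> 0 < p \<and> p < q}. E p q n)"
    proof
      fix x assume "x \<in> {x. \<not> f differentiable (at x)}"
      then have nd: "\<not> f differentiable (at x)" by simp
      define Q where "Q y = (F y - F x) / (y - x)" for y
      have Qb: "1 \<le> Q y \<and> Q y \<le> 2 * L + 1" if "y \<noteq> x" for y
      proof (cases "x < y")
        case True
        then show ?thesis using slope[of x y] slope'[of x y] by (simp add: Q_def field_simps)
      next
        case False
        then have "y < x" using that by simp
        then have "1 \<le> (F x - F y) / (x - y) \<and> (F x - F y) / (x - y) \<le> 2 * L + 1"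
          using slope[of y x] slope'[of y x] by (simp add: field_simps)
        moreover have "Q y = (F x - F y) / (x - y)" unfolding Q_def by (metis minus_diff_eq minus_divide_divide)
        ultimately show ?thesis by simp
      qed
      have ev: "\<forall>\<^sub>F y in at x. y \<noteq> x" by (simp add: eventually_at_filter)
      have "\<nexists>l. (Q \<longlongrightarrow> l) (at x)"
      proof
        assume "\<exists>l. (Q \<longlongrightarrow> l) (at x)"
        then obtain l where "(Q \<longlongrightarrow> l) (at x)" by blast
        then have "(F has_field_derivative l) (at x)" by (simp add: has_field_derivative_iff Q_def[abs_def])
        then have "((\<lambda>t. F t - (L + 1) * t) has_field_derivative (l - (L + 1))) (at x)"
          by (auto intro!: derivative_eq_intros)
        then have "f differentiable (at x)" unfolding F_def by (auto simp: real_differentiable_def)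
        then show False using nd by simp
      qed
      moreover have "\<forall>\<^sub>F y in at x. 0 < Q y"
        using ev by eventually_elim (use Qb in \<open>force intro: less_le_trans[OF zero_less_one]\<close>)
      moreover have "\<forall>\<^sub>F y in at x. Q y \<le> 2 * L + 1"
        using ev by eventually_elim (use Qb in blast)
      ultimately obtain p q where pq: "p \<in> \<rat>" "q \<in> \<rat>" "0 < p" "p < q" "\<exists>\<^sub>F y in at x. Q y < p" "\<exists>\<^sub>F y in at x. q < Q y"
        using bounded_function_limit_or_oscillates[of 0 Q "at x" "2 * L + 1"] at_neq_bot by metis
      have near: "\<exists>y. y \<noteq> x \<and> \<bar>y - x\<bar> < d \<and> P y" if "\<exists>\<^sub>F y in at x. P y" "0 < d" for P d
      proof -
        have "\<forall>\<^sub>F y in at x. y \<noteq> x \<and> dist y x < d" using that(2) by (auto simp: eventually_at)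
        from frequently_ex[OF frequently_eventually_conj[OF that(1) this]]
        show ?thesis unfolding dist_real_def by blast
      qed
      have uv: "\<exists>u v. u \<le> x \<and> x \<le> v \<and> u < v \<and> v - u < d \<and> P ((F v - F u) / (v - u))"
        if fr: "\<exists>\<^sub>F y in at x. P (Q y)" "0 < d" for P d
      proof -
        obtain y where y: "y \<noteq> x" "\<bar>y - x\<bar> < d" "P (Q y)" using near[OF fr] by blast
        show ?thesis
        proof (cases "x < y")
          case True
          then show ?thesis using y by (intro exI[of _ x] exI[of _ y]) (auto simp: Q_def)
        next
          case False
          moreover have "Q y = (F x - F y) / (x - y)" unfolding Q_def by (metis minus_diff_eq minus_divide_divide)
          ultimately show ?thesis using y by (intro exI[of _ y] exI[of _ x]) auto
        qed
      qed
      obtain n where n: "\<bar>x\<bar> < real n" using reals_Archimedean2 by blast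
      have "x \<in> E p q n"
        unfolding E_def
      proof (intro CollectI conjI allI impI)
        show "x \<in> ball 0 (real n)" using n by simp
        fix d :: real assume d: "0 < d"
        show "\<exists>u v. u \<le> x \<and> x \<le> v \<and> u < v \<and> v - u < d \<and> F v - F u \<le> p * (v - u)"
        proof -
          obtain u v where "u \<le> x" "x \<le> v" "u < v" "v - u < d" "(F v - F u) / (v - u) < p"
            using uv[of "\<lambda>t. t < p", OF pq(5) d] by blast
          then show ?thesis by (intro exI[of _ u] exI[of _ v]) (simp add: pos_divide_less_eq)
        qed
        show "\<exists>u v. u \<le> x \<and> x \<le> v \<and> u < v \<and> v - u < d \<and> q * (v - u) \<le> F v - F u"
        proof -
          obtain u v where "u \<le> x" "x \<le> v" "u < v" "v - u < d" "q < (F v - F u) / (v - u)"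
            using uv[of "\<lambda>t. q < t", OF pq(6) d] by blast
          then show ?thesis by (intro exI[of _ u] exI[of _ v]) (simp add: pos_less_divide_eq)
        qed
      qed
      then show "x \<in> (\<Union>(p, q, n)\<in>{(p, q, n). p \<in> \<rat> \<and> q \<in> \<rat> \<and> 0 < p \<and> p < q}. E p q n)"
        using pq by blast
    qed
  qed
qed

lemma negligible_not_differentiable_lipschitz:
  fixes X :: "real \<Rightarrow> 'a::euclidean_space"
  assumes L: "L-lipschitz_on UNIV X"
  shows "negligible {t. \<not> X differentiable (at t)}"
proof -
  have "L-lipschitz_on UNIV (\<lambda>t. X t \<bullet> i)" if "i \<in> Basis" for i
  proof (rule lipschitz_onI)
    fix s t
    have "dist (X s \<bullet> i) (X t \<bullet> i) \<le> dist (X s) (X t)"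
      using Basis_le_norm[OF that, of "X s - X t"] by (simp add: dist_norm inner_diff_left)
    also have "\<dots> \<le> L * dist s t" using lipschitz_onD[OF L] by simp
    finally show "dist (X s \<bullet> i) (X t \<bullet> i) \<le> L * dist s t" .
  qed (use lipschitz_on_nonneg[OF L] in simp)
  then have "negligible {t. \<not> (\<lambda>t. X t \<bullet> i) differentiable (at t)}" if "i \<in> Basis" for i
    using that by (intro negligible_not_differentiable_lipschitz_real)
  then have "negligible (\<Union>i\<in>Basis. {t. \<not> (\<lambda>t. X t \<bullet> i) differentiable (at t)})"
    by (intro negligible_Union) auto
  moreover have "{t. \<not> X differentiable (at t)} = (\<Union>i\<in>Basis. {t. \<not> (\<lambda>t. X t \<bullet> i) differentiable (at t)})"
    using differentiable_componentwise_within[of X _ UNIV] by auto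
  ultimately show ?thesis by simp
qed

lemma has_vector_derivative_imp_quotient_tendsto:
  assumes "(X has_vector_derivative D) (at t)"
  shows "((\<lambda>s. (X s - X t) /\<^sub>R (s - t)) \<longlongrightarrow> D) (at t)"
proof (rule Lim_null[THEN iffD2], rule tendsto_norm_zero_cancel)
  have "((\<lambda>s. norm (X s - X t - (s - t) *\<^sub>R D) / norm (s - t)) \<longlongrightarrow> 0) (at t)"
    using assms unfolding has_vector_derivative_def has_derivative_iff_norm by blast
  then show "((\<lambda>s. norm ((X s - X t) /\<^sub>R (s - t) - D)) \<longlongrightarrow> 0) (at t)"
  proof (rule Lim_transform_eventually)
    have "norm (X s - X t - (s - t) *\<^sub>R D) / norm (s - t) = norm ((X s - X t) /\<^sub>R (s - t) - D)" if "s \<noteq> t" for s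
    proof -
      have "(X s - X t) /\<^sub>R (s - t) - D = (X s - X t - (s - t) *\<^sub>R D) /\<^sub>R (s - t)"
        using that by (simp add: scaleR_diff_right)
      then show ?thesis by (simp add: divide_inverse mult.commute)
    qed
    then show "\<forall>\<^sub>F s in at t. norm (X s - X t - (s - t) *\<^sub>R D) / norm (s - t) = norm ((X s - X t) /\<^sub>R (s - t) - D)"
      by (simp add: eventually_at_filter)
  qed
qed

lemma norm_quotient: "norm (v /\<^sub>R d) = norm v / \<bar>d\<bar>"
  by (simp add: divide_inverse mult.commute)

lemma norm_quotient_le: "norm v \<le> L * \<bar>d\<bar> \<Longrightarrow> d \<noteq> 0 \<Longrightarrow> norm (v /\<^sub>R d) \<le> L"
  unfolding norm_quotient by (simp add: pos_divide_le_eq)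

lemma norm_vector_derivative_le_lipschitz:
  assumes L: "L-lipschitz_on UNIV X" and d: "X differentiable (at t)"
  shows "norm (vector_derivative X (at t)) \<le> L"
proof -
  have "(X has_vector_derivative vector_derivative X (at t)) (at t)" using d by (simp add: vector_derivative_works)
  then have "((\<lambda>s. (X s - X t) /\<^sub>R (s - t)) \<longlongrightarrow> vector_derivative X (at t)) (at t)"
    by (rule has_vector_derivative_imp_quotient_tendsto)
  then show ?thesis
  proof (rule Lim_norm_ubound[rotated])
    show "\<forall>\<^sub>F s in at t. norm ((X s - X t) /\<^sub>R (s - t)) \<le> L"
      unfolding eventually_at_filter
    proof (rule always_eventually, intro allI impI)
      fix s assume "s \<noteq> t"
      then show "norm ((X s - X t) /\<^sub>R (s - t)) \<le> L"
        using lipschitz_onD[OF L, of s t] by (intro norm_quotient_le) (simp_all add: dist_norm)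
    qed
  qed simp
qed

text \<open>The difference quotients \<open>(X (s + 1/n) - X s) * n\<close> are bounded by the Lipschitz constant and
  converge almost everywhere, and their integrals telescope to averages of \<open>X\<close> at the end points.\<close>

lemma has_integral_vector_derivative_lipschitz:
  fixes X :: "real \<Rightarrow> 'a::euclidean_space"
  assumes L: "L-lipschitz_on UNIV X" and t: "0 \<le> t"
  shows "((\<lambda>s. vector_derivative X (at s)) has_integral (X t - X 0)) {0..t}"
proof -
  define N where "N = {t. \<not> X differentiable (at t)}"
  have N: "negligible N" unfolding N_def by (rule negligible_not_differentiable_lipschitz[OF L])
  have cont: "continuous_on UNIV X" by (rule lipschitz_on_continuous_on[OF L])
  have contS: "continuous_on S X" for S by (rule continuous_on_subset[OF cont]) simp
  have L0: "0 \<le> L" by (rule lipschitz_on_nonneg[OF L])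
  define h where "h n = 1 / real (Suc n)" for n
  have h: "0 < h n" for n by (simp add: h_def)
  have h0: "h \<longlonglongrightarrow> 0" using LIMSEQ_Suc[OF lim_1_over_n[where 'a=real]] by (simp add: h_def[abs_def])
  define q where "q n s = (X (s + h n) - X s) /\<^sub>R h n" for n s
  define f where "f n s = (if s \<in> N then 0 else q n s)" for n s
  define g where "g s = (if s \<in> N then 0 else vector_derivative X (at s))" for s
  have qint: "(q n has_integral ((integral {t..t + h n} X - integral {0..h n} X) /\<^sub>R h n)) {0..t}" for n
  proof -
    have iX: "X integrable_on {a..b}" for a b by (intro integrable_continuous_real contS)
    have "integral {0..t} (\<lambda>s. X (s + h n)) = integral {h n..t + h n} X"
      using integral_shift_real_ivl[of "h n" "h n" "t + h n" X] by simp
    moreover have "(\<lambda>s. X (s + h n)) integrable_on {0..t}"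
      by (intro integrable_continuous_real continuous_on_compose2[OF cont] continuous_intros) auto
    ultimately have "((\<lambda>s. X (s + h n) - X s) has_integral (integral {h n..t + h n} X - integral {0..t} X)) {0..t}"
      by (metis has_integral_diff iX integrable_integral)
    moreover have "integral {0..h n} X + integral {h n..t + h n} X = integral {0..t + h n} X"
      "integral {0..t} X + integral {t..t + h n} X = integral {0..t + h n} X"
      using t h[of n] by (intro Henstock_Kurzweil_Integration.integral_combine iX; simp)+
    then have "integral {h n..t + h n} X - integral {0..t} X = integral {t..t + h n} X - integral {0..h n} X"
      by (simp add: algebra_simps)
    ultimately show ?thesis unfolding q_def by (metis has_integral_cmul[where c="inverse (h n)"])
  qed
  have avg: "(\<lambda>n. integral {c..c + h n} X /\<^sub>R h n) \<longlonglongrightarrow> X c" for c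
  proof (rule Lim_null[THEN iffD2], rule Lim_null_comparison)
    have "norm (integral {c..c + h n} X /\<^sub>R h n - X c) \<le> L * h n" for n
    proof -
      have i: "((\<lambda>s. X s - X c) has_integral (integral {c..c + h n} X - h n *\<^sub>R X c)) {c..c + h n}"
        using has_integral_diff[OF integrable_integral has_integral_const_real, of X c "c + h n" "X c"]
          integrable_continuous_real[OF contS] h[of n] by simp
      have "norm (integral {c..c + h n} X - h n *\<^sub>R X c) \<le> (L * h n) * measure lborel (cbox c (c + h n))"
      proof (rule has_integral_bound)
        show "((\<lambda>s. X s - X c) has_integral (integral {c..c + h n} X - h n *\<^sub>R X c)) (cbox c (c + h n))" using i by simp
        fix s assume s: "s \<in> cbox c (c + h n)"
        have "norm (X s - X c) \<le> L * dist s c" using lipschitz_onD[OF L, of s c] by (simp add: dist_norm)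
        also have "\<dots> \<le> L * h n" using s L0 by (intro mult_left_mono) (auto simp: dist_real_def)
        finally show "norm (X s - X c) \<le> L * h n" .
      qed (use L0 h[of n] in simp)
      then have b: "norm (integral {c..c + h n} X - h n *\<^sub>R X c) \<le> (L * h n) * h n" using h[of n] by simp
      have "integral {c..c + h n} X /\<^sub>R h n - X c = (integral {c..c + h n} X - h n *\<^sub>R X c) /\<^sub>R h n"
        using h[of n] by (simp add: scaleR_diff_right)
      then have "norm (integral {c..c + h n} X /\<^sub>R h n - X c) = norm (integral {c..c + h n} X - h n *\<^sub>R X c) / h n"
        using h[of n] by (simp add: divide_inverse mult.commute)
      also have "\<dots> \<le> L * h n" using b h[of n] by (simp add: pos_divide_le_eq)
      finally show ?thesis .
    qed
    then show "\<forall>\<^sub>F n in sequentially. norm (integral {c..c + h n} X /\<^sub>R h n - X c) \<le> L * h n"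
      by (rule always_eventually[OF allI])
    show "(\<lambda>n. L * h n) \<longlonglongrightarrow> 0" using tendsto_mult_right_zero[OF h0] by simp
  qed
  have fl: "(\<lambda>n. f n s) \<longlonglongrightarrow> g s" for s
  proof (cases "s \<in> N")
    case False
    then have "(X has_vector_derivative vector_derivative X (at s)) (at s)"
      by (simp add: N_def vector_derivative_works)
    then have "((\<lambda>u. (X u - X s) /\<^sub>R (u - s)) \<longlongrightarrow> vector_derivative X (at s)) (at s)"
      by (rule has_vector_derivative_imp_quotient_tendsto)
    moreover have "filterlim (\<lambda>n. s + h n) (at s) sequentially"
    proof (rule filterlim_atI)
      show "(\<lambda>n. s + h n) \<longlonglongrightarrow> s" using tendsto_add[OF tendsto_const h0, of s] by simp
    qed (use h in \<open>simp add: less_imp_neq[symmetric]\<close>)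
    ultimately have "(\<lambda>n. (X (s + h n) - X s) /\<^sub>R ((s + h n) - s)) \<longlonglongrightarrow> vector_derivative X (at s)"
      by (rule filterlim_compose)
    then show ?thesis using False by (simp add: f_def g_def q_def)
  qed (simp add: f_def g_def)
  have fint: "(f n has_integral ((integral {t..t + h n} X - integral {0..h n} X) /\<^sub>R h n)) {0..t}" for n
    by (rule has_integral_spike[OF N _ qint]) (simp add: f_def)
  have fb: "norm (f n s) \<le> L" for n s
  proof -
    have "norm (q n s) \<le> L"
      using lipschitz_onD[OF L, of "s + h n" s] h[of n] unfolding q_def
      by (intro norm_quotient_le) (simp_all add: dist_norm)
    then show ?thesis using L0 by (simp add: f_def)
  qed
  have dc: "g integrable_on {0..t}" "(\<lambda>n. integral {0..t} (f n)) \<longlonglongrightarrow> integral {0..t} g"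
    using dominated_convergence[of f "{0..t}" "\<lambda>_. L" g] fint fb fl by (auto simp: has_integral_integrable)
  have "(\<lambda>n. integral {t..t + h n} X /\<^sub>R h n - integral {0..0 + h n} X /\<^sub>R h n) \<longlonglongrightarrow> X t - X 0"
    by (intro tendsto_diff avg)
  moreover have "integral {0..t} (f n) = integral {t..t + h n} X /\<^sub>R h n - integral {0..0 + h n} X /\<^sub>R h n" for n
    using integral_unique[OF fint] by (simp add: scaleR_diff_right)
  ultimately have "integral {0..t} g = X t - X 0" using dc(2) LIMSEQ_unique by simp
  then have "(g has_integral (X t - X 0)) {0..t}" using dc(1) by (metis integrable_integral)
  then show ?thesis
    by (rule has_integral_spike[OF N, rotated]) (simp add: g_def)
qed

lemma abs_continuous_curve_lipschitz:
  fixes X :: "real \<Rightarrow> 'a::euclidean_space"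
  assumes L: "L-lipschitz_on UNIV X"
  shows "abs_continuous_curve X" "curve_length X \<le> L"
proof -
  define N where "N = {t. \<not> X differentiable (at t)}"
  have N: "negligible N" unfolding N_def by (rule negligible_not_differentiable_lipschitz[OF L])
  let ?d = "\<lambda>t. vector_derivative X (at t)"
  define g where "g s = (if s \<in> N then 0 else ?d s)" for s
  have L0: "0 \<le> L" by (rule lipschitz_on_nonneg[OF L])
  have gb: "norm (g s) \<le> L" for s
    using norm_vector_derivative_le_lipschitz[OF L] L0 by (simp add: g_def N_def)
  have "?d integrable_on {0..1}" using has_integral_vector_derivative_lipschitz[OF L, of 1] by auto
  then have "g integrable_on {0..1}" by (rule integrable_spike[OF _ N]) (simp add: g_def)
  then have gi: "g absolutely_integrable_on {0..1}"
    by (intro absolutely_integrable_integrable_bound[of _ _ "\<lambda>_. L"] gb) auto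
  then have di: "?d absolutely_integrable_on {0..1}"
    by (rule absolutely_integrable_spike[OF _ N]) (simp add: g_def)
  show "abs_continuous_curve X"
    unfolding abs_continuous_curve_def
    using N di has_integral_vector_derivative_lipschitz[OF L] by (auto simp: N_def intro!: exI[of _ N])
  have "curve_length X = integral {0..1} (\<lambda>s. norm (g s))"
    unfolding curve_length_def by (rule integral_spike[OF N]) (simp add: g_def)
  also have "\<dots> \<le> integral {0..1::real} (\<lambda>_. L)"
    using gi by (intro integral_le gb) (auto simp: absolutely_integrable_on_def)
  finally show "curve_length X \<le> L" by simp
qed

section \<open>Joining points by Lipschitz curves\<close>

text \<open>For the infimum of lengths it suffices to consider Lipschitz curves. The Lipschitz constant on \<open>[0,1]\<close>
  bounds the length and behaves well under Lipschitz maps, concatenation and uniform limits.\<close>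

definition reachable :: "'a::metric_space set \<Rightarrow> 'a \<Rightarrow> 'a \<Rightarrow> real \<Rightarrow> bool" where
  "reachable \<Omega> x y L \<longleftrightarrow> (\<exists>Y. L-lipschitz_on {0..1::real} Y \<and> Y 0 = x \<and> Y 1 = y \<and> Y ` {0..1} \<subseteq> \<Omega>)"

lemma reachable_nonneg: "reachable \<Omega> x y L \<Longrightarrow> 0 \<le> L"
  unfolding reachable_def using lipschitz_on_nonneg by blast

lemma reachable_dist_le: "reachable \<Omega> x y L \<Longrightarrow> dist x y \<le> L"
  unfolding reachable_def using lipschitz_onD[of L "{0..1::real}" _ 0 1] by fastforce

lemma reachable_mem: "reachable \<Omega> x y L \<Longrightarrow> x \<in> \<Omega> \<and> y \<in> \<Omega>"
  unfolding reachable_def by force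

lemma reachable_mono: "reachable \<Omega> x y L \<Longrightarrow> L \<le> M \<Longrightarrow> reachable \<Omega> x y M"
  unfolding reachable_def using lipschitz_on_le by blast

lemma reachable_refl: "x \<in> \<Omega> \<Longrightarrow> reachable \<Omega> x x 0"
  unfolding reachable_def by (intro exI[of _ "\<lambda>_. x"]) (auto intro!: lipschitz_onI)

lemma reachable_segment:
  fixes x y :: "'a::real_normed_vector"
  assumes "closed_segment x y \<subseteq> \<Omega>"
  shows "reachable \<Omega> x y (dist x y)"
proof -
  have "(dist x y)-lipschitz_on {0..1} (\<lambda>t. x + t *\<^sub>R (y - x))"
  proof (rule lipschitz_onI)
    fix s t :: real
    have "dist (x + s *\<^sub>R (y - x)) (x + t *\<^sub>R (y - x)) = norm ((s - t) *\<^sub>R (y - x))"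
      by (simp add: dist_norm algebra_simps)
    then show "dist (x + s *\<^sub>R (y - x)) (x + t *\<^sub>R (y - x)) \<le> dist x y * dist s t"
      by (simp add: dist_norm norm_minus_commute mult.commute)
  qed simp
  moreover have "x + t *\<^sub>R (y - x) \<in> \<Omega>" if "t \<in> {0..1}" for t
  proof -
    have "x + t *\<^sub>R (y - x) = (1 - t) *\<^sub>R x + t *\<^sub>R y" by (simp add: algebra_simps)
    then show ?thesis using that assms unfolding closed_segment_def by auto
  qed
  ultimately show ?thesis unfolding reachable_def
    by (intro exI[of _ "\<lambda>t. x + t *\<^sub>R (y - x)"]) auto
qed

lemma reachable_sym:
  assumes "reachable \<Omega> x y L" shows "reachable \<Omega> y x L"
proof -
  obtain Y where Y: "L-lipschitz_on {0..1::real} Y" "Y 0 = x" "Y 1 = y" "Y ` {0..1} \<subseteq> \<Omega>"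
    using assms unfolding reachable_def by blast
  have "L-lipschitz_on {0..1::real} (\<lambda>t. Y (1 - t))"
  proof (rule lipschitz_onI)
    fix s t :: real assume "s \<in> {0..1}" "t \<in> {0..1}"
    then show "dist (Y (1 - s)) (Y (1 - t)) \<le> L * dist s t"
      using lipschitz_onD[OF Y(1), of "1 - s" "1 - t"] by (simp add: dist_real_def abs_minus_commute)
  qed (rule lipschitz_on_nonneg[OF Y(1)])
  then show ?thesis unfolding reachable_def using Y by (intro exI[of _ "\<lambda>t. Y (1 - t)"]) auto
qed

lemma reachable_image:
  assumes "reachable \<Omega> x y L" and T: "K-lipschitz_on \<Omega> T" "T ` \<Omega> \<subseteq> \<Omega>'"
  shows "reachable \<Omega>' (T x) (T y) (K * L)"
proof -
  obtain Y where Y: "L-lipschitz_on {0..1::real} Y" "Y 0 = x" "Y 1 = y" "Y ` {0..1} \<subseteq> \<Omega>"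
    using assms unfolding reachable_def by blast
  have "(K * L)-lipschitz_on {0..1::real} (\<lambda>t. T (Y t))"
    using lipschitz_on_compose2[OF Y(1) lipschitz_on_subset[OF T(1) Y(4)]] .
  then show ?thesis unfolding reachable_def using Y T by (intro exI[of _ "\<lambda>t. T (Y t)"]) force
qed

lemma lipschitz_on_reparametrize:
  fixes Y :: "real \<Rightarrow> 'a::metric_space"
  assumes "L-lipschitz_on {0..1} Y" and "0 < c" and M: "L / c \<le> M" and S: "\<And>t. t \<in> S \<Longrightarrow> (t - b) / c \<in> {0..1}"
  shows "M-lipschitz_on S (\<lambda>t. Y ((t - b) / c))"
proof (rule lipschitz_onI)
  have L: "0 \<le> L" by (rule lipschitz_on_nonneg[OF assms(1)])
  show "0 \<le> M" using L M \<open>0 < c\<close> by (meson divide_nonneg_pos order_trans)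
  fix s t assume st: "s \<in> S" "t \<in> S"
  have "dist (Y ((s - b) / c)) (Y ((t - b) / c)) \<le> L * dist ((s - b) / c) ((t - b) / c)"
    by (rule lipschitz_onD[OF assms(1) S[OF st(1)] S[OF st(2)]])
  also have "\<dots> = (L / c) * dist s t"
    using \<open>0 < c\<close> by (simp add: dist_real_def diff_divide_distrib[symmetric])
  also have "\<dots> \<le> M * dist s t" using M by (rule mult_right_mono) simp
  finally show "dist (Y ((s - b) / c)) (Y ((t - b) / c)) \<le> M * dist s t" .
qed

text \<open>Run through the concatenation at constant speed: the first curve receives the share \<open>L / (L + M)\<close> of
  the time.\<close>

lemma reachable_trans:
  assumes "reachable \<Omega> x y L" "reachable \<Omega> y z M"
  shows "reachable \<Omega> x z (L + M)"
proof (cases "L = 0 \<or> M = 0")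
  case True
  then show ?thesis using assms reachable_dist_le[OF assms(1)] reachable_dist_le[OF assms(2)] by auto
next
  case False
  then have LM: "0 < L" "0 < M" using reachable_nonneg[OF assms(1)] reachable_nonneg[OF assms(2)] by auto
  obtain Y where Y: "L-lipschitz_on {0..1::real} Y" "Y 0 = x" "Y 1 = y" "Y ` {0..1} \<subseteq> \<Omega>"
    using assms(1) unfolding reachable_def by blast
  obtain Z where Z: "M-lipschitz_on {0..1::real} Z" "Z 0 = y" "Z 1 = z" "Z ` {0..1} \<subseteq> \<Omega>"
    using assms(2) unfolding reachable_def by blast
  define c where "c = L / (L + M)"
  have c: "0 < c" "c < 1" "1 - c = M / (L + M)" using LM by (auto simp: c_def field_simps)
  have LM_div: "L / c = L + M" "M / (1 - c) = L + M" using LM c(3) by (simp_all add: c_def)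
  let ?f = "\<lambda>t. Y ((t - 0) / c)" and ?g = "\<lambda>t. Z ((t - c) / (1 - c))"
  have "(L + M)-lipschitz_on {0..1} (\<lambda>t. if t \<le> c then ?f t else ?g t)"
  proof (rule lipschitz_on_concat)
    show "(L + M)-lipschitz_on {0..c} ?f"
      by (rule lipschitz_on_reparametrize[OF Y(1)]) (use c(1,2) in \<open>auto simp: LM_div\<close>)
    show "(L + M)-lipschitz_on {c..1} ?g"
      by (rule lipschitz_on_reparametrize[OF Z(1)]) (use c(1,2) in \<open>auto simp: LM_div\<close>)
    show "?f c = ?g c" using c Y Z by simp
  qed
  moreover have "(if t \<le> c then ?f t else ?g t) \<in> \<Omega>" if "t \<in> {0..1}" for t
  proof (cases "t \<le> c")
    case True
    then have "(t - 0) / c \<in> {0..1}" using that c(1,2) by auto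
    then show ?thesis using Y(4) True by (simp only: if_True image_subset_iff)
  next
    case False
    then have "(t - c) / (1 - c) \<in> {0..1}" using that c(1,2) by auto
    then show ?thesis using Z(4) False by (simp only: if_False image_subset_iff)
  qed
  ultimately show ?thesis unfolding reachable_def image_subset_iff
    using c(1,2) Y(2) Z(3) by (intro exI[of _ "\<lambda>t. if t \<le> c then ?f t else ?g t"]) simp
qed

text \<open>By the theorem of Arzela and Ascoli, connecting curves with bounded Lipschitz constants have a uniformly
  convergent subsequence. This yields both the minimizer and the semicontinuity of the distance.\<close>

lemma reachable_limit:
  fixes \<Omega> :: "'a::euclidean_space set"
  assumes \<Omega>: "compact \<Omega>" and R: "\<And>n. reachable \<Omega> (x n) (y n) (M n)"
    and lim: "M \<longlonglongrightarrow> L" "x \<longlonglongrightarrow> x'" "y \<longlonglongrightarrow> y'"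
  shows "reachable \<Omega> x' y' L"
proof -
  have "\<exists>Y. \<forall>n. (M n)-lipschitz_on {0..1::real} (Y n) \<and> Y n 0 = x n \<and> Y n 1 = y n \<and> Y n ` {0..1} \<subseteq> \<Omega>"
    using R unfolding reachable_def by (intro choice) blast
  then obtain Y where Y: "\<And>n. (M n)-lipschitz_on {0..1::real} (Y n)" "\<And>n. Y n 0 = x n" "\<And>n. Y n 1 = y n"
      "\<And>n. Y n ` {0..1} \<subseteq> \<Omega>" by blast
  obtain B where B: "\<And>z. z \<in> \<Omega> \<Longrightarrow> norm z \<le> B" using compact_imp_bounded[OF \<Omega>] by (auto simp: bounded_iff)
  obtain C where C: "0 < C" "\<And>n. \<bar>M n\<bar> \<le> C"
    using convergent_imp_Bseq[OF convergentI[OF lim(1)]] unfolding Bseq_def by auto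
  obtain g k where g: "continuous_on {0..1::real} g" "strict_mono (k :: nat \<Rightarrow> nat)"
      "\<And>e. 0 < e \<Longrightarrow> \<exists>N. \<forall>n x. n \<ge> N \<and> x \<in> {0..1} \<longrightarrow> norm (Y (k n) x - g x) < e"
  proof (rule Arzela_Ascoli[of "{0..1::real}" Y B])
    fix n :: nat and t :: real assume t: "t \<in> {0..1}"
    show "norm (Y n t) \<le> B" using Y(4)[of n] t by (intro B) auto
  next
    fix t e :: real assume t: "t \<in> {0..1}" and e: "0 < e"
    have "norm (Y n t - Y n s) < e" if "s \<in> {0..1}" "norm (t - s) < e / C" for n s
    proof -
      have "norm (Y n t - Y n s) \<le> M n * dist t s" using lipschitz_onD[OF Y(1) t that(1), of n] by (simp add: dist_norm)
      also have "\<dots> \<le> C * dist t s" using C(2)[of n] by (intro mult_right_mono) auto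
      also have "\<dots> < e" using that(2) C(1) by (simp add: dist_norm pos_less_divide_eq mult.commute)
      finally show ?thesis .
    qed
    then show "\<exists>d>0. \<forall>n s. s \<in> {0..1} \<and> norm (t - s) < d \<longrightarrow> norm (Y n t - Y n s) < e"
      using e C(1) by (intro exI[of _ "e / C"]) simp
  qed simp_all
  have pt: "(\<lambda>n. Y (k n) t) \<longlonglongrightarrow> g t" if "t \<in> {0..1}" for t
    unfolding LIMSEQ_def dist_norm using g(3) that by blast
  have Mk: "(\<lambda>n. M (k n)) \<longlonglongrightarrow> L" using LIMSEQ_subseq_LIMSEQ[OF lim(1) g(2)] by (simp add: o_def)
  have "L-lipschitz_on {0..1} g"
  proof (rule lipschitz_onI)
    fix s t :: real assume st: "s \<in> {0..1}" "t \<in> {0..1}"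
    show "dist (g s) (g t) \<le> L * dist s t"
    proof (rule LIMSEQ_le)
      show "(\<lambda>n. dist (Y (k n) s) (Y (k n) t)) \<longlonglongrightarrow> dist (g s) (g t)" by (intro tendsto_dist pt st)
      show "(\<lambda>n. M (k n) * dist s t) \<longlonglongrightarrow> L * dist s t" by (intro tendsto_mult_right Mk)
      show "\<exists>N. \<forall>n\<ge>N. dist (Y (k n) s) (Y (k n) t) \<le> M (k n) * dist s t"
        using lipschitz_onD[OF Y(1) st] by blast
    qed
  next
    show "0 \<le> L" by (rule LIMSEQ_le_const[OF lim(1)]) (use reachable_nonneg[OF R] in blast)
  qed
  moreover have "g 0 = x'" "g 1 = y'"
    using LIMSEQ_unique[OF pt[of 0]] LIMSEQ_unique[OF pt[of 1]] Y(2,3)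
      LIMSEQ_subseq_LIMSEQ[OF lim(2) g(2)] LIMSEQ_subseq_LIMSEQ[OF lim(3) g(2)] by (auto simp: o_def)
  moreover have "g ` {0..1} \<subseteq> \<Omega>"
  proof clarify
    fix t :: real assume t: "t \<in> {0..1}"
    show "g t \<in> \<Omega>"
      by (rule closed_sequentially[OF compact_imp_closed[OF \<Omega>] _ pt[OF t]]) (use Y(4) t in \<open>simp add: image_subset_iff\<close>)
  qed
  ultimately show ?thesis unfolding reachable_def by blast
qed

lemma reachable_imp_curve:
  fixes \<Omega> :: "'a::euclidean_space set"
  assumes "reachable \<Omega> x y L"
  shows "\<exists>X\<in>curves \<Omega> x y. curve_length X \<le> L"
proof -
  obtain Y where Y: "L-lipschitz_on {0..1::real} Y" "Y 0 = x" "Y 1 = y" "Y ` {0..1} \<subseteq> \<Omega>"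
    using assms unfolding reachable_def by blast
  define X where "X t = Y (max 0 (min 1 t))" for t
  have "L-lipschitz_on UNIV X"
  proof (rule lipschitz_onI)
    fix s t :: real
    have "dist (X s) (X t) \<le> L * dist (max 0 (min 1 s)) (max 0 (min 1 t))"
      unfolding X_def by (rule lipschitz_onD[OF Y(1)]) auto
    also have "\<dots> \<le> L * dist s t"
      using lipschitz_on_nonneg[OF Y(1)] by (intro mult_left_mono) (auto simp: dist_real_def max_def min_def)
    finally show "dist (X s) (X t) \<le> L * dist s t" .
  qed (rule lipschitz_on_nonneg[OF Y(1)])
  note X = abs_continuous_curve_lipschitz[OF this]
  have "X \<in> curves \<Omega> x y" using X(1) Y by (auto simp: curves_def X_def)
  then show ?thesis using X(2) by blast
qed

text \<open>Reparametrization by arc length.\<close>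

lemma curve_imp_reachable:
  fixes \<Omega> :: "'a::euclidean_space set"
  assumes X: "X \<in> curves \<Omega> x y"
  shows "reachable \<Omega> x y (curve_length X)"
proof -
  let ?d = "\<lambda>t. vector_derivative X (at t)"
  have ac: "?d absolutely_integrable_on {0..1}"
    "\<And>t. t \<in> {0..1} \<Longrightarrow> (?d has_integral (X t - X 0)) {0..t}"
    and X01: "X 0 = x" "X 1 = y" "\<And>t. t \<in> {0..1} \<Longrightarrow> X t \<in> \<Omega>"
    using X unfolding curves_def abs_continuous_curve_def by auto
  have ni: "(\<lambda>t. norm (?d t)) integrable_on {0..1}" using ac(1) by (simp add: absolutely_integrable_on_def)
  define s where "s t = integral {0..t} (\<lambda>t. norm (?d t))" for t
  define L where "L = curve_length X"
  have s01: "s 0 = 0" "s 1 = L" by (simp_all add: s_def L_def curve_length_def)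
  have ni': "(\<lambda>t. norm (?d t)) integrable_on {u..v}" if "0 \<le> u" "v \<le> 1" for u v
    by (rule integrable_on_subinterval[OF ni]) (use that in auto)
  have scont: "continuous_on {0..1} s" unfolding s_def by (rule indefinite_integral_continuous_1[OF ni])
  have incr: "dist (X u) (X v) \<le> s v - s u" if uv: "0 \<le> u" "u \<le> v" "v \<le> 1" for u v
  proof -
    have di: "?d integrable_on {0..v}" using ac(2)[of v] uv by auto
    have "integral {0..u} ?d + integral {u..v} ?d = integral {0..v} ?d"
      using uv di by (intro Henstock_Kurzweil_Integration.integral_combine) auto
    then have "X v - X u = integral {u..v} ?d"
      using integral_unique[OF ac(2)[of u]] integral_unique[OF ac(2)[of v]] uv by (simp add: algebra_simps)
    moreover have "norm (integral {u..v} ?d) \<le> integral {u..v} (\<lambda>t. norm (?d t))"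
      using uv by (intro integral_norm_bound_integral ni' integrable_on_subinterval[OF di]) auto
    moreover have "integral {0..u} (\<lambda>t. norm (?d t)) + integral {u..v} (\<lambda>t. norm (?d t)) = integral {0..v} (\<lambda>t. norm (?d t))"
      using uv by (intro Henstock_Kurzweil_Integration.integral_combine ni') auto
    ultimately show ?thesis unfolding s_def dist_norm norm_minus_commute[of "X u"] by simp
  qed
  have L0: "0 \<le> L" using order_trans[OF zero_le_dist incr[of 0 1]] s01 by simp
  have ex: "\<exists>t\<in>{0..1}. s t = u * L" if "u \<in> {0..1}" for u
    using IVT'[of s 0 "u * L" 1] s01 scont that L0 by (auto simp: mult_left_le_one_le)
  then obtain T where T: "\<And>u. u \<in> {0..1} \<Longrightarrow> T u \<in> {0..1} \<and> s (T u) = u * L" by metis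
  have lip: "dist (X t) (X t') \<le> \<bar>s t - s t'\<bar>" if "t \<in> {0..1}" "t' \<in> {0..1}" for t t'
    using incr[of t t'] incr[of t' t] that by (cases "t \<le> t'") (auto simp: dist_commute)
  define Y where "Y u = X (T u)" for u
  have "L-lipschitz_on {0..1} Y"
  proof (rule lipschitz_onI)
    fix u v :: real assume uv: "u \<in> {0..1}" "v \<in> {0..1}"
    have "dist (Y u) (Y v) \<le> \<bar>u * L - v * L\<bar>" using lip[of "T u" "T v"] T[OF uv(1)] T[OF uv(2)] by (simp add: Y_def)
    also have "\<dots> = L * dist u v" using L0 by (simp add: dist_real_def left_diff_distrib[symmetric] abs_mult)
    finally show "dist (Y u) (Y v) \<le> L * dist u v" .
  qed (rule L0)
  moreover have "Y 0 = x" "Y 1 = y"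
    using lip[of "T 0" 0] lip[of "T 1" 1] T[of 0] T[of 1] s01 X01 by (auto simp: Y_def)
  moreover have "Y ` {0..1} \<subseteq> \<Omega>" using T X01(3) by (auto simp: Y_def)
  ultimately show ?thesis unfolding reachable_def L_def by blast
qed

lemma domain_dist_reachable:
  fixes \<Omega> :: "'a::euclidean_space set"
  assumes "compact \<Omega>" "reachable \<Omega> x y M"
  shows "reachable \<Omega> x y (domain_dist \<Omega> x y)"
    and "\<And>L. reachable \<Omega> x y L \<Longrightarrow> domain_dist \<Omega> x y \<le> L"
    and "\<exists>X\<in>curves \<Omega> x y. curve_length X = domain_dist \<Omega> x y"
    and "\<And>X. X \<in> curves \<Omega> x y \<Longrightarrow> domain_dist \<Omega> x y \<le> curve_length X"
proof -
  let ?S = "curve_length ` curves \<Omega> x y"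
  have bdd: "bdd_below ?S"
    using reachable_nonneg[OF curve_imp_reachable] by (intro bdd_belowI[of _ 0]) auto
  show le: "domain_dist \<Omega> x y \<le> curve_length X" if "X \<in> curves \<Omega> x y" for X
    unfolding domain_dist_def by (rule cINF_lower[OF bdd that])
  show le': "domain_dist \<Omega> x y \<le> L" if "reachable \<Omega> x y L" for L
    using reachable_imp_curve[OF that] le by (metis order_trans)
  have ne: "?S \<noteq> {}" using reachable_imp_curve[OF assms(2)] by blast
  have "\<exists>X\<in>curves \<Omega> x y. curve_length X < domain_dist \<Omega> x y + 1 / real (Suc n)" for n
  proof -
    have "Inf ?S < domain_dist \<Omega> x y + 1 / real (Suc n)" by (simp add: domain_dist_def)
    then show ?thesis using cInf_lessD[OF ne] by blast
  qed
  then have "reachable \<Omega> x y (domain_dist \<Omega> x y + 1 / real (Suc n))" for n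
    using reachable_mono[OF curve_imp_reachable] by (metis less_imp_le)
  moreover have "(\<lambda>n. domain_dist \<Omega> x y + 1 / real (Suc n)) \<longlonglongrightarrow> domain_dist \<Omega> x y + 0"
    by (intro tendsto_add tendsto_const LIMSEQ_Suc[OF lim_1_over_n[where 'a=real]])
  ultimately show R: "reachable \<Omega> x y (domain_dist \<Omega> x y)"
    using reachable_limit[OF assms(1), of "\<lambda>_. x" "\<lambda>_. y" "\<lambda>n. domain_dist \<Omega> x y + 1 / real (Suc n)"] by simp
  show "\<exists>X\<in>curves \<Omega> x y. curve_length X = domain_dist \<Omega> x y"
    using reachable_imp_curve[OF R] le by (metis antisym)
qed

section \<open>Pushing the domain into its interior\<close>

lemma gradient_eq: "(f has_derivative (\<lambda>h. v \<bullet> h)) (at x) \<Longrightarrow> gradient f x = v"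
proof -
  assume f: "(f has_derivative (\<lambda>h. v \<bullet> h)) (at x)"
  have "w = v" if "GDERIV f x :> w" for w
  proof -
    have "(\<lambda>h. h \<bullet> w) = (\<lambda>h. v \<bullet> h)"
      using that f unfolding gderiv_def by (rule has_derivative_unique)
    then have "h \<bullet> (w - v) = 0" for h by (metis inner_commute inner_diff_right right_minus_eq)
    then show ?thesis by (metis inner_eq_zero_iff right_minus_eq)
  qed
  moreover have "GDERIV f x :> v" using f unfolding gderiv_def by (simp add: inner_commute)
  ultimately show ?thesis unfolding gradient_def by blast
qed

definition defining_function :: "'a::euclidean_space set \<Rightarrow> 'a set \<Rightarrow> ('a \<Rightarrow> real) \<Rightarrow> ('a \<Rightarrow> 'a) \<Rightarrow> bool" where
  "defining_function \<Omega> U \<rho> g \<longleftrightarrow>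
     open U \<and> C1_grad U \<rho> g \<and> (\<forall>x\<in>U. g x \<noteq> 0) \<and> \<Omega> \<inter> U = {x\<in>U. \<rho> x \<le> 0}"

lemma defining_functionD:
  assumes "defining_function \<Omega> U \<rho> g"
  shows "open U" "C1_grad U \<rho> g" "x \<in> U \<Longrightarrow> g x \<noteq> 0" "x \<in> U \<Longrightarrow> x \<in> \<Omega> \<longleftrightarrow> \<rho> x \<le> 0"
  using assms unfolding defining_function_def by blast+

lemma smooth_boundary_defining_function:
  assumes "smooth_boundary \<Omega>" "p \<in> frontier \<Omega>"
  obtains U \<rho> g where "defining_function \<Omega> U \<rho> g" "p \<in> U"
proof -
  obtain U \<rho> where U: "open U" "p \<in> U" "smooth_on U \<rho>" "\<forall>x\<in>U. gradient \<rho> x \<noteq> 0" "\<Omega> \<inter> U = {x\<in>U. \<rho> x \<le> 0}"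
    using assms unfolding smooth_boundary_def by metis
  have "Ck_on 1 U \<rho>" using U(3) unfolding smooth_on_def by blast
  then obtain g where g: "C1_grad U \<rho> g" using Ck_on_imp_C1_grad by blast
  have "gradient \<rho> x = g x" if "x \<in> U" for x by (rule gradient_eq[OF C1_gradD(1)[OF g that]])
  then have "defining_function \<Omega> U \<rho> g" unfolding defining_function_def using U g by simp
  then show thesis using that U(2) by blast
qed

lemma defining_function_interior:
  assumes D: "defining_function \<Omega> U \<rho> g" and x: "x \<in> U"
  shows "x \<in> interior \<Omega> \<longleftrightarrow> \<rho> x < 0"
proof
  note D = defining_functionD[OF D]
  assume "\<rho> x < 0"
  have "open (U \<inter> \<rho> -` {..<0})"
    by (rule continuous_open_preimage[OF C1_gradD(3)[OF D(2)] D(1)]) simp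
  moreover have "U \<inter> \<rho> -` {..<0} \<subseteq> \<Omega>" using D(4) by force
  moreover have "x \<in> U \<inter> \<rho> -` {..<0}" using x \<open>\<rho> x < 0\<close> by simp
  ultimately show "x \<in> interior \<Omega>" by (meson interiorI)
next
  note D = defining_functionD[OF D]
  assume xi: "x \<in> interior \<Omega>"
  have le: "\<rho> y \<le> 0" if "y \<in> U \<inter> interior \<Omega>" for y using D(4)[of y] interior_subset that by blast
  have "\<rho> x \<noteq> 0"
  proof
    assume 0: "\<rho> x = 0"
    have "(\<lambda>h. g x \<bullet> h) = (\<lambda>h. 0)"
      by (rule differential_zero_maxmin[of x "U \<inter> interior \<Omega>" \<rho>])
         (use x xi D(1) C1_gradD(1)[OF D(2) x] le 0 in auto)
    then have "g x \<bullet> g x = 0" by metis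
    then show False using D(3)[OF x] by simp
  qed
  then show "\<rho> x < 0" using le[of x] x xi by force
qed

lemma defining_function_frontier:
  assumes D: "defining_function \<Omega> U \<rho> g" and x: "x \<in> U" and "closed \<Omega>"
  shows "x \<in> frontier \<Omega> \<longleftrightarrow> \<rho> x = 0"
  using defining_functionD(4)[OF D x] defining_function_interior[OF D x] \<open>closed \<Omega>\<close>
  by (auto simp: frontier_def)

definition push_map :: "'a::euclidean_space set \<Rightarrow> real \<Rightarrow> 'a set \<Rightarrow> ('a \<Rightarrow> 'a) \<Rightarrow> bool" where
  "push_map \<Omega> \<eta> A T \<longleftrightarrow> (1 + \<eta>)-lipschitz_on UNIV T \<and> (\<forall>x. dist (T x) x \<le> \<eta>) \<and>
     (\<forall>x\<in>\<Omega>. (T x = x \<or> T x \<in> interior \<Omega>) \<and> (\<exists>L. reachable \<Omega> x (T x) L)) \<and> (\<forall>x\<in>\<Omega> \<inter> A. T x \<in> interior \<Omega>)"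

lemma push_mapD:
  assumes "push_map \<Omega> \<eta> A T"
  shows "(1 + \<eta>)-lipschitz_on UNIV T" "\<forall>x. dist (T x) x \<le> \<eta>"
    "\<forall>x\<in>\<Omega>. (T x = x \<or> T x \<in> interior \<Omega>) \<and> (\<exists>L. reachable \<Omega> x (T x) L)" "\<forall>x\<in>\<Omega> \<inter> A. T x \<in> interior \<Omega>"
  using assms unfolding push_map_def by blast+

text \<open>Near \<open>p\<close> the defining function decreases in the direction opposite to \<open>g p\<close>. The map \<open>T\<close> moves points in
  this direction, by a small multiple of a Lipschitz cutoff function.\<close>

lemma push_near_boundary_point:
  fixes \<Omega> :: "'a::euclidean_space set"
  assumes D: "defining_function \<Omega> U \<rho> g" and p: "p \<in> U"
  shows "\<exists>r>0. \<forall>\<eta>>0. \<exists>T. push_map \<Omega> \<eta> (ball p r) T"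
proof -
  note DD = defining_functionD[OF D]
  have gp: "g p \<noteq> 0" by (rule DD(3)[OF p])
  have "open (U \<inter> (\<lambda>x. g x \<bullet> g p) -` {0<..})"
    by (rule continuous_open_preimage[OF _ DD(1)]) (auto intro!: continuous_intros C1_gradD(2)[OF DD(2)])
  moreover have "p \<in> U \<inter> (\<lambda>x. g x \<bullet> g p) -` {0<..}" using p gp by simp
  ultimately obtain s where s: "0 < s" "ball p s \<subseteq> U \<inter> (\<lambda>x. g x \<bullet> g p) -` {0<..}"
    by (metis open_contains_ball)
  define r where "r = s / 3"
  have r: "0 < r" using s by (simp add: r_def)
  have rU: "x \<in> U" "0 < g x \<bullet> g p" if "dist x p < 3 * r" for x
    using that s by (auto simp: r_def dist_commute subset_iff)
  define u where "u = g p /\<^sub>R norm (g p)"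
  have nu: "norm u = 1" using gp by (simp add: u_def)
  have gu: "0 < g x \<bullet> u" if "dist x p < 3 * r" for x using rU(2)[OF that] gp by (simp add: u_def)
  have inner: "x - t *\<^sub>R u \<in> interior \<Omega>" if x: "x \<in> \<Omega>" "dist x p < 2 * r" and t: "0 < t" "t \<le> r" for x t
  proof -
    have near: "dist (x - \<tau> *\<^sub>R u) p < 3 * r" if "0 \<le> \<tau>" "\<tau> \<le> t" for \<tau>
    proof -
      have "dist (x - \<tau> *\<^sub>R u) p \<le> dist (x - \<tau> *\<^sub>R u) x + dist x p" by (rule dist_triangle)
      also have "dist (x - \<tau> *\<^sub>R u) x = \<tau>" using that nu by (simp add: dist_norm)
      finally show ?thesis using that x(2) t by simp
    qed
    have "\<rho> (x - t *\<^sub>R u) < \<rho> (x - 0 *\<^sub>R u)"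
    proof (rule DERIV_neg_imp_decreasing[OF t(1)])
      fix \<tau> assume \<tau>: "0 \<le> \<tau>" "\<tau> \<le> t"
      have "((\<lambda>\<tau>. \<rho> (x - \<tau> *\<^sub>R u)) has_derivative (\<lambda>h. g (x - \<tau> *\<^sub>R u) \<bullet> (- (h *\<^sub>R u)))) (at \<tau>)"
      proof -
        have "((\<lambda>\<tau>. x - \<tau> *\<^sub>R u) has_derivative (\<lambda>h. - (h *\<^sub>R u))) (at \<tau>)"
          by (auto intro!: derivative_eq_intros)
        from has_derivative_compose[OF this C1_gradD(1)[OF DD(2) rU(1)[OF near[OF \<tau>]]]] show ?thesis .
      qed
      then have "((\<lambda>\<tau>. \<rho> (x - \<tau> *\<^sub>R u)) has_field_derivative (- (g (x - \<tau> *\<^sub>R u) \<bullet> u))) (at \<tau>)"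
        unfolding has_field_derivative_def by (rule has_derivative_eq_rhs) (auto simp: fun_eq_iff)
      then show "\<exists>y. ((\<lambda>\<tau>. \<rho> (x - \<tau> *\<^sub>R u)) has_real_derivative y) (at \<tau>) \<and> y < 0"
        using gu[OF near[OF \<tau>]] by (intro exI[of _ "- (g (x - \<tau> *\<^sub>R u) \<bullet> u)"]) simp
    qed
    moreover have "x \<in> U" using rU(1)[of x] x(2) r by simp
    then have "\<rho> x \<le> 0" using DD(4) x(1) by blast
    ultimately have "\<rho> (x - t *\<^sub>R u) < 0" by simp
    then show ?thesis using defining_function_interior[OF D rU(1)[OF near[of t]]] t by simp
  qed
  have "\<exists>T. push_map \<Omega> \<eta> (ball p r) T"
    if \<eta>: "0 < \<eta>" for \<eta>
  proof -
    \<comment> \<open>The size of the move is at most \<open>e * (2 * r) \<le> r\<close>, which keeps it in the ball of radius \<open>3 * r\<close>.\<close>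
    define e where "e = min (min \<eta> (\<eta> / (2 * r))) (1 / 2)"
    have e: "0 < e" "e \<le> \<eta>" "e * (2 * r) \<le> \<eta>" "e * (2 * r) \<le> r"
    proof -
      have "e \<le> \<eta> / (2 * r)" "e \<le> 1 / 2" by (simp_all add: e_def)
      then show "0 < e" "e \<le> \<eta>" "e * (2 * r) \<le> \<eta>" "e * (2 * r) \<le> r"
        using r \<eta> by (simp_all add: e_def pos_le_divide_eq)
    qed
    define \<phi> where "\<phi> x = max 0 (2 * r - dist x p)" for x
    have \<phi>: "0 \<le> \<phi> x" "\<phi> x \<le> 2 * r" for x using r by (auto simp: \<phi>_def)
    have \<phi>lip: "\<bar>\<phi> x - \<phi> y\<bar> \<le> dist x y" for x y
    proof -
      have "\<bar>max 0 s - max 0 t\<bar> \<le> \<bar>s - t\<bar>" for s t :: real by (auto simp: max_def)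
      from order_trans[OF this[of "2 * r - dist x p" "2 * r - dist y p"]] show ?thesis
        using abs_dist_diff_le[of x p y] by (simp add: \<phi>_def abs_minus_commute dist_commute)
    qed
    define T where "T x = x - (e * \<phi> x) *\<^sub>R u" for x
    have "(1 + \<eta>)-lipschitz_on UNIV T"
    proof (rule lipschitz_onI)
      fix x y
      have "dist (T x) (T y) = norm ((x - y) - (e * (\<phi> x - \<phi> y)) *\<^sub>R u)"
        unfolding dist_norm T_def by (simp add: algebra_simps)
      also have "\<dots> \<le> norm (x - y) + norm ((e * (\<phi> x - \<phi> y)) *\<^sub>R u)" by (rule norm_triangle_ineq4)
      also have "norm ((e * (\<phi> x - \<phi> y)) *\<^sub>R u) = e * \<bar>\<phi> x - \<phi> y\<bar>" using e nu by (simp add: abs_mult)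
      also have "e * \<bar>\<phi> x - \<phi> y\<bar> \<le> \<eta> * dist x y" using e \<phi>lip by (intro mult_mono) auto
      finally show "dist (T x) (T y) \<le> (1 + \<eta>) * dist x y" by (simp add: dist_norm algebra_simps)
    qed (use \<eta> in simp)
    moreover have "dist (T x) x \<le> \<eta>" for x
    proof -
      have "dist (T x) x = e * \<phi> x" using e \<phi> nu by (simp add: T_def dist_norm)
      also have "\<dots> \<le> e * (2 * r)" using e \<phi> by (intro mult_left_mono) auto
      finally show ?thesis using e by simp
    qed
    moreover have pos: "x - (\<tau> * (e * \<phi> x)) *\<^sub>R u \<in> interior \<Omega>" if "x \<in> \<Omega>" "0 < \<phi> x" "0 < \<tau>" "\<tau> \<le> 1" for x \<tau>
    proof (rule inner[OF that(1)])
      show "dist x p < 2 * r" using that(2) by (simp add: \<phi>_def max_def split: if_splits)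
      have "e * \<phi> x \<le> e * (2 * r)" using e \<phi> by (intro mult_left_mono) auto
      then have "e * \<phi> x \<le> r" using e(4) by (rule order_trans)
      moreover have "\<tau> * (e * \<phi> x) \<le> 1 * (e * \<phi> x)" using that e \<phi> by (intro mult_right_mono) auto
      ultimately show "\<tau> * (e * \<phi> x) \<le> r" by simp
    qed (use that e in simp)
    moreover have "(T x = x \<or> T x \<in> interior \<Omega>) \<and> (\<exists>L. reachable \<Omega> x (T x) L)" if x: "x \<in> \<Omega>" for x
    proof (cases "0 < \<phi> x")
      case True
      have "y \<in> \<Omega>" if y: "y \<in> closed_segment x (T x)" for y
      proof -
        obtain \<tau> where \<tau>: "0 \<le> \<tau>" "\<tau> \<le> 1" "y = (1 - \<tau>) *\<^sub>R x + \<tau> *\<^sub>R T x"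
          using y unfolding closed_segment_def by blast
        have "y = x - (\<tau> * (e * \<phi> x)) *\<^sub>R u" by (simp add: \<tau>(3) T_def algebra_simps)
        then show ?thesis
          using pos[OF x True, of \<tau>] \<tau> x interior_subset[of \<Omega>] by (cases "\<tau> = 0") auto
      qed
      then have "reachable \<Omega> x (T x) (dist x (T x))" by (intro reachable_segment) blast
      then show ?thesis using pos[OF x True, of 1] by (auto simp: T_def)
    next
      case False
      then have "T x = x" using \<phi>(1)[of x] by (simp add: T_def)
      then show ?thesis using reachable_refl[OF x] by auto
    qed
    moreover have "T x \<in> interior \<Omega>" if "x \<in> \<Omega> \<inter> ball p r" for x
      using pos[of x 1] that r by (simp add: T_def \<phi>_def dist_commute)
    ultimately show ?thesis unfolding push_map_def by (intro exI[of _ T]) simp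
  qed
  then show ?thesis using r by (intro exI[of _ r]) simp
qed

locale smooth_domain =
  fixes \<Omega> :: "'a::euclidean_space set"
  assumes compact_domain: "compact \<Omega>" and connected_domain: "connected \<Omega>" and smooth: "smooth_boundary \<Omega>"
begin

lemma closed_domain: "closed \<Omega>" by (rule compact_imp_closed[OF compact_domain])

text \<open>The local pushes are composed. A point that one of them has moved into the interior stays there, because
  each push either fixes a point of the domain or moves it into the interior.\<close>

lemma push_finite:
  assumes "finite F" and "\<And>p. p \<in> F \<Longrightarrow> 0 < r p \<and> (\<forall>\<eta>>0. \<exists>T. push_map \<Omega> \<eta> (ball p (r p)) T)"
    and "0 < \<eta>"
  shows "\<exists>T. push_map \<Omega> \<eta> (\<Union>p\<in>F. ball p (r p)) T"
  using assms
proof (induction F arbitrary: \<eta> rule: finite_induct)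
  case empty
  have "(1 + \<eta>)-lipschitz_on UNIV (\<lambda>x::'a. x)"
    using \<open>0 < \<eta>\<close> by (intro lipschitz_onI) (auto simp: mult_le_cancel_right1 algebra_simps)
  then show ?case unfolding push_map_def using \<open>0 < \<eta>\<close> reachable_refl by (intro exI[of _ "\<lambda>x. x"]) auto
next
  case (insert p F)
  \<comment> \<open>With \<open>\<kappa> \<le> 1\<close> the Lipschitz constants multiply to at most \<open>1 + 3 * \<kappa>\<close>, and the displacements add up.\<close>
  define \<kappa> where "\<kappa> = min (\<eta> / 3) 1"
  have \<kappa>: "0 < \<kappa>" "3 * \<kappa> \<le> \<eta>" "\<kappa> \<le> 1" using insert.prems(2) by (auto simp: \<kappa>_def)
  have "\<exists>T. push_map \<Omega> \<kappa> (\<Union>p\<in>F. ball p (r p)) T" by (rule insert.IH[OF insert.prems(1) \<kappa>(1)]) simp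
  then obtain T where push_T: "push_map \<Omega> \<kappa> (\<Union>p\<in>F. ball p (r p)) T" by blast
  note T = push_mapD[OF push_T]
  obtain S where push_S: "push_map \<Omega> \<kappa> (ball p (r p)) S" using insert.prems(1)[of p] \<kappa>(1) by auto
  note S = push_mapD[OF push_S]
  have I: "interior \<Omega> \<subseteq> \<Omega>" by (rule interior_subset)
  have T\<Omega>: "T x \<in> \<Omega>" if "x \<in> \<Omega>" for x using T(3) I that by (metis subsetD)
  have "((1 + \<kappa>) * (1 + \<kappa>))-lipschitz_on UNIV (\<lambda>x. S (T x))"
    by (rule lipschitz_on_compose2[OF T(1) lipschitz_on_subset[OF S(1)]]) simp
  moreover have "(1 + \<kappa>) * (1 + \<kappa>) \<le> 1 + \<eta>"
  proof -
    have "\<kappa> * \<kappa> \<le> \<kappa> * 1" using \<kappa> by (intro mult_left_mono) auto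
    moreover have "(1 + \<kappa>) * (1 + \<kappa>) = 1 + 2 * \<kappa> + \<kappa> * \<kappa>" by (simp add: algebra_simps)
    ultimately show ?thesis using \<kappa> by linarith
  qed
  ultimately have "(1 + \<eta>)-lipschitz_on UNIV (\<lambda>x. S (T x))" by (rule lipschitz_on_le)
  moreover have "dist (S (T x)) x \<le> \<eta>" for x
    using dist_triangle[of "S (T x)" x "T x"] S(2)[rule_format, of "T x"] T(2)[rule_format, of x] \<kappa> by linarith
  moreover have int: "S (T x) \<in> interior \<Omega>" if "x \<in> \<Omega>" "T x \<in> interior \<Omega>" for x
    using S(3)[rule_format, OF T\<Omega>[OF that(1)]] that by auto
  moreover have "S (T x) = x \<or> S (T x) \<in> interior \<Omega>" if "x \<in> \<Omega>" for x
    using int[OF that] S(3)[rule_format, OF that] T(3)[rule_format, OF that] by auto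
  moreover have "\<exists>L. reachable \<Omega> x (S (T x)) L" if x: "x \<in> \<Omega>" for x
  proof -
    obtain L where "reachable \<Omega> x (T x) L" using T(3) x by blast
    moreover obtain L' where "reachable \<Omega> (T x) (S (T x)) L'" using S(3) T\<Omega>[OF x] by blast
    ultimately show ?thesis using reachable_trans by blast
  qed
  moreover have "S (T x) \<in> interior \<Omega>" if "x \<in> \<Omega> \<inter> (\<Union>q\<in>insert p F. ball q (r q))" for x
  proof (cases "T x \<in> interior \<Omega>")
    case False
    then have "T x = x" using that T(3) by auto
    moreover have "x \<in> ball p (r p)" using False T(4)[rule_format, of x] that by auto
    ultimately show ?thesis using S(4) that by simp
  qed (use int that in simp)
  ultimately show ?case unfolding push_map_def by (intro exI[of _ "\<lambda>x. S (T x)"]) simp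
qed

lemma push_into_interior:
  assumes "0 < \<eta>"
  obtains T where "(1 + \<eta>)-lipschitz_on UNIV T" "\<And>x. dist (T x) x \<le> \<eta>" "\<And>x. x \<in> \<Omega> \<Longrightarrow> T x \<in> interior \<Omega>"
    "\<And>x. x \<in> \<Omega> \<Longrightarrow> \<exists>L. reachable \<Omega> x (T x) L"
proof -
  define P where "P p r \<longleftrightarrow> 0 < r \<and> (\<forall>\<eta>>0. \<exists>T. push_map \<Omega> \<eta> (ball p r) T)" for p r
  have "\<forall>p\<in>frontier \<Omega>. \<exists>r. P p r"
  proof
    fix p assume p: "p \<in> frontier \<Omega>"
    obtain U \<rho> g where D: "defining_function \<Omega> U \<rho> g" "p \<in> U"
      by (rule smooth_boundary_defining_function[OF smooth p])
    from push_near_boundary_point[OF D] show "\<exists>r. P p r" unfolding P_def .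
  qed
  from bchoice[OF this] obtain r where rP: "\<forall>p\<in>frontier \<Omega>. P p (r p)" by blast
  then have r: "0 < r p" if "p \<in> frontier \<Omega>" for p using that unfolding P_def by blast
  have cpt: "compact (frontier \<Omega>)" using compact_domain by (rule compact_frontier)
  have cov: "frontier \<Omega> \<subseteq> (\<Union>p\<in>frontier \<Omega>. ball p (r p))" using r by force
  obtain F where F: "F \<subseteq> frontier \<Omega>" "finite F" "frontier \<Omega> \<subseteq> (\<Union>p\<in>F. ball p (r p))"
    by (rule compactE_image[OF cpt _ cov]) (auto intro: that)
  have "\<exists>T. push_map \<Omega> \<eta> (\<Union>p\<in>F. ball p (r p)) T"
    by (rule push_finite[OF F(2) _ assms]) (use F(1) rP in \<open>unfold P_def, blast\<close>)
  then obtain T where push_T: "push_map \<Omega> \<eta> (\<Union>p\<in>F. ball p (r p)) T" by blast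
  note T = push_mapD[OF push_T]
  have "T x \<in> interior \<Omega>" if x: "x \<in> \<Omega>" for x
  proof (cases "x \<in> interior \<Omega>")
    case True then show ?thesis using T(3) x by force
  next
    case False
    then have "x \<in> frontier \<Omega>" using x closed_domain by (simp add: frontier_def)
    then show ?thesis using T(4) F(3) x by blast
  qed
  then show thesis using that[of T] T by simp
qed

lemma push_neighbourhood:
  assumes K: "K-lipschitz_on UNIV T" and T: "\<And>x. x \<in> \<Omega> \<Longrightarrow> T x \<in> interior \<Omega>"
  obtains \<delta> where "0 < \<delta>" "\<And>x z. x \<in> \<Omega> \<Longrightarrow> dist x z < \<delta> \<Longrightarrow> T z \<in> interior \<Omega>"
proof -
  have K0: "0 \<le> K" by (rule lipschitz_on_nonneg[OF K])
  have "compact (T ` \<Omega>)"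
    by (intro compact_continuous_image compact_domain continuous_on_subset[OF lipschitz_on_continuous_on[OF K]]) simp
  moreover have "T ` \<Omega> \<subseteq> interior \<Omega>" using T by blast
  ultimately obtain e where e: "0 < e" "(\<Union>y\<in>T ` \<Omega>. cball y e) \<subseteq> interior \<Omega>"
    using compact_subset_open_imp_cball_epsilon_subset[of "T ` \<Omega>" "interior \<Omega>"] by auto
  have "T z \<in> interior \<Omega>" if "x \<in> \<Omega>" "dist x z < e / (K + 1)" for x z
  proof -
    have "dist (T x) (T z) \<le> K * dist x z" using lipschitz_onD[OF K] by simp
    also have "\<dots> \<le> (K + 1) * dist x z" by (simp add: mult_right_mono)
    also have "\<dots> \<le> e" using that(2) K0 by (simp add: pos_less_divide_eq mult.commute)
    finally show ?thesis using e(2) that(1) by (auto simp: subset_iff)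
  qed
  moreover have "0 < e / (K + 1)" using e K0 by simp
  ultimately show thesis using that by blast
qed

text \<open>The push takes a neighbourhood of a point into a ball contained in the interior, so points close to each other
  can be joined through this ball. Connectedness does the rest.\<close>

lemma domain_reachable:
  assumes "x \<in> \<Omega>" "y \<in> \<Omega>"
  shows "\<exists>L. reachable \<Omega> x y L"
proof (rule connected_equivalence_relation[OF connected_domain, of x y "\<lambda>x y. \<exists>L. reachable \<Omega> x y L"])
  show "\<exists>L. reachable \<Omega> y x L" if "\<exists>L. reachable \<Omega> x y L" for x y using that reachable_sym by blast
  show "\<exists>L. reachable \<Omega> x z L" if "\<exists>L. reachable \<Omega> x y L" "\<exists>L. reachable \<Omega> y z L" for x y z
    using that reachable_trans by blast
  fix a assume a: "a \<in> \<Omega>"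
  obtain T where T: "(1 + 1)-lipschitz_on UNIV T" "\<And>x. x \<in> \<Omega> \<Longrightarrow> T x \<in> interior \<Omega>"
    "\<And>x. x \<in> \<Omega> \<Longrightarrow> \<exists>L. reachable \<Omega> x (T x) L"
    using push_into_interior[of 1] by (metis zero_less_one)
  obtain \<delta> where \<delta>: "0 < \<delta>" "\<And>x z. x \<in> \<Omega> \<Longrightarrow> dist x z < \<delta> \<Longrightarrow> T z \<in> interior \<Omega>"
    by (rule push_neighbourhood[OF T(1,2)]) auto
  have "\<exists>L. reachable \<Omega> a x L" if x: "x \<in> \<Omega> \<inter> ball a \<delta>" for x
  proof -
    have "closed_segment a x \<subseteq> ball a \<delta>" using x \<delta>(1) by (intro closed_segment_subset) auto
    then have "T ` closed_segment a x \<subseteq> \<Omega>" using \<delta>(2)[OF a] interior_subset by fastforce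
    from reachable_image[OF reachable_segment[OF order_refl] lipschitz_on_subset[OF T(1) subset_UNIV] this]
    have "\<exists>L. reachable \<Omega> (T a) (T x) L" by blast
    then show ?thesis using T(3)[OF a] T(3)[of x] x reachable_trans reachable_sym by (metis IntD1)
  qed
  then show "\<exists>U. openin (top_of_set \<Omega>) U \<and> a \<in> U \<and> (\<forall>x\<in>U. \<exists>L. reachable \<Omega> a x L)"
    using a \<delta>(1) by (intro exI[of _ "\<Omega> \<inter> ball a \<delta>"]) auto
qed (use assms in auto)

end

section \<open>Charts of the boundary\<close>

definition off_axis :: "'a::euclidean_space \<Rightarrow> 'a \<Rightarrow> 'a" where
  "off_axis e x = x - (x \<bullet> e) *\<^sub>R e"

lemma off_axis_inner: "e \<in> Basis \<Longrightarrow> off_axis e x \<bullet> e = 0"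
  by (simp add: off_axis_def inner_diff_left inner_Basis)

lemma off_axis_inner_other: "e \<in> Basis \<Longrightarrow> b \<in> Basis \<Longrightarrow> b \<noteq> e \<Longrightarrow> off_axis e x \<bullet> b = x \<bullet> b"
  by (simp add: off_axis_def inner_diff_left inner_Basis)

lemma off_axis_eq: "x \<bullet> e = 0 \<Longrightarrow> off_axis e x = x"
  by (simp add: off_axis_def)

lemma off_axis_add: "e \<in> Basis \<Longrightarrow> off_axis e (x + t *\<^sub>R e) = off_axis e x"
  by (simp add: off_axis_def inner_add_left inner_Basis algebra_simps)

lemma norm_off_axis_le: "e \<in> Basis \<Longrightarrow> norm (off_axis e x) \<le> norm x"
proof -
  assume e: "e \<in> Basis"
  have "off_axis e x \<bullet> off_axis e x = x \<bullet> x - (x \<bullet> e)\<^sup>2"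
    using e by (simp add: off_axis_def inner_diff_left inner_diff_right inner_Basis power2_eq_square inner_commute)
  then have "(norm (off_axis e x))\<^sup>2 \<le> (norm x)\<^sup>2" by (simp add: power2_norm_eq_inner)
  then show ?thesis by (rule power2_le_imp_le) simp
qed

lemma off_axis_diff: "off_axis e x - off_axis e y = off_axis e (x - y)"
  by (simp add: off_axis_def inner_diff_left algebra_simps)

lemma bounded_linear_off_axis: "bounded_linear (off_axis e)"
  unfolding off_axis_def by (intro bounded_linear_intros)

text \<open>The map that replaces the coordinate along \<open>e\<close> by the value of the defining function is a local
  diffeomorphism. It flattens the boundary, and on the boundary itself it is the projection along \<open>e\<close>. The chart
  \<open>\<gamma>\<close> inverts this projection. It is defined on a box of full dimension and ignores the coordinate along
  \<open>e\<close>, so that the surface measure can be compared with the Lebesgue measure of the same space.\<close>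

locale boundary_chart =
  fixes \<Omega> :: "'a::euclidean_space set" and U \<rho> g p e W q r \<gamma> K
  assumes def_fun: "defining_function \<Omega> U \<rho> g" and e: "e \<in> Basis" and r: "0 < r" and K: "0 \<le> K"
    and W: "open W" "p \<in> W" "W \<subseteq> U" and q: "q = off_axis e p"
    and \<gamma>_mem: "y \<in> box (q - r *\<^sub>R One) (q + r *\<^sub>R One) \<Longrightarrow> \<gamma> y \<in> W \<inter> frontier \<Omega> \<and> off_axis e (\<gamma> y) = off_axis e y"
    and \<gamma>_inv: "x \<in> W \<inter> frontier \<Omega> \<Longrightarrow> \<bar>t\<bar> < r \<Longrightarrow>
       off_axis e x + t *\<^sub>R e \<in> box (q - r *\<^sub>R One) (q + r *\<^sub>R One) \<and> \<gamma> (off_axis e x + t *\<^sub>R e) = x"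
    and \<gamma>_lip: "y \<in> box (q - r *\<^sub>R One) (q + r *\<^sub>R One) \<Longrightarrow> y' \<in> box (q - r *\<^sub>R One) (q + r *\<^sub>R One) \<Longrightarrow>
       dist (\<gamma> y) (\<gamma> y') \<le> K * dist (off_axis e y) (off_axis e y')"
    and \<gamma>_deriv: "y \<in> box (q - r *\<^sub>R One) (q + r *\<^sub>R One) \<Longrightarrow>
       (\<gamma> has_derivative (\<lambda>h. off_axis e h - ((g (\<gamma> y) \<bullet> off_axis e h) / (g (\<gamma> y) \<bullet> e)) *\<^sub>R e)) (at y)"
    and g_e: "x \<in> W \<Longrightarrow> g x \<bullet> e \<noteq> 0 \<and> norm (g x) \<le> K * \<bar>g x \<bullet> e\<bar>"

lemma boundary_chart_exists:
  fixes \<Omega> :: "'a::euclidean_space set"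
  assumes D: "defining_function \<Omega> U \<rho> g" and cl: "closed \<Omega>" and p: "p \<in> U" "p \<in> frontier \<Omega>"
  obtains e W q r \<gamma> K where "boundary_chart \<Omega> U \<rho> g p e W q r \<gamma> K"
proof -
  note DD = defining_functionD[OF D]
  have \<rho>p: "\<rho> p = 0" using defining_function_frontier[OF D p(1) cl] p(2) by simp
  obtain e where e: "e \<in> Basis" "g p \<bullet> e \<noteq> 0" using DD(3)[OF p(1)] euclidean_all_zero_iff by blast
  have ee: "e \<bullet> e = 1" using e(1) by (simp add: inner_Basis)
  define c where "c = \<bar>g p \<bullet> e\<bar> / 2"
  have c: "0 < c" using e by (simp add: c_def)
  define M where "M = norm (g p) + 1"
  have gc: "continuous_on U g" by (rule C1_gradD(2)[OF DD(2)])
  define U0 where "U0 = (U \<inter> (\<lambda>x. \<bar>g x \<bullet> e\<bar>) -` {c<..}) \<inter> (U \<inter> (\<lambda>x. norm (g x)) -` {..<M})"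
  have U0: "open U0" "p \<in> U0" "U0 \<subseteq> U"
  proof -
    show "open U0" unfolding U0_def
      by (intro open_Int continuous_open_preimage[OF _ DD(1)] continuous_intros gc open_greaterThan open_lessThan)
    show "p \<in> U0" using e p by (simp add: U0_def c_def M_def)
  qed (auto simp: U0_def)
  have gU0: "c < \<bar>g x \<bullet> e\<bar>" "norm (g x) < M" if "x \<in> U0" for x using that by (auto simp: U0_def)
  define K where "K = 1 + M / c"
  have M0: "0 \<le> M" by (simp add: M_def)
  have K1: "1 \<le> K" using c M0 by (simp add: K_def)
  \<comment> \<open>Replaces the coordinate along \<open>e\<close> by \<open>\<rho>\<close>; \<open>inv_at\<close> is the inverse of its derivative.\<close>
  define \<Phi> where "\<Phi> x = x + (\<rho> x - x \<bullet> e) *\<^sub>R e" for x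
  define f' where "f' x = id_blinfun + (blinfun_scaleR_left e o\<^sub>L (blinfun_inner_right (g x) - blinfun_inner_right e))" for x
  have f'_apply: "blinfun_apply (f' x) h = h + (g x \<bullet> h - h \<bullet> e) *\<^sub>R e" for x h
    by (simp add: f'_def blinfun.add_left blinfun.diff_left inner_commute)
  define inv_at where "inv_at x k = k + ((k \<bullet> e - g x \<bullet> k) / (g x \<bullet> e)) *\<^sub>R e" for x k
  have inv_at: "inv_at x (blinfun_apply (f' x) h) = h" "blinfun_apply (f' x) (inv_at x h) = h" if "x \<in> U0" for x h
  proof -
    have ne: "g x \<bullet> e \<noteq> 0" using gU0(1)[OF that] c by auto
    have cancel: "h + a *\<^sub>R e + (- a) *\<^sub>R e = h" for a by simp
    have "inv_at x (blinfun_apply (f' x) h) = h + (g x \<bullet> h - h \<bullet> e) *\<^sub>R e + ((g x \<bullet> h - (g x \<bullet> h + (g x \<bullet> h - h \<bullet> e) * (g x \<bullet> e))) / (g x \<bullet> e)) *\<^sub>R e"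
      unfolding inv_at_def f'_apply by (simp add: inner_add_left inner_add_right ee)
    also have "(g x \<bullet> h - (g x \<bullet> h + (g x \<bullet> h - h \<bullet> e) * (g x \<bullet> e))) / (g x \<bullet> e) = - (g x \<bullet> h - h \<bullet> e)"
      using ne by simp
    also have "h + (g x \<bullet> h - h \<bullet> e) *\<^sub>R e + (- (g x \<bullet> h - h \<bullet> e)) *\<^sub>R e = h" by (rule cancel)
    finally show "inv_at x (blinfun_apply (f' x) h) = h" .
    define s where "s = (h \<bullet> e - g x \<bullet> h) / (g x \<bullet> e)"
    have "s * (g x \<bullet> e) = h \<bullet> e - g x \<bullet> h" using ne by (simp add: s_def)
    moreover have "blinfun_apply (f' x) (inv_at x h) = h + (s + (g x \<bullet> h + s * (g x \<bullet> e) - (h \<bullet> e + s))) *\<^sub>R e"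
      unfolding inv_at_def f'_apply s_def[symmetric] by (simp add: inner_add_left inner_add_right ee algebra_simps)
    ultimately show "blinfun_apply (f' x) (inv_at x h) = h" by simp
  qed
  have der: "(\<Phi> has_derivative blinfun_apply (f' x)) (at x)" if "x \<in> U0" for x
  proof -
    have "(\<Phi> has_derivative (\<lambda>h. h + (g x \<bullet> h - h \<bullet> e) *\<^sub>R e)) (at x)"
      unfolding \<Phi>_def using that U0(3)
      by (auto intro!: derivative_eq_intros C1_gradD(1)[OF DD(2)])
    moreover have "blinfun_apply (f' x) = (\<lambda>h. h + (g x \<bullet> h - h \<bullet> e) *\<^sub>R e)" using f'_apply by auto
    ultimately show ?thesis by simp
  qed
  have f'c: "continuous_on U0 f'"
    unfolding f'_def by (intro continuous_intros bounded_linear.continuous_on[OF bounded_linear_blinfun_inner_right] continuous_on_subset[OF gc U0(3)])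
  define invf where "invf = id_blinfun + (blinfun_scaleR_left e o\<^sub>L ((1 / (g p \<bullet> e)) *\<^sub>R (blinfun_inner_right e - blinfun_inner_right (g p))))"
  have "blinfun_apply invf k = inv_at p k" for k
    by (simp add: invf_def inv_at_def blinfun.add_left blinfun.diff_left blinfun.scaleR_left inner_commute)
  then have invf: "invf o\<^sub>L f' p = id_blinfun"
    using inv_at(1)[OF U0(2)] by (intro blinfun_eqI) simp
  obtain U' V G G' where IFT: "open U'" "U' \<subseteq> U0" "p \<in> U'" "open V" "\<Phi> p \<in> V" "homeomorphism U' V \<Phi> G"
    "\<And>y. y \<in> V \<Longrightarrow> (G has_derivative (G' y)) (at y)"
    "\<And>y. y \<in> V \<Longrightarrow> G' y = inv (blinfun_apply (f' (G y)))"
    "\<And>y. y \<in> V \<Longrightarrow> bij (blinfun_apply (f' (G y)))"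
    by (rule inverse_function_theorem[OF U0(1) der f'c U0(2) invf]) (assumption | rule that)+
  have GV: "G y \<in> U'" "\<Phi> (G y) = y" if "y \<in> V" for y using IFT(6) that unfolding homeomorphism_def by blast+
  have \<Phi>U: "\<Phi> x \<in> V" "G (\<Phi> x) = x" if "x \<in> U'" for x using IFT(6) that unfolding homeomorphism_def by blast+
  have G': "G' y = inv_at (G y)" if "y \<in> V" for y
  proof
    fix k
    have U0G: "G y \<in> U0" using GV(1)[OF that] IFT(2) by blast
    show "G' y k = inv_at (G y) k"
      unfolding IFT(8)[OF that] using inv_at(2)[OF U0G] bij_is_inj[OF IFT(9)[OF that]] by (intro inv_f_eq)
  qed
  define q where "q = off_axis e p"
  have \<Phi>p: "\<Phi> p = q" using \<rho>p by (simp add: \<Phi>_def q_def off_axis_def)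
  obtain d where d: "0 < d" "ball q d \<subseteq> V" using IFT(4,5) \<Phi>p by (metis open_contains_ball)
  define r where "r = d / real DIM('a)"
  have r: "0 < r" using d by (simp add: r_def)
  define Q where "Q = box (q - r *\<^sub>R One) (q + r *\<^sub>R One)"
  have memQ: "y \<in> Q \<longleftrightarrow> (\<forall>b\<in>Basis. \<bar>(y - q) \<bullet> b\<bar> < r)" for y
    unfolding Q_def mem_box by (intro ball_cong refl) (auto simp: inner_diff_left inner_add_left abs_less_iff)
  have QV: "Q \<subseteq> V"
  proof
    fix y assume y: "y \<in> Q"
    have "norm (y - q) \<le> (\<Sum>b\<in>Basis. \<bar>(y - q) \<bullet> b\<bar>)" by (rule norm_le_l1)
    also have "\<dots> < (\<Sum>b\<in>(Basis::'a set). r)" using y unfolding memQ by (intro sum_strict_mono) auto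
    also have "\<dots> = d" by (simp add: r_def)
    finally have "y \<in> ball q d" by (simp add: dist_norm norm_minus_commute)
    then show "y \<in> V" using d by blast
  qed
  have qe: "q \<bullet> e = 0" using e by (simp add: q_def off_axis_inner)
  have shift: "off_axis e y + t *\<^sub>R e \<in> Q" if y: "y \<in> Q" and t: "\<bar>t\<bar> < r" for y t
    unfolding memQ
  proof
    fix b :: 'a assume b: "b \<in> Basis"
    show "\<bar>(off_axis e y + t *\<^sub>R e - q) \<bullet> b\<bar> < r"
    proof (cases "b = e")
      case True
      then show ?thesis using t qe e by (simp add: inner_diff_left inner_add_left off_axis_inner inner_Basis)
    next
      case False
      then have "(off_axis e y + t *\<^sub>R e - q) \<bullet> b = (y - q) \<bullet> b"
        using e b by (simp add: inner_diff_left inner_add_left off_axis_inner_other inner_Basis)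
      then show ?thesis using y b unfolding memQ by simp
    qed
  qed
  have offQ: "off_axis e y \<in> Q" if "y \<in> Q" for y using shift[OF that, of 0] r by simp
  define \<gamma> where "\<gamma> y = G (off_axis e y)" for y
  define W where "W = U' \<inter> \<Phi> -` Q"
  have \<Phi>c: "continuous_on U' \<Phi>" using IFT(6) unfolding homeomorphism_def by blast
  have Wo: "open W" unfolding W_def by (rule continuous_open_preimage[OF \<Phi>c IFT(1)]) (simp add: Q_def open_box)
  have pW: "p \<in> W" using IFT(3) r by (simp add: W_def \<Phi>p memQ)
  have WU: "W \<subseteq> U" "W \<subseteq> U0" using IFT(2) U0(3) by (auto simp: W_def)
  have \<Phi>e: "\<Phi> x \<bullet> e = \<rho> x" "off_axis e (\<Phi> x) = off_axis e x" for x
    using e ee by (simp_all add: \<Phi>_def inner_add_left off_axis_add)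
  have \<gamma>m: "\<gamma> y \<in> W \<inter> frontier \<Omega> \<and> off_axis e (\<gamma> y) = off_axis e y" if y: "y \<in> Q" for y
  proof -
    have o: "off_axis e y \<in> Q" "off_axis e y \<in> V" using offQ[OF y] QV by auto
    have \<Phi>\<gamma>: "\<Phi> (\<gamma> y) = off_axis e y" using GV(2)[OF o(2)] by (simp add: \<gamma>_def)
    then have "\<gamma> y \<in> W" using GV(1)[OF o(2)] o(1) by (simp add: W_def \<gamma>_def)
    moreover have "\<rho> (\<gamma> y) = 0" using \<Phi>e(1)[of "\<gamma> y"] \<Phi>\<gamma> off_axis_inner[OF e(1)] by simp
    moreover have "off_axis e (\<gamma> y) = off_axis e y"
      using \<Phi>e(2)[of "\<gamma> y"] \<Phi>\<gamma> off_axis_eq[OF off_axis_inner[OF e(1)]] by metis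
    ultimately show ?thesis using defining_function_frontier[OF D _ cl] WU by blast
  qed
  have \<gamma>i: "off_axis e x + t *\<^sub>R e \<in> Q \<and> \<gamma> (off_axis e x + t *\<^sub>R e) = x" if x: "x \<in> W \<inter> frontier \<Omega>" and t: "\<bar>t\<bar> < r" for x t
  proof -
    have "\<rho> x = 0" using defining_function_frontier[OF D _ cl] WU x by blast
    then have \<Phi>x: "\<Phi> x = off_axis e x" by (simp add: \<Phi>_def off_axis_def)
    have "off_axis e x \<in> Q" using x \<Phi>x by (simp add: W_def)
    then have "off_axis e (off_axis e x) + t *\<^sub>R e \<in> Q" by (rule shift[OF _ t])
    moreover have "\<gamma> (off_axis e x + t *\<^sub>R e) = G (\<Phi> x)"
      using e by (simp add: \<gamma>_def off_axis_add off_axis_eq off_axis_inner \<Phi>x)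
    moreover have "G (\<Phi> x) = x" using x \<Phi>U(2) by (simp add: W_def)
    ultimately show ?thesis using e by (simp add: off_axis_eq off_axis_inner)
  qed
  have der\<gamma>: "(\<gamma> has_derivative (\<lambda>h. off_axis e h - ((g (\<gamma> y) \<bullet> off_axis e h) / (g (\<gamma> y) \<bullet> e)) *\<^sub>R e)) (at y)" if y: "y \<in> Q" for y
  proof -
    have o: "off_axis e y \<in> V" using offQ[OF y] QV by auto
    have "(off_axis e has_derivative off_axis e) (at y)"
      by (rule bounded_linear_imp_has_derivative[OF bounded_linear_off_axis])
    from has_derivative_compose[OF this IFT(7)[OF o]]
    have "(\<gamma> has_derivative (\<lambda>h. G' (off_axis e y) (off_axis e h))) (at y)" unfolding \<gamma>_def .
    then show ?thesis
      by (rule has_derivative_eq_rhs)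
         (simp add: fun_eq_iff G'[OF o] inv_at_def off_axis_inner[OF e(1)] \<gamma>_def)
  qed
  have ge: "g x \<bullet> e \<noteq> 0 \<and> norm (g x) \<le> K * \<bar>g x \<bullet> e\<bar>" if "x \<in> W" for x
  proof -
    have x: "x \<in> U0" using that WU by blast
    have "norm (g x) \<le> M" using gU0(2)[OF x] by simp
    also have "M = (M / c) * c" using c by simp
    also have "\<dots> \<le> K * \<bar>g x \<bullet> e\<bar>"
      using gU0(1)[OF x] c M0 by (intro mult_mono) (auto simp: K_def)
    finally show ?thesis using gU0(1)[OF x] c by auto
  qed
  have lip: "dist (\<gamma> y) (\<gamma> y') \<le> (1 + K) * dist (off_axis e y) (off_axis e y')" if y: "y \<in> Q" "y' \<in> Q" for y y'
  proof -
    have "norm (\<gamma> (off_axis e y) - \<gamma> (off_axis e y')) \<le> (1 + K) * norm (off_axis e y - off_axis e y')"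
    proof (rule differentiable_bound[of Q])
      show "convex Q" by (simp add: Q_def convex_box)
      fix z assume z: "z \<in> Q"
      show "(\<gamma> has_derivative (\<lambda>h. off_axis e h - ((g (\<gamma> z) \<bullet> off_axis e h) / (g (\<gamma> z) \<bullet> e)) *\<^sub>R e)) (at z within Q)"
        by (rule has_derivative_at_withinI[OF der\<gamma>[OF z]])
      show "onorm (\<lambda>h. off_axis e h - ((g (\<gamma> z) \<bullet> off_axis e h) / (g (\<gamma> z) \<bullet> e)) *\<^sub>R e) \<le> 1 + K"
      proof (rule onorm_le)
        fix h
        have gz: "g (\<gamma> z) \<bullet> e \<noteq> 0" "norm (g (\<gamma> z)) \<le> K * \<bar>g (\<gamma> z) \<bullet> e\<bar>" using ge \<gamma>m[OF z] by auto
        have "\<bar>g (\<gamma> z) \<bullet> off_axis e h\<bar> \<le> norm (g (\<gamma> z)) * norm (off_axis e h)" by (rule Cauchy_Schwarz_ineq2)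
        also have "\<dots> \<le> (K * \<bar>g (\<gamma> z) \<bullet> e\<bar>) * norm h"
          by (rule mult_mono[OF gz(2) norm_off_axis_le[OF e(1)]]) (use K1 in auto)
        finally have "\<bar>(g (\<gamma> z) \<bullet> off_axis e h) / (g (\<gamma> z) \<bullet> e)\<bar> \<le> K * norm h"
          using gz(1) by (simp add: abs_divide pos_divide_le_eq mult.commute mult.left_commute)
        then have "norm (((g (\<gamma> z) \<bullet> off_axis e h) / (g (\<gamma> z) \<bullet> e)) *\<^sub>R e) \<le> K * norm h" using e by simp
        then show "norm (off_axis e h - ((g (\<gamma> z) \<bullet> off_axis e h) / (g (\<gamma> z) \<bullet> e)) *\<^sub>R e) \<le> (1 + K) * norm h"
          using norm_off_axis_le[OF e(1), of h] norm_triangle_ineq4[of "off_axis e h" "((g (\<gamma> z) \<bullet> off_axis e h) / (g (\<gamma> z) \<bullet> e)) *\<^sub>R e"]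
          by (simp add: distrib_right)
      qed
    qed (use offQ y in auto)
    moreover have "\<gamma> (off_axis e z) = \<gamma> z" for z using e by (simp add: \<gamma>_def off_axis_eq off_axis_inner)
    ultimately show ?thesis by (simp add: dist_norm)
  qed
  have ge': "g x \<bullet> e \<noteq> 0 \<and> norm (g x) \<le> (1 + K) * \<bar>g x \<bullet> e\<bar>" if "x \<in> W" for x
    using ge[OF that] by (simp add: distrib_right add_increasing)
  have "boundary_chart \<Omega> U \<rho> g p e W q r \<gamma> (1 + K)"
    by unfold_locales
       (rule D e(1) r Wo pW WU(1) q_def \<gamma>m[unfolded Q_def] \<gamma>i[unfolded Q_def] lip[unfolded Q_def]
          der\<gamma>[unfolded Q_def] ge' | assumption | use K1 in simp)+
  then show thesis by (rule that)
qed

context boundary_chart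
begin

abbreviation "Q \<equiv> box (q - r *\<^sub>R One) (q + r *\<^sub>R One)"

lemma center_mem: "q \<in> Q"
  using r by (simp add: mem_box inner_diff_left inner_add_left)

lemma \<gamma>_continuous: "continuous_on Q \<gamma>"
  by (rule has_derivative_continuous_on[OF has_derivative_at_withinI[OF \<gamma>_deriv]])

end

section \<open>Tangent spaces and tangential gradients\<close>

text \<open>The defining function is constant along curves in the boundary. Conversely, the chart turns a segment into a
  curve in the boundary with a prescribed tangent velocity.\<close>

lemma tangent_space_frontier:
  fixes \<Omega> :: "'a::euclidean_space set"
  assumes D: "defining_function \<Omega> U \<rho> g" and cl: "closed \<Omega>" and x: "x \<in> U" "x \<in> frontier \<Omega>"
  shows "tangent_space (frontier \<Omega>) x = {v. g x \<bullet> v = 0}"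
proof (intro equalityI subsetI)
  note DD = defining_functionD[OF D]
  fix v assume "v \<in> tangent_space (frontier \<Omega>) x"
  then obtain \<gamma> \<epsilon> where \<gamma>: "0 < \<epsilon>" "\<gamma> 0 = x" "\<And>t::real. \<bar>t\<bar> < \<epsilon> \<Longrightarrow> \<gamma> t \<in> frontier \<Omega>"
    "(\<gamma> has_vector_derivative v) (at 0)" unfolding tangent_space_def by blast
  have "((\<lambda>t. \<rho> (\<gamma> t)) has_derivative (\<lambda>h. g x \<bullet> (h *\<^sub>R v))) (at 0)"
    using has_derivative_compose[OF \<gamma>(4)[unfolded has_vector_derivative_def], of \<rho> "\<lambda>h. g x \<bullet> h"] C1_gradD(1)[OF DD(2) x(1)] \<gamma>(2) by simp
  moreover have "((\<lambda>t. \<rho> (\<gamma> t)) has_derivative (\<lambda>h. 0)) (at 0)"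
  proof (rule has_derivative_transform_eventually)
    show "((\<lambda>t. 0) has_derivative (\<lambda>h. 0)) (at (0::real))" by simp
    have "continuous (at 0) \<gamma>" using \<gamma>(4) has_vector_derivative_continuous by blast
    then have "\<gamma> \<midarrow>0\<rightarrow> x" using \<gamma>(2) by (simp add: continuous_at)
    then have "\<forall>\<^sub>F t in at 0. \<gamma> t \<in> U" using DD(1) x(1) topological_tendstoD by blast
    moreover have "\<forall>\<^sub>F t in at (0::real). \<bar>t\<bar> < \<epsilon>"
      using \<gamma>(1) by (auto simp: eventually_at dist_real_def)
    ultimately show "\<forall>\<^sub>F t in at 0. 0 = \<rho> (\<gamma> t)"
      by eventually_elim (use \<gamma>(3) defining_function_frontier[OF D _ cl] in metis)
    show "0 = \<rho> (\<gamma> 0)" using \<gamma>(2) defining_function_frontier[OF D x(1) cl] x(2) by simp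
  qed simp
  ultimately have "(\<lambda>h. g x \<bullet> (h *\<^sub>R v)) = (\<lambda>h. 0)" by (rule has_derivative_unique)
  from fun_cong[OF this, of 1] show "v \<in> {v. g x \<bullet> v = 0}" by simp
next
  fix v assume v: "v \<in> {v. g x \<bullet> v = 0}"
  obtain e W q r \<gamma> K where "boundary_chart \<Omega> U \<rho> g x e W q r \<gamma> K"
    by (rule boundary_chart_exists[OF D cl x])
  then interpret boundary_chart \<Omega> U \<rho> g x e W q r \<gamma> K .
  have \<gamma>q: "\<gamma> q = x" using \<gamma>_inv[of x 0] W(2) x(2) r by (simp add: q)
  have "((\<lambda>t. q + t *\<^sub>R v) has_derivative (\<lambda>t. t *\<^sub>R v)) (at 0)" by (auto intro!: derivative_eq_intros)
  from has_derivative_compose[OF this, of \<gamma>] \<gamma>_deriv[OF center_mem]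
  have der: "((\<lambda>t. \<gamma> (q + t *\<^sub>R v)) has_derivative
      (\<lambda>t. off_axis e (t *\<^sub>R v) - ((g x \<bullet> off_axis e (t *\<^sub>R v)) / (g x \<bullet> e)) *\<^sub>R e)) (at 0)"
    by (simp add: \<gamma>q)
  have "off_axis e (t *\<^sub>R v) - ((g x \<bullet> off_axis e (t *\<^sub>R v)) / (g x \<bullet> e)) *\<^sub>R e = t *\<^sub>R v" for t
  proof -
    have "g x \<bullet> off_axis e (t *\<^sub>R v) = - (t * (v \<bullet> e)) * (g x \<bullet> e)"
      using v by (simp add: off_axis_def inner_diff_right)
    then show ?thesis using g_e[OF W(2)] by (simp add: off_axis_def)
  qed
  with der have vd: "((\<lambda>t. \<gamma> (q + t *\<^sub>R v)) has_vector_derivative v) (at 0)"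
    unfolding has_vector_derivative_def by simp
  have "\<forall>\<^sub>F t in at 0. q + t *\<^sub>R v \<in> Q"
  proof (rule topological_tendstoD[OF _ open_box])
    show "((\<lambda>t. q + t *\<^sub>R v) \<longlongrightarrow> q) (at 0)" by (auto intro!: tendsto_eq_intros)
  qed (rule center_mem)
  then obtain \<epsilon> where \<epsilon>: "0 < \<epsilon>" "\<And>t. t \<noteq> 0 \<Longrightarrow> \<bar>t\<bar> < \<epsilon> \<Longrightarrow> q + t *\<^sub>R v \<in> Q"
    unfolding eventually_at by (auto simp: dist_real_def)
  have "\<gamma> (q + t *\<^sub>R v) \<in> frontier \<Omega>" if "\<bar>t\<bar> < \<epsilon>" for t
    using \<epsilon>(2)[OF _ that] \<gamma>_mem center_mem by (cases "t = 0") auto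
  then show "v \<in> tangent_space (frontier \<Omega>) x"
    unfolding tangent_space_def using \<epsilon>(1) vd \<gamma>q
    by (intro CollectI exI[of _ "\<lambda>t. \<gamma> (q + t *\<^sub>R v)"] exI[of _ \<epsilon>]) simp
qed

text \<open>The candidate is tangent and represents the derivative on tangent vectors. Any other candidate differs from it
  by a tangent vector that is orthogonal to all tangent vectors.\<close>

lemma tangential_gradient_frontier:
  fixes \<Omega> :: "'a::euclidean_space set"
  assumes D: "defining_function \<Omega> U \<rho> g" and cl: "closed \<Omega>" and x: "x \<in> U" "x \<in> frontier \<Omega>"
    and F: "(F has_derivative (\<lambda>h. f \<bullet> h)) (at x)" and eq: "\<And>y. y \<in> frontier \<Omega> \<Longrightarrow> F' y = F y"
  shows "tangential_gradient (frontier \<Omega>) F' x = f - ((f \<bullet> g x) / (g x \<bullet> g x)) *\<^sub>R g x"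
proof -
  note DD = defining_functionD[OF D]
  let ?M = "frontier \<Omega>"
  define c where "c = (f \<bullet> g x) / (g x \<bullet> g x)"
  have gg: "g x \<bullet> g x \<noteq> 0" using DD(3)[OF x(1)] by simp
  have T: "tangent_space ?M x = {v. g x \<bullet> v = 0}" by (rule tangent_space_frontier[OF D cl x])
  let ?v = "f - c *\<^sub>R g x"
  have vT: "?v \<in> tangent_space ?M x" using gg by (simp add: T inner_diff_right c_def inner_commute)
  have "((\<lambda>y. F y - c * \<rho> y) has_derivative (\<lambda>h. ?v \<bullet> h)) (at x)"
    by (auto intro!: derivative_eq_intros F C1_gradD(1)[OF DD(2) x(1)] simp: inner_diff_left)
  then have d0: "((\<lambda>y. F y - c * \<rho> y) has_derivative (\<lambda>h. ?v \<bullet> h)) (at x within ?M)"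
    by (rule has_derivative_at_withinI)
  have d: "(F' has_derivative (\<lambda>h. ?v \<bullet> h)) (at x within ?M)"
  proof -
    obtain s where s: "0 < s" "ball x s \<subseteq> U" using DD(1) x(1) by (metis open_contains_ball)
    show ?thesis
    proof (rule has_derivative_transform_within[OF d0])
    show "0 < s" by (rule s)
    show "F y - c * \<rho> y = F' y" if "y \<in> ?M" "dist y x < s" for y
      using that s defining_function_frontier[OF D _ cl, of y] eq[of y] by (auto simp: dist_commute)
    qed (rule x(2))
  qed
  have uniq: "w = ?v" if w: "w \<in> tangent_space ?M x \<and> (F' has_derivative (\<lambda>h. w \<bullet> h)) (at x within ?M)" for w
  proof -
    have "((\<lambda>y. F' y - F' y) has_derivative (\<lambda>h. w \<bullet> h - ?v \<bullet> h)) (at x within ?M)"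
      using w d by (intro has_derivative_diff) auto
    then have z: "((\<lambda>y. 0::real) has_derivative (\<lambda>h. (w - ?v) \<bullet> h)) (at x within ?M)" by (simp add: inner_diff_left)
    have "w - ?v \<in> tangent_space ?M x" using w vT unfolding T by (simp add: inner_diff_right)
    then obtain \<gamma> \<epsilon> where \<gamma>: "0 < \<epsilon>" "\<gamma> 0 = x" "\<And>t::real. \<bar>t\<bar> < \<epsilon> \<Longrightarrow> \<gamma> t \<in> ?M"
      "(\<gamma> has_vector_derivative (w - ?v)) (at 0)" unfolding tangent_space_def by blast
    have g0: "(\<gamma> has_derivative (\<lambda>h. h *\<^sub>R (w - ?v))) (at 0 within {-\<epsilon><..<\<epsilon>})"
      using \<gamma>(4) unfolding has_vector_derivative_def by (rule has_derivative_at_withinI)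
    have "\<gamma> ` {-\<epsilon><..<\<epsilon>} \<subseteq> ?M" using \<gamma>(3) by (auto simp: abs_less_iff)
    then have "((\<lambda>y. 0::real) has_derivative (\<lambda>h. (w - ?v) \<bullet> h)) (at (\<gamma> 0) within \<gamma> ` {-\<epsilon><..<\<epsilon>})"
      using has_derivative_subset[OF z] \<gamma>(2) by simp
    from has_derivative_in_compose[OF g0 this]
    have "((\<lambda>t. 0::real) has_derivative (\<lambda>h. (w - ?v) \<bullet> (h *\<^sub>R (w - ?v)))) (at 0 within {-\<epsilon><..<\<epsilon>})" by simp
    then have "((\<lambda>t. 0::real) has_derivative (\<lambda>h. (w - ?v) \<bullet> (h *\<^sub>R (w - ?v)))) (at 0)"
      using \<gamma>(1) by (simp add: at_within_open[of 0 "{-\<epsilon><..<\<epsilon>}"])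
    moreover have "((\<lambda>t. 0::real) has_derivative (\<lambda>h. 0)) (at (0::real))" by simp
    ultimately have "(\<lambda>h. (w - ?v) \<bullet> (h *\<^sub>R (w - ?v))) = (\<lambda>h. 0)" by (rule has_derivative_unique)
    from fun_cong[OF this, of 1] show ?thesis by simp
  qed
  show ?thesis
    unfolding tangential_gradient_def c_def[symmetric]
    by (rule the_equality, rule conjI[OF vT d], rule uniq)
qed

section \<open>Surface measure in a chart\<close>

lemma powr_real_DIM: "0 \<le> x \<Longrightarrow> 2 \<le> DIM('a::euclidean_space) \<Longrightarrow> x powr (real DIM('a) - 1) = x ^ (DIM('a) - 1)"
  by (cases "x = 0") (simp_all add: powr_realpow[symmetric] of_nat_diff)

lemma emeasure_lborel_Collect_le_cboxes:
  fixes l u :: "nat \<Rightarrow> 'a::euclidean_space"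
  assumes "S \<subseteq> (\<Union>i. cbox (l i) (u i))"
  shows "emeasure lborel S \<le> (\<Sum>i. emeasure lborel (cbox (l i) (u i)))"
  by (rule order_trans[OF emeasure_mono[OF assms] emeasure_subadditive_countably]) auto

context boundary_chart
begin

lemma \<gamma>_preimage_borel: "A \<in> sets borel \<Longrightarrow> {y \<in> Q. \<gamma> y \<in> A} \<in> sets borel"
proof -
  assume A: "A \<in> sets borel"
  have "\<gamma> \<in> borel_measurable (restrict_space borel Q)"
    by (rule borel_measurable_continuous_on_restrict[OF \<gamma>_continuous])
  from measurable_sets[OF this A] have "\<gamma> -` A \<inter> Q \<in> sets (restrict_space borel Q)"
    by (simp add: space_restrict_space)
  moreover have "\<gamma> -` A \<inter> Q = {y \<in> Q. \<gamma> y \<in> A}" by auto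
  ultimately show ?thesis by (auto simp: sets_restrict_space)
qed

text \<open>A set of diameter \<open>d\<close> on the boundary is the image of a subset of a box with one side \<open>2 r\<close> and
  the other sides \<open>2 d\<close>.\<close>

lemma lebesgue_le_surface:
  assumes dim: "2 \<le> DIM('a)" and A: "A \<in> sets borel"
  shows "emeasure lborel {y \<in> Q. \<gamma> y \<in> A}
    \<le> ennreal (2 * r * 4 powr (real DIM('a) - 1) / unit_ball_vol (real DIM('a) - 1)) * hausdorff_outer (real DIM('a) - 1) A"
proof -
  let ?s = "real DIM('a) - 1" and ?S = "{y \<in> Q. \<gamma> y \<in> A}"
  define c where "c = 2 * r * 4 powr ?s / unit_ball_vol ?s"
  have s: "0 < ?s" using dim by simp
  have ub: "0 < unit_ball_vol ?s" using s by (intro unit_ball_vol_pos) simp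
  have c: "0 < c" using r ub by (simp add: c_def)
  have "ennreal (1 / c) * emeasure lborel ?S \<le> hausdorff_content ?s 1 A"
    unfolding hausdorff_content_def
  proof (rule INF_greatest, clarsimp)
    fix C :: "nat \<Rightarrow> 'a set" assume C: "A \<subseteq> (\<Union>i. C i)" "\<forall>i. bounded (C i) \<and> diameter (C i) \<le> 1"
    define y0 where "y0 i = (SOME y. y \<in> Q \<and> \<gamma> y \<in> C i)" for i
    define l where "l i = (\<Sum>b\<in>Basis. (if b = e then - r else y0 i \<bullet> b - diameter (C i)) *\<^sub>R b)" for i
    define u where "u i = (\<Sum>b\<in>Basis. (if b = e then r else y0 i \<bullet> b + diameter (C i)) *\<^sub>R b)" for i
    have lu: "l i \<bullet> b = (if b = e then - r else y0 i \<bullet> b - diameter (C i))"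
      "u i \<bullet> b = (if b = e then r else y0 i \<bullet> b + diameter (C i))" if "b \<in> Basis" for i b
      using that by (simp_all add: l_def u_def)
    have dnn: "0 \<le> diameter (C i)" for i using C(2) diameter_ge_0 by blast
    have "?S \<subseteq> (\<Union>i. cbox (l i) (u i))"
    proof
      fix y assume y: "y \<in> ?S"
      then obtain i where i: "\<gamma> y \<in> C i" using C(1) by blast
      have y0: "y0 i \<in> Q \<and> \<gamma> (y0 i) \<in> C i"
        unfolding y0_def by (rule someI[of "\<lambda>y. y \<in> Q \<and> \<gamma> y \<in> C i" y]) (use y i in simp)
      have "norm (off_axis e (y - y0 i)) = norm (off_axis e (\<gamma> y - \<gamma> (y0 i)))"
        using \<gamma>_mem[of y] \<gamma>_mem[of "y0 i"] y y0 by (simp add: off_axis_diff[symmetric])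
      also have "\<dots> \<le> norm (\<gamma> y - \<gamma> (y0 i))" by (rule norm_off_axis_le[OF e])
      also have "\<dots> \<le> diameter (C i)"
        using diameter_bounded_bound[of "C i" "\<gamma> y" "\<gamma> (y0 i)"] C(2) i y0 by (simp add: dist_norm)
      finally have d: "norm (off_axis e (y - y0 i)) \<le> diameter (C i)" .
      have "y \<in> cbox (l i) (u i)"
        unfolding mem_box
      proof
        fix b :: 'a assume b: "b \<in> Basis"
        show "l i \<bullet> b \<le> y \<bullet> b \<and> y \<bullet> b \<le> u i \<bullet> b"
        proof (cases "b = e")
          case True
          have "\<bar>y \<bullet> e\<bar> < r"
            using y e off_axis_inner[OF e, of p] by (auto simp: mem_box q inner_diff_left inner_add_left abs_less_iff)
          then show ?thesis using True b lu[OF b, of i] by auto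
        next
          case False
          have "\<bar>(y - y0 i) \<bullet> b\<bar> \<le> diameter (C i)"
            using Basis_le_norm[OF b, of "off_axis e (y - y0 i)"] d off_axis_inner_other[OF e b False] by simp
          then show ?thesis using False lu[OF b, of i] by (auto simp: inner_diff_left abs_le_iff)
        qed
      qed
      then show "y \<in> (\<Union>i. cbox (l i) (u i))" by blast
    qed
    then have "emeasure lborel ?S \<le> (\<Sum>i. emeasure lborel (cbox (l i) (u i)))"
      by (rule emeasure_lborel_Collect_le_cboxes)
    also have "\<dots> = (\<Sum>i. ennreal c * ennreal (unit_ball_vol ?s * (diameter (C i) / 2) powr ?s))"
    proof (rule suminf_cong)
      fix i
      have "(\<Prod>b\<in>Basis. (u i - l i) \<bullet> b) = ((u i - l i) \<bullet> e) * (\<Prod>b\<in>Basis - {e}. (u i - l i) \<bullet> b)"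
        by (rule prod.remove) (use e in auto)
      also have "(\<Prod>b\<in>Basis - {e}. (u i - l i) \<bullet> b) = (\<Prod>b\<in>Basis - {e}. 2 * diameter (C i))"
        by (rule prod.cong) (auto simp: inner_diff_left lu)
      also have "\<dots> = (2 * diameter (C i)) ^ (DIM('a) - 1)" using e by (simp add: card_Diff_singleton)
      also have "(u i - l i) \<bullet> e = 2 * r" using e by (simp add: inner_diff_left lu)
      also have "(2 * diameter (C i)) ^ (DIM('a) - 1) = (2 * diameter (C i)) powr ?s"
        using powr_real_DIM[OF _ dim, of "2 * diameter (C i)"] dnn[of i] by simp
      also have "\<dots> = 4 powr ?s * (diameter (C i) / 2) powr ?s"
        using dnn[of i] by (simp add: powr_mult[symmetric])
      also have "2 * r * (4 powr ?s * (diameter (C i) / 2) powr ?s) = c * (unit_ball_vol ?s * (diameter (C i) / 2) powr ?s)"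
        using less_imp_neq[OF ub] by (simp add: c_def)
      finally have vol: "(\<Prod>b\<in>Basis. (u i - l i) \<bullet> b) = c * (unit_ball_vol ?s * (diameter (C i) / 2) powr ?s)" .
      have "l i \<bullet> b \<le> u i \<bullet> b" if "b \<in> Basis" for b using lu[OF that, of i] r dnn[of i] by auto
      then have "emeasure lborel (cbox (l i) (u i)) = ennreal (\<Prod>b\<in>Basis. (u i - l i) \<bullet> b)" by simp
      then show "emeasure lborel (cbox (l i) (u i)) = ennreal c * ennreal (unit_ball_vol ?s * (diameter (C i) / 2) powr ?s)"
        unfolding vol using c ub by (simp add: ennreal_mult)
    qed
    also have "\<dots> = ennreal c * (\<Sum>i. ennreal (unit_ball_vol ?s * (diameter (C i) / 2) powr ?s))" by simp
    finally have "ennreal (1 / c) * emeasure lborel ?S \<le> ennreal (1 / c) * (ennreal c * (\<Sum>i. ennreal (unit_ball_vol ?s * (diameter (C i) / 2) powr ?s)))"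
      by (rule mult_left_mono) simp
    also have "\<dots> = (\<Sum>i. ennreal (unit_ball_vol ?s * (diameter (C i) / 2) powr ?s))"
      using c by (simp add: mult.assoc[symmetric] ennreal_mult[symmetric])
    finally show "ennreal (1 / c) * emeasure lborel ?S \<le> (\<Sum>i. ennreal (unit_ball_vol ?s * (diameter (C i) / 2) powr ?s))" .
  qed
  also have "\<dots> \<le> hausdorff_outer ?s A" by (rule hausdorff_content_le_outer) simp
  finally have "ennreal c * (ennreal (1 / c) * emeasure lborel ?S) \<le> ennreal c * hausdorff_outer ?s A"
    by (rule mult_left_mono) simp
  then show ?thesis using c by (simp add: c_def[symmetric] mult.assoc[symmetric] ennreal_mult[symmetric])
qed

text \<open>Cover the cylinder over \<open>A\<close> by small cubes. For every height \<open>t\<close>, the slices of the cubes at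
  height \<open>t\<close> are mapped to a cover of \<open>A\<close>, and integrating over \<open>t\<close> turns the sum over the slices into
  the total volume of the cubes.\<close>

lemma surface_le_lebesgue:
  assumes dim: "2 \<le> DIM('a)" and A: "A \<in> sets borel" "A \<subseteq> W \<inter> frontier \<Omega>"
  shows "ennreal (2 * r) * hausdorff_outer (real DIM('a) - 1) A
    \<le> ennreal (unit_ball_vol (real DIM('a) - 1) * (real DIM('a) * K / 2) powr (real DIM('a) - 1)) * emeasure lborel {y \<in> Q. \<gamma> y \<in> A}"
proof -
  let ?s = "real DIM('a) - 1" and ?S = "{y \<in> Q. \<gamma> y \<in> A}"
  define c where "c = unit_ball_vol ?s * (real DIM('a) * K / 2) powr ?s"
  have s: "0 < ?s" using dim by simp
  have ub: "0 < unit_ball_vol ?s" using s by (intro unit_ball_vol_pos) simp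
  have c: "0 \<le> c" using ub by (simp add: c_def)
  have Sb: "?S \<in> sets borel" by (rule \<gamma>_preimage_borel[OF A(1)])
  have main: "ennreal (2 * r) * hausdorff_content ?s \<delta> A \<le> ennreal c * (emeasure lborel ?S + ennreal \<epsilon>)"
    if \<delta>: "0 < \<delta>" and \<epsilon>: "0 < \<epsilon>" for \<delta> \<epsilon> :: real
  proof -
    obtain O' where O': "open O'" "?S \<subseteq> O'" "emeasure lborel (O' - ?S) < ennreal \<epsilon>"
      using outer_regular_lborel[OF Sb \<epsilon>] by auto
    have "emeasure lborel O' = emeasure lborel (?S \<union> (O' - ?S))" using O'(2) by (simp add: Un_absorb1)
    also have "\<dots> \<le> emeasure lborel ?S + emeasure lborel (O' - ?S)"
      using Sb O'(1) by (intro emeasure_subadditive) auto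
    finally have mO: "emeasure lborel O' \<le> emeasure lborel ?S + ennreal \<epsilon>"
      using O'(3) by (meson add_left_mono less_imp_le order_trans)
    define \<eta> where "\<eta> = \<delta> / (2 * (K + 1))"
    have \<eta>: "0 < \<eta>" using \<delta> K by (simp add: \<eta>_def)
    define G where "G x = (if x \<in> ?S then ball x \<eta> \<inter> O' else ball x \<eta>)" for x
    have gauge: "gauge G" unfolding gauge_def G_def using \<eta> O' by auto
    have sub: "?S \<subseteq> cbox (q - r *\<^sub>R One) (q + r *\<^sub>R One)" using box_subset_cbox by blast
    have ne: "Q \<noteq> {}" using center_mem by blast
    obtain \<D> where D: "countable \<D>" "\<Union>\<D> \<subseteq> cbox (q - r *\<^sub>R One) (q + r *\<^sub>R One)"
      "\<And>D. D \<in> \<D> \<Longrightarrow> interior D \<noteq> {} \<and> (\<exists>c d. D = cbox c d)"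
      "pairwise (\<lambda>A B. interior A \<inter> interior B = {}) \<D>"
      "\<And>D. D \<in> \<D> \<Longrightarrow> \<exists>x \<in> ?S \<inter> D. D \<subseteq> G x"
      "\<And>u v. cbox u v \<in> \<D> \<Longrightarrow> \<exists>n. \<forall>i \<in> Basis. v \<bullet> i - u \<bullet> i = ((q + r *\<^sub>R One) \<bullet> i - (q - r *\<^sub>R One) \<bullet> i) / 2^n"
      "?S \<subseteq> \<Union>\<D>"
      by (rule covering_lemma[OF sub ne gauge]) (rule that; (assumption | blast))
    have "\<exists>u v len. D = cbox u v \<and> 0 < len \<and> (\<forall>b\<in>Basis. v \<bullet> b - u \<bullet> b = len)" if DD: "D \<in> \<D>" for D
    proof -
      obtain u v where uv: "D = cbox u v" using D(3)[OF DD] by blast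
      obtain n where "\<forall>i \<in> Basis. v \<bullet> i - u \<bullet> i = ((q + r *\<^sub>R One) \<bullet> i - (q - r *\<^sub>R One) \<bullet> i) / 2^n"
        using D(6) DD uv by blast
      then show ?thesis using uv r
        by (intro exI[of _ u] exI[of _ v] exI[of _ "2 * r / 2 ^ n"]) (simp add: inner_add_left inner_diff_left)
    qed
    then obtain u v len where cube: "\<And>D. D \<in> \<D> \<Longrightarrow> D = cbox (u D) (v D)" "\<And>D. D \<in> \<D> \<Longrightarrow> 0 < len D"
      "\<And>D b. D \<in> \<D> \<Longrightarrow> b \<in> Basis \<Longrightarrow> v D \<bullet> b - u D \<bullet> b = len D" by metis
    have DO: "D \<subseteq> O'" "\<And>x y. x \<in> D \<Longrightarrow> y \<in> D \<Longrightarrow> norm (x - y) \<le> 2 * \<eta>" if DD: "D \<in> \<D>" for D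
    proof -
      obtain x where x: "x \<in> ?S" "D \<subseteq> G x" using D(5)[OF DD] by blast
      then show "D \<subseteq> O'" by (auto simp: G_def)
      fix y z assume "y \<in> D" "z \<in> D"
      then have "dist x y < \<eta>" "dist x z < \<eta>" using x by (auto simp: G_def)
      then show "norm (y - z) \<le> 2 * \<eta>" using dist_triangle3[of y z x] by (simp add: dist_norm[symmetric] dist_commute)
    qed
    have size: "norm (x - y) \<le> real DIM('a) * len D" if "D \<in> \<D>" "x \<in> D" "y \<in> D" for D x y
    proof -
      have "norm (x - y) \<le> (\<Sum>b\<in>Basis. \<bar>(x - y) \<bullet> b\<bar>)" by (rule norm_le_l1)
      also have "\<dots> \<le> (\<Sum>b\<in>(Basis::'a set). len D)"
      proof (rule sum_mono)
        fix b :: 'a assume b: "b \<in> Basis"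
        have "x \<in> cbox (u D) (v D)" "y \<in> cbox (u D) (v D)" using that cube(1)[OF that(1)] by auto
        then show "\<bar>(x - y) \<bullet> b\<bar> \<le> len D"
          using b cube(3)[OF that(1) b] unfolding mem_box inner_diff_left by (smt (verit, best))
      qed
      finally show ?thesis by simp
    qed
    have volD: "emeasure lborel (interior D) = ennreal (len D ^ DIM('a))" if DD: "D \<in> \<D>" for D
    proof -
      have "emeasure lborel (interior D) = emeasure lborel (box (u D) (v D))"
        by (subst cube(1)[OF DD]) (simp add: interior_cbox)
      also have "\<dots> = ennreal (\<Prod>b\<in>Basis. (v D - u D) \<bullet> b)"
        using cube(2,3)[OF DD] by (intro emeasure_lborel_box) (metis diff_ge_0_iff_ge less_imp_le)
      also have "(\<Prod>b\<in>Basis. (v D - u D) \<bullet> b) = (\<Prod>b\<in>(Basis::'a set). len D)"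
        by (rule prod.cong) (auto simp: inner_diff_left cube(3)[OF DD])
      finally show ?thesis by simp
    qed
    define J where "J = to_nat_on \<D> ` \<D>"
    define E where "E i = from_nat_into \<D> i" for i
    have E: "E i \<in> \<D>" if "i \<in> J" for i using that D(1) by (auto simp: J_def E_def)
    have Einj: "E i \<noteq> E j" if "i \<in> J" "j \<in> J" "i \<noteq> j" for i j using that D(1) by (auto simp: J_def E_def)
    have Eall: "\<exists>i\<in>J. E i = D" if "D \<in> \<D>" for D using that D(1) by (auto simp: J_def E_def)
    define w where "w i = (if i \<in> J then len (E i) else 0)" for i
    define B where "B i = (if i \<in> J then interior (E i) else {})" for i
    have "(\<Sum>i. ennreal (w i ^ DIM('a))) = (\<Sum>i. emeasure lborel (B i))"
      by (rule suminf_cong) (simp add: w_def B_def volD E)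
    also have "\<dots> = emeasure lborel (\<Union>i. B i)"
    proof (rule suminf_emeasure)
      show "disjoint_family B"
        using D(4) E Einj unfolding disjoint_family_on_def pairwise_def B_def by auto
    qed (auto simp: B_def)
    also have "(\<Union>i. B i) \<subseteq> O'"
      using DO(1)[OF E] interior_subset unfolding B_def by (fastforce split: if_splits)
    then have "emeasure lborel (\<Union>i. B i) \<le> emeasure lborel O'"
      using O'(1) by (intro emeasure_mono) simp_all
    finally have vol: "(\<Sum>i. ennreal (w i ^ DIM('a))) \<le> emeasure lborel ?S + ennreal \<epsilon>" using mO by simp
    have w0: "0 \<le> w i" for i using cube(2)[OF E] by (simp add: w_def less_imp_le)
    define I where "I i = {u (E i) \<bullet> e..v (E i) \<bullet> e}" for i
    have slice: "hausdorff_content ?s \<delta> A \<le> (\<Sum>i. ennreal (c * w i ^ (DIM('a) - 1)) * indicator (I i) t)"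
      if t: "t \<in> {-r<..<r}" for t
    proof -
      define C where "C i = (if i \<in> J then \<gamma> ` (E i \<inter> {y \<in> Q. y \<bullet> e = t}) else {})" for i
      have Cd: "norm (x - x') \<le> K * norm (y - y')" if "y \<in> Q" "y' \<in> Q" "x = \<gamma> y" "x' = \<gamma> y'" for x x' y y'
      proof -
        have "norm (x - x') \<le> K * norm (off_axis e (y - y'))"
          using \<gamma>_lip[OF that(1,2)] that by (simp add: dist_norm off_axis_diff)
        also have "\<dots> \<le> K * norm (y - y')" using norm_off_axis_le[OF e] K by (intro mult_left_mono)
        finally show ?thesis .
      qed
      have dC: "diameter (C i) \<le> K * (real DIM('a) * w i)" for i
      proof (rule diameter_le)
        show "C i \<noteq> {} \<or> 0 \<le> K * (real DIM('a) * w i)" using K w0 by simp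
        fix x x' assume "x \<in> C i" "x' \<in> C i"
        then obtain y y' where yy: "i \<in> J" "y \<in> E i" "y \<in> Q" "x = \<gamma> y" "y' \<in> E i" "y' \<in> Q" "x' = \<gamma> y'"
          by (auto simp: C_def split: if_splits)
        have "norm (y - y') \<le> real DIM('a) * w i" using size[OF E[OF yy(1)] yy(2,5)] yy(1) by (simp add: w_def)
        then show "norm (x - x') \<le> K * (real DIM('a) * w i)"
          using Cd[OF yy(3,6,4,7)] K by (meson mult_left_mono order_trans)
      qed
      have dC': "diameter (C i) \<le> \<delta>" for i
      proof (rule diameter_le)
        show "C i \<noteq> {} \<or> 0 \<le> \<delta>" using \<delta> by simp
        fix x x' assume "x \<in> C i" "x' \<in> C i"
        then obtain y y' where yy: "i \<in> J" "y \<in> E i" "y \<in> Q" "x = \<gamma> y" "y' \<in> E i" "y' \<in> Q" "x' = \<gamma> y'"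
          by (auto simp: C_def split: if_splits)
        have "norm (x - x') \<le> K * (2 * \<eta>)"
          using Cd[OF yy(3,6,4,7)] DO(2)[OF E[OF yy(1)] yy(2,5)] K by (meson mult_left_mono order_trans)
        also have "\<dots> \<le> (K + 1) * (2 * \<eta>)" using \<eta> by (intro mult_right_mono) auto
        also have "\<dots> = (2 * (K + 1)) * (\<delta> / (2 * (K + 1)))" by (simp only: \<eta>_def mult_ac)
        also have "\<dots> = \<delta>" unfolding times_divide_eq_right
          by (rule nonzero_mult_div_cancel_left) (rule less_imp_neq[symmetric], use K in simp)
        finally show "norm (x - x') \<le> \<delta>" .
      qed
      have bC: "bounded (C i)" for i
      proof (cases "i \<in> J")
        case True
        have "bounded (E i)" using cube(1)[OF E[OF True]] bounded_cbox by metis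
        have "bounded (\<gamma> ` (E i \<inter> {y \<in> Q. y \<bullet> e = t}))"
        proof (cases "E i \<inter> {y \<in> Q. y \<bullet> e = t} = {}")
          case False
          then obtain y where y: "y \<in> E i" "y \<in> Q" by blast
          show ?thesis
            by (rule bounded_subset[of "cball (\<gamma> y) (K * (2 * \<eta>))"])
               (use Cd[OF y(2) _ refl refl] DO(2)[OF E[OF True] y(1)] K in
                 \<open>auto simp: dist_norm intro!: order_trans[OF Cd[OF y(2) _ refl refl]] mult_left_mono\<close>)
        qed simp
        then show ?thesis using True by (simp add: C_def)
      qed (simp add: C_def)
      have cov: "A \<subseteq> (\<Union>i. C i)"
      proof
        fix x assume x: "x \<in> A"
        have xW: "x \<in> W \<inter> frontier \<Omega>" using A(2) x by blast
        define y where "y = off_axis e x + t *\<^sub>R e"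
        have y: "y \<in> Q" "\<gamma> y = x" using \<gamma>_inv[OF xW, of t] t by (auto simp: y_def abs_less_iff)
        have ye: "y \<bullet> e = t" using e by (simp add: y_def inner_add_left off_axis_inner inner_Basis)
        have "y \<in> ?S" using y x by simp
        then obtain D where "D \<in> \<D>" "y \<in> D" using D(7) by blast
        then obtain i where "i \<in> J" "y \<in> E i" using Eall by metis
        then have "x \<in> C i" using y ye by (auto simp: C_def)
        then show "x \<in> (\<Union>i. C i)" by blast
      qed
      have "hausdorff_content ?s \<delta> A \<le> (\<Sum>i. ennreal (unit_ball_vol ?s * (diameter (C i) / 2) powr ?s))"
        by (rule hausdorff_content_le[OF cov bC dC'])
      also have "\<dots> \<le> (\<Sum>i. ennreal (c * w i ^ (DIM('a) - 1)) * indicator (I i) t)"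
      proof (rule suminf_le)
        fix i
        show "ennreal (unit_ball_vol ?s * (diameter (C i) / 2) powr ?s) \<le> ennreal (c * w i ^ (DIM('a) - 1)) * indicator (I i) t"
        proof (cases "C i = {}")
          case True
          then show ?thesis using s by simp
        next
          case False
          then obtain y where y: "i \<in> J" "y \<in> E i" "y \<bullet> e = t" by (auto simp: C_def split: if_splits)
          have "y \<in> cbox (u (E i)) (v (E i))" using y cube(1)[OF E[OF y(1)]] by simp
          then have tI: "t \<in> I i" using y(3) e by (auto simp: I_def mem_box)
          have "(diameter (C i) / 2) powr ?s \<le> ((real DIM('a) * K / 2) * w i) powr ?s"
            using dC[of i] s diameter_ge_0[OF bC[of i]] by (intro powr_mono2) (auto simp: mult_ac)
          also have "\<dots> = (real DIM('a) * K / 2) powr ?s * w i ^ (DIM('a) - 1)"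
            using K w0[of i] powr_real_DIM[OF w0[of i] dim] by (subst powr_mult) simp_all
          finally have "unit_ball_vol ?s * (diameter (C i) / 2) powr ?s \<le> unit_ball_vol ?s * ((real DIM('a) * K / 2) powr ?s * w i ^ (DIM('a) - 1))"
            by (rule mult_left_mono) (use ub in simp)
          then show ?thesis using tI by (simp add: c_def ennreal_leI mult.assoc)
        qed
      qed auto
      finally show ?thesis .
    qed
    have "ennreal (2 * r) * hausdorff_content ?s \<delta> A = hausdorff_content ?s \<delta> A * emeasure lborel {-r<..<r}"
      using r by (simp add: mult.commute)
    also have "\<dots> = (\<integral>\<^sup>+t. hausdorff_content ?s \<delta> A * indicator {-r<..<r} t \<partial>lborel)"
      by (rule nn_integral_cmult_indicator[symmetric]) simp
    also have "\<dots> \<le> (\<integral>\<^sup>+t. (\<Sum>i. ennreal (c * w i ^ (DIM('a) - 1)) * indicator (I i) t) \<partial>lborel)"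
      using slice by (intro nn_integral_mono) (auto simp: indicator_def[of "{-r<..<r}"])
    also have "\<dots> = (\<Sum>i. \<integral>\<^sup>+t. ennreal (c * w i ^ (DIM('a) - 1)) * indicator (I i) t \<partial>lborel)"
      by (rule nn_integral_suminf) (simp add: I_def)
    also have "\<dots> = (\<Sum>i. ennreal c * ennreal (w i ^ DIM('a)))"
    proof (rule suminf_cong)
      fix i
      have "(\<integral>\<^sup>+t. ennreal (c * w i ^ (DIM('a) - 1)) * indicator (I i) t \<partial>lborel) = ennreal (c * w i ^ (DIM('a) - 1)) * emeasure lborel (I i)"
        by (rule nn_integral_cmult_indicator) (simp add: I_def)
      also have "\<dots> = ennreal (c * w i ^ (DIM('a) - 1)) * ennreal (w i)"
      proof (cases "i \<in> J")
        case True
        have "v (E i) \<bullet> e - u (E i) \<bullet> e = w i" using cube(3)[OF E[OF True] e] True by (simp add: w_def)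
        then have "emeasure lborel (I i) = ennreal (w i)" using w0[of i] by (simp add: I_def)
        then show ?thesis by simp
      qed (use dim in \<open>simp add: w_def power_0_left\<close>)
      also have "\<dots> = ennreal c * ennreal (w i ^ DIM('a))"
      proof -
        have "w i ^ DIM('a) = w i ^ (DIM('a) - 1) * w i" by (simp flip: power_Suc2)
        then show ?thesis using c w0[of i] by (simp add: ennreal_mult[symmetric])
      qed
      finally show "(\<integral>\<^sup>+t. ennreal (c * w i ^ (DIM('a) - 1)) * indicator (I i) t \<partial>lborel) = ennreal c * ennreal (w i ^ DIM('a))" .
    qed
    also have "\<dots> = ennreal c * (\<Sum>i. ennreal (w i ^ DIM('a)))" by simp
    also have "\<dots> \<le> ennreal c * (emeasure lborel ?S + ennreal \<epsilon>)" by (rule mult_left_mono[OF vol]) simp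
    finally show ?thesis .
  qed
  have "ennreal (2 * r) * hausdorff_outer ?s A = (SUP \<delta>\<in>{0<..}. ennreal (2 * r) * hausdorff_content ?s \<delta> A)"
    unfolding hausdorff_outer_def by (rule SUP_mult_left_ennreal)
  also have "\<dots> \<le> ennreal c * emeasure lborel ?S"
  proof (rule SUP_least)
    fix \<delta> :: real assume \<delta>: "\<delta> \<in> {0<..}"
    show "ennreal (2 * r) * hausdorff_content ?s \<delta> A \<le> ennreal c * emeasure lborel ?S"
    proof (rule ennreal_le_epsilon)
      fix \<epsilon> :: real assume \<epsilon>: "0 < \<epsilon>"
      have "ennreal (2 * r) * hausdorff_content ?s \<delta> A \<le> ennreal c * (emeasure lborel ?S + ennreal (\<epsilon> / (c + 1)))"
        using \<delta> \<epsilon> c by (intro main) auto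
      also have "\<dots> = ennreal c * emeasure lborel ?S + ennreal (c * (\<epsilon> / (c + 1)))"
        using c \<epsilon> by (simp add: distrib_left ennreal_mult[symmetric])
      also have "c * (\<epsilon> / (c + 1)) \<le> \<epsilon>" using c \<epsilon> by (simp add: field_simps)
      then have "ennreal c * emeasure lborel ?S + ennreal (c * (\<epsilon> / (c + 1))) \<le> ennreal c * emeasure lborel ?S + ennreal \<epsilon>"
        by (intro add_left_mono ennreal_leI)
      finally show "ennreal (2 * r) * hausdorff_content ?s \<delta> A \<le> ennreal c * emeasure lborel ?S + ennreal \<epsilon>" .
    qed
  qed
  finally show ?thesis by (simp add: c_def)
qed

end

lemma nn_integral_le_emeasure_le:
  assumes "sets M = sets N" and "\<And>A. A \<in> sets M \<Longrightarrow> emeasure M A \<le> C * emeasure N A" and "f \<in> borel_measurable N"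
  shows "nn_integral M f \<le> C * nn_integral N f"
proof -
  have "M \<le> scale_measure C N"
    using assms(1,2) sets_eq_imp_space_eq[OF assms(1)] emeasure_notin_sets[of _ M]
    by (auto simp: le_measure_iff le_fun_def space_scale_measure)
       (metis assms(2) emeasure_notin_sets zero_le)
  then have "nn_integral M f \<le> nn_integral (scale_measure C N) f"
    using assms(1) by (intro nn_integral_mono_measure) auto
  then show ?thesis using assms(3) by (simp add: nn_integral_scale_measure)
qed

lemma (in boundary_chart) nn_integral_chart:
  assumes dim: "2 \<le> DIM('a)"
  shows "\<exists>C\<ge>0. \<forall>f. f \<in> borel_measurable borel \<longrightarrow> (\<integral>\<^sup>+y. f (\<gamma> y) \<partial>lborel_on Q)
      \<le> ennreal C * (\<integral>\<^sup>+x. f x * indicator (W \<inter> frontier \<Omega>) x \<partial>hausdorff_measure (real DIM('a) - 1))"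
    and "\<exists>C\<ge>0. \<forall>f. f \<in> borel_measurable borel \<longrightarrow> (\<integral>\<^sup>+x. f x * indicator (W \<inter> frontier \<Omega>) x \<partial>hausdorff_measure (real DIM('a) - 1))
      \<le> ennreal C * (\<integral>\<^sup>+y. f (\<gamma> y) \<partial>lborel_on Q)"
proof -
  let ?s = "real DIM('a) - 1" and ?WM = "W \<inter> frontier \<Omega>"
  let ?H = "hausdorff_measure ?s :: 'a measure" and ?L = "lborel_on Q"
  have WM: "?WM \<in> sets borel" using W(1) by (intro sets.Int) auto
  have mg: "\<gamma> \<in> measurable ?L borel"
    by (rule measurable_continuous_restrict_lborel[OF \<gamma>_continuous]) simp
  define N1 where "N1 = distr ?L borel \<gamma>"
  define N2 where "N2 = density (?H) (indicator ?WM)"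
  have sN: "sets N1 = sets borel" "sets N2 = sets borel" by (simp_all add: N1_def N2_def)
  have e1: "emeasure N1 A = emeasure lborel {y \<in> Q. \<gamma> y \<in> A}" if "A \<in> sets borel" for A
  proof -
    have "emeasure N1 A = emeasure ?L (\<gamma> -` A \<inter> Q)"
      unfolding N1_def using that mg by (subst emeasure_distr) (auto simp: space_restrict_space)
    also have "\<dots> = emeasure lborel (\<gamma> -` A \<inter> Q)" by (rule emeasure_restrict_space) auto
    also have "\<gamma> -` A \<inter> Q = {y \<in> Q. \<gamma> y \<in> A}" by auto
    finally show ?thesis .
  qed
  have e2: "emeasure N2 A = hausdorff_outer ?s (A \<inter> ?WM)" if "A \<in> sets borel" for A
  proof -
    have "emeasure N2 A = (\<integral>\<^sup>+x. indicator ?WM x * indicator A x \<partial>?H)"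
      unfolding N2_def using that WM by (subst emeasure_density) auto
    also have "\<dots> = (\<integral>\<^sup>+x. indicator (A \<inter> ?WM) x \<partial>?H)"
      by (rule nn_integral_cong) (auto simp: indicator_def)
    also have "\<dots> = emeasure (?H) (A \<inter> ?WM)"
      using that WM by (intro nn_integral_indicator) auto
    also have "\<dots> = hausdorff_outer ?s (A \<inter> ?WM)" using that WM by (intro emeasure_hausdorff_measure) auto
    finally show ?thesis .
  qed
  have e1': "emeasure N1 A = emeasure lborel {y \<in> Q. \<gamma> y \<in> A \<inter> ?WM}" if "A \<in> sets borel" for A
  proof -
    have "{y \<in> Q. \<gamma> y \<in> A} = {y \<in> Q. \<gamma> y \<in> A \<inter> ?WM}" using \<gamma>_mem by blast
    then show ?thesis using e1[OF that] by simp
  qed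
  have i1: "nn_integral N1 f = (\<integral>\<^sup>+y. f (\<gamma> y) \<partial>?L)" if f: "f \<in> borel_measurable borel" for f
    unfolding N1_def using mg f by (intro nn_integral_distr) auto
  have i2: "nn_integral N2 f = (\<integral>\<^sup>+x. f x * indicator ?WM x \<partial>?H)" if f: "f \<in> borel_measurable borel" for f
    unfolding N2_def using f WM by (subst nn_integral_density) (auto simp: mult.commute)
  define C1 where "C1 = 2 * r * 4 powr ?s / unit_ball_vol ?s"
  define C2 where "C2 = unit_ball_vol ?s * (real DIM('a) * K / 2) powr ?s"
  have ub: "0 < unit_ball_vol ?s" using dim by (intro unit_ball_vol_pos) simp
  have C: "0 \<le> C1" "0 \<le> C2" using r ub by (simp_all add: C1_def C2_def)
  have le1: "nn_integral N1 f \<le> ennreal C1 * nn_integral N2 f" if f: "f \<in> borel_measurable borel" for f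
  proof (rule nn_integral_le_emeasure_le)
    fix A assume "A \<in> sets N1"
    then have A: "A \<in> sets borel" using sN by simp
    show "emeasure N1 A \<le> ennreal C1 * emeasure N2 A"
      using lebesgue_le_surface[OF dim, of "A \<inter> ?WM"] A WM by (simp add: e1'[OF A] e2[OF A] C1_def)
  qed (use sN f in \<open>auto simp: measurable_cong_sets[OF sN(2) refl]\<close>)
  show "\<exists>C\<ge>0. \<forall>f. f \<in> borel_measurable borel \<longrightarrow> (\<integral>\<^sup>+y. f (\<gamma> y) \<partial>?L)
      \<le> ennreal C * (\<integral>\<^sup>+x. f x * indicator ?WM x \<partial>?H)"
    using C(1) le1 by (intro exI[of _ C1]) (simp add: i1 i2)
  have le2: "nn_integral N2 f \<le> ennreal (C2 / (2 * r)) * nn_integral N1 f" if f: "f \<in> borel_measurable borel" for f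
  proof (rule nn_integral_le_emeasure_le)
    fix A assume "A \<in> sets N2"
    then have A: "A \<in> sets borel" using sN by simp
    have "ennreal (2 * r) * emeasure N2 A \<le> ennreal C2 * emeasure N1 A"
      unfolding e1'[OF A] e2[OF A] C2_def by (rule surface_le_lebesgue[OF dim]) (use A WM in auto)
    then have "ennreal (1 / (2 * r)) * (ennreal (2 * r) * emeasure N2 A) \<le> ennreal (1 / (2 * r)) * (ennreal C2 * emeasure N1 A)"
      by (rule mult_left_mono) simp
    then show "emeasure N2 A \<le> ennreal (C2 / (2 * r)) * emeasure N1 A"
      using r C(2) by (simp add: mult.assoc[symmetric] ennreal_mult[symmetric])
  qed (use sN f in \<open>auto simp: measurable_cong_sets[OF sN(1) refl]\<close>)
  show "\<exists>C\<ge>0. \<forall>f. f \<in> borel_measurable borel \<longrightarrow> (\<integral>\<^sup>+x. f x * indicator ?WM x \<partial>?H)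
      \<le> ennreal C * (\<integral>\<^sup>+y. f (\<gamma> y) \<partial>?L)"
    using C(2) r le2 by (intro exI[of _ "C2 / (2 * r)"]) (simp add: i1 i2)
qed

section \<open>The reference measure\<close>

locale dirichlet_domain = smooth_domain \<Omega> for \<Omega> :: "'a::euclidean_space set" +
  fixes a :: real
  assumes dim: "2 \<le> DIM('a)" and interior_nonempty: "interior \<Omega> \<noteq> {}" and a: "0 < a" "a \<le> 1"
begin

abbreviation "\<sigma> \<equiv> hausdorff_measure (real DIM('a) - 1) :: 'a measure"
abbreviation "\<mu> \<equiv> ref_measure \<Omega>"
abbreviation "c \<equiv> norm_const \<Omega>"
abbreviation "D\<Omega> \<equiv> interior \<Omega>"
abbreviation "\<Gamma> \<equiv> frontier \<Omega>"
abbreviation "\<E> \<equiv> pre_energy \<Omega> a"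
abbreviation "approx \<equiv> approximates \<Omega> a"
abbreviation "\<D> \<equiv> dirichlet_form \<Omega> a"

lemma domain_split: "\<Omega> = D\<Omega> \<union> \<Gamma>" "D\<Omega> \<inter> \<Gamma> = {}"
  using closed_domain interior_subset[of \<Omega>] by (auto simp: frontier_def)

lemma compact_boundary: "compact \<Gamma>"
  by (rule compact_frontier[OF compact_domain])

lemma boundary_chart_at:
  assumes "p \<in> \<Gamma>"
  obtains U \<rho> g e W q r \<gamma> K where "boundary_chart \<Omega> U \<rho> g p e W q r \<gamma> K"
proof -
  obtain U \<rho> g where D: "defining_function \<Omega> U \<rho> g" "p \<in> U"
    by (rule smooth_boundary_defining_function[OF smooth assms])
  show thesis by (rule boundary_chart_exists[OF D(1) closed_domain D(2) assms]) (rule that)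
qed

lemma boundary_covering:
  assumes "\<And>p. p \<in> \<Gamma> \<Longrightarrow> \<exists>W. open W \<and> p \<in> W \<and> P W"
  obtains \<F> where "finite \<F>" "\<And>W. W \<in> \<F> \<Longrightarrow> open W \<and> P W" "\<Gamma> \<subseteq> \<Union>\<F>"
proof -
  have "\<forall>p\<in>\<Gamma>. \<exists>W. open W \<and> p \<in> W \<and> P W" using assms by blast
  from bchoice[OF this] obtain W where W: "\<forall>p\<in>\<Gamma>. open (W p) \<and> p \<in> W p \<and> P (W p)" by blast
  have op: "open (W p)" if "p \<in> \<Gamma>" for p using W that by blast
  have cov: "\<Gamma> \<subseteq> (\<Union>p\<in>\<Gamma>. W p)" using W by blast
  obtain F where F: "F \<subseteq> \<Gamma>" "finite F" "\<Gamma> \<subseteq> (\<Union>p\<in>F. W p)"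
    by (rule compactE_image[OF compact_boundary op cov]) (auto intro: that)
  show thesis by (rule that[of "W ` F"]) (use F W in auto)
qed

lemma finite_surface: "emeasure \<sigma> \<Gamma> < top"
proof -
  have "\<exists>W. open W \<and> p \<in> W \<and> emeasure \<sigma> (W \<inter> \<Gamma>) < top" if p: "p \<in> \<Gamma>" for p
  proof -
    obtain U \<rho> g e W q r \<gamma> K where "boundary_chart \<Omega> U \<rho> g p e W q r \<gamma> K" by (rule boundary_chart_at[OF p])
    then interpret boundary_chart \<Omega> U \<rho> g p e W q r \<gamma> K .
    have WM: "W \<inter> \<Gamma> \<in> sets borel" using W(1) by (intro sets.Int) auto
    obtain C where "\<forall>f. f \<in> borel_measurable borel \<longrightarrow> (\<integral>\<^sup>+x. f x * indicator (W \<inter> \<Gamma>) x \<partial>\<sigma>)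
        \<le> ennreal C * (\<integral>\<^sup>+y. f (\<gamma> y) \<partial>lborel_on Q)"
      using nn_integral_chart(2)[OF dim] by blast
    from this[rule_format, of "\<lambda>_. 1"]
    have C: "(\<integral>\<^sup>+x. 1 * indicator (W \<inter> \<Gamma>) x \<partial>\<sigma>) \<le> ennreal C * (\<integral>\<^sup>+y. 1 \<partial>lborel_on Q)" by simp
    have "emeasure \<sigma> (W \<inter> \<Gamma>) = (\<integral>\<^sup>+x. 1 * indicator (W \<inter> \<Gamma>) x \<partial>\<sigma>)" using WM by simp
    also have "\<dots> \<le> ennreal C * emeasure lborel Q"
      using C by (simp add: emeasure_restrict_space space_restrict_space)
    also have "\<dots> < top" using emeasure_bounded_finite[OF bounded_box] by (intro ennreal_mult_less_top[THEN iffD2]) auto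
    finally show ?thesis using W by blast
  qed
  then obtain \<F> where F: "finite \<F>" "\<And>W. W \<in> \<F> \<Longrightarrow> open W \<and> emeasure \<sigma> (W \<inter> \<Gamma>) < top" "\<Gamma> \<subseteq> \<Union>\<F>"
    using boundary_covering[of "\<lambda>W. emeasure \<sigma> (W \<inter> \<Gamma>) < top"] by metis
  have "emeasure \<sigma> \<Gamma> \<le> emeasure \<sigma> (\<Union>W\<in>\<F>. W \<inter> \<Gamma>)"
  proof (rule emeasure_mono)
    have "(\<Union>W\<in>\<F>. W \<inter> \<Gamma>) \<in> sets borel" by (intro sets.finite_UN F(1)) (use F(2) in auto)
    then show "(\<Union>W\<in>\<F>. W \<inter> \<Gamma>) \<in> sets \<sigma>" by simp
  qed (use F(3) in blast)
  also have "\<dots> \<le> (\<Sum>W\<in>\<F>. emeasure \<sigma> (W \<inter> \<Gamma>))"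
    using F by (intro emeasure_subadditive_finite) auto
  also have "\<dots> < top" using F by (simp add: less_top)
  finally show ?thesis .
qed

text \<open>Charts are differentiable, and they already reach the boundary from the hyperplane through the origin orthogonal to \<open>e\<close>.\<close>

lemma negligible_boundary: "negligible \<Gamma>"
proof -
  have "\<exists>W. open W \<and> p \<in> W \<and> negligible (W \<inter> \<Gamma>)" if p: "p \<in> \<Gamma>" for p
  proof -
    obtain U \<rho> g e W q r \<gamma> K where "boundary_chart \<Omega> U \<rho> g p e W q r \<gamma> K" by (rule boundary_chart_at[OF p])
    then interpret boundary_chart \<Omega> U \<rho> g p e W q r \<gamma> K .
    have "negligible {y. y \<bullet> e = 0}" by (rule negligible_standard_hyperplane[OF e])
    then have "negligible (Q \<inter> {y. y \<bullet> e = 0})" by (rule negligible_subset) simp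
    moreover have "\<gamma> differentiable_on (Q \<inter> {y. y \<bullet> e = 0})"
      using \<gamma>_deriv unfolding differentiable_on_def differentiable_def by (blast intro: has_derivative_at_withinI)
    ultimately have "negligible (\<gamma> ` (Q \<inter> {y. y \<bullet> e = 0}))"
      by (intro negligible_differentiable_image_negligible) auto
    moreover have "W \<inter> \<Gamma> \<subseteq> \<gamma> ` (Q \<inter> {y. y \<bullet> e = 0})"
    proof
      fix x assume "x \<in> W \<inter> \<Gamma>"
      from \<gamma>_inv[OF this, of 0] show "x \<in> \<gamma> ` (Q \<inter> {y. y \<bullet> e = 0})"
        using r off_axis_inner[OF e, of x] by (intro image_eqI[of _ _ "off_axis e x"]) auto
    qed
    ultimately show ?thesis using W negligible_subset by blast
  qed
  then obtain \<F> where F: "finite \<F>" "\<And>W. W \<in> \<F> \<Longrightarrow> open W \<and> negligible (W \<inter> \<Gamma>)" "\<Gamma> \<subseteq> \<Union>\<F>"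
    using boundary_covering[of "\<lambda>W. negligible (W \<inter> \<Gamma>)"] by metis
  have "negligible (\<Union>((\<lambda>W. W \<inter> \<Gamma>) ` \<F>))" using F by (intro negligible_Union) auto
  then show ?thesis by (rule negligible_subset) (use F in auto)
qed

lemma emeasure_boundary [simp]: "emeasure lborel \<Gamma> = 0"
  using negligible_boundary by (simp add: negligible_iff_emeasure0)

lemma finite_domain: "emeasure lborel \<Omega> < top"
  using emeasure_bounded_finite[OF compact_imp_bounded[OF compact_domain]] by simp

lemma emeasure_surface_measure: "A \<in> sets borel \<Longrightarrow> emeasure (surface_measure \<Omega>) (A \<inter> \<Gamma>) = emeasure \<sigma> (A \<inter> \<Gamma>)"
  unfolding surface_measure_def by (intro emeasure_restrict_space) auto

lemma norm_const_pos: "0 < c"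
proof -
  have "0 < measure lborel \<Omega>"
  proof -
    obtain z d where d: "0 < d" "ball z d \<subseteq> \<Omega>"
      using interior_nonempty by (metis all_not_in_conv mem_interior)
    have "0 < measure lborel (ball z d)" using d(1) by (rule content_ball_pos)
    also have "\<dots> \<le> measure lborel \<Omega>"
      using d(2) finite_domain closed_domain by (intro measure_mono_fmeasurable) (auto simp: fmeasurable_def)
    finally show ?thesis .
  qed
  then show ?thesis unfolding norm_const_def by (simp add: add_pos_nonneg)
qed

lemma sets_ref_measure [measurable_cong]: "sets \<mu> = sets (restrict_space borel \<Omega>)"
  and space_ref_measure [simp]: "space \<mu> = \<Omega>"
proof -
  have sub: "sets (restrict_space borel \<Omega>) \<subseteq> Pow \<Omega>"
    using sets.space_closed[of "restrict_space borel \<Omega>"] by (simp add: space_restrict_space)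
  show "space \<mu> = \<Omega>" unfolding ref_measure_def using sub by (rule space_measure_of)
  have "sigma_sets \<Omega> (sets (restrict_space borel \<Omega>)) = sets (restrict_space borel \<Omega>)"
    using sets.sigma_sets_eq[of "restrict_space borel \<Omega>"] by (simp add: space_restrict_space)
  then show "sets \<mu> = sets (restrict_space borel \<Omega>)" unfolding ref_measure_def using sub by (simp add: sets_measure_of)
qed

lemma sets_ref_iff: "A \<in> sets \<mu> \<longleftrightarrow> A \<in> sets borel \<and> A \<subseteq> \<Omega>"
  unfolding sets_ref_measure using closed_domain by (subst sets_restrict_space_iff) auto

lemma parts_in_sets:
  "D\<Omega> \<in> sets \<mu>" "\<Gamma> \<in> sets \<mu>" "D\<Omega> \<inter> space \<mu> \<in> sets \<mu>" "\<Gamma> \<inter> space \<mu> \<in> sets \<mu>"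
proof -
  have "D\<Omega> \<inter> \<Omega> = D\<Omega>" "\<Gamma> \<inter> \<Omega> = \<Gamma>" using domain_split by blast+
  then show "D\<Omega> \<in> sets \<mu>" "\<Gamma> \<in> sets \<mu>" "D\<Omega> \<inter> space \<mu> \<in> sets \<mu>" "\<Gamma> \<inter> space \<mu> \<in> sets \<mu>"
    by (auto simp: sets_ref_iff)
qed

lemma sets_restrict_ref:
  assumes "A \<subseteq> \<Omega>" shows "sets (restrict_space \<mu> A) = sets (restrict_space borel A)"
proof -
  have "sets (restrict_space \<mu> A) = sets (restrict_space (restrict_space borel \<Omega>) A)"
    by (rule sets_restrict_space_cong[OF sets_ref_measure])
  also have "\<dots> = sets (restrict_space borel (\<Omega> \<inter> A))" by (rule sets_restrict_restrict_space)
  finally show ?thesis using assms by (simp add: inf.absorb2)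
qed

lemma emeasure_ref_measure:
  assumes "A \<in> sets borel" "A \<subseteq> \<Omega>"
  shows "emeasure \<mu> A = ennreal c * (emeasure lborel A + emeasure \<sigma> (A \<inter> \<Gamma>))"
proof -
  let ?f = "\<lambda>A. ennreal c * (emeasure lborel A + emeasure (surface_measure \<Omega>) (A \<inter> \<Gamma>))"
  let ?S = "sets (restrict_space borel \<Omega>)"
  have S: "B \<in> ?S \<longleftrightarrow> B \<in> sets borel \<and> B \<subseteq> \<Omega>" for B using sets_ref_iff sets_ref_measure by simp
  have "emeasure (measure_of \<Omega> ?S ?f) A = ?f A"
  proof (rule emeasure_measure_of_sigma)
    show "sigma_algebra \<Omega> ?S"
      using sets.sigma_algebra_axioms[of "restrict_space borel \<Omega>"] by (simp add: space_restrict_space)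
    show "positive ?S ?f" by (simp add: positive_def)
    show "countably_additive ?S ?f"
    proof (rule countably_additiveI)
      fix B :: "nat \<Rightarrow> 'a set" assume B: "range B \<subseteq> ?S" "disjoint_family B" "(\<Union>i. B i) \<in> ?S"
      then have Bb: "B i \<in> sets borel" for i using S by blast
      have "(\<Sum>i. emeasure lborel (B i)) = emeasure lborel (\<Union>i. B i)"
        using Bb B(2) by (intro suminf_emeasure) auto
      moreover have "(\<Sum>i. emeasure (surface_measure \<Omega>) (B i \<inter> \<Gamma>)) = emeasure (surface_measure \<Omega>) ((\<Union>i. B i) \<inter> \<Gamma>)"
      proof -
        have "(\<Sum>i. emeasure (surface_measure \<Omega>) (B i \<inter> \<Gamma>)) = emeasure (surface_measure \<Omega>) (\<Union>i. B i \<inter> \<Gamma>)"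
          using Bb B(2) by (intro suminf_emeasure) (auto simp: surface_measure_def sets_restrict_space disjoint_family_on_def)
        also have "(\<Union>i. B i \<inter> \<Gamma>) = (\<Union>i. B i) \<inter> \<Gamma>" by blast
        finally show ?thesis .
      qed
      ultimately show "(\<Sum>i. ?f (B i)) = ?f (\<Union>i. B i)" by (simp add: suminf_add[symmetric])
    qed
    show "A \<in> ?S" using assms S by simp
  qed
  then show ?thesis unfolding ref_measure_def using emeasure_surface_measure[OF assms(1)] by simp
qed

sublocale finite_measure \<mu>
proof (rule finite_measureI)
  have "emeasure \<mu> \<Omega> = ennreal c * (emeasure lborel \<Omega> + emeasure \<sigma> (\<Omega> \<inter> \<Gamma>))"
    using closed_domain by (intro emeasure_ref_measure) auto
  also have "\<Omega> \<inter> \<Gamma> = \<Gamma>" using domain_split by blast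
  finally show "emeasure \<mu> (space \<mu>) \<noteq> \<infinity>"
    using less_imp_neq[OF finite_domain] less_imp_neq[OF finite_surface] by (simp add: ennreal_mult_eq_top_iff)
qed

lemma restrict_ref_interior: "restrict_space \<mu> D\<Omega> = density (lborel_on D\<Omega>) (\<lambda>_. ennreal c)"
proof (rule measure_eqI)
  note D = parts_in_sets(3)
  show s: "sets (restrict_space \<mu> D\<Omega>) = sets (density (lborel_on D\<Omega>) (\<lambda>_. ennreal c))"
    using sets_restrict_ref[OF interior_subset] sets_restrict_space_cong[OF sets_lborel, of D\<Omega>] by simp
  fix A assume A: "A \<in> sets (restrict_space \<mu> D\<Omega>)"
  then have A': "A \<in> sets borel" "A \<subseteq> D\<Omega>" unfolding sets_restrict_space_iff[OF D] by (auto simp: sets_ref_iff)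
  have A3: "A \<in> sets (lborel_on D\<Omega>)" using A s by simp
  have "emeasure (restrict_space \<mu> D\<Omega>) A = emeasure \<mu> A" using A'(2) D by (intro emeasure_restrict_space)
  also have "\<dots> = ennreal c * (emeasure lborel A + emeasure \<sigma> (A \<inter> \<Gamma>))"
    using A' interior_subset by (intro emeasure_ref_measure) auto
  also have "A \<inter> \<Gamma> = {}" using A'(2) domain_split by blast
  finally have "emeasure (restrict_space \<mu> D\<Omega>) A = ennreal c * emeasure lborel A" by simp
  also have "\<dots> = emeasure (density (lborel_on D\<Omega>) (\<lambda>_. ennreal c)) A"
    using A' A3 by (simp add: emeasure_density_const emeasure_restrict_space)
  finally show "emeasure (restrict_space \<mu> D\<Omega>) A = emeasure (density (lborel_on D\<Omega>) (\<lambda>_. ennreal c)) A" .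
qed

lemma restrict_ref_boundary: "restrict_space \<mu> \<Gamma> = density (surface_measure \<Omega>) (\<lambda>_. ennreal c)"
proof (rule measure_eqI)
  have sub: "\<Gamma> \<subseteq> \<Omega>" using domain_split by blast
  note D = parts_in_sets(4)
  show s: "sets (restrict_space \<mu> \<Gamma>) = sets (density (surface_measure \<Omega>) (\<lambda>_. ennreal c))"
  proof -
    have "sets (restrict_space \<sigma> \<Gamma>) = sets (restrict_space borel \<Gamma>)" by (rule sets_restrict_space_cong) simp
    then show ?thesis using sets_restrict_ref[OF sub] by (simp add: surface_measure_def)
  qed
  fix A assume A: "A \<in> sets (restrict_space \<mu> \<Gamma>)"
  then have A': "A \<in> sets borel" "A \<subseteq> \<Gamma>" unfolding sets_restrict_space_iff[OF D] by (auto simp: sets_ref_iff)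
  have A3: "A \<in> sets (surface_measure \<Omega>)" using A s by simp
  have "emeasure (restrict_space \<mu> \<Gamma>) A = emeasure \<mu> A" using A'(2) D by (intro emeasure_restrict_space)
  also have "\<dots> = ennreal c * (emeasure lborel A + emeasure \<sigma> (A \<inter> \<Gamma>))"
    using A' sub by (intro emeasure_ref_measure) auto
  also have "emeasure lborel A = 0"
    using emeasure_mono[OF A'(2), of lborel] by simp
  also have "emeasure \<sigma> (A \<inter> \<Gamma>) = emeasure (surface_measure \<Omega>) A"
    using emeasure_surface_measure[OF A'(1)] A'(2) by (simp add: inf.absorb1)
  finally show "emeasure (restrict_space \<mu> \<Gamma>) A = emeasure (density (surface_measure \<Omega>) (\<lambda>_. ennreal c)) A"
    using A' A3 by (simp add: emeasure_density_const)
qed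

lemma integral_interior:
  fixes f :: "'a \<Rightarrow> real"
  assumes "f \<in> borel_measurable \<mu>"
  shows "(LINT x|\<mu>. indicator D\<Omega> x * f x) = c * (LINT x|lborel_on D\<Omega>. f x)"
proof -
  note D = parts_in_sets(3)
  have fm: "f \<in> borel_measurable (lborel_on D\<Omega>)"
    using measurable_restrict_space1[OF assms, of D\<Omega>] unfolding restrict_ref_interior by simp
  have "(LINT x|\<mu>. indicator D\<Omega> x * f x) = (LINT x|restrict_space \<mu> D\<Omega>. f x)"
    by (simp add: integral_restrict_space[OF D])
  also have "\<dots> = (LINT x|lborel_on D\<Omega>. c *\<^sub>R f x)"
    unfolding restrict_ref_interior using fm norm_const_pos by (intro integral_density) auto
  finally show ?thesis by simp
qed

lemma integral_boundary:
  fixes f :: "'a \<Rightarrow> real"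
  assumes "f \<in> borel_measurable \<mu>"
  shows "(LINT x|\<mu>. indicator \<Gamma> x * f x) = c * (LINT x|surface_measure \<Omega>. f x)"
proof -
  note D = parts_in_sets(4)
  have fm: "f \<in> borel_measurable (surface_measure \<Omega>)"
    using measurable_restrict_space1[OF assms, of \<Gamma>] unfolding restrict_ref_boundary by simp
  have "(LINT x|\<mu>. indicator \<Gamma> x * f x) = (LINT x|restrict_space \<mu> \<Gamma>. f x)"
    by (simp add: integral_restrict_space[OF D])
  also have "\<dots> = (LINT x|surface_measure \<Omega>. c *\<^sub>R f x)"
    unfolding restrict_ref_boundary using fm norm_const_pos by (intro integral_density) auto
  finally show ?thesis by simp
qed

lemma nn_integral_boundary:
  assumes "f \<in> borel_measurable borel"
  shows "(\<integral>\<^sup>+x. f x * indicator \<Gamma> x \<partial>\<mu>) = ennreal c * (\<integral>\<^sup>+x. f x * indicator \<Gamma> x \<partial>\<sigma>)"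
proof -
  note D = parts_in_sets(4)
  have "(\<integral>\<^sup>+x. f x * indicator \<Gamma> x \<partial>\<mu>) = (\<integral>\<^sup>+x. f x \<partial>restrict_space \<mu> \<Gamma>)"
    by (rule nn_integral_restrict_space[OF D, symmetric])
  also have "\<dots> = (\<integral>\<^sup>+x. ennreal c * f x \<partial>surface_measure \<Omega>)"
    unfolding restrict_ref_boundary surface_measure_def using assms
    by (intro nn_integral_density) (auto intro: measurable_restrict_space1)
  also have "\<dots> = ennreal c * (\<integral>\<^sup>+x. f x \<partial>surface_measure \<Omega>)"
    using assms unfolding surface_measure_def by (intro nn_integral_cmult) (auto intro: measurable_restrict_space1)
  also have "(\<integral>\<^sup>+x. f x \<partial>surface_measure \<Omega>) = (\<integral>\<^sup>+x. f x * indicator \<Gamma> x \<partial>\<sigma>)"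
    unfolding surface_measure_def by (intro nn_integral_restrict_space) simp
  finally show ?thesis .
qed

section \<open>The gradient of the form\<close>

text \<open>The tangential part of a vector at a boundary point is the tangential gradient of a linear function,
  which spares the choice of a normal field.\<close>

definition proj :: "'a \<Rightarrow> 'a \<Rightarrow> 'a" where
  "proj x v = (if x \<in> \<Gamma> then tangential_gradient \<Gamma> (\<lambda>y. v \<bullet> y) x else v)"

definition form_grad :: "('a \<Rightarrow> real) \<Rightarrow> 'a \<Rightarrow> 'a" where
  "form_grad f x = (if x \<in> \<Gamma> then tangential_gradient \<Gamma> f x else gradient f x)"

definition weight :: "'a \<Rightarrow> real" where
  "weight x = (if x \<in> \<Gamma> then a else 1)"

lemma proj_boundary:
  assumes "defining_function \<Omega> U \<rho> g" "x \<in> U" "x \<in> \<Gamma>"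
  shows "proj x v = v - ((v \<bullet> g x) / (g x \<bullet> g x)) *\<^sub>R g x"
proof -
  have "((\<lambda>y. v \<bullet> y) has_derivative (\<lambda>h. v \<bullet> h)) (at x)" by (auto intro!: derivative_eq_intros)
  from tangential_gradient_frontier[OF assms(1) closed_domain assms(2,3) this] assms(3)
  show ?thesis by (simp add: proj_def)
qed

lemma proj_cases:
  obtains "\<And>v. proj x v = v" | n where "\<And>v. proj x v = v - ((v \<bullet> n) / (n \<bullet> n)) *\<^sub>R n"
proof (cases "x \<in> \<Gamma>")
  case True
  obtain U \<rho> g where D: "defining_function \<Omega> U \<rho> g" "x \<in> U"
    by (rule smooth_boundary_defining_function[OF smooth True])
  show ?thesis using that(2)[OF proj_boundary[OF D True]] .
qed (use that(1) in \<open>simp add: proj_def\<close>)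

lemma proj_add: "proj x (u + v) = proj x u + proj x v"
proof (rule proj_cases[of x])
  fix n assume n: "\<And>v. proj x v = v - ((v \<bullet> n) / (n \<bullet> n)) *\<^sub>R n"
  show ?thesis unfolding n by (simp add: inner_add_left add_divide_distrib scaleR_add_left)
qed simp

lemma proj_scaleR: "proj x (t *\<^sub>R v) = t *\<^sub>R proj x v"
proof (rule proj_cases[of x])
  fix n assume n: "\<And>v. proj x v = v - ((v \<bullet> n) / (n \<bullet> n)) *\<^sub>R n"
  show ?thesis unfolding n by (simp add: scaleR_diff_right)
qed simp

lemma proj_diff: "proj x (u - v) = proj x u - proj x v"
  using proj_add[of x u "(-1) *\<^sub>R v"] proj_scaleR[of x "-1" v] by simp

lemma norm_proj_le: "norm (proj x v) \<le> norm v"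
proof (rule proj_cases[of x])
  fix n assume n: "\<And>v. proj x v = v - ((v \<bullet> n) / (n \<bullet> n)) *\<^sub>R n"
  show ?thesis
  proof (cases "n = 0")
    case False
    then have nn: "n \<bullet> n \<noteq> 0" by simp
    have "proj x v \<bullet> proj x v = v \<bullet> v - (v \<bullet> n)\<^sup>2 / (n \<bullet> n)"
      using nn by (simp add: n inner_diff_left inner_diff_right inner_commute[of n v] power2_eq_square)
    also have "\<dots> \<le> v \<bullet> v" by simp
    finally show ?thesis by (simp add: norm_le)
  qed (simp add: n)
qed simp

definition C1_rep :: "('a \<Rightarrow> real) \<Rightarrow> ('a \<Rightarrow> real) \<Rightarrow> ('a \<Rightarrow> 'a) \<Rightarrow> bool" where
  "C1_rep f g G \<longleftrightarrow> C1_grad UNIV g G \<and> (\<forall>x\<in>\<Omega>. f x = g x)"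

lemma C1_fun_iff: "f \<in> C1_fun \<Omega> \<longleftrightarrow> (\<exists>g G. C1_rep f g G)"
  unfolding C1_fun_def C1_rep_def using C1_grad_imp_Ck_on Ck_on_imp_C1_grad by blast

lemma form_grad_eq:
  assumes "C1_rep f g G" "x \<in> \<Omega>"
  shows "form_grad f x = proj x (G x)"
proof -
  have g: "(g has_derivative (\<lambda>h. G x \<bullet> h)) (at x)" "\<And>y. y \<in> \<Omega> \<Longrightarrow> f y = g y"
    using assms(1) unfolding C1_rep_def by (auto intro: C1_gradD(1))
  show ?thesis
  proof (cases "x \<in> \<Gamma>")
    case True
    obtain U \<rho> g' where D: "defining_function \<Omega> U \<rho> g'" "x \<in> U"
      by (rule smooth_boundary_defining_function[OF smooth True])
    have "tangential_gradient \<Gamma> f x = G x - ((G x \<bullet> g' x) / (g' x \<bullet> g' x)) *\<^sub>R g' x"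
      by (rule tangential_gradient_frontier[OF D(1) closed_domain D(2) True g(1)]) (use g(2) domain_split in blast)
    then show ?thesis using True proj_boundary[OF D True] by (simp add: form_grad_def)
  next
    case False
    then have x: "x \<in> D\<Omega>" using assms(2) domain_split by blast
    have "(f has_derivative (\<lambda>h. G x \<bullet> h)) (at x)"
      by (rule has_derivative_transform_within_open[OF g(1) open_interior x]) (use g(2) interior_subset in force)
    then have "gradient f x = G x" by (rule gradient_eq)
    then show ?thesis using False by (simp add: form_grad_def proj_def)
  qed
qed

lemma continuous_on_proj:
  assumes G: "continuous_on UNIV G"
  shows "continuous_on \<Gamma> (\<lambda>x. proj x (G x))"
  unfolding continuous_on_eq_continuous_within
proof
  fix p assume p: "p \<in> \<Gamma>"
  obtain U \<rho> g where D: "defining_function \<Omega> U \<rho> g" "p \<in> U"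
    by (rule smooth_boundary_defining_function[OF smooth p])
  note DD = defining_functionD[OF D(1)]
  have ne: "g x \<bullet> g x \<noteq> 0" if "x \<in> U" for x using DD(3)[OF that] by simp
  have "continuous_on U (\<lambda>x. G x - ((G x \<bullet> g x) / (g x \<bullet> g x)) *\<^sub>R g x)"
    by (intro continuous_intros continuous_on_subset[OF G] C1_gradD(2)[OF DD(2)]) (use DD(3) in auto)
  then have "continuous_on (U \<inter> \<Gamma>) (\<lambda>x. G x - ((G x \<bullet> g x) / (g x \<bullet> g x)) *\<^sub>R g x)"
    by (rule continuous_on_subset) blast
  then have "continuous_on (U \<inter> \<Gamma>) (\<lambda>x. proj x (G x))"
    using proj_boundary[OF D(1)] by (subst continuous_on_cong[OF refl]) auto
  then have "continuous (at p within \<Gamma> \<inter> U) (\<lambda>x. proj x (G x))"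
    using p D(2) by (simp add: continuous_on_eq_continuous_within Int_commute)
  then show "continuous (at p within \<Gamma>) (\<lambda>x. proj x (G x))"
    using at_within_nhd[OF D(2) DD(1), of \<Gamma> "\<Gamma> \<inter> U"] by simp
qed

lemma proj_measurable:
  assumes "continuous_on UNIV G"
  shows "(\<lambda>x. proj x (G x)) \<in> borel_measurable borel"
proof -
  have "(\<lambda>x. if x \<in> \<Gamma> then proj x (G x) else G x) \<in> borel_measurable borel"
    by (rule borel_measurable_continuous_on_if)
       (use continuous_on_proj[OF assms] continuous_on_subset[OF assms] in auto)
  moreover have "(\<lambda>x. if x \<in> \<Gamma> then proj x (G x) else G x) = (\<lambda>x. proj x (G x))"
    by (simp add: proj_def fun_eq_iff)
  ultimately show ?thesis by simp
qed

lemma borel_measurable_ref: "f \<in> borel_measurable borel \<Longrightarrow> f \<in> borel_measurable \<mu>"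
  using measurable_restrict_space1[of f borel borel \<Omega>]
  by (simp only: measurable_cong_sets[OF sets_ref_measure refl])

lemma weight_measurable [measurable]: "weight \<in> borel_measurable \<mu>"
  unfolding weight_def by (intro borel_measurable_ref) simp

lemma weight_bounds: "0 < weight x" "weight x \<le> 1"
  using a by (auto simp: weight_def)

lemma form_grad_measurable:
  assumes "f \<in> C1_fun \<Omega>"
  shows "form_grad f \<in> borel_measurable \<mu>"
proof -
  obtain g G where f: "C1_rep f g G" using assms C1_fun_iff by blast
  have "(\<lambda>x. proj x (G x)) \<in> borel_measurable \<mu>"
    using f C1_gradD(2) unfolding C1_rep_def by (intro borel_measurable_ref proj_measurable) blast
  then show ?thesis
    by (rule measurable_cong[THEN iffD1, rotated]) (simp add: form_grad_eq[OF f])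
qed

lemma C1_fun_measurable:
  assumes "f \<in> C1_fun \<Omega>"
  shows "f \<in> borel_measurable \<mu>"
proof -
  obtain g G where f: "C1_rep f g G" using assms C1_fun_iff by blast
  have "g \<in> borel_measurable \<mu>"
    using f C1_gradD(3) unfolding C1_rep_def by (intro borel_measurable_ref borel_measurable_continuous_onI) blast
  then show ?thesis
    by (rule measurable_cong[THEN iffD1, rotated]) (use f in \<open>simp add: C1_rep_def\<close>)
qed

lemma continuous_bounded_on_domain:
  fixes G :: "'a \<Rightarrow> 'b::real_normed_vector"
  assumes "continuous_on UNIV G"
  shows "\<exists>B\<ge>0. \<forall>x\<in>\<Omega>. norm (G x) \<le> B"
proof -
  have "bounded (G ` \<Omega>)"
    by (intro compact_imp_bounded compact_continuous_image compact_domain continuous_on_subset[OF assms]) simp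
  then obtain B where "\<forall>x\<in>\<Omega>. norm (G x) \<le> B" by (auto simp: bounded_iff)
  then have "\<forall>x\<in>\<Omega>. norm (G x) \<le> max B 0" by (auto simp: le_max_iff_disj)
  then show ?thesis by (intro exI[of _ "max B 0"]) auto
qed

lemma C1_fun_bounds:
  assumes "f \<in> C1_fun \<Omega>"
  obtains B where "0 \<le> B" "\<And>x. x \<in> \<Omega> \<Longrightarrow> \<bar>f x\<bar> \<le> B" "\<And>x. x \<in> \<Omega> \<Longrightarrow> norm (form_grad f x) \<le> B"
proof -
  obtain g G where f: "C1_rep f g G" using assms C1_fun_iff by blast
  then have gG: "C1_grad UNIV g G" by (simp add: C1_rep_def)
  obtain B1 where B1: "0 \<le> B1" "\<forall>x\<in>\<Omega>. norm (g x) \<le> B1"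
    using continuous_bounded_on_domain[OF C1_gradD(3)[OF gG]] by blast
  obtain B2 where B2: "0 \<le> B2" "\<forall>x\<in>\<Omega>. norm (G x) \<le> B2"
    using continuous_bounded_on_domain[OF C1_gradD(2)[OF gG]] by blast
  show thesis
  proof (rule that[of "max B1 B2"])
    fix x assume x: "x \<in> \<Omega>"
    show "\<bar>f x\<bar> \<le> max B1 B2" using f B1(2) x by (auto simp: C1_rep_def le_max_iff_disj)
    show "norm (form_grad f x) \<le> max B1 B2"
      using form_grad_eq[OF f x] norm_proj_le[of x "G x"] B2(2) x by (auto simp: le_max_iff_disj intro: order_trans)
  qed (use B1 in simp)
qed

lemma integrable_bounded:
  fixes f :: "'a \<Rightarrow> real"
  assumes "f \<in> borel_measurable \<mu>" "\<And>x. x \<in> \<Omega> \<Longrightarrow> norm (f x) \<le> B"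
  shows "integrable \<mu> f"
  by (rule integrable_const_bound[OF AE_I2 assms(1)]) (use assms(2) in simp)

lemma integrable_form_grad:
  assumes "f \<in> C1_fun \<Omega>"
  shows "integrable \<mu> (\<lambda>x. weight x * (norm (form_grad f x))\<^sup>2)"
proof -
  obtain B where B: "0 \<le> B" "\<And>x. x \<in> \<Omega> \<Longrightarrow> norm (form_grad f x) \<le> B" using C1_fun_bounds[OF assms] by metis
  have [measurable]: "form_grad f \<in> borel_measurable \<mu>" by (rule form_grad_measurable[OF assms])
  show ?thesis
  proof (rule integrable_bounded)
    fix x assume x: "x \<in> \<Omega>"
    have "norm ((norm (form_grad f x))\<^sup>2) \<le> B\<^sup>2" by (rule norm_power2_le) (use B(2)[OF x] in simp)
    then have "weight x * (norm (form_grad f x))\<^sup>2 \<le> 1 * B\<^sup>2"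
      using weight_bounds[of x] by (intro mult_mono) auto
    then show "norm (weight x * (norm (form_grad f x))\<^sup>2) \<le> 1 * B\<^sup>2" using weight_bounds[of x] by simp
  qed simp
qed

text \<open>This writes the interior and the boundary part of the energy as one integral, so that all later
  computations are pointwise identities between vectors.\<close>

lemma pre_energy_eq:
  assumes "f \<in> C1_fun \<Omega>"
  shows "pre_energy \<Omega> a f = (LINT x|\<mu>. weight x * (norm (form_grad f x))\<^sup>2)"
proof -
  let ?h = "\<lambda>x. (norm (form_grad f x))\<^sup>2"
  note fm [measurable] = form_grad_measurable[OF assms]
  have hm: "?h \<in> borel_measurable \<mu>" by simp
  have Dm: "D\<Omega> \<in> sets \<mu>" "\<Gamma> \<in> sets \<mu>" using domain_split by (auto simp: sets_ref_iff)
  have "integrable \<mu> ?h"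
  proof -
    obtain B where B: "0 \<le> B" "\<And>x. x \<in> \<Omega> \<Longrightarrow> norm (form_grad f x) \<le> B" using C1_fun_bounds[OF assms] by metis
    show ?thesis by (rule integrable_bounded[of _ "B\<^sup>2"]) (use B norm_power2_le in auto)
  qed
  then have i: "integrable \<mu> (\<lambda>x. indicator D\<Omega> x * ?h x)" "integrable \<mu> (\<lambda>x. indicator \<Gamma> x * ?h x)"
    using integrable_mult_indicator[OF Dm(1), of ?h] integrable_mult_indicator[OF Dm(2), of ?h] by simp_all
  have "(LINT x|\<mu>. weight x * ?h x) = (LINT x|\<mu>. indicator D\<Omega> x * ?h x + a * (indicator \<Gamma> x * ?h x))"
  proof (rule Bochner_Integration.integral_cong[OF refl])
    fix x assume "x \<in> space \<mu>"
    then have "x \<in> \<Omega>" by simp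
    then consider "x \<in> D\<Omega>" "x \<notin> \<Gamma>" | "x \<in> \<Gamma>" "x \<notin> D\<Omega>" using domain_split by blast
    then show "weight x * ?h x = indicator D\<Omega> x * ?h x + a * (indicator \<Gamma> x * ?h x)"
      by cases (simp_all add: weight_def)
  qed
  also have "\<dots> = (LINT x|\<mu>. indicator D\<Omega> x * ?h x) + a * (LINT x|\<mu>. indicator \<Gamma> x * ?h x)"
    using i by simp
  also have "\<dots> = c * (LINT x|lborel_on D\<Omega>. ?h x) + a * (c * (LINT x|surface_measure \<Omega>. ?h x))"
    by (simp only: integral_interior[OF hm] integral_boundary[OF hm])
  also have "c * (LINT x|lborel_on D\<Omega>. ?h x) = (LINT x:D\<Omega>|lborel. (norm (gradient f x))\<^sup>2 * c)"
  proof -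
    have "(LINT x:D\<Omega>|lborel. (norm (gradient f x))\<^sup>2 * c) = (LINT x|lborel_on D\<Omega>. (norm (gradient f x))\<^sup>2 * c)"
      unfolding set_lebesgue_integral_def by (subst integral_restrict_space) auto
    also have "\<dots> = (LINT x|lborel_on D\<Omega>. ?h x * c)"
      using domain_split by (intro Bochner_Integration.integral_cong) (auto simp: form_grad_def space_restrict_space)
    also have "\<dots> = c * (LINT x|lborel_on D\<Omega>. ?h x)" by (simp add: mult.commute)
    finally show ?thesis by (rule sym)
  qed
  also have "c * (LINT x|surface_measure \<Omega>. ?h x) = (LINT x|surface_measure \<Omega>. (norm (tangential_gradient \<Gamma> f x))\<^sup>2 * c)"
  proof -
    have "(LINT x|surface_measure \<Omega>. (norm (tangential_gradient \<Gamma> f x))\<^sup>2 * c) = (LINT x|surface_measure \<Omega>. ?h x * c)"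
      by (intro Bochner_Integration.integral_cong) (auto simp: form_grad_def surface_measure_def space_restrict_space)
    also have "\<dots> = c * (LINT x|surface_measure \<Omega>. ?h x)" by (simp add: mult.commute)
    finally show ?thesis by (rule sym)
  qed
  finally show ?thesis unfolding pre_energy_def by simp
qed

end

context boundary_chart
begin

text \<open>In the chart, the gradient of \<open>F \<circ> \<gamma>\<close> is the gradient of \<open>F\<close> moved along the normal until it is orthogonal to \<open>e\<close>.\<close>

definition chart_grad :: "('a \<Rightarrow> 'a) \<Rightarrow> 'a \<Rightarrow> 'a" where
  "chart_grad G x = G x - ((G x \<bullet> e) / (g x \<bullet> e)) *\<^sub>R g x"

lemma chart_grad_diff: "chart_grad G x - chart_grad G' x = chart_grad (\<lambda>x. G x - G' x) x"
  by (simp add: chart_grad_def inner_diff_left diff_divide_distrib algebra_simps)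

lemma C1_grad_chart:
  assumes F: "C1_grad UNIV F G"
  shows "C1_grad Q (\<lambda>y. F (\<gamma> y)) (\<lambda>y. chart_grad G (\<gamma> y))"
  unfolding C1_grad_def
proof (intro conjI ballI)
  fix y assume y: "y \<in> Q"
  have gy: "g (\<gamma> y) \<bullet> e \<noteq> 0" using g_e \<gamma>_mem[OF y] by blast
  have "((\<lambda>y. F (\<gamma> y)) has_derivative (\<lambda>h. G (\<gamma> y) \<bullet> (off_axis e h - ((g (\<gamma> y) \<bullet> off_axis e h) / (g (\<gamma> y) \<bullet> e)) *\<^sub>R e))) (at y)"
    using has_derivative_compose[OF \<gamma>_deriv[OF y] C1_gradD(1)[OF F UNIV_I]] .
  moreover have "G (\<gamma> y) \<bullet> (off_axis e h - ((g (\<gamma> y) \<bullet> off_axis e h) / (g (\<gamma> y) \<bullet> e)) *\<^sub>R e) = chart_grad G (\<gamma> y) \<bullet> h" for h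
  proof -
    let ?G = "G (\<gamma> y)" and ?g = "g (\<gamma> y)"
    define k where "k = (?G \<bullet> e) / (?g \<bullet> e)"
    have k: "k * (?g \<bullet> e) = ?G \<bullet> e" using gy by (simp add: k_def)
    have "?G \<bullet> (off_axis e h - ((?g \<bullet> off_axis e h) / (?g \<bullet> e)) *\<^sub>R e) = ?G \<bullet> off_axis e h - k * (?g \<bullet> off_axis e h)"
      by (simp add: inner_diff_right k_def)
    also have "\<dots> = ?G \<bullet> h - (h \<bullet> e) * (?G \<bullet> e) - k * (?g \<bullet> h) + (h \<bullet> e) * (k * (?g \<bullet> e))"
      by (simp add: off_axis_def inner_diff_right algebra_simps)
    also have "\<dots> = chart_grad G (\<gamma> y) \<bullet> h"
      unfolding k by (simp add: chart_grad_def k_def[symmetric] inner_diff_left)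
    finally show ?thesis .
  qed
  ultimately show "((\<lambda>y. F (\<gamma> y)) has_derivative (\<lambda>h. chart_grad G (\<gamma> y) \<bullet> h)) (at y)" by simp
next
  have "continuous_on W (chart_grad G)"
    unfolding chart_grad_def using g_e
    by (intro continuous_intros continuous_on_subset[OF C1_gradD(2)[OF F]] continuous_on_subset[OF C1_gradD(2)[OF defining_functionD(2)[OF def_fun]] W(3)]) auto
  then show "continuous_on Q (\<lambda>y. chart_grad G (\<gamma> y))"
    by (rule continuous_on_compose2[OF _ \<gamma>_continuous]) (use \<gamma>_mem in blast)
qed

text \<open>The vectors \<open>chart_grad G x\<close> and \<open>\<tau>\<close> arise from \<open>G x\<close> by moving along \<open>g x\<close>, and \<open>\<tau>\<close> is the shortest such
  vector. The constant \<open>K\<close> controls the angle between \<open>g x\<close> and \<open>e\<close>.\<close>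

lemma chart_grad_bounds:
  assumes x: "x \<in> W" and \<tau>: "\<tau> = G x - ((G x \<bullet> g x) / (g x \<bullet> g x)) *\<^sub>R g x"
  shows "norm (chart_grad G x) \<le> (1 + K) * norm \<tau>" "norm \<tau> \<le> norm (chart_grad G x)" "norm (chart_grad G x) \<le> (1 + K) * norm (G x)"
proof -
  have ge: "g x \<bullet> e \<noteq> 0" "norm (g x) \<le> K * \<bar>g x \<bullet> e\<bar>" using g_e[OF x] by auto
  then have gg: "g x \<bullet> g x \<noteq> 0" by auto
  define k where "k = (\<tau> \<bullet> e) / (g x \<bullet> e)"
  define m where "m = (G x \<bullet> g x) / (g x \<bullet> g x)"
  have bound: "norm (v - ((v \<bullet> e) / (g x \<bullet> e)) *\<^sub>R g x) \<le> (1 + K) * norm v" for v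
  proof -
    have "\<bar>(v \<bullet> e) / (g x \<bullet> e)\<bar> * norm (g x) \<le> \<bar>(v \<bullet> e) / (g x \<bullet> e)\<bar> * (K * \<bar>g x \<bullet> e\<bar>)"
      using ge(2) by (rule mult_left_mono) simp
    also have "\<dots> = K * \<bar>v \<bullet> e\<bar>" using ge(1) by (simp add: abs_divide)
    also have "\<dots> \<le> K * norm v" using Basis_le_norm[OF e, of v] K by (rule mult_left_mono)
    finally have "norm (((v \<bullet> e) / (g x \<bullet> e)) *\<^sub>R g x) \<le> K * norm v" by simp
    then show ?thesis using norm_triangle_ineq4[of v "((v \<bullet> e) / (g x \<bullet> e)) *\<^sub>R g x"] by (simp add: distrib_right)
  qed
  have eq: "chart_grad G x = \<tau> - k *\<^sub>R g x"
  proof -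
    have "k = (G x \<bullet> e) / (g x \<bullet> e) - m"
      using ge(1) by (simp add: k_def \<tau> m_def[symmetric] inner_diff_left diff_divide_distrib)
    then have "chart_grad G x = G x - (k + m) *\<^sub>R g x" by (simp add: chart_grad_def)
    then show ?thesis by (simp add: \<tau> m_def[symmetric] scaleR_add_left)
  qed
  show "norm (chart_grad G x) \<le> (1 + K) * norm \<tau>" using bound[of \<tau>] eq by (simp add: k_def)
  show "norm (chart_grad G x) \<le> (1 + K) * norm (G x)" using bound[of "G x"] by (simp add: chart_grad_def)
  have "\<tau> \<bullet> g x = 0" using gg by (simp add: \<tau> inner_diff_left)
  then have "chart_grad G x \<bullet> chart_grad G x = \<tau> \<bullet> \<tau> + k\<^sup>2 * (g x \<bullet> g x)"
    by (simp add: eq inner_diff_left inner_diff_right inner_commute[of "g x" \<tau>] power2_eq_square)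
  then have "\<tau> \<bullet> \<tau> \<le> chart_grad G x \<bullet> chart_grad G x" by simp
  then show "norm \<tau> \<le> norm (chart_grad G x)" by (simp add: norm_le)
qed

end

context dirichlet_domain
begin

section \<open>Closability of the form\<close>

lemma integral_chart_le:
  assumes "boundary_chart \<Omega> U \<rho> g p e W q r \<gamma> K"
  shows "\<exists>C\<ge>0. \<forall>f B. f \<in> borel_measurable borel \<and> (\<forall>x\<in>\<Omega>. 0 \<le> f x \<and> f x \<le> B) \<longrightarrow>
     (LINT y|lborel_on (box (q - r *\<^sub>R One) (q + r *\<^sub>R One)). f (\<gamma> y)) \<le> C * (LINT x|\<mu>. weight x * f x)"
    and "\<exists>C\<ge>0. \<forall>f B. f \<in> borel_measurable borel \<and> (\<forall>x\<in>\<Omega>. 0 \<le> f x \<and> f x \<le> B) \<longrightarrow>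
     (LINT x|\<mu>. weight x * f x * indicator (W \<inter> \<Gamma>) x) \<le> C * (LINT y|lborel_on (box (q - r *\<^sub>R One) (q + r *\<^sub>R One)). f (\<gamma> y))"
proof -
  interpret ch: boundary_chart \<Omega> U \<rho> g p e W q r \<gamma> K by fact
  let ?R = "lborel_on (box (q - r *\<^sub>R One) (q + r *\<^sub>R One))"
  interpret R: finite_measure ?R by (rule finite_measure_restrict_bounded) auto
  let ?i = "\<lambda>x. indicator (W \<inter> \<Gamma>) x" and ?J = "\<lambda>f. LINT y|?R. f (\<gamma> y)" and ?E = "\<lambda>f. LINT x|\<mu>. weight x * f x"
  let ?S = "\<lambda>f. \<integral>\<^sup>+x. ennreal (f x) * ?i x \<partial>\<sigma>" and ?N = "\<lambda>f. \<integral>\<^sup>+x. ennreal (weight x * f x) * ?i x \<partial>\<mu>"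
    and ?B = "\<lambda>f. LINT x|\<mu>. weight x * f x * ?i x"
  have WM: "W \<inter> \<Gamma> \<in> sets borel" using ch.W(1) by (intro sets.Int) auto
  have \<gamma>\<Omega>: "\<gamma> y \<in> \<Omega>" if "y \<in> box (q - r *\<^sub>R One) (q + r *\<^sub>R One)" for y
    using ch.\<gamma>_mem[OF that] domain_split by blast
  have mg: "\<gamma> \<in> measurable ?R borel"
    by (rule measurable_continuous_restrict_lborel[OF ch.\<gamma>_continuous]) simp
  have iR: "(\<integral>\<^sup>+y. ennreal (f (\<gamma> y)) \<partial>?R) = ennreal (?J f) \<and> 0 \<le> ?J f"
    if f: "f \<in> borel_measurable borel" "\<forall>x\<in>\<Omega>. 0 \<le> f x \<and> f x \<le> B" for f :: "'a \<Rightarrow> real" and B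
  proof
    have "integrable ?R (\<lambda>y. f (\<gamma> y))"
      by (rule R.integrable_const_bound[of _ B]) (use f \<gamma>\<Omega> measurable_compose[OF mg f(1)] in \<open>auto simp: space_restrict_space intro!: AE_I2\<close>)
    then show "(\<integral>\<^sup>+y. ennreal (f (\<gamma> y)) \<partial>?R) = ennreal (?J f)"
      using f \<gamma>\<Omega> by (intro nn_integral_eq_integral AE_I2) (auto simp: space_restrict_space)
    show "0 \<le> ?J f"
      using f \<gamma>\<Omega> by (intro Bochner_Integration.integral_nonneg) (auto simp: space_restrict_space)
  qed
  have im: "integrable \<mu> (\<lambda>x. weight x * f x)" "f \<in> borel_measurable \<mu>"
    if f: "f \<in> borel_measurable borel" "\<forall>x\<in>\<Omega>. 0 \<le> f x \<and> f x \<le> B" for f :: "'a \<Rightarrow> real" and B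
  proof -
    show fm [measurable]: "f \<in> borel_measurable \<mu>" by (rule borel_measurable_ref[OF f(1)])
    show "integrable \<mu> (\<lambda>x. weight x * f x)"
    proof (rule integrable_bounded)
      fix x assume "x \<in> \<Omega>"
      then have fx: "0 \<le> f x" "f x \<le> B" using f(2) by auto
      then have "weight x * f x \<le> 1 * f x" using weight_bounds[of x] by (intro mult_right_mono) auto
      then show "norm (weight x * f x) \<le> B" using fx weight_bounds[of x] by simp
    qed simp
  qed
  have wind: "ennreal (weight x * f x) * ?i x = ennreal a * (ennreal (f x) * ?i x)" for f :: "'a \<Rightarrow> real" and x
    using a by (cases "x \<in> \<Gamma>") (auto simp: weight_def indicator_def ennreal_mult')
  have rel: "?N f = ennreal (a * c) * ?S f"
    if f: "f \<in> borel_measurable borel" for f :: "'a \<Rightarrow> real"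
  proof -
    define F where "F x = ennreal (f x) * ?i x" for x
    have [measurable]: "f \<in> borel_measurable borel" "W \<inter> \<Gamma> \<in> sets borel" by (fact f WM)+
    have Fm: "F \<in> borel_measurable borel" unfolding F_def by measurable
    have FG: "F x * indicator \<Gamma> x = F x" for x by (auto simp: F_def indicator_def)
    have "?N f = (\<integral>\<^sup>+x. ennreal a * F x \<partial>\<mu>)"
      by (simp only: wind F_def)
    also have "\<dots> = ennreal a * (\<integral>\<^sup>+x. F x \<partial>\<mu>)"
      by (rule nn_integral_cmult[OF borel_measurable_ref[OF Fm]])
    also have "\<dots> = ennreal a * (ennreal c * (\<integral>\<^sup>+x. F x \<partial>\<sigma>))"
      using nn_integral_boundary[OF Fm] by (simp only: FG)
    also have "(\<integral>\<^sup>+x. F x \<partial>\<sigma>) = ?S f"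
      by (simp only: F_def)
    finally show ?thesis using a norm_const_pos by (simp add: ennreal_mult mult.assoc)
  qed
  have ac: "0 < a * c" using a norm_const_pos by simp
  show "\<exists>C\<ge>0. \<forall>f B. f \<in> borel_measurable borel \<and> (\<forall>x\<in>\<Omega>. 0 \<le> f x \<and> f x \<le> B) \<longrightarrow>
     ?J f \<le> C * ?E f"
  proof -
    have "\<exists>C\<ge>0. \<forall>f. f \<in> borel_measurable borel \<longrightarrow> (\<integral>\<^sup>+y. f (\<gamma> y) \<partial>?R) \<le> ennreal C * (\<integral>\<^sup>+x. f x * ?i x \<partial>\<sigma>)"
      by (rule ch.nn_integral_chart(1)[OF dim])
    then obtain C where C: "0 \<le> C" "\<And>f. f \<in> borel_measurable borel \<Longrightarrow> (\<integral>\<^sup>+y. f (\<gamma> y) \<partial>?R) \<le> ennreal C * (\<integral>\<^sup>+x. f x * ?i x \<partial>\<sigma>)" by blast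
    have "?J f \<le> (C / (a * c)) * ?E f"
      if f: "f \<in> borel_measurable borel" "\<forall>x\<in>\<Omega>. 0 \<le> f x \<and> f x \<le> B" for f :: "'a \<Rightarrow> real" and B
    proof -
      have w0: "0 \<le> weight x * f x" if "x \<in> \<Omega>" for x using f(2) that weight_bounds[of x] by simp
      have "ennreal (a * c) * ennreal (?J f) \<le> ennreal (a * c) * (ennreal C * ?S f)"
        using C(2)[of "\<lambda>x. ennreal (f x)"] f iR[OF f] by (intro mult_left_mono) auto
      also have "\<dots> = ennreal C * ?N f"
        by (simp only: rel[OF f(1)] mult.left_commute)
      also have "\<dots> \<le> ennreal C * (\<integral>\<^sup>+x. ennreal (weight x * f x) \<partial>\<mu>)"
        by (intro mult_left_mono nn_integral_mono) (auto simp: indicator_def)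
      also have "\<dots> = ennreal (C * ?E f)"
        using im[OF f] w0 C(1) by (subst nn_integral_eq_integral) (auto simp: ennreal_mult')
      finally have fin: "ennreal (a * c) * ennreal (?J f) \<le> ennreal (C * ?E f)" .
      have "(a * c) * ?J f \<le> C * ?E f"
      proof -
        have "0 \<le> ?E f" by (rule Bochner_Integration.integral_nonneg) (use w0 in simp)
        then have "0 \<le> C * ?E f" using C(1) by simp
        moreover have "ennreal ((a * c) * ?J f) \<le> ennreal (C * ?E f)"
          using fin ac by (simp only: ennreal_mult'[OF less_imp_le[OF ac]])
        ultimately show ?thesis by (simp only: ennreal_le_iff)
      qed
      then show ?thesis using ac by (simp add: pos_le_divide_eq mult.commute)
    qed
    then show ?thesis using ac C(1) by (intro exI[of _ "C / (a * c)"]) auto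
  qed
  show "\<exists>C\<ge>0. \<forall>f B. f \<in> borel_measurable borel \<and> (\<forall>x\<in>\<Omega>. 0 \<le> f x \<and> f x \<le> B) \<longrightarrow>
     ?B f \<le> C * ?J f"
  proof -
    have "\<exists>C\<ge>0. \<forall>f. f \<in> borel_measurable borel \<longrightarrow> (\<integral>\<^sup>+x. f x * ?i x \<partial>\<sigma>) \<le> ennreal C * (\<integral>\<^sup>+y. f (\<gamma> y) \<partial>?R)"
      by (rule ch.nn_integral_chart(2)[OF dim])
    then obtain C where C: "0 \<le> C" "\<And>f. f \<in> borel_measurable borel \<Longrightarrow> (\<integral>\<^sup>+x. f x * ?i x \<partial>\<sigma>) \<le> ennreal C * (\<integral>\<^sup>+y. f (\<gamma> y) \<partial>?R)" by blast
    have "?B f \<le> (a * c * C) * ?J f"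
      if f: "f \<in> borel_measurable borel" "\<forall>x\<in>\<Omega>. 0 \<le> f x \<and> f x \<le> B" for f :: "'a \<Rightarrow> real" and B
    proof -
      have w0: "0 \<le> weight x * f x * ?i x" if "x \<in> \<Omega>" for x using f(2) that weight_bounds[of x] by simp
      have WMm: "W \<inter> \<Gamma> \<in> sets \<mu>" using WM domain_split by (auto simp: sets_ref_iff)
      have ii: "integrable \<mu> (\<lambda>x. weight x * f x * ?i x)"
        using integrable_mult_indicator[OF WMm im(1)[OF f]] by (simp add: mult.commute)
      have "ennreal (?B f) = (\<integral>\<^sup>+x. ennreal (weight x * f x * ?i x) \<partial>\<mu>)"
        using ii w0 by (intro nn_integral_eq_integral[symmetric]) auto
      also have "\<dots> = ?N f"
        by (rule nn_integral_cong) (auto simp: indicator_def)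
      also have "\<dots> = ennreal (a * c) * ?S f" by (rule rel[OF f(1)])
      also have "\<dots> \<le> ennreal (a * c) * (ennreal C * ennreal (?J f))"
        using C(2)[of "\<lambda>x. ennreal (f x)"] f iR[OF f] by (intro mult_left_mono) auto
      also have "\<dots> = ennreal ((a * c * C) * ?J f)"
      proof -
        have I0: "0 \<le> ?J f" using iR[OF f] by simp
        show ?thesis
          by (simp only: mult.assoc[of "a * c" C] ennreal_mult[OF less_imp_le[OF ac] mult_nonneg_nonneg[OF C(1) I0]] ennreal_mult[OF C(1) I0])
      qed
      finally show ?thesis using ac C(1) iR[OF f] by (simp add: ennreal_le_iff)
    qed
    then show ?thesis using ac C(1) by (intro exI[of _ "a * c * C"]) auto
  qed
qed

end

context dirichlet_domain
begin

lemma C1_rep_diff: "C1_rep f g G \<Longrightarrow> C1_rep f' g' G' \<Longrightarrow> C1_rep (\<lambda>x. f x - f' x) (\<lambda>x. g x - g' x) (\<lambda>x. G x - G' x)"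
  and C1_rep_add: "C1_rep f g G \<Longrightarrow> C1_rep f' g' G' \<Longrightarrow> C1_rep (\<lambda>x. f x + f' x) (\<lambda>x. g x + g' x) (\<lambda>x. G x + G' x)"
  and C1_rep_mult: "C1_rep f g G \<Longrightarrow> C1_rep f' g' G' \<Longrightarrow>
      C1_rep (\<lambda>x. f x * f' x) (\<lambda>x. g x * g' x) (\<lambda>x. g x *\<^sub>R G' x + g' x *\<^sub>R G x)"
proof -
  assume f: "C1_rep f g G" "C1_rep f' g' G'"
  have d: "(g has_derivative (\<lambda>h. G x \<bullet> h)) (at x)" "(g' has_derivative (\<lambda>h. G' x \<bullet> h)) (at x)" for x
    using f C1_gradD(1)[of UNIV _ _ x] unfolding C1_rep_def by auto
  have c: "continuous_on UNIV G" "continuous_on UNIV G'" "continuous_on UNIV g" "continuous_on UNIV g'"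
    using f C1_gradD(2,3) unfolding C1_rep_def by auto
  show "C1_rep (\<lambda>x. f x - f' x) (\<lambda>x. g x - g' x) (\<lambda>x. G x - G' x)"
    using f unfolding C1_rep_def C1_grad_def
    by (auto intro!: has_derivative_eq_rhs[OF has_derivative_diff[OF d]] continuous_on_diff c simp: inner_diff_left)
  show "C1_rep (\<lambda>x. f x + f' x) (\<lambda>x. g x + g' x) (\<lambda>x. G x + G' x)"
    using f unfolding C1_rep_def C1_grad_def
    by (auto intro!: has_derivative_eq_rhs[OF has_derivative_add[OF d]] continuous_on_add c simp: inner_add_left)
  show "C1_rep (\<lambda>x. f x * f' x) (\<lambda>x. g x * g' x) (\<lambda>x. g x *\<^sub>R G' x + g' x *\<^sub>R G x)"
    using f unfolding C1_rep_def C1_grad_def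
    by (auto intro!: has_derivative_eq_rhs[OF has_derivative_mult[OF d]] continuous_on_add continuous_on_scaleR c simp: inner_add_left)
qed

lemma C1_rep_compose:
  assumes f: "C1_rep f g G" and \<psi>: "\<And>t. (\<psi> has_field_derivative \<psi>' t) (at t)" "continuous_on UNIV \<psi>'"
  shows "C1_rep (\<lambda>x. \<psi> (f x)) (\<lambda>x. \<psi> (g x)) (\<lambda>x. \<psi>' (g x) *\<^sub>R G x)"
proof -
  have d: "(g has_derivative (\<lambda>h. G x \<bullet> h)) (at x)" for x
    using f C1_gradD(1)[of UNIV _ _ x] unfolding C1_rep_def by auto
  have c: "continuous_on UNIV G" "continuous_on UNIV g" using f C1_gradD(2,3) unfolding C1_rep_def by auto
  have "((\<lambda>x. \<psi> (g x)) has_derivative (\<lambda>h. (\<psi>' (g x) *\<^sub>R G x) \<bullet> h)) (at x)" for x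
    by (rule has_derivative_eq_rhs[OF DERIV_compose_FDERIV[OF \<psi>(1) d]]) (simp add: mult.commute)
  moreover have "continuous_on UNIV (\<lambda>x. \<psi>' (g x) *\<^sub>R G x)"
    by (intro continuous_on_scaleR c continuous_on_compose2[OF \<psi>(2) c(2)]) simp
  ultimately have "C1_grad UNIV (\<lambda>x. \<psi> (g x)) (\<lambda>x. \<psi>' (g x) *\<^sub>R G x)" unfolding C1_grad_def by blast
  then show ?thesis using f unfolding C1_rep_def by simp
qed

lemma C1_fun_diff: "f \<in> C1_fun \<Omega> \<Longrightarrow> f' \<in> C1_fun \<Omega> \<Longrightarrow> (\<lambda>x. f x - f' x) \<in> C1_fun \<Omega>"
  and C1_fun_add: "f \<in> C1_fun \<Omega> \<Longrightarrow> f' \<in> C1_fun \<Omega> \<Longrightarrow> (\<lambda>x. f x + f' x) \<in> C1_fun \<Omega>"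
  and C1_fun_mult: "f \<in> C1_fun \<Omega> \<Longrightarrow> f' \<in> C1_fun \<Omega> \<Longrightarrow> (\<lambda>x. f x * f' x) \<in> C1_fun \<Omega>"
  unfolding C1_fun_iff using C1_rep_diff C1_rep_add C1_rep_mult by blast+

lemma form_grad_algebra:
  assumes "f \<in> C1_fun \<Omega>" "f' \<in> C1_fun \<Omega>" "x \<in> \<Omega>"
  shows "form_grad (\<lambda>x. f x - f' x) x = form_grad f x - form_grad f' x"
    and "form_grad (\<lambda>x. f x + f' x) x = form_grad f x + form_grad f' x"
    and "form_grad (\<lambda>x. f x * f' x) x = f x *\<^sub>R form_grad f' x + f' x *\<^sub>R form_grad f x"
proof -
  obtain g G g' G' where r: "C1_rep f g G" "C1_rep f' g' G'" using assms C1_fun_iff by metis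
  have e: "f x = g x" "f' x = g' x" using r assms(3) unfolding C1_rep_def by auto
  show "form_grad (\<lambda>x. f x - f' x) x = form_grad f x - form_grad f' x"
    using form_grad_eq[OF C1_rep_diff[OF r] assms(3)] form_grad_eq[OF r(1) assms(3)] form_grad_eq[OF r(2) assms(3)]
    by (simp add: proj_diff)
  show "form_grad (\<lambda>x. f x + f' x) x = form_grad f x + form_grad f' x"
    using form_grad_eq[OF C1_rep_add[OF r] assms(3)] form_grad_eq[OF r(1) assms(3)] form_grad_eq[OF r(2) assms(3)]
    by (simp add: proj_add)
  show "form_grad (\<lambda>x. f x * f' x) x = f x *\<^sub>R form_grad f' x + f' x *\<^sub>R form_grad f x"
    using form_grad_eq[OF C1_rep_mult[OF r] assms(3)] form_grad_eq[OF r(1) assms(3)] form_grad_eq[OF r(2) assms(3)] e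
    by (simp add: proj_add proj_scaleR)
qed

lemma form_grad_compose:
  assumes "f \<in> C1_fun \<Omega>" "x \<in> \<Omega>" "\<And>t. (\<psi> has_field_derivative \<psi>' t) (at t)" "continuous_on UNIV \<psi>'"
  shows "(\<lambda>x. \<psi> (f x)) \<in> C1_fun \<Omega>" "form_grad (\<lambda>x. \<psi> (f x)) x = \<psi>' (f x) *\<^sub>R form_grad f x"
proof -
  obtain g G where r: "C1_rep f g G" using assms(1) C1_fun_iff by blast
  note r' = C1_rep_compose[OF r assms(3,4)]
  show "(\<lambda>x. \<psi> (f x)) \<in> C1_fun \<Omega>" using r' C1_fun_iff by blast
  show "form_grad (\<lambda>x. \<psi> (f x)) x = \<psi>' (f x) *\<^sub>R form_grad f x"
    using form_grad_eq[OF r' assms(2)] form_grad_eq[OF r assms(2)] r assms(2) by (simp add: proj_scaleR C1_rep_def)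
qed

lemma integral_mono_domain:
  fixes f g :: "'a \<Rightarrow> real"
  assumes "integrable \<mu> f" "integrable \<mu> g" "\<And>x. x \<in> \<Omega> \<Longrightarrow> f x \<le> g x"
  shows "(LINT x|\<mu>. f x) \<le> (LINT x|\<mu>. g x)"
  using assms by (intro integral_mono) auto

lemma integrable_C1_sq: "f \<in> C1_fun \<Omega> \<Longrightarrow> integrable \<mu> (\<lambda>x. (f x)\<^sup>2)"
proof -
  assume f: "f \<in> C1_fun \<Omega>"
  obtain B where "\<And>x. x \<in> \<Omega> \<Longrightarrow> \<bar>f x\<bar> \<le> B" using C1_fun_bounds[OF f] by metis
  then show ?thesis using C1_fun_measurable[OF f] by (intro integrable_bounded[of _ "B\<^sup>2"] norm_power2_le) auto
qed

text \<open>In the interior this is the closability of the gradient. Near a boundary point the chart turns the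
  tangential gradient into the gradient of \<open>F \<circ> \<gamma>\<close> on a box, up to bounded factors.\<close>

lemma form_closable:
  assumes F: "\<And>n. F n \<in> C1_fun \<Omega>" and L2: "(\<lambda>n. LINT x|\<mu>. (F n x)\<^sup>2) \<longlonglongrightarrow> 0"
    and Cauchy: "\<And>e. 0 < e \<Longrightarrow> \<exists>N. \<forall>m\<ge>N. \<forall>n\<ge>N. \<E> (\<lambda>x. F m x - F n x) < e"
  shows "(\<lambda>n. \<E> (F n)) \<longlonglongrightarrow> 0"
proof -
  have "\<forall>n. \<exists>p. C1_rep (F n) (fst p) (snd p)" using F C1_fun_iff by (metis fst_conv snd_conv)
  from choice[OF this] obtain p where p: "\<forall>n. C1_rep (F n) (fst (p n)) (snd (p n))" by blast
  define g where "g n = fst (p n)" for n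
  define G where "G n = snd (p n)" for n
  let ?p = "\<lambda>n x. (norm (proj x (G n x)))\<^sup>2" and ?q = "\<lambda>m n x. (norm (proj x (G m x - G n x)))\<^sup>2"
  let ?b = "\<lambda>W n x. weight x * ?p n x * indicator (W \<inter> \<Gamma>) x" and ?d = "\<lambda>m n x. (norm (form_grad (\<lambda>x. F m x - F n x) x))\<^sup>2"
  let ?D = "lborel_on D\<Omega>"
  have rep: "C1_rep (F n) (g n) (G n)" for n using p by (simp add: g_def G_def)
  have gG: "C1_grad UNIV (g n) (G n)" and Fg: "x \<in> \<Omega> \<Longrightarrow> F n x = g n x" for n x
    using rep[of n] by (auto simp: C1_rep_def)
  have dF: "(\<lambda>x. F m x - F n x) \<in> C1_fun \<Omega>" for m n by (intro C1_fun_diff F)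
  have DF: "form_grad (F n) x = proj x (G n x)" if "x \<in> \<Omega>" for n x by (rule form_grad_eq[OF rep that])
  have DdF: "form_grad (\<lambda>x. F m x - F n x) x = proj x (G m x - G n x)" if "x \<in> \<Omega>" for m n x
    by (rule form_grad_eq[OF C1_rep_diff[OF rep rep] that])
  have [measurable]: "g n \<in> borel_measurable borel" "(\<lambda>x. proj x (G n x)) \<in> borel_measurable borel"
    "(\<lambda>x. proj x (G m x - G n x)) \<in> borel_measurable borel" for m n
    using C1_gradD(2,3)[OF gG] by (auto intro!: borel_measurable_continuous_onI proj_measurable continuous_on_diff)
  have gB: "\<exists>B\<ge>0. \<forall>x\<in>\<Omega>. norm (g n x) \<le> B" for n by (rule continuous_bounded_on_domain[OF C1_gradD(3)[OF gG]])
  have GB: "\<exists>B\<ge>0. \<forall>x\<in>\<Omega>. norm (G n x) \<le> B" for n by (rule continuous_bounded_on_domain[OF C1_gradD(2)[OF gG]])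
  let ?h = "\<lambda>n x. (norm (form_grad (F n) x))\<^sup>2"
  let ?E = "\<lambda>n. LINT x|\<mu>. weight x * ?h n x"
  have sq0: "(LINT x|\<mu>. weight x * (g n x)\<^sup>2) \<le> (LINT x|\<mu>. (F n x)\<^sup>2)" for n
  proof (rule integral_mono_domain[OF _ integrable_C1_sq[OF F]])
    show le: "weight x * (g n x)\<^sup>2 \<le> (F n x)\<^sup>2" if "x \<in> \<Omega>" for x
      using weight_bounds[of x] Fg[OF that] by (simp add: mult_left_le_one_le)
    have [measurable]: "g n \<in> borel_measurable \<mu>" by (rule borel_measurable_ref) simp
    show "integrable \<mu> (\<lambda>x. weight x * (g n x)\<^sup>2)"
      by (rule Bochner_Integration.integrable_bound[OF integrable_C1_sq[OF F[of n]]])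
         (use le weight_bounds in \<open>auto intro!: AE_I2 simp: abs_mult less_imp_le\<close>)
  qed
  have hm [measurable]: "form_grad (F n) \<in> borel_measurable \<mu>" "form_grad (\<lambda>x. F m x - F n x) \<in> borel_measurable \<mu>" for m n
    by (intro form_grad_measurable F dF)+
  have ih: "integrable \<mu> (\<lambda>x. weight x * ?h n x)" for n by (rule integrable_form_grad[OF F])
  \<comment> \<open>The weight is \<open>1\<close> on the interior, so the hypotheses restrict to Lebesgue measure there.\<close>
  have ind_le: "indicator D\<Omega> x * t \<le> weight x * t" if "0 \<le> t" for x t
    using that weight_bounds[of x] domain_split by (cases "x \<in> D\<Omega>") (auto simp: weight_def)
  have int: "(\<lambda>n. LINT x|\<mu>. indicator D\<Omega> x * ?h n x) \<longlonglongrightarrow> 0"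
  proof -
    have "(\<lambda>n. LINT x|?D. (norm (G n x))\<^sup>2) \<longlonglongrightarrow> 0"
    proof (rule gradient_closable[where F=g])
      show "open D\<Omega>" by simp
      show "bounded D\<Omega>" by (rule bounded_interior[OF compact_imp_bounded[OF compact_domain]])
      show "C1_grad D\<Omega> (g n) (G n)" for n using gG[of n] unfolding C1_grad_def by (auto intro: continuous_on_subset)
      show "bounded (g n ` D\<Omega>)" "bounded (G n ` D\<Omega>)" for n
        using gB[of n] GB[of n] interior_subset[of \<Omega>] by (auto simp: bounded_iff subset_iff)
      have le: "c * (LINT x|?D. (g n x)\<^sup>2) \<le> (LINT x|\<mu>. (F n x)\<^sup>2)" for n
      proof -
        have [measurable]: "g n \<in> borel_measurable \<mu>" by (rule borel_measurable_ref) simp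
        have "c * (LINT x|?D. (g n x)\<^sup>2) = (LINT x|\<mu>. indicator D\<Omega> x * (g n x)\<^sup>2)"
          by (rule integral_interior[symmetric]) simp
        also have "\<dots> \<le> (LINT x|\<mu>. (F n x)\<^sup>2)"
        proof (rule integral_mono_domain[OF _ integrable_C1_sq[OF F]])
          show le: "indicator D\<Omega> x * (g n x)\<^sup>2 \<le> (F n x)\<^sup>2" if "x \<in> \<Omega>" for x using Fg[OF that] by (auto simp: indicator_def)
          show "integrable \<mu> (\<lambda>x. indicator D\<Omega> x * (g n x)\<^sup>2)"
            by (rule Bochner_Integration.integrable_bound[OF integrable_C1_sq[OF F[of n]]])
               (use le parts_in_sets in \<open>auto intro!: AE_I2 simp: abs_mult\<close>)
        qed
        finally show ?thesis .
      qed
      have "(\<lambda>n. c * (LINT x|?D. (g n x)\<^sup>2)) \<longlonglongrightarrow> 0"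
        by (rule tendsto_sandwich[OF _ _ tendsto_const L2])
           (use le norm_const_pos in \<open>auto intro!: always_eventually mult_nonneg_nonneg\<close>)
      then show "(\<lambda>n. LINT x|?D. (g n x)\<^sup>2) \<longlonglongrightarrow> 0"
        using norm_const_pos by (simp add: tendsto_mult_left_iff)
      fix e :: real assume "0 < e"
      then have "0 < c * e" using norm_const_pos by simp
      then obtain N where N: "\<forall>m\<ge>N. \<forall>n\<ge>N. \<E> (\<lambda>x. F m x - F n x) < c * e" using Cauchy by blast
      have "(LINT x|?D. (norm (G m x - G n x))\<^sup>2) < e" if "N \<le> m" "N \<le> n" for m n
      proof -
        have "(LINT x|?D. (norm (G m x - G n x))\<^sup>2) = (LINT x|?D. ?d m n x)"
        proof (rule Bochner_Integration.integral_cong)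
        fix x assume "x \<in> space (?D)"
        then have "x \<in> \<Omega>" "x \<notin> \<Gamma>" using domain_split by (auto simp: space_restrict_space)
        then show "(norm (G m x - G n x))\<^sup>2 = ?d m n x" using DdF by (simp add: proj_def)
      qed simp
        also have "c * \<dots> = (LINT x|\<mu>. indicator D\<Omega> x * ?d m n x)"
          by (rule integral_interior[symmetric]) simp
        also have "\<dots> \<le> (LINT x|\<mu>. weight x * ?d m n x)"
        proof (rule integral_mono_domain[OF _ integrable_form_grad[OF dF]])
          show "integrable \<mu> (\<lambda>x. indicator D\<Omega> x * ?d m n x)"
            by (rule Bochner_Integration.integrable_bound[OF integrable_form_grad[OF dF[of m n]]])
               (use ind_le parts_in_sets weight_bounds in \<open>auto intro!: AE_I2 simp: abs_mult less_imp_le\<close>)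
        qed (rule ind_le, simp)
        also have "\<dots> < c * e" using N that pre_energy_eq[OF dF] by simp
        finally show ?thesis using norm_const_pos by simp
      qed
      then show "\<exists>N. \<forall>m\<ge>N. \<forall>n\<ge>N. (LINT x|?D. (norm (G m x - G n x))\<^sup>2) < e" by blast
    qed
    moreover have "(LINT x|\<mu>. indicator D\<Omega> x * ?h n x) = c * (LINT x|?D. (norm (G n x))\<^sup>2)" for n
    proof -
      have "(LINT x|\<mu>. indicator D\<Omega> x * ?h n x) = c * (LINT x|?D. ?h n x)" by (rule integral_interior) simp
      also have "(LINT x|?D. ?h n x) = (LINT x|?D. (norm (G n x))\<^sup>2)"
      proof (rule Bochner_Integration.integral_cong)
        fix x assume "x \<in> space (?D)"
        then have "x \<in> \<Omega>" "x \<notin> \<Gamma>" using domain_split by (auto simp: space_restrict_space)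
        then show "?h n x = (norm (G n x))\<^sup>2" using DF by (simp add: proj_def)
      qed simp
      finally show ?thesis .
    qed
    ultimately show ?thesis by (simp add: tendsto_mult_right_zero)
  qed
  \<comment> \<open>On the boundary the claim is local, and the gradients in a chart inherit the Cauchy property.\<close>
  have bd: "\<exists>W. open W \<and> p \<in> W \<and> (\<lambda>n. LINT x|\<mu>. ?b W n x) \<longlonglongrightarrow> 0" if p: "p \<in> \<Gamma>" for p
  proof -
    obtain U \<rho> g' e W q r \<gamma> K where ch: "boundary_chart \<Omega> U \<rho> g' p e W q r \<gamma> K" by (rule boundary_chart_at[OF p])
    then interpret ch: boundary_chart \<Omega> U \<rho> g' p e W q r \<gamma> K .
    let ?c = "\<lambda>n y. ch.chart_grad (G n) (\<gamma> y)"
    let ?Q = "box (q - r *\<^sub>R One) (q + r *\<^sub>R One)"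
    let ?R = "lborel_on ?Q"
    interpret R: finite_measure ?R by (rule finite_measure_restrict_bounded) auto
    obtain C1 where C1: "0 \<le> C1" "\<And>f B. f \<in> borel_measurable borel \<and> (\<forall>x\<in>\<Omega>. 0 \<le> f x \<and> f x \<le> B) \<Longrightarrow>
       (LINT y|?R. f (\<gamma> y)) \<le> C1 * (LINT x|\<mu>. weight x * f x)"
      using integral_chart_le(1)[OF ch] by blast
    obtain C2 where C2: "0 \<le> C2" "\<And>f B. f \<in> borel_measurable borel \<and> (\<forall>x\<in>\<Omega>. 0 \<le> f x \<and> f x \<le> B) \<Longrightarrow>
       (LINT x|\<mu>. weight x * f x * indicator (W \<inter> \<Gamma>) x) \<le> C2 * (LINT y|?R. f (\<gamma> y))"
      using integral_chart_le(2)[OF ch] by blast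
    have \<gamma>W: "\<gamma> y \<in> W" "\<gamma> y \<in> \<Gamma>" "\<gamma> y \<in> U" "\<gamma> y \<in> \<Omega>" if "y \<in> ?Q" for y
      using ch.\<gamma>_mem[OF that] ch.W(3) domain_split by blast+
    have pr: "proj (\<gamma> y) v = v - ((v \<bullet> g' (\<gamma> y)) / (g' (\<gamma> y) \<bullet> g' (\<gamma> y))) *\<^sub>R g' (\<gamma> y)" if "y \<in> ?Q" for y v
      by (rule proj_boundary[OF ch.def_fun \<gamma>W(3)[OF that] \<gamma>W(2)[OF that]])
    have bnd: "norm (ch.chart_grad H (\<gamma> y)) \<le> (1 + K) * norm (proj (\<gamma> y) (H (\<gamma> y)))"
      "norm (proj (\<gamma> y) (H (\<gamma> y))) \<le> norm (ch.chart_grad H (\<gamma> y))"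
      "norm (ch.chart_grad H (\<gamma> y)) \<le> (1 + K) * norm (H (\<gamma> y))" if "y \<in> ?Q" for y H
      by (rule ch.chart_grad_bounds[OF \<gamma>W(1)[OF that] pr[OF that]])+
    have Cg: "C1_grad ?Q (\<lambda>y. g n (\<gamma> y)) (\<lambda>y. ?c n y)" for n by (rule ch.C1_grad_chart[OF gG])
    have cm: "(\<lambda>y. ?c n y) \<in> borel_measurable ?R" for n
      by (rule measurable_continuous_restrict_lborel[OF C1_gradD(2)[OF Cg]]) simp
    have \<gamma>m: "\<gamma> \<in> measurable ?R borel" by (rule measurable_continuous_restrict_lborel[OF ch.\<gamma>_continuous]) simp
    have cb: "\<exists>B. \<forall>y\<in>?Q. norm (?c n y) \<le> B" for n
    proof -
      obtain B where B: "\<forall>x\<in>\<Omega>. norm (G n x) \<le> B" using GB by blast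
      have "norm (?c n y) \<le> (1 + K) * B" if "y \<in> ?Q" for y
        using bnd(3)[OF that, of "G n"] B \<gamma>W(4)[OF that] ch.K by (meson add_nonneg_nonneg mult_left_mono order_trans zero_le_one)
      then show ?thesis by blast
    qed
    have ib: "integrable ?R (\<lambda>y. (norm (?c m y - ?c n y))\<^sup>2)"
      "integrable ?R (\<lambda>y. (norm (?c n y))\<^sup>2)" for m n
    proof -
      obtain B B' where B: "\<forall>y\<in>?Q. norm (?c m y) \<le> B" "\<forall>y\<in>?Q. norm (?c n y) \<le> B'"
        using cb by meson
      show "integrable ?R (\<lambda>y. (norm (?c n y))\<^sup>2)"
      proof (rule R.integrable_const_bound[of _ "B'\<^sup>2"])
        show "AE y in ?R. norm ((norm (?c n y))\<^sup>2) \<le> B'\<^sup>2"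
        proof (rule AE_I2)
          fix y assume "y \<in> space ?R"
          then have "norm (?c n y) \<le> B'" using B(2) by (simp add: space_restrict_space)
          from power_mono[OF this norm_ge_zero] show "norm ((norm (?c n y))\<^sup>2) \<le> B'\<^sup>2" by simp
        qed
      qed (use cm in simp)
      show "integrable ?R (\<lambda>y. (norm (?c m y - ?c n y))\<^sup>2)"
      proof (rule R.integrable_const_bound[of _ "(B + B')\<^sup>2"])
        show "AE y in ?R. norm ((norm (?c m y - ?c n y))\<^sup>2) \<le> (B + B')\<^sup>2"
        proof (rule AE_I2)
          fix y assume "y \<in> space ?R"
          then have "norm (?c m y) \<le> B" "norm (?c n y) \<le> B'" using B by (simp_all add: space_restrict_space)
          then have "norm (?c m y - ?c n y) \<le> B + B'"
            using norm_triangle_ineq4[of "?c m y" "?c n y"] by linarith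
          from power_mono[OF this norm_ge_zero]
          show "norm ((norm (?c m y - ?c n y))\<^sup>2) \<le> (B + B')\<^sup>2" by simp
        qed
      qed (use cm in simp)
    qed
    have pb: "\<exists>B. \<forall>x\<in>\<Omega>. 0 \<le> ?q m n x \<and> ?q m n x \<le> B" for m n
    proof -
      obtain B B' where B: "\<forall>x\<in>\<Omega>. norm (G m x) \<le> B" "\<forall>x\<in>\<Omega>. norm (G n x) \<le> B'" using GB by meson
      have "norm (proj x (G m x - G n x)) \<le> B + B'" if "x \<in> \<Omega>" for x
        using order_trans[OF norm_proj_le order_trans[OF norm_triangle_ineq4 add_mono]] B that by blast
      then show ?thesis by (intro exI[of _ "(B + B')\<^sup>2"]) (auto intro: power_mono)
    qed
    have pb': "\<exists>B. \<forall>x\<in>\<Omega>. 0 \<le> ?p n x \<and> ?p n x \<le> B" for n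
    proof -
      obtain B where B: "\<forall>x\<in>\<Omega>. norm (G n x) \<le> B" using GB by meson
      then have "norm (proj x (G n x)) \<le> B" if "x \<in> \<Omega>" for x using norm_proj_le order_trans that by blast
      then show ?thesis by (intro exI[of _ "B\<^sup>2"]) (auto intro: power_mono)
    qed
    have lim: "(\<lambda>n. LINT y|?R. (norm (?c n y))\<^sup>2) \<longlonglongrightarrow> 0"
    proof (rule gradient_closable[where F="\<lambda>n y. g n (\<gamma> y)"])
      show "open ?Q" "bounded ?Q" by (simp_all add: open_box)
      show "C1_grad ?Q (\<lambda>y. g n (\<gamma> y)) (\<lambda>y. ?c n y)" for n by (rule Cg)
      show "bounded ((\<lambda>y. g n (\<gamma> y)) ` ?Q)" for n using gB[of n] \<gamma>W(4) by (auto simp: bounded_iff)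
      show "bounded ((\<lambda>y. ?c n y) ` ?Q)" for n using cb[of n] by (auto simp: bounded_iff)
      have le: "(LINT y|?R. (g n (\<gamma> y))\<^sup>2) \<le> C1 * (LINT x|\<mu>. (F n x)\<^sup>2)" for n
      proof -
        obtain B where "\<forall>x\<in>\<Omega>. norm (g n x) \<le> B" using gB by blast
        then have "\<forall>x\<in>\<Omega>. 0 \<le> (g n x)\<^sup>2 \<and> (g n x)\<^sup>2 \<le> B\<^sup>2" using norm_power2_le by fastforce
        then have "(LINT y|?R. (g n (\<gamma> y))\<^sup>2) \<le> C1 * (LINT x|\<mu>. weight x * (g n x)\<^sup>2)" by (intro C1(2)[of "\<lambda>x. (g n x)\<^sup>2"]) simp
        also have "\<dots> \<le> C1 * (LINT x|\<mu>. (F n x)\<^sup>2)" by (rule mult_left_mono[OF sq0 C1(1)])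
        finally show ?thesis .
      qed
      show "(\<lambda>n. LINT y|?R. (g n (\<gamma> y))\<^sup>2) \<longlonglongrightarrow> 0"
        by (rule tendsto_sandwich[OF _ _ tendsto_const tendsto_mult_right_zero[OF L2, of C1]])
           (use le in \<open>auto intro!: always_eventually\<close>)
      fix e :: real assume e: "0 < e"
      define D where "D = (1 + K)\<^sup>2 * C1 + 1"
      have D: "0 < D" using C1(1) by (simp add: D_def add_nonneg_pos)
      obtain N where N: "\<forall>m\<ge>N. \<forall>n\<ge>N. \<E> (\<lambda>x. F m x - F n x) < e / D" using Cauchy[of "e / D"] e D by auto
      have "(LINT y|?R. (norm (?c m y - ?c n y))\<^sup>2) < e" if mn: "N \<le> m" "N \<le> n" for m n
      proof -
        have pm: "(\<lambda>y. ?q m n (\<gamma> y)) \<in> borel_measurable ?R"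
          by (rule measurable_compose[OF \<gamma>m, of "\<lambda>x. ?q m n x"]) simp
        obtain B where B: "\<forall>x\<in>\<Omega>. 0 \<le> ?q m n x \<and> ?q m n x \<le> B" using pb by blast
        have ip: "integrable ?R (\<lambda>y. ?q m n (\<gamma> y))"
          by (rule R.integrable_const_bound[OF AE_I2 pm, of B]) (use B \<gamma>W(4) in \<open>auto simp: space_restrict_space\<close>)
        have E0: "0 \<le> \<E> (\<lambda>x. F m x - F n x)"
          unfolding pre_energy_eq[OF dF] by (rule Bochner_Integration.integral_nonneg) (simp add: weight_bounds less_imp_le)
        have "(LINT y|?R. (norm (?c m y - ?c n y))\<^sup>2)
          \<le> (LINT y|?R. (1 + K)\<^sup>2 * ?q m n (\<gamma> y))"
        proof (rule integral_mono[OF ib(1)])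
          fix y assume "y \<in> space ?R"
          then have y: "y \<in> ?Q" by (simp add: space_restrict_space)
          have "norm (?c m y - ?c n y) \<le> (1 + K) * norm (proj (\<gamma> y) (G m (\<gamma> y) - G n (\<gamma> y)))"
            using bnd(1)[OF y, of "\<lambda>x. G m x - G n x"] by (simp only: ch.chart_grad_diff)
          then show "(norm (?c m y - ?c n y))\<^sup>2 \<le> (1 + K)\<^sup>2 * ?q m n (\<gamma> y)"
            unfolding power_mult_distrib[symmetric] by (rule power_mono) simp
        qed (use ip in simp)
        also have "\<dots> = (1 + K)\<^sup>2 * (LINT y|?R. ?q m n (\<gamma> y))" by simp
        also have "\<dots> \<le> (1 + K)\<^sup>2 * (C1 * (LINT x|\<mu>. weight x * ?q m n x))"
          using B by (intro mult_left_mono C1(2)[of "\<lambda>x. ?q m n x" B]) auto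
        also have "(LINT x|\<mu>. weight x * ?q m n x) = \<E> (\<lambda>x. F m x - F n x)"
          unfolding pre_energy_eq[OF dF] by (rule Bochner_Integration.integral_cong) (simp_all add: DdF)
        also have "(1 + K)\<^sup>2 * (C1 * \<E> (\<lambda>x. F m x - F n x)) \<le> D * \<E> (\<lambda>x. F m x - F n x)"
          unfolding D_def mult.assoc[symmetric] by (rule mult_right_mono[OF _ E0]) simp
        also have "\<dots> < e" using N mn D by (simp add: pos_less_divide_eq mult.commute)
        finally show ?thesis .
      qed
      then show "\<exists>N. \<forall>m\<ge>N. \<forall>n\<ge>N. (LINT y|?R. (norm (?c m y - ?c n y))\<^sup>2) < e" by blast
    qed
    have le: "(LINT x|\<mu>. ?b W n x) \<le> C2 * (LINT y|?R. (norm (?c n y))\<^sup>2)" for n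
    proof -
      obtain B where B: "\<forall>x\<in>\<Omega>. 0 \<le> ?p n x \<and> ?p n x \<le> B" using pb' by blast
      have pm: "(\<lambda>y. ?p n (\<gamma> y)) \<in> borel_measurable ?R"
        by (rule measurable_compose[OF \<gamma>m, of "\<lambda>x. ?p n x"]) simp
      have "(LINT x|\<mu>. ?b W n x) \<le> C2 * (LINT y|?R. ?p n (\<gamma> y))"
        using B by (intro C2(2)[of "\<lambda>x. ?p n x" B]) simp
      also have "\<dots> \<le> C2 * (LINT y|?R. (norm (?c n y))\<^sup>2)"
      proof (rule mult_left_mono[OF integral_mono C2(1)])
        show "integrable ?R (\<lambda>y. ?p n (\<gamma> y))"
          by (rule R.integrable_const_bound[OF AE_I2 pm, of B]) (use B \<gamma>W(4) in \<open>auto simp: space_restrict_space\<close>)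
        show "?p n (\<gamma> y) \<le> (norm (?c n y))\<^sup>2" if "y \<in> space ?R" for y
          using bnd(2)[of y "G n"] that by (intro power_mono) (simp_all add: space_restrict_space)
      qed (rule ib(2))
      finally show ?thesis .
    qed
    have "(\<lambda>n. LINT x|\<mu>. ?b W n x) \<longlonglongrightarrow> 0"
      by (rule tendsto_sandwich[OF _ _ tendsto_const tendsto_mult_right_zero[OF lim, of C2]])
         (use le weight_bounds in \<open>auto intro!: always_eventually Bochner_Integration.integral_nonneg simp: less_imp_le\<close>)
    then show ?thesis using ch.W by blast
  qed
  obtain \<F> where \<F>: "finite \<F>"
    "\<And>W. W \<in> \<F> \<Longrightarrow> open W \<and> (\<lambda>n. LINT x|\<mu>. ?b W n x) \<longlonglongrightarrow> 0" "\<Gamma> \<subseteq> \<Union>\<F>"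
    by (rule boundary_covering[of "\<lambda>W. (\<lambda>n. LINT x|\<mu>. ?b W n x) \<longlonglongrightarrow> 0"])
       (use bd in auto)
  have le: "?E n \<le> (LINT x|\<mu>. indicator D\<Omega> x * ?h n x) + (\<Sum>W\<in>\<F>. LINT x|\<mu>. ?b W n x)" for n
  proof -
    have ihp: "integrable \<mu> (\<lambda>x. weight x * ?p n x)"
      by (rule Bochner_Integration.integrable_cong[THEN iffD1, OF refl _ ih[of n]]) (simp add: DF)
    have iW: "integrable \<mu> (\<lambda>x. ?b W n x)" if "W \<in> \<F>" for W
    proof -
      have "W \<inter> \<Gamma> \<in> sets \<mu>" using \<F>(2)[OF that] domain_split unfolding sets_ref_iff by (auto intro!: sets.Int)
      from integrable_mult_indicator[OF this ihp] show ?thesis by (simp add: mult.commute)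
    qed
    have iD: "integrable \<mu> (\<lambda>x. indicator D\<Omega> x * ?h n x)"
      by (rule Bochner_Integration.integrable_bound[OF ih[of n]])
         (use ind_le parts_in_sets weight_bounds in \<open>auto intro!: AE_I2 simp: abs_mult less_imp_le\<close>)
    have "?E n \<le> (LINT x|\<mu>. indicator D\<Omega> x * ?h n x + (\<Sum>W\<in>\<F>. ?b W n x))"
    proof (rule integral_mono_domain[OF ih])
      show "integrable \<mu> (\<lambda>x. indicator D\<Omega> x * ?h n x + (\<Sum>W\<in>\<F>. ?b W n x))"
        by (intro Bochner_Integration.integrable_add iD Bochner_Integration.integrable_sum iW)
      fix x assume x: "x \<in> \<Omega>"
      have s0: "0 \<le> (\<Sum>W\<in>\<F>. ?b W n x)"
        using weight_bounds[of x] by (intro sum_nonneg) (simp add: less_imp_le)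
      show "weight x * ?h n x \<le> indicator D\<Omega> x * ?h n x + (\<Sum>W\<in>\<F>. ?b W n x)"
      proof (cases "x \<in> \<Gamma>")
        case True
        then obtain W where W: "W \<in> \<F>" "x \<in> W" using \<F>(3) by blast
        have "weight x * ?h n x = ?b W n x" using DF[OF x] True W by simp
        also have "\<dots> \<le> (\<Sum>W\<in>\<F>. ?b W n x)"
          using W(1) \<F>(1) weight_bounds[of x] by (intro member_le_sum) (auto simp: less_imp_le)
        finally show ?thesis by (simp add: add_increasing)
      next
        case False
        then have "x \<in> D\<Omega>" "weight x = 1" using x domain_split by (auto simp: weight_def)
        then show ?thesis using s0 by simp
      qed
    qed
    also have "\<dots> = (LINT x|\<mu>. indicator D\<Omega> x * ?h n x) + (\<Sum>W\<in>\<F>. LINT x|\<mu>. ?b W n x)"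
      using iD iW by (simp add: Bochner_Integration.integral_add Bochner_Integration.integral_sum Bochner_Integration.integrable_sum)
    finally show ?thesis .
  qed
  have "(\<lambda>n. (LINT x|\<mu>. indicator D\<Omega> x * ?h n x) + (\<Sum>W\<in>\<F>. LINT x|\<mu>. ?b W n x)) \<longlonglongrightarrow> 0 + (\<Sum>W\<in>\<F>. 0)"
    by (intro tendsto_add tendsto_sum int) (use \<F>(2) in blast)
  then have "?E \<longlonglongrightarrow> 0"
    by (intro tendsto_sandwich[OF _ _ tendsto_const, of _ ?E])
       (use le weight_bounds in \<open>auto intro!: always_eventually Bochner_Integration.integral_nonneg simp: less_imp_le\<close>)
  then show ?thesis by (simp only: pre_energy_eq[OF F])
qed

end

context dirichlet_domain
begin

section \<open>The Dirichlet form on limits of smooth functions\<close>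

definition sq_int :: "('a \<Rightarrow> real) \<Rightarrow> bool" where
  "sq_int f \<longleftrightarrow> f \<in> borel_measurable \<mu> \<and> integrable \<mu> (\<lambda>x. (f x)\<^sup>2)"

lemma sq_int_C1: "f \<in> C1_fun \<Omega> \<Longrightarrow> sq_int f"
  unfolding sq_int_def using C1_fun_measurable integrable_C1_sq by blast

lemma sq_int_bounded:
  assumes "f \<in> borel_measurable \<mu>" "\<And>x. x \<in> \<Omega> \<Longrightarrow> \<bar>f x\<bar> \<le> B"
  shows "sq_int f"
  unfolding sq_int_def using assms by (auto intro!: integrable_bounded[of _ "B\<^sup>2"] norm_power2_le)

lemma sq_int_add: "sq_int f \<Longrightarrow> sq_int g \<Longrightarrow> sq_int (\<lambda>x. f x + g x)"
  and sq_int_diff: "sq_int f \<Longrightarrow> sq_int g \<Longrightarrow> sq_int (\<lambda>x. f x - g x)"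
proof -
  assume fg: "sq_int f" "sq_int g"
  then have m: "f \<in> borel_measurable \<mu>" "g \<in> borel_measurable \<mu>"
    and i: "integrable \<mu> (\<lambda>x. (f x)\<^sup>2)" "integrable \<mu> (\<lambda>x. (g x)\<^sup>2)" "integrable \<mu> (\<lambda>x. f x * g x)"
    using integrable_mult_of_squares[of f \<mu> g] by (auto simp: sq_int_def)
  have "(\<lambda>x. (f x + g x)\<^sup>2) = (\<lambda>x. (f x)\<^sup>2 + (g x)\<^sup>2 + 2 * (f x * g x))"
    "(\<lambda>x. (f x - g x)\<^sup>2) = (\<lambda>x. (f x)\<^sup>2 + (g x)\<^sup>2 - 2 * (f x * g x))"
    by (auto simp: power2_sum power2_diff)
  then show "sq_int (\<lambda>x. f x + g x)" "sq_int (\<lambda>x. f x - g x)" unfolding sq_int_def using m i by auto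
qed

lemma integral_square_add_le:
  assumes "sq_int f" "sq_int g" "sq_int h" "\<And>x. x \<in> \<Omega> \<Longrightarrow> \<bar>h x\<bar> \<le> \<bar>f x\<bar> + \<bar>g x\<bar>"
  shows "(LINT x|\<mu>. (h x)\<^sup>2) \<le> 2 * (LINT x|\<mu>. (f x)\<^sup>2) + 2 * (LINT x|\<mu>. (g x)\<^sup>2)"
proof -
  have i: "integrable \<mu> (\<lambda>x. (f x)\<^sup>2)" "integrable \<mu> (\<lambda>x. (g x)\<^sup>2)" "integrable \<mu> (\<lambda>x. (h x)\<^sup>2)"
    using assms(1-3) by (auto simp: sq_int_def)
  have "(LINT x|\<mu>. (h x)\<^sup>2) \<le> (LINT x|\<mu>. 2 * (f x)\<^sup>2 + 2 * (g x)\<^sup>2)"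
  proof (rule integral_mono_domain)
    fix x assume "x \<in> \<Omega>"
    then have "(\<bar>h x\<bar>)\<^sup>2 \<le> (\<bar>f x\<bar> + \<bar>g x\<bar>)\<^sup>2" by (intro power_mono assms(4)) auto
    also have "\<dots> \<le> 2 * \<bar>f x\<bar>\<^sup>2 + 2 * \<bar>g x\<bar>\<^sup>2" using sum_squares_bound[of "\<bar>f x\<bar>" "\<bar>g x\<bar>"] by (simp add: power2_sum)
    finally show "(h x)\<^sup>2 \<le> 2 * (f x)\<^sup>2 + 2 * (g x)\<^sup>2" by simp
  qed (use i in auto)
  then show ?thesis using i by simp
qed

definition form :: "('a \<Rightarrow> real) \<Rightarrow> ('a \<Rightarrow> real) \<Rightarrow> real" where
  "form f g = (LINT x|\<mu>. weight x * (form_grad f x \<bullet> form_grad g x))"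

lemma integrable_form:
  assumes f: "f \<in> C1_fun \<Omega>" and g: "g \<in> C1_fun \<Omega>"
  shows "integrable \<mu> (\<lambda>x. weight x * (form_grad f x \<bullet> form_grad g x))"
proof -
  obtain B where B: "0 \<le> B" "\<And>x. x \<in> \<Omega> \<Longrightarrow> norm (form_grad f x) \<le> B" using C1_fun_bounds[OF f] by metis
  obtain C where C: "0 \<le> C" "\<And>x. x \<in> \<Omega> \<Longrightarrow> norm (form_grad g x) \<le> C" using C1_fun_bounds[OF g] by metis
  have [measurable]: "form_grad f \<in> borel_measurable \<mu>" "form_grad g \<in> borel_measurable \<mu>"
    by (intro form_grad_measurable f g)+
  show ?thesis
  proof (rule integrable_bounded)
    fix x assume x: "x \<in> \<Omega>"
    have "\<bar>form_grad f x \<bullet> form_grad g x\<bar> \<le> norm (form_grad f x) * norm (form_grad g x)" by (rule Cauchy_Schwarz_ineq2)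
    also have "\<dots> \<le> B * C" using B(2)[OF x] C(2)[OF x] B(1) by (intro mult_mono) auto
    finally have "weight x * \<bar>form_grad f x \<bullet> form_grad g x\<bar> \<le> 1 * (B * C)"
      using weight_bounds[of x] by (intro mult_mono) auto
    then show "norm (weight x * (form_grad f x \<bullet> form_grad g x)) \<le> B * C"
      using weight_bounds[of x] by (simp add: abs_mult)
  qed simp
qed

lemma pre_energy_form: "f \<in> C1_fun \<Omega> \<Longrightarrow> \<E> f = form f f"
  by (simp add: pre_energy_eq form_def power2_norm_eq_inner)

lemma pre_energy_nonneg: "f \<in> C1_fun \<Omega> \<Longrightarrow> 0 \<le> \<E> f"
  by (simp add: pre_energy_eq Bochner_Integration.integral_nonneg weight_bounds less_imp_le)

lemma pre_energy_add:
  assumes "f \<in> C1_fun \<Omega>" "g \<in> C1_fun \<Omega>"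
  shows "\<E> (\<lambda>x. f x + g x) = \<E> f + 2 * form f g + \<E> g"
    and "\<E> (\<lambda>x. f x - g x) = \<E> f - 2 * form f g + \<E> g"
proof -
  note i = integrable_form[OF assms(1,1)] integrable_form[OF assms] integrable_form[OF assms(2,2)]
  let ?u = "form_grad f" and ?v = "form_grad g"
  have "form (\<lambda>x. f x + g x) (\<lambda>x. f x + g x) = (LINT x|\<mu>. weight x * (?u x \<bullet> ?u x) + 2 * (weight x * (?u x \<bullet> ?v x)) + weight x * (?v x \<bullet> ?v x))"
    unfolding form_def
    by (rule Bochner_Integration.integral_cong)
       (simp_all add: form_grad_algebra(2)[OF assms] inner_add_left inner_add_right inner_commute algebra_simps)
  then show "\<E> (\<lambda>x. f x + g x) = \<E> f + 2 * form f g + \<E> g"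
    using i by (simp add: pre_energy_form C1_fun_add assms form_def)
  have "form (\<lambda>x. f x - g x) (\<lambda>x. f x - g x) = (LINT x|\<mu>. weight x * (?u x \<bullet> ?u x) - 2 * (weight x * (?u x \<bullet> ?v x)) + weight x * (?v x \<bullet> ?v x))"
    unfolding form_def
    by (rule Bochner_Integration.integral_cong)
       (simp_all add: form_grad_algebra(1)[OF assms] inner_diff_left inner_diff_right inner_commute algebra_simps)
  then show "\<E> (\<lambda>x. f x - g x) = \<E> f - 2 * form f g + \<E> g"
    using i by (simp add: pre_energy_form C1_fun_diff assms form_def)
qed

lemma weighted_Cauchy_Schwarz:
  fixes u v :: "'a \<Rightarrow> real"
  assumes [measurable]: "u \<in> borel_measurable \<mu>" "v \<in> borel_measurable \<mu>"
    and i: "integrable \<mu> (\<lambda>x. weight x * (u x)\<^sup>2)" "integrable \<mu> (\<lambda>x. weight x * (v x)\<^sup>2)"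
  shows "(LINT x|\<mu>. weight x * (u x * v x))\<^sup>2 \<le> (LINT x|\<mu>. weight x * (u x)\<^sup>2) * (LINT x|\<mu>. weight x * (v x)\<^sup>2)"
proof -
  have e: "(\<lambda>x. (sqrt (weight x) * u x)\<^sup>2) = (\<lambda>x. weight x * (u x)\<^sup>2)" for u
    using weight_bounds by (auto simp: power_mult_distrib less_imp_le)
  have e2: "weight x * (u x * v x) = (sqrt (weight x) * u x) * (sqrt (weight x) * v x)" for x
  proof -
    have "(sqrt (weight x) * u x) * (sqrt (weight x) * v x) = (sqrt (weight x) * sqrt (weight x)) * (u x * v x)" by (simp only: mult_ac)
    then show ?thesis using weight_bounds[of x] by simp
  qed
  have "(LINT x|\<mu>. (sqrt (weight x) * u x) * (sqrt (weight x) * v x))\<^sup>2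
      \<le> (LINT x|\<mu>. (sqrt (weight x) * u x)\<^sup>2) * (LINT x|\<mu>. (sqrt (weight x) * v x)\<^sup>2)"
    by (rule Cauchy_Schwarz_integral) (use i in \<open>simp_all add: e\<close>)
  then show ?thesis by (simp only: e e2)
qed

lemma form_square_le:
  assumes f: "f \<in> C1_fun \<Omega>" and g: "g \<in> C1_fun \<Omega>"
  shows "(form f g)\<^sup>2 \<le> \<E> f * \<E> g"
proof -
  have [measurable]: "form_grad f \<in> borel_measurable \<mu>" "form_grad g \<in> borel_measurable \<mu>"
    by (intro form_grad_measurable f g)+
  have ii: "integrable \<mu> (\<lambda>x. weight x * (norm (form_grad f x) * norm (form_grad g x)))"
  proof (rule Bochner_Integration.integrable_bound)
    show "integrable \<mu> (\<lambda>x. weight x * (norm (form_grad f x))\<^sup>2 + weight x * (norm (form_grad g x))\<^sup>2)"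
      by (intro Bochner_Integration.integrable_add integrable_form_grad f g)
    show "AE x in \<mu>. norm (weight x * (norm (form_grad f x) * norm (form_grad g x)))
        \<le> norm (weight x * (norm (form_grad f x))\<^sup>2 + weight x * (norm (form_grad g x))\<^sup>2)"
    proof (rule AE_I2)
      fix x
      have "0 \<le> norm (form_grad f x) * norm (form_grad g x)" by simp
      then have "norm (form_grad f x) * norm (form_grad g x) \<le> (norm (form_grad f x))\<^sup>2 + (norm (form_grad g x))\<^sup>2"
        using sum_squares_bound[of "norm (form_grad f x)" "norm (form_grad g x)"] by linarith
      then have "weight x * (norm (form_grad f x) * norm (form_grad g x)) \<le> weight x * ((norm (form_grad f x))\<^sup>2 + (norm (form_grad g x))\<^sup>2)"
        using weight_bounds[of x] by (intro mult_left_mono) auto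
      then show "norm (weight x * (norm (form_grad f x) * norm (form_grad g x)))
        \<le> norm (weight x * (norm (form_grad f x))\<^sup>2 + weight x * (norm (form_grad g x))\<^sup>2)"
        using weight_bounds[of x] by (simp add: abs_mult distrib_left)
    qed
  qed simp
  have "\<bar>form f g\<bar> \<le> (LINT x|\<mu>. \<bar>weight x * (form_grad f x \<bullet> form_grad g x)\<bar>)" unfolding form_def by (rule integral_abs_bound)
  also have "\<dots> \<le> (LINT x|\<mu>. weight x * (norm (form_grad f x) * norm (form_grad g x)))"
  proof (rule integral_mono_domain[OF integrable_abs[OF integrable_form[OF f g]] ii])
    show "\<bar>weight x * (form_grad f x \<bullet> form_grad g x)\<bar> \<le> weight x * (norm (form_grad f x) * norm (form_grad g x))" for x
      using weight_bounds[of x] Cauchy_Schwarz_ineq2[of "form_grad f x" "form_grad g x"] by (simp add: abs_mult)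
  qed
  finally have "\<bar>form f g\<bar>\<^sup>2 \<le> (LINT x|\<mu>. weight x * (norm (form_grad f x) * norm (form_grad g x)))\<^sup>2" by (rule power_mono) simp
  also have "\<dots> \<le> \<E> f * \<E> g"
    unfolding pre_energy_eq[OF f] pre_energy_eq[OF g]
    by (rule weighted_Cauchy_Schwarz) (simp_all add: integrable_form_grad f g)
  finally show ?thesis by simp
qed

lemma pre_energy_add_le:
  assumes "f \<in> C1_fun \<Omega>" "g \<in> C1_fun \<Omega>"
  shows "\<E> (\<lambda>x. f x + g x) \<le> 2 * \<E> f + 2 * \<E> g"
    and "\<E> (\<lambda>x. f x - g x) \<le> 2 * \<E> f + 2 * \<E> g"
  using pre_energy_add[OF assms] pre_energy_nonneg[OF C1_fun_add[OF assms]] pre_energy_nonneg[OF C1_fun_diff[OF assms]]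
  by linarith+

lemma sqrt_pre_energy_diff:
  assumes f: "f \<in> C1_fun \<Omega>" and g: "g \<in> C1_fun \<Omega>"
  shows "\<bar>sqrt (\<E> f) - sqrt (\<E> g)\<bar> \<le> sqrt (\<E> (\<lambda>x. f x - g x))"
proof (rule real_le_rsqrt)
  note p = pre_energy_nonneg[OF f] pre_energy_nonneg[OF g]
  have "\<bar>form f g\<bar> \<le> sqrt (\<E> f * \<E> g)" using form_square_le[OF f g] by (simp add: real_le_rsqrt)
  then have "form f g \<le> sqrt (\<E> f) * sqrt (\<E> g)" by (simp add: real_sqrt_mult)
  then show "\<bar>sqrt (\<E> f) - sqrt (\<E> g)\<bar>\<^sup>2 \<le> \<E> (\<lambda>x. f x - g x)"
    unfolding pre_energy_add(2)[OF f g] using p by (simp add: power2_diff)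
qed

lemma approximatesD:
  assumes "approx F f"
  shows "F n \<in> C1_fun \<Omega>" "\<And>e. 0 < e \<Longrightarrow> \<exists>N. \<forall>m\<ge>N. \<forall>n\<ge>N. \<E> (\<lambda>x. F m x - F n x) < e"
    "(\<lambda>n. LINT x|\<mu>. (F n x - f x)\<^sup>2) \<longlonglongrightarrow> 0"
  using assms unfolding approximates_def by blast+

lemma approximates_const: "f \<in> C1_fun \<Omega> \<Longrightarrow> approx (\<lambda>_. f) f"
proof -
  assume f: "f \<in> C1_fun \<Omega>"
  have "\<E> (\<lambda>x. f x - f x) = 0"
    using pre_energy_add(2)[OF f f] pre_energy_form[OF f] by linarith
  then show ?thesis unfolding approximates_def using f by simp
qed

lemma approximates_add:
  assumes F: "approx F f" "sq_int f" and G: "approx G g" "sq_int g"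
  shows "approx (\<lambda>n x. F n x + G n x) (\<lambda>x. f x + g x)"
    and "approx (\<lambda>n x. F n x - G n x) (\<lambda>x. f x - g x)"
proof -
  note FD = approximatesD[OF F(1)] and GD = approximatesD[OF G(1)]
  have dF: "(\<lambda>x. F m x - F n x) \<in> C1_fun \<Omega>" "(\<lambda>x. G m x - G n x) \<in> C1_fun \<Omega>" for m n
    by (intro C1_fun_diff FD GD)+
  have c: "\<exists>N. \<forall>m\<ge>N. \<forall>n\<ge>N. 2 * \<E> (\<lambda>x. F m x - F n x) + 2 * \<E> (\<lambda>x. G m x - G n x) < e" if e: "0 < e" for e
  proof -
    obtain N1 where N1: "\<forall>m\<ge>N1. \<forall>n\<ge>N1. \<E> (\<lambda>x. F m x - F n x) < e / 4" using FD(2)[of "e / 4"] e by auto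
    obtain N2 where N2: "\<forall>m\<ge>N2. \<forall>n\<ge>N2. \<E> (\<lambda>x. G m x - G n x) < e / 4" using GD(2)[of "e / 4"] e by auto
    have "2 * \<E> (\<lambda>x. F m x - F n x) + 2 * \<E> (\<lambda>x. G m x - G n x) < e"
      if "max N1 N2 \<le> m" "max N1 N2 \<le> n" for m n
    proof -
      have "\<E> (\<lambda>x. F m x - F n x) < e / 4" "\<E> (\<lambda>x. G m x - G n x) < e / 4" using N1 N2 that by auto
      then show ?thesis by linarith
    qed
    then show ?thesis by blast
  qed
  have L: "(\<lambda>n. 2 * (LINT x|\<mu>. (F n x - f x)\<^sup>2) + 2 * (LINT x|\<mu>. (G n x - g x)\<^sup>2)) \<longlonglongrightarrow> 2 * 0 + 2 * 0"
    by (intro tendsto_intros FD GD)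
  note s = sq_int_diff[OF sq_int_C1[OF FD(1)] F(2)] sq_int_diff[OF sq_int_C1[OF GD(1)] G(2)]
  have main: "approx (\<lambda>n x. p (F n x) (G n x)) (\<lambda>x. p (f x) (g x))"
    if p: "p = (+) \<or> p = (-)" for p :: "real \<Rightarrow> real \<Rightarrow> real"
  proof -
    have e: "p s t - p s' t' = p (s - s') (t - t')" "\<bar>p s t\<bar> \<le> \<bar>s\<bar> + \<bar>t\<bar>" for s t s' t' using p by auto
    have C: "u \<in> C1_fun \<Omega> \<Longrightarrow> v \<in> C1_fun \<Omega> \<Longrightarrow> (\<lambda>x. p (u x) (v x)) \<in> C1_fun \<Omega>" for u v
      using p C1_fun_add C1_fun_diff by blast
    have I: "sq_int u \<Longrightarrow> sq_int v \<Longrightarrow> sq_int (\<lambda>x. p (u x) (v x))" for u v using p sq_int_add sq_int_diff by blast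
    have "(LINT x|\<mu>. (p (F n x) (G n x) - p (f x) (g x))\<^sup>2) \<le> 2 * (LINT x|\<mu>. (F n x - f x)\<^sup>2) + 2 * (LINT x|\<mu>. (G n x - g x)\<^sup>2)" for n
      unfolding e(1) by (rule integral_square_add_le[OF s I[OF s] e(2)])
    then have "(\<lambda>n. LINT x|\<mu>. (p (F n x) (G n x) - p (f x) (g x))\<^sup>2) \<longlonglongrightarrow> 0"
      by (intro tendsto_sandwich[OF _ _ tendsto_const L[simplified]] always_eventually allI) simp_all
    moreover have "\<exists>N. \<forall>m\<ge>N. \<forall>n\<ge>N. \<E> (\<lambda>x. p (F m x) (G m x) - p (F n x) (G n x)) < e'" if "0 < e'" for e'
    proof -
      have "\<E> (\<lambda>x. p (F m x - F n x) (G m x - G n x)) \<le> 2 * \<E> (\<lambda>x. F m x - F n x) + 2 * \<E> (\<lambda>x. G m x - G n x)" for m n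
        using p pre_energy_add_le[OF dF] by auto
      then show ?thesis unfolding e(1) using c[OF that] by (meson le_less_trans)
    qed
    ultimately show ?thesis unfolding approximates_def using C FD(1) GD(1) by blast
  qed
  show "approx (\<lambda>n x. F n x + G n x) (\<lambda>x. f x + g x)" using main[of "(+)"] by simp
  show "approx (\<lambda>n x. F n x - G n x) (\<lambda>x. f x - g x)" using main[of "(-)"] by simp
qed

text \<open>The reverse triangle inequality makes the energies of an approximating sequence a Cauchy sequence. Two approximating
  sequences differ by one that approximates \<open>0\<close>, whose energies tend to zero by closability.\<close>

lemma energy_limit:
  assumes F: "approx F f" and f: "sq_int f"
  shows "(\<lambda>n. \<E> (F n)) \<longlonglongrightarrow> energy \<Omega> a f"
proof -
  have ex: "\<exists>e. (\<lambda>n. \<E> (F n)) \<longlonglongrightarrow> e"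
  proof -
    note FD = approximatesD[OF F]
    have "Cauchy (\<lambda>n. sqrt (\<E> (F n)))"
    proof (rule CauchyI)
      fix e :: real assume e: "0 < e"
      then obtain N where N: "\<forall>m\<ge>N. \<forall>n\<ge>N. \<E> (\<lambda>x. F m x - F n x) < e\<^sup>2" using FD(2)[of "e\<^sup>2"] by auto
      have "norm (sqrt (\<E> (F m)) - sqrt (\<E> (F n))) < e" if mn: "m \<ge> N" "n \<ge> N" for m n
      proof -
        have "sqrt (\<E> (\<lambda>x. F m x - F n x)) < sqrt (e\<^sup>2)" using N mn by (simp only: real_sqrt_less_iff)
        then show ?thesis using sqrt_pre_energy_diff[OF FD(1) FD(1), of m n] e by simp
      qed
      then show "\<exists>M. \<forall>m\<ge>M. \<forall>n\<ge>M. norm (sqrt (\<E> (F m)) - sqrt (\<E> (F n))) < e" by blast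
    qed
    then obtain s where "(\<lambda>n. sqrt (\<E> (F n))) \<longlonglongrightarrow> s" using Cauchy_convergent convergent_def by blast
    from tendsto_power[OF this, of 2] show ?thesis using pre_energy_nonneg[OF FD(1)] by auto
  qed
  have uniq: "e = e'" if G: "approx G f" "(\<lambda>n. \<E> (G n)) \<longlonglongrightarrow> e"
    and H: "approx H f" "(\<lambda>n. \<E> (H n)) \<longlonglongrightarrow> e'" for G H e e'
  proof -
    note D = approximates_add(2)[OF G(1) f H(1) f]
    have "(\<lambda>n. \<E> (\<lambda>x. G n x - H n x)) \<longlonglongrightarrow> 0"
      by (rule form_closable[OF approximatesD(1)[OF D]]) (use approximatesD(2,3)[OF D] in simp_all)
    from tendsto_real_sqrt[OF this] have 0: "(\<lambda>n. sqrt (\<E> (\<lambda>x. G n x - H n x))) \<longlonglongrightarrow> 0" by simp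
    have "(\<lambda>n. \<bar>sqrt (\<E> (G n)) - sqrt (\<E> (H n))\<bar>) \<longlonglongrightarrow> 0"
      by (rule tendsto_sandwich[OF _ _ tendsto_const 0])
         (simp_all add: sqrt_pre_energy_diff approximatesD(1)[OF G(1)] approximatesD(1)[OF H(1)])
    moreover have "(\<lambda>n. \<bar>sqrt (\<E> (G n)) - sqrt (\<E> (H n))\<bar>) \<longlonglongrightarrow> \<bar>sqrt e - sqrt e'\<bar>"
      by (intro tendsto_intros G H)
    ultimately have "\<bar>sqrt e - sqrt e'\<bar> = 0" using LIMSEQ_unique by blast
    then show ?thesis by simp
  qed
  obtain e where e: "(\<lambda>n. \<E> (F n)) \<longlonglongrightarrow> e" using ex by blast
  have "energy \<Omega> a f = e"
    unfolding energy_def by (rule the_equality) (use F e uniq in blast)+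
  then show ?thesis using e by simp
qed

text \<open>Polarization gives the limit a quarter of the difference of energies, against an eighth in \<open>dirichlet_form\<close>.\<close>

lemma dirichlet_form_limit:
  assumes "approx F f" "sq_int f" "approx G g" "sq_int g"
  shows "(\<lambda>n. form (F n) (G n)) \<longlonglongrightarrow> 2 * \<D> f g"
proof -
  note FD = approximatesD[OF assms(1)] and GD = approximatesD[OF assms(3)]
  note e = energy_limit[OF approximates_add(1)[OF assms] sq_int_add[OF assms(2,4)]]
    energy_limit[OF approximates_add(2)[OF assms] sq_int_diff[OF assms(2,4)]]
  have "form (F n) (G n) = (\<E> (\<lambda>x. F n x + G n x) - \<E> (\<lambda>x. F n x - G n x)) / 4" for n
    using pre_energy_add[OF FD(1)[of n] GD(1)[of n]] by simp
  moreover have "(\<lambda>n. (\<E> (\<lambda>x. F n x + G n x) - \<E> (\<lambda>x. F n x - G n x)) / 4) \<longlonglongrightarrow>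
      (energy \<Omega> a (\<lambda>x. f x + g x) - energy \<Omega> a (\<lambda>x. f x - g x)) / 4"
    by (intro tendsto_intros e) simp
  ultimately have "(\<lambda>n. form (F n) (G n)) \<longlonglongrightarrow> (energy \<Omega> a (\<lambda>x. f x + g x) - energy \<Omega> a (\<lambda>x. f x - g x)) / 4"
    by (simp only:)
  moreover have "2 * \<D> f g = (energy \<Omega> a (\<lambda>x. f x + g x) - energy \<Omega> a (\<lambda>x. f x - g x)) / 4"
    by (simp add: dirichlet_form_def)
  ultimately show ?thesis by (simp only:)
qed

end

context dirichlet_domain
begin

section \<open>The gradient condition\<close>

lemma pre_energy_mult_le:
  assumes f: "f \<in> C1_fun \<Omega>" and g: "g \<in> C1_fun \<Omega>"
    and B: "\<And>x. x \<in> \<Omega> \<Longrightarrow> \<bar>f x\<bar> \<le> B" "\<And>x. x \<in> \<Omega> \<Longrightarrow> norm (form_grad f x) \<le> B"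
  shows "\<E> (\<lambda>x. f x * g x) \<le> 2 * B\<^sup>2 * \<E> g + 2 * B\<^sup>2 * (LINT x|\<mu>. (g x)\<^sup>2)"
proof -
  have "\<E> (\<lambda>x. f x * g x) \<le> (LINT x|\<mu>. 2 * B\<^sup>2 * (weight x * (norm (form_grad g x))\<^sup>2) + 2 * B\<^sup>2 * (g x)\<^sup>2)"
    unfolding pre_energy_eq[OF C1_fun_mult[OF f g]]
  proof (rule integral_mono_domain[OF integrable_form_grad[OF C1_fun_mult[OF f g]]])
    show "integrable \<mu> (\<lambda>x. 2 * B\<^sup>2 * (weight x * (norm (form_grad g x))\<^sup>2) + 2 * B\<^sup>2 * (g x)\<^sup>2)"
      using integrable_form_grad[OF g] integrable_C1_sq[OF g] by simp
    fix x assume x: "x \<in> \<Omega>"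
    let ?G = "norm (form_grad g x)"
    have "norm (form_grad (\<lambda>x. f x * g x) x) \<le> \<bar>f x\<bar> * ?G + \<bar>g x\<bar> * norm (form_grad f x)"
      unfolding form_grad_algebra(3)[OF f g x] by (rule order_trans[OF norm_triangle_ineq]) simp
    also have "\<dots> \<le> B * ?G + \<bar>g x\<bar> * B" by (intro add_mono mult_right_mono mult_left_mono B x) auto
    finally have "(norm (form_grad (\<lambda>x. f x * g x) x))\<^sup>2 \<le> (B * ?G + \<bar>g x\<bar> * B)\<^sup>2" by (rule power_mono) simp
    also have "\<dots> \<le> 2 * (B * ?G)\<^sup>2 + 2 * (\<bar>g x\<bar> * B)\<^sup>2"
      using sum_squares_bound[of "B * ?G" "\<bar>g x\<bar> * B"] by (simp add: power2_sum)
    finally have "weight x * (norm (form_grad (\<lambda>x. f x * g x) x))\<^sup>2 \<le> weight x * (2 * (B * ?G)\<^sup>2 + 2 * (\<bar>g x\<bar> * B)\<^sup>2)"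
      using weight_bounds[of x] by (intro mult_left_mono) auto
    also have "\<dots> = 2 * B\<^sup>2 * (weight x * ?G\<^sup>2) + weight x * (2 * B\<^sup>2 * (g x)\<^sup>2)" by (simp add: power_mult_distrib algebra_simps)
    also have "weight x * (2 * B\<^sup>2 * (g x)\<^sup>2) \<le> 1 * (2 * B\<^sup>2 * (g x)\<^sup>2)" using weight_bounds[of x] by (intro mult_right_mono) auto
    finally show "weight x * (norm (form_grad (\<lambda>x. f x * g x) x))\<^sup>2 \<le> 2 * B\<^sup>2 * (weight x * ?G\<^sup>2) + 2 * B\<^sup>2 * (g x)\<^sup>2" by simp
  qed
  also have "\<dots> = 2 * B\<^sup>2 * \<E> g + 2 * B\<^sup>2 * (LINT x|\<mu>. (g x)\<^sup>2)"
    unfolding pre_energy_eq[OF g] using integrable_form_grad[OF g] integrable_C1_sq[OF g] by simp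
  finally show ?thesis .
qed

lemma approximates_L2_Cauchy:
  assumes F: "approx F f" and f: "sq_int f" and e: "0 < e"
  shows "\<exists>N. \<forall>m\<ge>N. \<forall>n\<ge>N. (LINT x|\<mu>. (F m x - F n x)\<^sup>2) < e"
proof -
  note FD = approximatesD[OF F]
  have s: "sq_int (\<lambda>x. F n x - f x)" for n by (rule sq_int_diff[OF sq_int_C1[OF FD(1)] f])
  have "\<forall>\<^sub>F n in sequentially. (LINT x|\<mu>. (F n x - f x)\<^sup>2) < e / 4" using order_tendstoD(2)[OF FD(3), of "e / 4"] e by simp
  then obtain N where N: "\<And>n. n \<ge> N \<Longrightarrow> (LINT x|\<mu>. (F n x - f x)\<^sup>2) < e / 4" unfolding eventually_sequentially by blast
  have "(LINT x|\<mu>. (F m x - F n x)\<^sup>2) < e" if "m \<ge> N" "n \<ge> N" for m n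
  proof -
    have "(LINT x|\<mu>. (F m x - F n x)\<^sup>2) \<le> 2 * (LINT x|\<mu>. (F m x - f x)\<^sup>2) + 2 * (LINT x|\<mu>. (F n x - f x)\<^sup>2)"
      by (rule integral_square_add_le[OF s s sq_int_diff[OF sq_int_C1[OF FD(1)] sq_int_C1[OF FD(1)]]]) simp
    then show ?thesis using N[OF that(1)] N[OF that(2)] by linarith
  qed
  then show ?thesis by blast
qed

lemma approximates_mult:
  assumes f: "f \<in> C1_fun \<Omega>" and H: "approx H h" "sq_int h"
  shows "approx (\<lambda>n x. f x * H n x) (\<lambda>x. f x * h x)"
  unfolding approximates_def
proof (intro conjI allI impI)
  note HD = approximatesD[OF H(1)]
  obtain B where B: "0 \<le> B" "\<And>x. x \<in> \<Omega> \<Longrightarrow> \<bar>f x\<bar> \<le> B" "\<And>x. x \<in> \<Omega> \<Longrightarrow> norm (form_grad f x) \<le> B"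
    using C1_fun_bounds[OF f] by blast
  show "(\<lambda>x. f x * H n x) \<in> C1_fun \<Omega>" for n by (rule C1_fun_mult[OF f HD(1)])
  have s: "integrable \<mu> (\<lambda>x. (H n x - h x)\<^sup>2)" for n using sq_int_diff[OF sq_int_C1[OF HD(1)] H(2)] by (simp add: sq_int_def)
  have [measurable]: "f \<in> borel_measurable \<mu>" "h \<in> borel_measurable \<mu>" "H n \<in> borel_measurable \<mu>" for n
    using C1_fun_measurable[OF f] C1_fun_measurable[OF HD(1)] H(2) by (auto simp: sq_int_def)
  have le: "(f x * H n x - f x * h x)\<^sup>2 \<le> B\<^sup>2 * (H n x - h x)\<^sup>2" if "x \<in> \<Omega>" for n x
  proof -
    have "(f x)\<^sup>2 \<le> B\<^sup>2" using power_mono[OF B(2)[OF that] abs_ge_zero, of 2] by simp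
    then have "(f x)\<^sup>2 * (H n x - h x)\<^sup>2 \<le> B\<^sup>2 * (H n x - h x)\<^sup>2" by (intro mult_right_mono) auto
    then show ?thesis by (simp add: power_mult_distrib[symmetric] algebra_simps)
  qed
  have "(LINT x|\<mu>. (f x * H n x - f x * h x)\<^sup>2) \<le> B\<^sup>2 * (LINT x|\<mu>. (H n x - h x)\<^sup>2)" for n
  proof -
    have "(LINT x|\<mu>. (f x * H n x - f x * h x)\<^sup>2) \<le> (LINT x|\<mu>. B\<^sup>2 * (H n x - h x)\<^sup>2)"
    proof (rule integral_mono_domain)
      show "integrable \<mu> (\<lambda>x. (f x * H n x - f x * h x)\<^sup>2)"
        by (rule Bochner_Integration.integrable_bound[OF integrable_mult_right[OF s[of n], of "B\<^sup>2"]])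
           (use le in \<open>auto intro!: AE_I2\<close>)
    qed (use s le in auto)
    then show ?thesis by simp
  qed
  then show "(\<lambda>n. LINT x|\<mu>. (f x * H n x - f x * h x)\<^sup>2) \<longlonglongrightarrow> 0"
    by (intro tendsto_sandwich[OF _ _ tendsto_const tendsto_mult_right_zero[OF HD(3), of "B\<^sup>2"]]) simp_all
  fix e :: real assume e: "0 < e"
  define d where "d = e / (4 * B\<^sup>2 + 1)"
  have p: "0 < 4 * B\<^sup>2 + 1" by (simp add: add_nonneg_pos)
  have d: "0 < d" "(4 * B\<^sup>2 + 1) * d = e" using e p by (simp_all add: d_def)
  obtain N1 where N1: "\<forall>m\<ge>N1. \<forall>n\<ge>N1. \<E> (\<lambda>x. H m x - H n x) < d" using HD(2)[OF d(1)] by blast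
  obtain N2 where N2: "\<forall>m\<ge>N2. \<forall>n\<ge>N2. (LINT x|\<mu>. (H m x - H n x)\<^sup>2) < d" using approximates_L2_Cauchy[OF H d(1)] by blast
  have "\<E> (\<lambda>x. f x * H m x - f x * H n x) < e" if "max N1 N2 \<le> m" "max N1 N2 \<le> n" for m n
  proof -
    have "\<E> (\<lambda>x. f x * H m x - f x * H n x) = \<E> (\<lambda>x. f x * (H m x - H n x))" by (simp add: right_diff_distrib)
    also have "\<dots> \<le> 2 * B\<^sup>2 * \<E> (\<lambda>x. H m x - H n x) + 2 * B\<^sup>2 * (LINT x|\<mu>. (H m x - H n x)\<^sup>2)"
      by (rule pre_energy_mult_le[OF f C1_fun_diff[OF HD(1) HD(1)] B(2,3)])
    also have "\<dots> \<le> 2 * B\<^sup>2 * d + 2 * B\<^sup>2 * d"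
      using N1 N2 that by (intro add_mono mult_left_mono) (auto simp: less_imp_le)
    also have "\<dots> < e" using d by (simp add: algebra_simps)
    finally show ?thesis .
  qed
  then show "\<exists>N. \<forall>m\<ge>N. \<forall>n\<ge>N. \<E> (\<lambda>x. f x * H m x - f x * H n x) < e" by blast
qed

text \<open>The difference of the gradients contains the gradient of \<open>f\<close> multiplied by the difference of the values of
  \<open>\<psi>'\<close>. To make this small by means of \<open>f - g\<close> a bounded gradient is needed, and it is supplied by an auxiliary
  function \<open>k\<close> close to \<open>f\<close> in energy.\<close>

lemma pre_energy_compose_diff_le:
  assumes f: "f \<in> C1_fun \<Omega>" and g: "g \<in> C1_fun \<Omega>" and k: "k \<in> C1_fun \<Omega>"
    and \<psi>: "\<And>t. (\<psi> has_field_derivative \<psi>' t) (at t)" "continuous_on UNIV \<psi>'"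
    and K: "\<And>t. \<bar>\<psi>' t\<bar> \<le> K" and L: "\<And>s t. \<bar>\<psi>' s - \<psi>' t\<bar> \<le> L * \<bar>s - t\<bar>" "0 \<le> L"
    and B: "\<And>x. x \<in> \<Omega> \<Longrightarrow> norm (form_grad k x) \<le> B" "0 \<le> B"
  shows "\<E> (\<lambda>x. \<psi> (f x) - \<psi> (g x)) \<le> 3 * K\<^sup>2 * \<E> (\<lambda>x. f x - g x)
     + 12 * K\<^sup>2 * \<E> (\<lambda>x. f x - k x) + 3 * (L * B)\<^sup>2 * (LINT x|\<mu>. (f x - g x)\<^sup>2)"
proof -
  note dfg = C1_fun_diff[OF f g] and dfk = C1_fun_diff[OF f k]
  have pf: "(\<lambda>x. \<psi> (f x)) \<in> C1_fun \<Omega>" "(\<lambda>x. \<psi> (g x)) \<in> C1_fun \<Omega>"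
    using form_grad_compose(1)[OF f _ \<psi>] form_grad_compose(1)[OF g _ \<psi>] interior_nonempty interior_subset by blast+
  note dp = C1_fun_diff[OF pf]
  let ?u = "\<lambda>x. norm (form_grad (\<lambda>x. f x - g x) x)" and ?v = "\<lambda>x. norm (form_grad (\<lambda>x. f x - k x) x)"
  have i: "integrable \<mu> (\<lambda>x. 3 * K\<^sup>2 * (weight x * (?u x)\<^sup>2) + 12 * K\<^sup>2 * (weight x * (?v x)\<^sup>2) + 3 * (L * B)\<^sup>2 * (f x - g x)\<^sup>2)"
    using integrable_form_grad[OF dfg] integrable_form_grad[OF dfk] integrable_C1_sq[OF dfg] by simp
  have "\<E> (\<lambda>x. \<psi> (f x) - \<psi> (g x))
    \<le> (LINT x|\<mu>. 3 * K\<^sup>2 * (weight x * (?u x)\<^sup>2) + 12 * K\<^sup>2 * (weight x * (?v x)\<^sup>2) + 3 * (L * B)\<^sup>2 * (f x - g x)\<^sup>2)"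
    unfolding pre_energy_eq[OF dp]
  proof (rule integral_mono_domain[OF integrable_form_grad[OF dp] i])
    fix x assume x: "x \<in> \<Omega>"
    let ?d = "\<psi>' (f x) - \<psi>' (g x)"
    have K0: "0 \<le> K" using K[of 0] by linarith
    have e: "form_grad (\<lambda>x. \<psi> (f x) - \<psi> (g x)) x = \<psi>' (g x) *\<^sub>R (form_grad f x - form_grad g x)
        + ?d *\<^sub>R (form_grad f x - form_grad k x) + ?d *\<^sub>R form_grad k x"
      unfolding form_grad_algebra(1)[OF pf x] form_grad_compose(2)[OF f x \<psi>] form_grad_compose(2)[OF g x \<psi>]
      by (simp add: algebra_simps)
    have "norm (form_grad (\<lambda>x. \<psi> (f x) - \<psi> (g x)) x) \<le> \<bar>\<psi>' (g x)\<bar> * ?u x + \<bar>?d\<bar> * ?v x + \<bar>?d\<bar> * norm (form_grad k x)"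
      unfolding e form_grad_algebra(1)[OF f g x] form_grad_algebra(1)[OF f k x]
      by (rule order_trans[OF norm_triangle_ineq], rule add_mono[OF order_trans[OF norm_triangle_ineq]]) simp_all
    also have "\<dots> \<le> K * ?u x + (2 * K) * ?v x + (L * \<bar>f x - g x\<bar>) * B"
      using K[of "f x"] K[of "g x"] L B x K0 by (intro add_mono mult_mono) auto
    finally have "(norm (form_grad (\<lambda>x. \<psi> (f x) - \<psi> (g x)) x))\<^sup>2 \<le> (K * ?u x + (2 * K) * ?v x + (L * \<bar>f x - g x\<bar>) * B)\<^sup>2"
      by (rule power_mono) simp
    also have "\<dots> \<le> 3 * (K * ?u x)\<^sup>2 + 3 * ((2 * K) * ?v x)\<^sup>2 + 3 * ((L * \<bar>f x - g x\<bar>) * B)\<^sup>2"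
    proof -
      have "(p + q + r)\<^sup>2 \<le> 3 * p\<^sup>2 + 3 * q\<^sup>2 + 3 * r\<^sup>2" for p q r :: real
        using sum_squares_bound[of p q] sum_squares_bound[of p r] sum_squares_bound[of q r]
        by (simp add: power2_eq_square algebra_simps)
      then show ?thesis .
    qed
    also have "\<dots> = 3 * K\<^sup>2 * (?u x)\<^sup>2 + 12 * K\<^sup>2 * (?v x)\<^sup>2 + 3 * (L * B)\<^sup>2 * (f x - g x)\<^sup>2"
      by (simp add: power_mult_distrib algebra_simps)
    finally have "weight x * (norm (form_grad (\<lambda>x. \<psi> (f x) - \<psi> (g x)) x))\<^sup>2
       \<le> weight x * (3 * K\<^sup>2 * (?u x)\<^sup>2 + 12 * K\<^sup>2 * (?v x)\<^sup>2 + 3 * (L * B)\<^sup>2 * (f x - g x)\<^sup>2)"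
      using weight_bounds[of x] by (intro mult_left_mono) auto
    also have "\<dots> = 3 * K\<^sup>2 * (weight x * (?u x)\<^sup>2) + 12 * K\<^sup>2 * (weight x * (?v x)\<^sup>2) + weight x * (3 * (L * B)\<^sup>2 * (f x - g x)\<^sup>2)"
      by (simp add: algebra_simps)
    also have "weight x * (3 * (L * B)\<^sup>2 * (f x - g x)\<^sup>2) \<le> 1 * (3 * (L * B)\<^sup>2 * (f x - g x)\<^sup>2)"
      using weight_bounds[of x] by (intro mult_right_mono) auto
    finally show "weight x * (norm (form_grad (\<lambda>x. \<psi> (f x) - \<psi> (g x)) x))\<^sup>2
      \<le> 3 * K\<^sup>2 * (weight x * (?u x)\<^sup>2) + 12 * K\<^sup>2 * (weight x * (?v x)\<^sup>2) + 3 * (L * B)\<^sup>2 * (f x - g x)\<^sup>2" by simp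
  qed
  also have "\<dots> = 3 * K\<^sup>2 * \<E> (\<lambda>x. f x - g x)
     + 12 * K\<^sup>2 * \<E> (\<lambda>x. f x - k x) + 3 * (L * B)\<^sup>2 * (LINT x|\<mu>. (f x - g x)\<^sup>2)"
    unfolding pre_energy_eq[OF dfg] pre_energy_eq[OF dfk]
    using integrable_form_grad[OF dfg] integrable_form_grad[OF dfk] integrable_C1_sq[OF dfg] by simp
  finally show ?thesis .
qed

lemma approximates_compose:
  assumes F: "approx F f" "sq_int f" and g: "sq_int g" "\<And>x. x \<in> \<Omega> \<Longrightarrow> g x = \<psi> (f x)"
    and \<psi>: "\<And>t. (\<psi> has_field_derivative \<psi>' t) (at t)" "continuous_on UNIV \<psi>'"
    and K: "\<And>t. \<bar>\<psi>' t\<bar> \<le> K" and L: "\<And>s t. \<bar>\<psi>' s - \<psi>' t\<bar> \<le> L * \<bar>s - t\<bar>" "0 \<le> L"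
  shows "approx (\<lambda>n x. \<psi> (F n x)) g"
  unfolding approximates_def
proof (intro conjI allI impI)
  note FD = approximatesD[OF F(1)]
  show C: "(\<lambda>x. \<psi> (F n x)) \<in> C1_fun \<Omega>" for n
    using form_grad_compose(1)[OF FD(1) _ \<psi>] interior_nonempty interior_subset by blast
  have K0: "0 \<le> K" using K[of 0] by linarith
  have s: "integrable \<mu> (\<lambda>x. (F n x - f x)\<^sup>2)" "integrable \<mu> (\<lambda>x. (\<psi> (F n x) - g x)\<^sup>2)" for n
    using sq_int_diff[OF sq_int_C1[OF FD(1)] F(2)] sq_int_diff[OF sq_int_C1[OF C] g(1)] by (simp_all add: sq_int_def)
  have "(LINT x|\<mu>. (\<psi> (F n x) - g x)\<^sup>2) \<le> K\<^sup>2 * (LINT x|\<mu>. (F n x - f x)\<^sup>2)" for n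
  proof -
    have "(LINT x|\<mu>. (\<psi> (F n x) - g x)\<^sup>2) \<le> (LINT x|\<mu>. K\<^sup>2 * (F n x - f x)\<^sup>2)"
    proof (rule integral_mono_domain[OF s(2) integrable_mult_right[OF s(1)]])
      fix x assume x: "x \<in> \<Omega>"
      have "norm (\<psi> (F n x) - \<psi> (f x)) \<le> K * norm (F n x - f x)"
        by (rule field_differentiable_bound[of UNIV \<psi> \<psi>']) (use \<psi> K in auto)
      then have "\<bar>\<psi> (F n x) - \<psi> (f x)\<bar>\<^sup>2 \<le> (K * \<bar>F n x - f x\<bar>)\<^sup>2" by (intro power_mono) auto
      then show "(\<psi> (F n x) - g x)\<^sup>2 \<le> K\<^sup>2 * (F n x - f x)\<^sup>2" by (simp add: g(2)[OF x] power_mult_distrib)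
    qed
    then show ?thesis by simp
  qed
  then show "(\<lambda>n. LINT x|\<mu>. (\<psi> (F n x) - g x)\<^sup>2) \<longlonglongrightarrow> 0"
    by (intro tendsto_sandwich[OF _ _ tendsto_const tendsto_mult_right_zero[OF FD(3), of "K\<^sup>2"]]) simp_all
  fix e :: real assume e: "0 < e"
  \<comment> \<open>The coefficient is the sum of the factors \<open>3 * K\<^sup>2\<close> and \<open>12 * K\<^sup>2\<close> of the two energies.\<close>
  define d where "d = (e / 2) / (15 * K\<^sup>2 + 1)"
  have cancel: "p * (q / p) = q" if "0 < p" for p q :: real using that by simp
  have p: "0 < 15 * K\<^sup>2 + 1" by (simp add: add_nonneg_pos)
  have d: "0 < d" "(15 * K\<^sup>2 + 1) * d = e / 2"
    unfolding d_def by (rule divide_pos_pos[OF half_gt_zero[OF e] p], rule cancel[OF p])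
  obtain k where k: "\<forall>m\<ge>k. \<forall>n\<ge>k. \<E> (\<lambda>x. F m x - F n x) < d" using FD(2)[OF d(1)] by blast
  obtain B where B: "0 \<le> B" "\<And>x. x \<in> \<Omega> \<Longrightarrow> norm (form_grad (F k) x) \<le> B" using C1_fun_bounds[OF FD(1)[of k]] by metis
  define d' where "d' = (e / 2) / (3 * (L * B)\<^sup>2 + 1)"
  have p': "0 < 3 * (L * B)\<^sup>2 + 1" by (simp add: add_nonneg_pos)
  have d': "0 < d'" "(3 * (L * B)\<^sup>2 + 1) * d' = e / 2"
    unfolding d'_def by (rule divide_pos_pos[OF half_gt_zero[OF e] p'], rule cancel[OF p'])
  obtain N where N: "\<forall>m\<ge>N. \<forall>n\<ge>N. (LINT x|\<mu>. (F m x - F n x)\<^sup>2) < d'" using approximates_L2_Cauchy[OF F d'(1)] by blast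
  have "\<E> (\<lambda>x. \<psi> (F m x) - \<psi> (F n x)) < e" if mn: "max k N \<le> m" "max k N \<le> n" for m n
  proof -
    have "\<E> (\<lambda>x. \<psi> (F m x) - \<psi> (F n x)) \<le> 3 * K\<^sup>2 * \<E> (\<lambda>x. F m x - F n x)
      + 12 * K\<^sup>2 * \<E> (\<lambda>x. F m x - F k x) + 3 * (L * B)\<^sup>2 * (LINT x|\<mu>. (F m x - F n x)\<^sup>2)"
      by (rule pre_energy_compose_diff_le[OF FD(1) FD(1) FD(1) \<psi> K L B(2,1)])
    also have "\<dots> \<le> 3 * K\<^sup>2 * d + 12 * K\<^sup>2 * d + 3 * (L * B)\<^sup>2 * d'"
      using k N mn by (intro add_mono mult_left_mono) (auto simp: less_imp_le)
    also have "\<dots> < e" using d d' by (simp add: algebra_simps)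
    finally show ?thesis .
  qed
  then show "\<exists>N. \<forall>m\<ge>N. \<forall>n\<ge>N. \<E> (\<lambda>x. \<psi> (F m x) - \<psi> (F n x)) < e" by blast
qed

lemma D_bcD:
  assumes "f \<in> D_bc \<Omega> a"
  shows "sq_int f" "\<exists>F. approx F f" "continuous_on \<Omega> f" "\<exists>M\<ge>0. \<forall>x\<in>\<Omega>. \<bar>f x\<bar> \<le> M"
proof -
  show "sq_int f" "\<exists>F. approx F f" "continuous_on \<Omega> f"
    using assms by (auto simp: D_bc_def form_domain_def sq_int_def)
  obtain M where "\<forall>x\<in>\<Omega>. \<bar>f x\<bar> \<le> M" using assms by (auto simp: D_bc_def bounded_iff)
  then show "\<exists>M\<ge>0. \<forall>x\<in>\<Omega>. \<bar>f x\<bar> \<le> M" by (intro exI[of _ "max M 0"]) auto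
qed

lemma C1_fun_in_D_bc: "f \<in> C1_fun \<Omega> \<Longrightarrow> f \<in> D_bc \<Omega> a"
proof -
  assume f: "f \<in> C1_fun \<Omega>"
  obtain g G where r: "C1_rep f g G" using f C1_fun_iff by blast
  then have "continuous_on \<Omega> g" using continuous_on_subset[OF C1_gradD(3)[of UNIV g G]] by (auto simp: C1_rep_def)
  then have "continuous_on \<Omega> f" using r by (simp add: C1_rep_def cong: continuous_on_cong)
  moreover obtain B where "\<And>x. x \<in> \<Omega> \<Longrightarrow> \<bar>f x\<bar> \<le> B" using C1_fun_bounds[OF f] by metis
  then have "bounded (f ` \<Omega>)" by (auto simp: bounded_iff)
  ultimately show ?thesis
    using sq_int_C1[OF f] approximates_const[OF f] by (auto simp: D_bc_def form_domain_def sq_int_def)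
qed

text \<open>The products cancel pointwise: with \<open>u\<close> and \<open>v\<close> the gradients of \<open>f\<close> and \<open>h\<close>,
  \<open>(f v + h u) \<bullet> u - (2 f u \<bullet> v) / 2 = h (u \<bullet> u)\<close>. As \<open>a \<le> 1\<close>, the weight cannot increase this.\<close>

lemma C1_contraction_in_D_0:
  assumes f: "f \<in> C1_fun \<Omega>" and le1: "\<And>x. x \<in> \<Omega> \<Longrightarrow> norm (form_grad f x) \<le> 1"
  shows "f \<in> D_0 \<Omega> a"
proof -
  have "2 * \<D> (\<lambda>x. f x * h x) f - \<D> (\<lambda>x. (f x)\<^sup>2) h \<le> (LINT x|\<mu>. \<bar>h x\<bar>)"
    if h: "h \<in> D_bc \<Omega> a" for h
  proof -
    note hD = D_bcD[OF h]
    obtain H where H: "approx H h" using hD by blast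
    note HD = approximatesD[OF H]
    obtain M where M: "\<forall>x\<in>\<Omega>. \<bar>h x\<bar> \<le> M" using hD by blast
    obtain B where B: "\<And>x. x \<in> \<Omega> \<Longrightarrow> \<bar>f x\<bar> \<le> B" using C1_fun_bounds[OF f] by metis
    have [measurable]: "h \<in> borel_measurable \<mu>" "f \<in> borel_measurable \<mu>" "H n \<in> borel_measurable \<mu>"
      "form_grad f \<in> borel_measurable \<mu>" for n
      using hD(1) C1_fun_measurable[OF f] C1_fun_measurable[OF HD(1)] form_grad_measurable[OF f] by (auto simp: sq_int_def)
    have ff: "(\<lambda>x. f x * f x) \<in> C1_fun \<Omega>" by (rule C1_fun_mult[OF f f])
    have "sq_int (\<lambda>x. f x * h x)"
    proof (rule sq_int_bounded)
      show "\<bar>f x * h x\<bar> \<le> B * M" if "x \<in> \<Omega>" for x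
        unfolding abs_mult by (rule mult_mono) (use B[OF that] M that in auto)
    qed simp
    then have l1: "(\<lambda>n. form (\<lambda>x. f x * H n x) f) \<longlonglongrightarrow> 2 * \<D> (\<lambda>x. f x * h x) f"
      by (rule dirichlet_form_limit[OF approximates_mult[OF f H hD(1)] _ approximates_const[OF f] sq_int_C1[OF f]])
    have l2: "(\<lambda>n. form (\<lambda>x. f x * f x) (H n)) \<longlonglongrightarrow> 2 * \<D> (\<lambda>x. f x * f x) h"
      by (rule dirichlet_form_limit[OF approximates_const[OF ff] sq_int_C1[OF ff] H hD(1)])
    have "(\<lambda>n. form (\<lambda>x. f x * H n x) f - form (\<lambda>x. f x * f x) (H n) / 2) \<longlonglongrightarrow>
        2 * \<D> (\<lambda>x. f x * h x) f - 2 * \<D> (\<lambda>x. f x * f x) h / 2"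
      by (intro tendsto_intros l1 l2) simp
    moreover have "form (\<lambda>x. f x * H n x) f - form (\<lambda>x. f x * f x) (H n) / 2 \<le> (LINT x|\<mu>. \<bar>H n x - h x\<bar> * 1) + (LINT x|\<mu>. \<bar>h x\<bar>)" for n
    proof -
      note i = integrable_form[OF C1_fun_mult[OF f HD(1)[of n]] f] integrable_form[OF ff HD(1)[of n]]
      have iH: "integrable \<mu> (\<lambda>x. \<bar>h x\<bar>)" by (rule integrable_bounded[of _ M]) (use M in auto)
      obtain C where C: "\<And>x. x \<in> \<Omega> \<Longrightarrow> \<bar>H n x\<bar> \<le> C" using C1_fun_bounds[OF HD(1)] by metis
      have iD: "integrable \<mu> (\<lambda>x. \<bar>H n x - h x\<bar>)"
        by (rule integrable_bounded[of _ "C + M"]) (use M C in \<open>auto intro: order_trans[OF abs_triangle_ineq4 add_mono]\<close>)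
      have "form (\<lambda>x. f x * H n x) f - form (\<lambda>x. f x * f x) (H n) / 2
         = (LINT x|\<mu>. weight x * (form_grad (\<lambda>x. f x * H n x) x \<bullet> form_grad f x)
              - weight x * (form_grad (\<lambda>x. f x * f x) x \<bullet> form_grad (H n) x) / 2)"
        unfolding form_def using i by simp
      also have "\<dots> \<le> (LINT x|\<mu>. \<bar>H n x - h x\<bar> + \<bar>h x\<bar>)"
      proof (rule integral_mono_domain)
        fix x assume x: "x \<in> \<Omega>"
        have "weight x * (form_grad (\<lambda>x. f x * H n x) x \<bullet> form_grad f x)
              - weight x * (form_grad (\<lambda>x. f x * f x) x \<bullet> form_grad (H n) x) / 2
            = weight x * ((form_grad f x \<bullet> form_grad f x) * H n x)"
          unfolding form_grad_algebra(3)[OF f HD(1) x] form_grad_algebra(3)[OF f f x]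
          by (simp add: inner_add_left inner_commute algebra_simps)
        also have "\<dots> \<le> \<bar>weight x * ((form_grad f x \<bullet> form_grad f x) * H n x)\<bar>" by simp
        also have "\<dots> = weight x * ((norm (form_grad f x))\<^sup>2 * \<bar>H n x\<bar>)"
          using weight_bounds[of x] by (simp add: abs_mult power2_norm_eq_inner)
        also have "\<dots> \<le> 1 * (1 * \<bar>H n x\<bar>)"
          using weight_bounds[of x] power_mono[OF le1[OF x] norm_ge_zero, of 2] by (intro mult_mono) auto
        finally show "weight x * (form_grad (\<lambda>x. f x * H n x) x \<bullet> form_grad f x)
              - weight x * (form_grad (\<lambda>x. f x * f x) x \<bullet> form_grad (H n) x) / 2 \<le> \<bar>H n x - h x\<bar> + \<bar>h x\<bar>" by linarith
      qed (use i iD iH in auto)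
      also have "\<dots> = (LINT x|\<mu>. \<bar>H n x - h x\<bar> * 1) + (LINT x|\<mu>. \<bar>h x\<bar>)" using iD iH by simp
      finally show ?thesis .
    qed
    moreover have "(\<lambda>n. (LINT x|\<mu>. \<bar>H n x - h x\<bar> * 1) + (LINT x|\<mu>. \<bar>h x\<bar>)) \<longlonglongrightarrow> 0 + (LINT x|\<mu>. \<bar>h x\<bar>)"
    proof (intro tendsto_add tendsto_const tendsto_zero_integral_mult)
      show "integrable \<mu> (\<lambda>x. \<bar>H n x - h x\<bar>\<^sup>2)" for n
        using sq_int_diff[OF sq_int_C1[OF HD(1)] hD(1)] by (simp add: sq_int_def)
    qed (use HD(3) in simp_all)
    ultimately have "2 * \<D> (\<lambda>x. f x * h x) f - 2 * \<D> (\<lambda>x. f x * f x) h / 2 \<le> 0 + (LINT x|\<mu>. \<bar>h x\<bar>)"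
      by (intro LIMSEQ_le[where X="\<lambda>n. form (\<lambda>x. f x * H n x) f - form (\<lambda>x. f x * f x) (H n) / 2"]) auto
    then show ?thesis by (simp add: power2_eq_square)
  qed
  then show ?thesis using C1_fun_in_D_bc[OF f] by (simp add: D_0_def)
qed

text \<open>Let \<open>M\<close> bound \<open>f\<close>. The functions \<open>F n\<close> are not uniformly bounded, so their squares need not approximate the
  square of \<open>f\<close>. The function \<open>\<psi>\<close> agrees with the square on \<open>[-M, M]\<close> and has the bounded derivative
  \<open>2 \<kappa>\<close>, where \<open>\<kappa>\<close> clamps to \<open>[-M, M]\<close>. It leaves an error term with the factor
  \<open>F n - \<kappa> (F n)\<close>, which is at most \<open>\<bar>F n - f\<bar>\<close> and so vanishes in the limit.\<close>

lemma D_0_gradient_bound: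
  assumes f: "f \<in> D_0 \<Omega> a"
  obtains F where "approx F f"
    and "\<And>h e. h \<in> C1_fun \<Omega> \<Longrightarrow> (\<And>x. x \<in> \<Omega> \<Longrightarrow> 0 \<le> h x) \<Longrightarrow> 0 < e \<Longrightarrow>
      \<forall>\<^sub>F n in sequentially. (LINT x|\<mu>. weight x * (norm (form_grad (F n) x))\<^sup>2 * h x) < (LINT x|\<mu>. h x) + e"
proof -
  have fb: "f \<in> D_bc \<Omega> a" using f by (simp add: D_0_def)
  note fD = D_bcD[OF fb]
  obtain F where F: "approx F f" using fD by blast
  note FD = approximatesD[OF F]
  let ?n = "\<lambda>n x. (norm (form_grad (F n) x))\<^sup>2"
  obtain M where M: "0 \<le> M" "\<forall>x\<in>\<Omega>. \<bar>f x\<bar> \<le> M" using fD by blast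
  have fm [measurable]: "f \<in> borel_measurable \<mu>" "F n \<in> borel_measurable \<mu>" "form_grad (F n) \<in> borel_measurable \<mu>" for n
    using fD(1) C1_fun_measurable[OF FD(1)] form_grad_measurable[OF FD(1)] by (auto simp: sq_int_def)
  define \<kappa> where "\<kappa> t = max (- M) (min M t)" for t
  define \<psi> where "\<psi> t = t\<^sup>2 - (max 0 (t - M))\<^sup>2 - (max 0 (- t - M))\<^sup>2" for t
  have d1: "((\<lambda>t. (max 0 (t - M))\<^sup>2) has_field_derivative 2 * max 0 (t - M) * 1) (at t)" for t
    by (rule DERIV_chain2[OF has_derivative_max_square]) (auto intro!: derivative_eq_intros)
  have d2: "((\<lambda>t. (max 0 (- t - M))\<^sup>2) has_field_derivative 2 * max 0 (- t - M) * (- 1)) (at t)" for t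
    by (rule DERIV_chain2[OF has_derivative_max_square]) (auto intro!: derivative_eq_intros)
  have \<psi>: "(\<psi> has_field_derivative 2 * \<kappa> t) (at t)" for t
    unfolding \<psi>_def by (rule derivative_eq_intros d1 d2 refl)+ (use M(1) in \<open>auto simp: \<kappa>_def max_def min_def\<close>)
  have c\<kappa>: "continuous_on UNIV (\<lambda>t. 2 * \<kappa> t)" unfolding \<kappa>_def by (intro continuous_intros)
  have [measurable]: "\<kappa> \<in> borel_measurable borel" unfolding \<kappa>_def by measurable
  have "sq_int (\<lambda>x. (f x)\<^sup>2)"
  proof (rule sq_int_bounded)
    show "\<bar>(f x)\<^sup>2\<bar> \<le> M\<^sup>2" if "x \<in> \<Omega>" for x using norm_power2_le[of "f x" M] M that by simp
  qed simp
  note s2 = this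
  have ap2: "approx (\<lambda>n x. \<psi> (F n x)) (\<lambda>x. (f x)\<^sup>2)"
  proof (rule approximates_compose[OF F fD(1) s2 _ \<psi> c\<kappa>])
    show "(f x)\<^sup>2 = \<psi> (f x)" if "x \<in> \<Omega>" for x
    proof -
      have "\<bar>f x\<bar> \<le> M" using M that by blast
      then have "max 0 (f x - M) = 0" "max 0 (- f x - M) = 0" by auto
      then show ?thesis by (simp add: \<psi>_def)
    qed
    show "\<bar>2 * \<kappa> t\<bar> \<le> 2 * M" for t using M(1) by (auto simp: \<kappa>_def)
    show "\<bar>2 * \<kappa> s - 2 * \<kappa> t\<bar> \<le> 2 * \<bar>s - t\<bar>" for s t using M(1) by (auto simp: \<kappa>_def max_def min_def abs_if)
  qed simp
  have "\<forall>\<^sub>F n in sequentially. (LINT x|\<mu>. weight x * ?n n x * h x) < (LINT x|\<mu>. h x) + e"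
    if h: "h \<in> C1_fun \<Omega>" and h0: "\<And>x. x \<in> \<Omega> \<Longrightarrow> 0 \<le> h x" and e: "0 < e" for h e
  proof -
    obtain B where B: "0 \<le> B" "\<And>x. x \<in> \<Omega> \<Longrightarrow> \<bar>h x\<bar> \<le> B" "\<And>x. x \<in> \<Omega> \<Longrightarrow> norm (form_grad h x) \<le> B"
      using C1_fun_bounds[OF h] by blast
    have [measurable]: "h \<in> borel_measurable \<mu>" "form_grad h \<in> borel_measurable \<mu>"
      using C1_fun_measurable[OF h] form_grad_measurable[OF h] by auto
    let ?w = "\<lambda>n x. F n x - \<kappa> (F n x)" and ?s = "\<lambda>n x. form_grad (F n) x \<bullet> form_grad h x"
    let ?R = "\<lambda>n. LINT x|\<mu>. weight x * (?w n x * ?s n x)"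
    let ?I = "\<lambda>n. LINT x|\<mu>. weight x * ?n n x * h x"
    have hf: "sq_int (\<lambda>x. h x * f x)"
    proof (rule sq_int_bounded)
      show "\<bar>h x * f x\<bar> \<le> B * M" if "x \<in> \<Omega>" for x
        unfolding abs_mult by (rule mult_mono) (use B M that in auto)
    qed simp
    have l1: "(\<lambda>n. form (\<lambda>x. h x * F n x) (F n)) \<longlonglongrightarrow> 2 * \<D> (\<lambda>x. h x * f x) f"
      by (rule dirichlet_form_limit[OF approximates_mult[OF h F fD(1)] hf F fD(1)])
    have l2: "(\<lambda>n. form (\<lambda>x. \<psi> (F n x)) h) \<longlonglongrightarrow> 2 * \<D> (\<lambda>x. (f x)\<^sup>2) h"
      by (rule dirichlet_form_limit[OF ap2 s2 approximates_const[OF h] sq_int_C1[OF h]])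
    have l: "(\<lambda>n. form (\<lambda>x. h x * F n x) (F n) - form (\<lambda>x. \<psi> (F n x)) h / 2) \<longlonglongrightarrow>
        2 * \<D> (\<lambda>x. h x * f x) f - 2 * \<D> (\<lambda>x. (f x)\<^sup>2) h / 2"
      by (intro tendsto_intros l1 l2) simp
    have iI: "integrable \<mu> (\<lambda>x. weight x * ?n n x * h x)"
      and iR: "integrable \<mu> (\<lambda>x. weight x * (?w n x * ?s n x))"
      and eq: "form (\<lambda>x. h x * F n x) (F n) - form (\<lambda>x. \<psi> (F n x)) h / 2 = ?I n + ?R n"
      and R: "(?R n)\<^sup>2 \<le> (LINT x|\<mu>. (F n x - f x)\<^sup>2) * (B\<^sup>2 * \<E> (F n))" for n
    proof -
      obtain C where C: "0 \<le> C" "\<And>x. x \<in> \<Omega> \<Longrightarrow> \<bar>F n x\<bar> \<le> C" "\<And>x. x \<in> \<Omega> \<Longrightarrow> norm (form_grad (F n) x) \<le> C"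
        using C1_fun_bounds[OF FD(1)[of n]] by blast
      have \<kappa>C: "\<bar>F n x - \<kappa> (F n x)\<bar> \<le> C + M" if "x \<in> \<Omega>" for x using C(2)[OF that] M(1) by (auto simp: \<kappa>_def)
      have \<kappa>f: "\<bar>F n x - \<kappa> (F n x)\<bar> \<le> \<bar>F n x - f x\<bar>" if "x \<in> \<Omega>" for x using M that by (force simp: \<kappa>_def max_def min_def)
      show iI: "integrable \<mu> (\<lambda>x. weight x * ?n n x * h x)"
      proof (rule integrable_bounded[of _ "1 * C\<^sup>2 * B"])
        fix x assume x: "x \<in> \<Omega>"
        have "weight x * ?n n x * \<bar>h x\<bar> \<le> 1 * C\<^sup>2 * B"
          using weight_bounds[of x] C(3)[OF x] B(2)[OF x] by (intro mult_mono power_mono) auto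
        then show "norm (weight x * ?n n x * h x) \<le> 1 * C\<^sup>2 * B"
          using weight_bounds[of x] by (simp add: abs_mult)
      qed simp
      have iu: "integrable \<mu> (\<lambda>x. weight x * (?w n x)\<^sup>2)"
      proof (rule integrable_bounded[of _ "1 * (C + M)\<^sup>2"])
        fix x assume x: "x \<in> \<Omega>"
        have "weight x * \<bar>F n x - \<kappa> (F n x)\<bar>\<^sup>2 \<le> 1 * (C + M)\<^sup>2"
          using weight_bounds[of x] \<kappa>C[OF x] by (intro mult_mono power_mono) auto
        then show "norm (weight x * (?w n x)\<^sup>2) \<le> 1 * (C + M)\<^sup>2" using weight_bounds[of x] by (simp add: abs_mult)
      qed simp
      have ip: "\<bar>form_grad (F n) x \<bullet> form_grad h x\<bar> \<le> norm (form_grad (F n) x) * B" if "x \<in> \<Omega>" for x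
        by (rule order_trans[OF Cauchy_Schwarz_ineq2 mult_left_mono[OF B(3)[OF that] norm_ge_zero]])
      have ip2: "(?s n x)\<^sup>2 \<le> ?n n x * B\<^sup>2" if "x \<in> \<Omega>" for x
        using power_mono[OF ip[OF that] abs_ge_zero, of 2] by (simp add: power_mult_distrib)
      have iv': "integrable \<mu> (\<lambda>x. B\<^sup>2 * (weight x * ?n n x))" using integrable_form_grad[OF FD(1)] by simp
      have iv2: "weight x * (?s n x)\<^sup>2 \<le> B\<^sup>2 * (weight x * ?n n x)" if "x \<in> \<Omega>" for x
        using mult_left_mono[OF ip2[OF that], of "weight x"] weight_bounds[of x] by (simp add: algebra_simps)
      have iv: "integrable \<mu> (\<lambda>x. weight x * (?s n x)\<^sup>2)"
        by (rule Bochner_Integration.integrable_bound[OF iv'])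
           (use iv2 weight_bounds in \<open>auto intro!: AE_I2 simp: abs_mult less_imp_le\<close>)
      show iR: "integrable \<mu> (\<lambda>x. weight x * (?w n x * ?s n x))"
      proof (rule integrable_bounded[of _ "1 * ((C + M) * (C * B))"])
        fix x assume x: "x \<in> \<Omega>"
        have "norm (form_grad (F n) x) * B \<le> C * B" using C(3)[OF x] B(1) by (rule mult_right_mono)
        then have "weight x * (\<bar>F n x - \<kappa> (F n x)\<bar> * \<bar>form_grad (F n) x \<bullet> form_grad h x\<bar>) \<le> 1 * ((C + M) * (C * B))"
          using weight_bounds[of x] \<kappa>C[OF x] ip[OF x] by (intro mult_mono) auto
        then show "norm (weight x * (?w n x * ?s n x)) \<le> 1 * ((C + M) * (C * B))"
          using weight_bounds[of x] by (simp add: abs_mult)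
      qed simp
      note pf = approximatesD(1)[OF ap2, of n]
      note i = integrable_form[OF C1_fun_mult[OF h FD(1)[of n]] FD(1)[of n]] integrable_form[OF pf h]
      have "form (\<lambda>x. h x * F n x) (F n) - form (\<lambda>x. \<psi> (F n x)) h / 2
         = (LINT x|\<mu>. weight x * (form_grad (\<lambda>x. h x * F n x) x \<bullet> form_grad (F n) x)
              - weight x * (form_grad (\<lambda>x. \<psi> (F n x)) x \<bullet> form_grad h x) / 2)"
        unfolding form_def using i by simp
      also have "\<dots> = (LINT x|\<mu>. weight x * ?n n x * h x
              + weight x * (?w n x * ?s n x))"
      proof (rule Bochner_Integration.integral_cong[OF refl])
        fix x assume "x \<in> space \<mu>"
        then have x: "x \<in> \<Omega>" by simp
        show "weight x * (form_grad (\<lambda>x. h x * F n x) x \<bullet> form_grad (F n) x)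
              - weight x * (form_grad (\<lambda>x. \<psi> (F n x)) x \<bullet> form_grad h x) / 2
            = weight x * ?n n x * h x
              + weight x * (?w n x * ?s n x)"
          unfolding form_grad_algebra(3)[OF h FD(1) x] form_grad_compose(2)[OF FD(1) x \<psi> c\<kappa>] power2_norm_eq_inner
          by (simp add: inner_add_left inner_commute algebra_simps)
      qed
      also have "\<dots> = ?I n + ?R n" using iI iR by simp
      finally show "form (\<lambda>x. h x * F n x) (F n) - form (\<lambda>x. \<psi> (F n x)) h / 2 = ?I n + ?R n" .
      have "(?R n)\<^sup>2 \<le> (LINT x|\<mu>. weight x * (?w n x)\<^sup>2) * (LINT x|\<mu>. weight x * (?s n x)\<^sup>2)"
        by (rule weighted_Cauchy_Schwarz[OF _ _ iu iv]) simp_all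
      also have "\<dots> \<le> (LINT x|\<mu>. (F n x - f x)\<^sup>2) * (B\<^sup>2 * \<E> (F n))"
      proof (rule mult_mono)
        show "(LINT x|\<mu>. weight x * (?w n x)\<^sup>2) \<le> (LINT x|\<mu>. (F n x - f x)\<^sup>2)"
        proof (rule integral_mono_domain[OF iu])
          show "integrable \<mu> (\<lambda>x. (F n x - f x)\<^sup>2)" using sq_int_diff[OF sq_int_C1[OF FD(1)] fD(1)] by (simp add: sq_int_def)
          fix x assume x: "x \<in> \<Omega>"
          have "weight x * \<bar>F n x - \<kappa> (F n x)\<bar>\<^sup>2 \<le> 1 * \<bar>F n x - f x\<bar>\<^sup>2"
            using weight_bounds[of x] \<kappa>f[OF x] by (intro mult_mono power_mono) auto
          then show "weight x * (?w n x)\<^sup>2 \<le> (F n x - f x)\<^sup>2" by simp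
        qed
        have "(LINT x|\<mu>. weight x * (?s n x)\<^sup>2) \<le> (LINT x|\<mu>. B\<^sup>2 * (weight x * ?n n x))"
          by (rule integral_mono_domain[OF iv iv' iv2])
        then show "(LINT x|\<mu>. weight x * (?s n x)\<^sup>2) \<le> B\<^sup>2 * \<E> (F n)"
          unfolding pre_energy_eq[OF FD(1)] by simp
      qed (simp_all add: Bochner_Integration.integral_nonneg weight_bounds less_imp_le)
      finally show "(?R n)\<^sup>2 \<le> (LINT x|\<mu>. (F n x - f x)\<^sup>2) * (B\<^sup>2 * \<E> (F n))" .
    qed
    have "(\<lambda>n. (LINT x|\<mu>. (F n x - f x)\<^sup>2) * (B\<^sup>2 * \<E> (F n))) \<longlonglongrightarrow> 0 * (B\<^sup>2 * energy \<Omega> a f)"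
      by (intro tendsto_intros FD(3) energy_limit F fD)
    then have "(\<lambda>n. (LINT x|\<mu>. (F n x - f x)\<^sup>2) * (B\<^sup>2 * \<E> (F n))) \<longlonglongrightarrow> 0" by simp
    then have "(\<lambda>n. (?R n)\<^sup>2) \<longlonglongrightarrow> 0"
      by (rule tendsto_sandwich[OF _ _ tendsto_const, rotated 2]) (use R in \<open>auto intro!: always_eventually\<close>)
    from tendsto_real_sqrt[OF this] have "?R \<longlonglongrightarrow> 0" by (simp add: tendsto_rabs_zero_iff)
    from tendsto_diff[OF l this]
    have "?I \<longlonglongrightarrow> 2 * \<D> (\<lambda>x. h x * f x) f - \<D> (\<lambda>x. (f x)\<^sup>2) h" by (simp add: eq)
    moreover have "2 * \<D> (\<lambda>x. h x * f x) f - \<D> (\<lambda>x. (f x)\<^sup>2) h < (LINT x|\<mu>. h x) + e"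
    proof -
      have "2 * \<D> (\<lambda>x. f x * h x) f - \<D> (\<lambda>x. (f x)\<^sup>2) h \<le> (LINT x|\<mu>. \<bar>h x\<bar>)"
        using f C1_fun_in_D_bc[OF h] unfolding D_0_def by blast
      also have "(LINT x|\<mu>. \<bar>h x\<bar>) = (LINT x|\<mu>. h x)" by (rule Bochner_Integration.integral_cong) (simp_all add: h0)
      finally show ?thesis using e by (simp add: mult.commute)
    qed
    ultimately show ?thesis by (rule order_tendstoD(2))
  qed
  then show thesis using that F by blast
qed

end

section \<open>Gradients of mollified functions\<close>

lemma norm_le_of_inner_le:
  fixes g :: "'a::real_inner"
  assumes "\<And>v. norm v = 1 \<Longrightarrow> g \<bullet> v \<le> K" "0 \<le> K"
  shows "norm g \<le> K"
proof (cases "g = 0")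
  case False
  have "norm g = g \<bullet> sgn g" using False by (simp add: sgn_div_norm power2_norm_eq_inner[symmetric] power2_eq_square)
  also have "\<dots> \<le> K" using False by (intro assms(1)) (simp add: norm_sgn)
  finally show ?thesis .
qed (simp add: assms)

lemma norm_gradient_le:
  fixes f :: "'a::euclidean_space \<Rightarrow> real"
  assumes f: "(f has_derivative (\<lambda>h. g \<bullet> h)) (at x)" and d: "0 < d"
    and K: "0 \<le> K" "\<And>y. dist x y < d \<Longrightarrow> \<bar>f y - f x\<bar> \<le> K * dist x y"
  shows "norm g \<le> K"
proof (rule norm_le_of_inner_le[OF _ K(1)])
  fix v :: 'a assume v: "norm v = 1"
  have fx: "(f has_derivative (\<lambda>h. g \<bullet> h)) (at (x + 0 *\<^sub>R v))" using f by simp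
  have l: "((\<lambda>t::real. x + t *\<^sub>R v) has_derivative (\<lambda>t. t *\<^sub>R v)) (at 0)" by (auto intro!: derivative_eq_intros)
  have "((\<lambda>t. f (x + t *\<^sub>R v)) has_derivative (\<lambda>t. g \<bullet> (t *\<^sub>R v))) (at 0)"
    using has_derivative_compose[OF l fx] by (simp add: o_def)
  then have "((\<lambda>t. f (x + t *\<^sub>R v)) has_field_derivative g \<bullet> v) (at 0)"
    by (simp add: has_field_derivative_def mult_commute_abs)
  then have lim: "((\<lambda>t. (f (x + t *\<^sub>R v) - f x) / t) \<longlongrightarrow> g \<bullet> v) (at 0)" by (simp add: DERIV_def)
  show "g \<bullet> v \<le> K"
  proof (rule tendsto_upperbound[OF lim])
    show "\<forall>\<^sub>F t in at 0. (f (x + t *\<^sub>R v) - f x) / t \<le> K"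
      unfolding eventually_at
    proof (intro exI[of _ d] conjI ballI impI d)
      fix t :: real assume t: "t \<noteq> 0 \<and> dist t 0 < d"
      then have "\<bar>f (x + t *\<^sub>R v) - f x\<bar> \<le> K * \<bar>t\<bar>" using K(2)[of "x + t *\<^sub>R v"] v by (simp add: dist_norm)
      then have "\<bar>(f (x + t *\<^sub>R v) - f x) / t\<bar> \<le> K" using t by (simp add: pos_divide_le_eq)
      then show "(f (x + t *\<^sub>R v) - f x) / t \<le> K" by linarith
    qed
  qed simp
qed

lemma mollify_diff_le:
  fixes f :: "'a::euclidean_space \<Rightarrow> real"
  assumes r: "0 < r" and [measurable]: "f \<in> borel_measurable borel" and B: "\<And>z. \<bar>f z\<bar> \<le> B"
    and C: "\<And>w. norm w < r \<Longrightarrow> \<bar>f (x - w) - f (y - w)\<bar> \<le> C"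
  shows "\<bar>mollify r f x - mollify r f y\<bar> \<le> C"
proof -
  have im: "integrable lborel (moll r :: 'a \<Rightarrow> real)" using lborel_integral_reflect(2)[OF _ integrable_moll[of r 0], of 0] r by simp
  have i1: "(LINT z|lborel. moll r (z::'a)) = 1"
    using integral_moll[OF r, of "0::'a"] lborel_integral_reflect(1)[of "moll r" "0::'a"] by simp
  have e: "mollify r f x = (LINT w|lborel. moll r w * f (x - w))" for x
    unfolding mollify_def using lborel_integral_reflect(1)[of "\<lambda>w. moll r w * f (x - w)" x] by simp
  have i: "integrable lborel (\<lambda>w. moll r w * f (x - w))" for x
    by (rule Bochner_Integration.integrable_bound[OF integrable_mult_right[OF im, of B]])
       (use B in \<open>auto intro!: AE_I2 mult_right_mono order_trans[OF B] simp: abs_mult moll_nonneg mult.commute[of "moll r _"]\<close>)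
  have C0: "0 \<le> C" using C[of 0] r by (auto intro: order_trans[OF abs_ge_zero])
  have "\<bar>mollify r f x - mollify r f y\<bar> = \<bar>LINT w|lborel. moll r w * f (x - w) - moll r w * f (y - w)\<bar>"
    unfolding e using i by simp
  also have "\<dots> \<le> (LINT w|lborel. \<bar>moll r w * f (x - w) - moll r w * f (y - w)\<bar>)" by (rule integral_abs_bound)
  also have "\<dots> \<le> (LINT w|lborel. moll r (w::'a) * C)"
  proof (rule integral_mono)
    fix w :: 'a
    show "\<bar>moll r w * f (x - w) - moll r w * f (y - w)\<bar> \<le> moll r w * C"
    proof (cases "norm w < r")
      case True
      have "\<bar>moll r w * f (x - w) - moll r w * f (y - w)\<bar> = moll r w * \<bar>f (x - w) - f (y - w)\<bar>"
        by (simp add: right_diff_distrib[symmetric] abs_mult moll_nonneg)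
      then show ?thesis using mult_left_mono[OF C[OF True] moll_nonneg[of r w]] by simp
    next
      case False
      then show ?thesis using r by (simp add: moll_eq_0)
    qed
  qed (use i im in auto)
  also have "\<dots> = C" using i1 by simp
  finally show ?thesis .
qed

context dirichlet_domain
begin

lemma D_0_interior_measurable:
  assumes f: "f \<in> D_bc \<Omega> a"
  shows "(\<lambda>x. indicator D\<Omega> x * f x) \<in> borel_measurable borel" "integrable lborel (\<lambda>x. indicator D\<Omega> x * f x)"
proof -
  note fD = D_bcD[OF f]
  have "continuous_on D\<Omega> f" using fD(3) interior_subset continuous_on_subset by blast
  from borel_measurable_continuous_on_indicator[OF _ this]
  show m: "(\<lambda>x. indicator D\<Omega> x * f x) \<in> borel_measurable borel" by simp
  obtain M where M: "0 \<le> M" "\<forall>x\<in>\<Omega>. \<bar>f x\<bar> \<le> M" using fD by blast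
  have "integrable lborel (\<lambda>x. M * indicator \<Omega> x :: real)"
    using finite_domain compact_domain by (intro integrable_mult_right integrable_real_indicator) (auto simp: borel_compact)
  then show "integrable lborel (\<lambda>x. indicator D\<Omega> x * f x)"
    by (rule Bochner_Integration.integrable_bound)
       (use m M interior_subset[of \<Omega>] in \<open>auto intro!: AE_I2 simp: indicator_def\<close>)
qed

text \<open>Test with the mollifier \<open>h\<close> centred at \<open>y\<close>, whose integral is \<open>c\<close>. Integration by parts writes the derivative of
  the mollification along \<open>v\<close> as the limit of the Lebesgue integrals of \<open>h * (G \<bullet> v)\<close>, with \<open>G\<close> the gradients of the approximating
  functions, and \<open>G \<bullet> v \<le> (1 + (norm G)\<^sup>2) / 2\<close>.\<close>

lemma D_0_mollified_gradient:
  assumes f: "f \<in> D_0 \<Omega> a" and r: "0 < r" and ball: "cball y r \<subseteq> D\<Omega>"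
  shows "norm (LINT z|lborel. (indicator D\<Omega> z * f z) *\<^sub>R moll_grad r (y - z)) \<le> 1"
proof (rule norm_le_of_inner_le)
  fix v :: 'a assume v: "norm v = 1"
  have fb: "f \<in> D_bc \<Omega> a" using f by (simp add: D_0_def)
  note fD = D_bcD[OF fb]
  obtain F where F: "approx F f"
    and bd: "\<And>h e. h \<in> C1_fun \<Omega> \<Longrightarrow> (\<And>x. x \<in> \<Omega> \<Longrightarrow> 0 \<le> h x) \<Longrightarrow> 0 < e \<Longrightarrow>
      \<forall>\<^sub>F n in sequentially. (LINT x|\<mu>. weight x * (norm (form_grad (F n) x))\<^sup>2 * h x) < (LINT x|\<mu>. h x) + e"
    by (rule D_0_gradient_bound[OF f]) blast
  note FD = approximatesD[OF F]
  define h where "h z = moll r (y - z)" for z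
  define h' where "h' z = - moll_grad r (y - z)" for z
  define m where "m z = moll_grad r (y - z) \<bullet> v" for z
  have sub: "((\<lambda>z. y - z) has_derivative (\<lambda>t. - t)) (at z)" for z by (auto intro!: derivative_eq_intros)
  have md: "(moll r has_derivative (\<lambda>t. moll_grad r w \<bullet> t)) (at w)" for w :: 'a by (rule C1_gradD(1)[OF C1_grad_moll]) simp
  have "(h has_derivative (\<lambda>t. h' z \<bullet> t)) (at z)" for z
    using has_derivative_compose[OF sub md, of z] by (simp add: h_def[abs_def] h'_def)
  moreover have "continuous_on UNIV h'"
    unfolding h'_def[abs_def]
    by (intro continuous_intros continuous_on_compose2[OF C1_gradD(2)[OF C1_grad_moll]]) auto
  ultimately have hC: "C1_grad UNIV h h'" unfolding C1_grad_def by blast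
  then have h: "h \<in> C1_fun \<Omega>" unfolding C1_fun_iff C1_rep_def by blast
  have h0: "0 \<le> h z" for z by (simp add: h_def moll_nonneg)
  have out: "h z = 0" "h' z = 0" "m z = 0" if "z \<notin> cball y r" for z
    using that r by (simp_all add: h_def h'_def m_def dist_norm moll_eq_0 moll_grad_eq_0)
  have [measurable]: "h \<in> borel_measurable borel" "m \<in> borel_measurable borel"
    unfolding h_def[abs_def] m_def[abs_def] by measurable
  have [measurable]: "f \<in> borel_measurable \<mu>" "F n \<in> borel_measurable \<mu>" "form_grad (F n) \<in> borel_measurable \<mu>"
    "h \<in> borel_measurable \<mu>" "m \<in> borel_measurable \<mu>" for n
    using fD(1) C1_fun_measurable[OF FD(1)] form_grad_measurable[OF FD(1)]
    by (auto simp: sq_int_def intro!: borel_measurable_ref)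
  have D_sets: "D\<Omega> \<inter> space lborel \<in> sets lborel" by simp
  have notD: "x \<notin> cball y r" if "x \<notin> D\<Omega>" for x using that ball by blast
  let ?D = "lborel_on D\<Omega>"
  have ih: "integrable lborel h" unfolding h_def[abs_def] by (rule integrable_moll) (use r in simp)
  have ihD: "integrable ?D h"
    by (subst integrable_restrict_space[OF D_sets]) (rule Bochner_Integration.integrable_bound[OF ih], measurable, auto intro!: AE_I2 split: split_indicator)
  have inth: "(LINT z|?D. h z) = 1"
  proof -
    have "(LINT z|?D. h z) = (LINT z|lborel. indicator D\<Omega> z *\<^sub>R h z)" by (rule integral_restrict_space[OF D_sets])
    also have "\<dots> = (LINT z|lborel. h z)"
      by (rule Bochner_Integration.integral_cong) (use out(1)[OF notD] in \<open>auto simp: indicator_def\<close>)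
    finally show ?thesis unfolding h_def[abs_def] using integral_moll[OF r] by simp
  qed
  have to_lebesgue: "(LINT x|\<mu>. k x) = c * (LINT z|?D. k z)" if "k \<in> borel_measurable \<mu>" "\<And>x. x \<notin> D\<Omega> \<Longrightarrow> k x = 0" for k :: "'a \<Rightarrow> real"
  proof -
    have "indicator D\<Omega> x * k x = k x" for x using that(2)[of x] by (cases "x \<in> D\<Omega>") simp_all
    then show ?thesis using integral_interior[OF that(1)] by (simp only:)
  qed
  have inth\<mu>: "(LINT x|\<mu>. h x) = c" by (subst to_lebesgue) (use inth out(1)[OF notD] in auto)
  let ?P = "LINT x|\<mu>. f x * m x"
  have lim: "(\<lambda>n. LINT x|\<mu>. F n x * m x) \<longlonglongrightarrow> ?P"
  proof -
    obtain M where M: "\<And>x. x \<in> \<Omega> \<Longrightarrow> \<bar>m x\<bar> \<le> M"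
    proof -
      have "continuous_on UNIV m" unfolding m_def[abs_def]
        by (intro continuous_intros continuous_on_compose2[OF C1_gradD(2)[OF C1_grad_moll]]) auto
      from continuous_bounded_on_domain[OF this] show thesis using that by auto
    qed
    then have sm: "sq_int m" by (intro sq_int_bounded) auto
    have sd: "sq_int (\<lambda>x. F n x - f x)" for n by (rule sq_int_diff[OF sq_int_C1[OF FD(1)] fD(1)])
    have "(\<lambda>n. LINT x|\<mu>. (F n x - f x) * m x) \<longlonglongrightarrow> 0"
      by (rule tendsto_zero_integral_mult) (use sm sd FD(3) in \<open>auto simp: sq_int_def\<close>)
    moreover have "(LINT x|\<mu>. (F n x - f x) * m x) = (LINT x|\<mu>. F n x * m x) - ?P" for n
    proof -
      have "integrable \<mu> (\<lambda>x. F n x * m x)" "integrable \<mu> (\<lambda>x. f x * m x)"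
        using sm fD(1) sq_int_C1[OF FD(1)[of n]] by (auto intro!: integrable_mult_of_squares simp: sq_int_def)
      then show ?thesis by (simp add: left_diff_distrib)
    qed
    ultimately have "(\<lambda>n. (LINT x|\<mu>. F n x * m x) - ?P) \<longlonglongrightarrow> 0" by simp
    then show ?thesis using LIM_zero_iff by blast
  qed
  have Ple: "?P \<le> c + e" if e: "0 < e" for e
  proof (rule tendsto_upperbound[OF lim])
    show "\<forall>\<^sub>F n in sequentially. (LINT x|\<mu>. F n x * m x) \<le> c + e"
    proof (rule eventually_mono[OF bd[OF h h0 e]])
      fix n assume n: "(LINT x|\<mu>. weight x * (norm (form_grad (F n) x))\<^sup>2 * h x) < (LINT x|\<mu>. h x) + e"
      obtain g G where rep: "C1_rep (F n) g G" using FD(1) C1_fun_iff by blast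
      then have gG: "C1_grad D\<Omega> g G" unfolding C1_rep_def C1_grad_def by (auto intro: continuous_on_subset)
      have Fg: "F n x = g x" "form_grad (F n) x = G x" "weight x = 1" if "x \<in> D\<Omega>" for x
      proof -
        have x: "x \<in> \<Omega>" "x \<notin> \<Gamma>" using that domain_split by auto
        show "F n x = g x" using rep x by (simp add: C1_rep_def)
        show "form_grad (F n) x = G x" using form_grad_eq[OF rep x(1)] x(2) by (simp add: proj_def)
        show "weight x = 1" using x by (simp add: weight_def)
      qed
      have cK: "compact (cball y r)" by simp
      note ibp = integration_by_parts_test_function[OF open_interior gG hC cK ball out(1,2)]
      have "c * (LINT z|?D. (norm (G z))\<^sup>2 * h z) = c * (LINT z|?D. weight z * (norm (form_grad (F n) z))\<^sup>2 * h z)"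
        by (rule arg_cong[where f="\<lambda>t. c * t", OF Bochner_Integration.integral_cong]) (auto simp: Fg space_restrict_space)
      also have "\<dots> = (LINT x|\<mu>. weight x * (norm (form_grad (F n) x))\<^sup>2 * h x)"
        by (rule to_lebesgue[symmetric]) (use out(1)[OF notD] in auto)
      also have "\<dots> < c + e" using n inth\<mu> by simp
      finally have E: "c * (LINT z|?D. (norm (G z))\<^sup>2 * h z) < c + e" .
      have iG: "integrable ?D (\<lambda>z. (norm (G z))\<^sup>2 * h z)"
      proof (subst integrable_restrict_space[OF D_sets])
        obtain C where C: "\<forall>x\<in>\<Omega>. norm (G x) \<le> C"
          using continuous_bounded_on_domain[of G] rep C1_gradD(2)[of UNIV g G] by (auto simp: C1_rep_def)
        have [measurable]: "G \<in> borel_measurable borel"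
          using rep C1_gradD(2)[of UNIV g G] by (auto simp: C1_rep_def intro!: borel_measurable_continuous_onI)
        show "integrable lborel (\<lambda>x. indicator D\<Omega> x *\<^sub>R ((norm (G x))\<^sup>2 * h x))"
        proof (rule Bochner_Integration.integrable_bound[OF integrable_mult_right[OF ih, of "C\<^sup>2"]])
          show "AE x in lborel. norm (indicator D\<Omega> x *\<^sub>R ((norm (G x))\<^sup>2 * h x)) \<le> norm (C\<^sup>2 * h x)"
          proof (rule AE_I2)
            fix x
            have "(norm (G x))\<^sup>2 * h x \<le> C\<^sup>2 * h x" if "x \<in> D\<Omega>"
              using C that interior_subset h0[of x] by (intro mult_right_mono power_mono) auto
            then show "norm (indicator D\<Omega> x *\<^sub>R ((norm (G x))\<^sup>2 * h x)) \<le> norm (C\<^sup>2 * h x)"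
              using h0[of x] by (auto simp: indicator_def abs_mult)
          qed
        qed measurable
      qed
      have "(LINT x|\<mu>. F n x * m x) = c * (LINT z|?D. F n z * m z)"
        by (rule to_lebesgue) (use out(3)[OF notD] in auto)
      also have "(LINT z|?D. F n z * m z) = - (LINT z|?D. g z * (h' z \<bullet> v))"
        unfolding Bochner_Integration.integral_minus[symmetric]
        by (rule Bochner_Integration.integral_cong) (auto simp: Fg space_restrict_space m_def h'_def)
      also have "\<dots> = (LINT z|?D. h z * (G z \<bullet> v))" using ibp(1) by simp
      also have "\<dots> \<le> (LINT z|?D. (h z + (norm (G z))\<^sup>2 * h z) / 2)"
      proof (rule integral_mono[OF ibp(2)])
        fix z
        have "G z \<bullet> v \<le> norm (G z)" using norm_cauchy_schwarz[of "G z" v] v by simp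
        also have "\<dots> \<le> (1 + (norm (G z))\<^sup>2) / 2" using sum_squares_bound[of 1 "norm (G z)"] by simp
        finally have "h z * (G z \<bullet> v) \<le> h z * ((1 + (norm (G z))\<^sup>2) / 2)" using h0 by (rule mult_left_mono)
        then show "h z * (G z \<bullet> v) \<le> (h z + (norm (G z))\<^sup>2 * h z) / 2" by (simp add: algebra_simps)
      qed (use ihD iG in auto)
      also have "\<dots> = (1 + (LINT z|?D. (norm (G z))\<^sup>2 * h z)) / 2" using ihD iG inth by simp
      finally have "(LINT x|\<mu>. F n x * m x) \<le> c * ((1 + (LINT z|?D. (norm (G z))\<^sup>2 * h z)) / 2)"
        using norm_const_pos by simp
      also have "\<dots> \<le> c + e" using E e by (simp add: algebra_simps)
      finally show "(LINT x|\<mu>. F n x * m x) \<le> c + e" .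
    qed
  qed simp
  then have "?P \<le> c" by (rule field_le_epsilon)
  moreover have "?P = c * ((LINT z|lborel. (indicator D\<Omega> z * f z) *\<^sub>R moll_grad r (y - z)) \<bullet> v)"
  proof -
    have "?P = c * (LINT z|?D. f z * m z)" by (rule to_lebesgue) (use out(3)[OF notD] in auto)
    also have "(LINT z|?D. f z * m z) = (LINT z|lborel. indicator D\<Omega> z *\<^sub>R (f z * m z))" by (rule integral_restrict_space[OF D_sets])
    also have "\<dots> = (LINT z|lborel. ((indicator D\<Omega> z * f z) *\<^sub>R moll_grad r (y - z)) \<bullet> v)"
      by (rule Bochner_Integration.integral_cong) (auto simp: m_def)
    also have "\<dots> = (LINT z|lborel. (indicator D\<Omega> z * f z) *\<^sub>R moll_grad r (y - z)) \<bullet> v"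
    proof (rule integral_inner_left)
      have cg: "continuous_on UNIV (\<lambda>z. moll_grad r (y - z))"
        by (intro continuous_intros continuous_on_compose2[OF C1_gradD(2)[OF C1_grad_moll]]) auto
      then obtain B where B: "\<And>x. x \<in> \<Omega> \<Longrightarrow> norm (moll_grad r (y - x)) \<le> B" using continuous_bounded_on_domain by blast
      have [measurable]: "(\<lambda>z. indicator D\<Omega> z * f z) \<in> borel_measurable borel" by (rule D_0_interior_measurable(1)[OF fb])
      show "integrable lborel (\<lambda>z. (indicator D\<Omega> z * f z) *\<^sub>R moll_grad r (y - z))"
      proof (rule Bochner_Integration.integrable_bound[OF integrable_mult_right[OF D_0_interior_measurable(2)[OF fb], of B]])
        show "AE z in lborel. norm ((indicator D\<Omega> z * f z) *\<^sub>R moll_grad r (y - z)) \<le> norm (B * (indicator D\<Omega> z * f z))"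
        proof (rule AE_I2)
          fix z
          show "norm ((indicator D\<Omega> z * f z) *\<^sub>R moll_grad r (y - z)) \<le> norm (B * (indicator D\<Omega> z * f z))"
          proof (cases "z \<in> D\<Omega>")
            case True
            then have "norm (moll_grad r (y - z)) \<le> \<bar>B\<bar>" using B[of z] interior_subset by force
            from mult_left_mono[OF this, of "\<bar>f z\<bar>"] show ?thesis using True by (simp add: abs_mult mult.commute)
          qed simp
        qed
      qed measurable
    qed
    finally show ?thesis .
  qed
  ultimately show "(LINT z|lborel. (indicator D\<Omega> z * f z) *\<^sub>R moll_grad r (y - z)) \<bullet> v \<le> 1"
    using norm_const_pos by simp
qed simp

end

context dirichlet_domain
begin

text \<open>Mollifications at scales below the distance to the boundary have gradient at most \<open>1\<close> along the segment and
  converge to \<open>f\<close> at its ends.\<close>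

section \<open>Comparison of the two distances\<close>

lemma D_0_segment:
  assumes f: "f \<in> D_0 \<Omega> a" and xy: "closed_segment x y \<subseteq> D\<Omega>"
  shows "f x - f y \<le> dist x y"
proof (rule field_le_epsilon)
  fix e :: real assume e: "0 < e"
  have fb: "f \<in> D_bc \<Omega> a" using f by (simp add: D_0_def)
  have cont: "continuous_on D\<Omega> f" using D_bcD(3)[OF fb] interior_subset continuous_on_subset by blast
  define g where "g z = indicator D\<Omega> z * f z" for z
  have gm [measurable]: "g \<in> borel_measurable borel" and gi: "integrable lborel g"
    using D_0_interior_measurable[OF fb] by (simp_all add: g_def[abs_def])
  have "compact (closed_segment x y)" by simp
  from compact_subset_open_imp_cball_epsilon_subset[OF this open_interior xy]
  obtain d where d: "0 < d" "(\<Union>z\<in>closed_segment x y. cball z d) \<subseteq> D\<Omega>" by blast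
  have close: "\<exists>s>0. \<forall>z. dist p z < s \<longrightarrow> \<bar>g z - f p\<bar> \<le> e / 2" if p: "p \<in> closed_segment x y" for p
  proof -
    have pD: "p \<in> D\<Omega>" using p xy by blast
    then obtain s where s: "0 < s" "\<And>z. z \<in> D\<Omega> \<Longrightarrow> dist z p < s \<Longrightarrow> dist (f z) (f p) < e / 2"
      using cont e unfolding continuous_on_iff by (metis half_gt_zero)
    have "\<bar>g z - f p\<bar> \<le> e / 2" if z: "dist p z < min s d" for z
    proof -
      have "z \<in> cball p d" using z by simp
      then have zD: "z \<in> D\<Omega>" using d(2) p by blast
      have "dist (f z) (f p) < e / 2" by (rule s(2)[OF zD]) (use z in \<open>simp add: dist_commute\<close>)
      then show ?thesis using zD by (simp add: g_def dist_real_def)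
    qed
    then show ?thesis using s(1) d(1) by (intro exI[of _ "min s d"]) auto
  qed
  obtain s1 where s1: "0 < s1" "\<And>z. dist x z < s1 \<Longrightarrow> \<bar>g z - f x\<bar> \<le> e / 2" using close[of x] by auto
  obtain s2 where s2: "0 < s2" "\<And>z. dist y z < s2 \<Longrightarrow> \<bar>g z - f y\<bar> \<le> e / 2" using close[of y] by auto
  define r where "r = min d (min s1 s2)"
  have r: "0 < r" "r \<le> d" "r \<le> s1" "r \<le> s2" using d s1 s2 by (auto simp: r_def)
  let ?G = "\<lambda>p. LINT z|lborel. g z *\<^sub>R moll_grad r (p - z)"
  have G1: "norm (?G p) \<le> 1" if "p \<in> closed_segment x y" for p
    unfolding g_def by (rule D_0_mollified_gradient[OF f r(1)]) (use d(2) that r(2) in force)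
  have "norm (mollify r g x - mollify r g y) \<le> 1 * norm (x - y)"
  proof (rule differentiable_bound[OF convex_closed_segment])
    show "(mollify r g has_derivative (\<lambda>h. ?G p \<bullet> h)) (at p within closed_segment x y)" for p
      using C1_gradD(1)[OF C1_grad_mollify[OF less_imp_le[OF r(1)] gi] UNIV_I] has_derivative_at_withinI by blast
    show "onorm (\<lambda>h. ?G p \<bullet> h) \<le> 1" if "p \<in> closed_segment x y" for p
    proof (rule onorm_bound)
      fix h
      show "norm (?G p \<bullet> h) \<le> 1 * norm h"
        using Cauchy_Schwarz_ineq2[of "?G p" h] mult_right_mono[OF G1[OF that] norm_ge_zero[of h]] by simp
    qed simp
  qed simp_all
  then have "\<bar>mollify r g x - mollify r g y\<bar> \<le> dist x y" by (simp add: dist_norm)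
  moreover have "\<bar>mollify r g x - f x\<bar> \<le> e / 2" by (rule mollify_close[OF r(1) gm]) (use s1 r in auto)
  moreover have "\<bar>mollify r g y - f y\<bar> \<le> e / 2" by (rule mollify_close[OF r(1) gm]) (use s2 r in auto)
  ultimately show "f x - f y \<le> dist x y + e" by linarith
qed

lemma D_0_interior_reachable:
  assumes f: "f \<in> D_0 \<Omega> a" and R: "reachable D\<Omega> x y L"
  shows "f x - f y \<le> L"
proof -
  obtain Y where Y: "L-lipschitz_on {0..1::real} Y" "Y 0 = x" "Y 1 = y" "Y ` {0..1} \<subseteq> D\<Omega>"
    using R unfolding reachable_def by blast
  have L0: "0 \<le> L" by (rule reachable_nonneg[OF R])
  have "compact (Y ` {0..1})" by (rule compact_continuous_image[OF lipschitz_on_continuous_on[OF Y(1)]]) simp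
  from compact_subset_open_imp_cball_epsilon_subset[OF this open_interior Y(4)]
  obtain d where d: "0 < d" "(\<Union>z\<in>Y ` {0..1}. cball z d) \<subseteq> D\<Omega>" by blast
  obtain n :: nat where n: "L / d < real n" using reals_Archimedean2 by blast
  then have n0: "0 < real n" using L0 d(1) by (smt (verit) divide_nonneg_pos)
  have Ld: "L / real n \<le> d" using n d(1) n0 by (simp add: field_simps)
  have step: "f (Y (real i / n)) - f (Y (real (Suc i) / n)) \<le> L / n" if i: "i < n" for i
  proof -
    have t: "real i / n \<in> {0..1}" "real (Suc i) / n \<in> {0..1}" using i by (auto simp: divide_le_eq_1)
    have "dist (Y (real i / n)) (Y (real (Suc i) / n)) \<le> L * dist (real i / n) (real (Suc i) / n)"
      by (rule lipschitz_onD[OF Y(1) t])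
    also have "dist (real i / n) (real (Suc i) / n) = 1 / n" by (simp add: dist_real_def diff_divide_distrib[symmetric])
    finally have le: "dist (Y (real i / n)) (Y (real (Suc i) / n)) \<le> L / n" by simp
    have "closed_segment (Y (real i / n)) (Y (real (Suc i) / n)) \<subseteq> cball (Y (real i / n)) d"
      using le Ld d(1) by (intro closed_segment_subset) auto
    also have "\<dots> \<subseteq> D\<Omega>" using d(2) t(1) by blast
    finally show ?thesis using D_0_segment[OF f] le by (meson order_trans)
  qed
  have "f (Y 0) - f (Y (real k / n)) \<le> real k * (L / n)" if "k \<le> n" for k
    using that
  proof (induction k)
    case (Suc k)
    then have "f (Y 0) - f (Y (real k / n)) \<le> real k * (L / n)" "f (Y (real k / n)) - f (Y (real (Suc k) / n)) \<le> L / n"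
      using step[of k] by auto
    moreover have "real (Suc k) * (L / n) = real k * (L / n) + L / n" by (simp add: distrib_right add.commute add_divide_distrib)
    ultimately show ?case by linarith
  qed simp
  from this[of n] show ?thesis using n0 Y(2,3) by simp
qed

text \<open>Pushing the curve into the interior changes its length by a factor near \<open>1\<close> and its ends, hence the
  values of \<open>f\<close> there, only slightly.\<close>

lemma D_0_le_reachable:
  assumes f: "f \<in> D_0 \<Omega> a" and R: "reachable \<Omega> x y L"
  shows "f x - f y \<le> L"
proof (rule field_le_epsilon)
  fix e :: real assume e: "0 < e"
  have L0: "0 \<le> L" by (rule reachable_nonneg[OF R])
  have xy: "x \<in> \<Omega>" "y \<in> \<Omega>" using reachable_mem[OF R] by auto
  have cont: "continuous_on \<Omega> f" using f D_bcD(3) by (simp add: D_0_def)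
  have e3: "0 < e / 3" using e by simp
  obtain s1 where s1: "0 < s1" "\<And>z. z \<in> \<Omega> \<Longrightarrow> dist z x < s1 \<Longrightarrow> dist (f z) (f x) < e / 3"
    using cont xy(1) e3 unfolding continuous_on_iff by metis
  obtain s2 where s2: "0 < s2" "\<And>z. z \<in> \<Omega> \<Longrightarrow> dist z y < s2 \<Longrightarrow> dist (f z) (f y) < e / 3"
    using cont xy(2) e3 unfolding continuous_on_iff by metis
  \<comment> \<open>The error \<open>e\<close> is shared by the length and the two ends of the curve.\<close>
  define \<eta> where "\<eta> = min (e / 3 / (L + 1)) (min (s1 / 2) (s2 / 2))"
  have \<eta>: "0 < \<eta>" "\<eta> < s1" "\<eta> < s2" using e3 s1 s2 L0 by (auto simp: \<eta>_def)
  have "\<eta> * L \<le> e / 3"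
  proof -
    have "\<eta> * L \<le> \<eta> * (L + 1)" using \<eta> by (intro mult_left_mono) auto
    also have "\<dots> \<le> e / 3 / (L + 1) * (L + 1)" using L0 by (intro mult_right_mono) (auto simp: \<eta>_def)
    also have "\<dots> = e / 3"
    proof -
      have "q / p * p = q" if "0 < p" for p q :: real using that by simp
      then show ?thesis using L0 by (metis add_nonneg_pos zero_less_one)
    qed
    finally show ?thesis .
  qed
  obtain T where T: "(1 + \<eta>)-lipschitz_on UNIV T" "\<And>x. dist (T x) x \<le> \<eta>" "\<And>x. x \<in> \<Omega> \<Longrightarrow> T x \<in> D\<Omega>"
    using push_into_interior[OF \<eta>(1)] by metis
  have "reachable D\<Omega> (T x) (T y) ((1 + \<eta>) * L)"
    by (rule reachable_image[OF R lipschitz_on_subset[OF T(1)]]) (use T(3) in auto)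
  from D_0_interior_reachable[OF f this] have "f (T x) - f (T y) \<le> L + \<eta> * L" by (simp add: distrib_right)
  moreover have "dist (f (T x)) (f x) < e / 3"
    by (rule s1(2)) (use T(2)[of x] T(3)[OF xy(1)] \<eta> interior_subset in auto)
  moreover have "dist (f (T y)) (f y) < e / 3"
    by (rule s2(2)) (use T(2)[of y] T(3)[OF xy(2)] \<eta> interior_subset in auto)
  ultimately show "f x - f y \<le> L + e" using \<open>\<eta> * L \<le> e / 3\<close> unfolding dist_real_def by linarith
qed

text \<open>The function \<open>z \<mapsto> domain_dist \<Omega> (T y) (T z)\<close> is defined and locally Lipschitz with constant \<open>1 + \<eta>\<close> on
  a neighbourhood \<open>W\<close> of the domain. Hence its mollifications are continuously differentiable up to the boundary with
  gradient at most \<open>1 + \<eta>\<close>. The smaller neighbourhood \<open>V\<close> leaves room for segments and for the mollifier.\<close>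

lemma near_distance_in_D_0:
  assumes \<eta>: "0 < \<eta>" and y: "y \<in> \<Omega>" and K: "(1 + \<eta>)-lipschitz_on UNIV T" and T: "\<And>x. x \<in> \<Omega> \<Longrightarrow> T x \<in> D\<Omega>"
  obtains u where "u \<in> D_0 \<Omega> a" "\<And>x. x \<in> \<Omega> \<Longrightarrow> domain_dist \<Omega> (T y) (T x) \<le> (1 + \<eta>) * (u x - u y + 2 * \<eta>)"
proof -
  obtain \<delta> where \<delta>: "0 < \<delta>" "\<And>x z. x \<in> \<Omega> \<Longrightarrow> dist x z < \<delta> \<Longrightarrow> T z \<in> interior \<Omega>"
    using push_neighbourhood[OF K T] by metis
  have \<Omega>ne: "\<Omega> \<noteq> {}" using y by blast
  have near: "\<exists>x\<in>\<Omega>. dist x z = infdist z \<Omega>" for z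
    using infdist_attains_inf[OF closed_domain \<Omega>ne, of z] by (metis dist_commute)
  define W where "W = {z. infdist z \<Omega> < \<delta>}"
  define V where "V = {z. infdist z \<Omega> \<le> \<delta> / 2}"
  have TW: "T z \<in> D\<Omega>" if "z \<in> W" for z using near[of z] \<delta>(2) that by (auto simp: W_def)
  have VW: "V \<subseteq> W" using \<delta>(1) by (auto simp: V_def W_def)
  have ball_W: "cball x s \<subseteq> W" if "x \<in> \<Omega>" "s < \<delta>" for x s

  proof
    fix z assume "z \<in> cball x s"
    then show "z \<in> W" using that(2) infdist_le[OF that(1), of z] by (simp add: W_def dist_commute)
  qed
  have ball_V: "z \<in> V" if "x \<in> \<Omega>" "dist x z \<le> \<delta> / 2" for x z
    using that infdist_le[OF that(1), of z] by (auto simp: V_def dist_commute)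
  define k where "k z = domain_dist \<Omega> (T y) (T z)" for z
  have yW: "y \<in> W" using ball_W[OF y, of 0] \<delta>(1) by auto
  have kR: "reachable \<Omega> (T y) (T z) (k z)" if "z \<in> W" for z
  proof -
    have "T y \<in> \<Omega>" "T z \<in> \<Omega>" using TW[OF yW] TW[OF that] interior_subset by auto
    then show ?thesis unfolding k_def using domain_reachable domain_dist_reachable(1)[OF compact_domain] by blast
  qed
  have k_step: "k z' \<le> k z + (1 + \<eta>) * dist z z'" if s: "closed_segment z z' \<subseteq> W" for z z'
  proof -
    have z: "z \<in> W" using s by auto
    have "reachable \<Omega> (T z) (T z') ((1 + \<eta>) * dist z z')"
      by (rule reachable_image[OF reachable_segment[OF s] lipschitz_on_subset[OF K]]) (use TW interior_subset in auto)
    note rr = reachable_trans[OF kR[OF z] this]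
    show ?thesis unfolding k_def[of z'] by (rule domain_dist_reachable(2)[OF compact_domain rr rr])
  qed
  have k_lip: "\<bar>k z - k z'\<bar> \<le> (1 + \<eta>) * dist z z'" if s: "closed_segment z z' \<subseteq> W" for z z'
    using k_step[OF s] k_step[of z' z] s by (simp add: closed_segment_commute dist_commute abs_le_iff)
  have seg: "closed_segment z z' \<subseteq> W" if "z \<in> V" "dist z z' < \<delta> / 2" for z z'
  proof
    fix w assume w: "w \<in> closed_segment z z'"
    then have "dist z w \<le> dist z z'" by (metis dist_commute dist_in_closed_segment(1))
    moreover have "infdist w \<Omega> \<le> infdist z \<Omega> + dist w z" by (rule infdist_triangle)
    ultimately show "w \<in> W" using that by (simp add: V_def W_def dist_commute)
  qed
  have kc: "continuous_on V k"
    unfolding continuous_on_iff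
  proof (intro ballI allI impI)
    fix z and e :: real assume z: "z \<in> V" and e: "0 < e"
    have "dist (k z') (k z) < e" if "dist z' z < min (\<delta> / 2) (e / (1 + \<eta>))" for z'
    proof -
      have "\<bar>k z - k z'\<bar> \<le> (1 + \<eta>) * dist z z'" by (rule k_lip[OF seg[OF z]]) (use that in \<open>simp add: dist_commute\<close>)
      also have "\<dots> < e" using that \<eta> by (simp add: pos_less_divide_eq dist_commute mult.commute)
      finally show ?thesis by (simp add: dist_real_def abs_minus_commute)
    qed
    then show "\<exists>d>0. \<forall>z'\<in>V. dist z' z < d \<longrightarrow> dist (k z') (k z) < e"
      using \<delta>(1) e \<eta> by (intro exI[of _ "min (\<delta> / 2) (e / (1 + \<eta>))"]) auto
  qed
  have cV: "compact V"
  proof (rule compact_eq_bounded_closed[THEN iffD2, OF conjI])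
    show "closed V" unfolding V_def by (intro closed_Collect_le continuous_intros)
    obtain B where B: "\<forall>x\<in>\<Omega>. norm x \<le> B" using compact_imp_bounded[OF compact_domain] by (auto simp: bounded_iff)
    have "norm z \<le> B + \<delta> / 2" if "z \<in> V" for z
    proof -
      obtain x where x: "x \<in> \<Omega>" "dist x z = infdist z \<Omega>" using near by blast
      have "norm z \<le> norm x + dist x z" using norm_triangle_sub[of z x] by (simp add: dist_norm norm_minus_commute)
      then show ?thesis using B x that by (force simp: V_def)
    qed
    then show "bounded V" by (auto simp: bounded_iff)
  qed
  have V_sets: "V \<in> sets borel" by (rule borel_compact[OF cV])
  define g where "g z = indicator V z * k z" for z
  have gm [measurable]: "g \<in> borel_measurable borel"
    using borel_measurable_continuous_on_indicator[OF V_sets kc] by (simp add: g_def[abs_def])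
  obtain B where B: "0 \<le> B" "\<And>z. \<bar>g z\<bar> \<le> B"
  proof -
    obtain B where "\<forall>z\<in>V. norm (k z) \<le> B"
      using compact_imp_bounded[OF compact_continuous_image[OF kc cV]] by (auto simp: bounded_iff)
    then have "\<bar>g z\<bar> \<le> max B 0" for z by (cases "z \<in> V") (auto simp: g_def)
    then show thesis using that[of "max B 0"] by simp
  qed
  have gi: "integrable lborel g"
  proof (rule Bochner_Integration.integrable_bound)
    show "integrable lborel (\<lambda>z. B * indicator V z :: real)"
      using V_sets emeasure_compact_finite[OF cV] by (intro integrable_mult_right integrable_real_indicator) auto
    show "AE z in lborel. norm (g z) \<le> norm (B * indicator V z)"
    proof (rule AE_I2)
      show "norm (g z) \<le> norm (B * indicator V z)" for z using B(1) B(2)[of z] by (cases "z \<in> V") (auto simp: g_def)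
    qed
  qed simp
  \<comment> \<open>A point within \<open>\<delta> / 4\<close> of the domain, shifted by less than \<open>r\<close>, stays in \<open>V\<close>.\<close>
  define r where "r = min \<eta> (\<delta> / 4)"
  have r: "0 < r" "r \<le> \<eta>" "r \<le> \<delta> / 4" using \<eta> \<delta>(1) by (auto simp: r_def)
  define G where "G x = (LINT z|lborel. g z *\<^sub>R moll_grad r (x - z))" for x
  have C: "C1_grad UNIV (mollify r g) G" unfolding G_def[abs_def] by (rule C1_grad_mollify[OF less_imp_le[OF r(1)] gi])
  have g_lip: "\<bar>g z - g z'\<bar> \<le> (1 + \<eta>) * dist z z'" if "x \<in> \<Omega>" "dist x z \<le> \<delta> / 2" "dist x z' \<le> \<delta> / 2" "dist z z' < \<delta> / 2" for x z z'
    using ball_V[OF that(1,2)] ball_V[OF that(1,3)] k_lip[OF seg] that(4) by (simp add: g_def)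
  have G_le: "norm (G x) \<le> 1 + \<eta>" if x: "x \<in> \<Omega>" for x
  proof (rule norm_gradient_le[OF C1_gradD(1)[OF C UNIV_I]])
    show "0 < \<delta> / 4" "0 \<le> 1 + \<eta>" using \<delta>(1) \<eta> by auto
    fix x' assume x': "dist x x' < \<delta> / 4"
    have "\<bar>mollify r g x' - mollify r g x\<bar> \<le> (1 + \<eta>) * dist x x'"
    proof (rule mollify_diff_le[OF r(1) gm B(2)])
      fix w :: 'a assume w: "norm w < r"
      have "dist x (x' - w) \<le> dist x x' + norm w" using norm_triangle_ineq[of "x - x'" w] by (simp add: dist_norm algebra_simps)
      then have "\<bar>g (x' - w) - g (x - w)\<bar> \<le> (1 + \<eta>) * dist (x' - w) (x - w)"
        using w r x' \<delta>(1) by (intro g_lip[OF x]) (auto simp: dist_norm norm_minus_commute)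
      then show "\<bar>g (x' - w) - g (x - w)\<bar> \<le> (1 + \<eta>) * dist x x'" by (simp add: dist_norm norm_minus_commute)
    qed
    then show "\<bar>mollify r g x' - mollify r g x\<bar> \<le> (1 + \<eta>) * dist x x'" .
  qed
  have g_close: "\<bar>mollify r g x - k x\<bar> \<le> (1 + \<eta>) * \<eta>" if x: "x \<in> \<Omega>" for x
  proof (rule mollify_close[OF r(1) gm])
    fix z assume z: "dist x z < r"
    have "x \<in> V" by (rule ball_V[OF x]) (use \<delta>(1) in simp)
    then have "\<bar>g z - k x\<bar> \<le> (1 + \<eta>) * dist z x" using g_lip[OF x, of z x] z r \<delta>(1) by (simp add: g_def dist_commute)
    also have "\<dots> \<le> (1 + \<eta>) * \<eta>" using z r \<eta> by (intro mult_left_mono) (auto simp: dist_commute)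
    finally show "\<bar>g z - k x\<bar> \<le> (1 + \<eta>) * \<eta>" .
  qed
  let ?u = "\<lambda>x. mollify r g x / (1 + \<eta>)"
  have rep: "C1_rep (mollify r g) (mollify r g) G" using C by (simp add: C1_rep_def)
  then have mC: "mollify r g \<in> C1_fun \<Omega>" using C1_fun_iff by blast
  have \<psi>: "((\<lambda>t. t / (1 + \<eta>)) has_field_derivative 1 / (1 + \<eta>)) (at t)" for t by (intro DERIV_cdivide DERIV_ident)
  have c\<psi>: "continuous_on UNIV (\<lambda>t::real. 1 / (1 + \<eta>))" by simp
  have "?u \<in> D_0 \<Omega> a"
  proof (rule C1_contraction_in_D_0)
    show "?u \<in> C1_fun \<Omega>" by (rule form_grad_compose(1)[OF mC y \<psi> c\<psi>])
    fix x assume x: "x \<in> \<Omega>"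
    have "norm (form_grad (mollify r g) x) \<le> 1 + \<eta>"
      unfolding form_grad_eq[OF rep x] using norm_proj_le[of x "G x"] G_le[OF x] by linarith
    then show "norm (form_grad ?u x) \<le> 1" unfolding form_grad_compose(2)[OF mC x \<psi> c\<psi>] using \<eta> by simp
  qed
  moreover have "domain_dist \<Omega> (T y) (T x) \<le> (1 + \<eta>) * (?u x - ?u y + 2 * \<eta>)" if x: "x \<in> \<Omega>" for x
  proof -
    have "k y \<le> 0"
      unfolding k_def using domain_dist_reachable(2)[OF compact_domain] reachable_refl TW[OF yW] interior_subset by blast
    then have "k x \<le> mollify r g x - mollify r g y + 2 * ((1 + \<eta>) * \<eta>)" using g_close[OF x] g_close[OF y] by linarith
    also have "\<dots> = (1 + \<eta>) * (?u x - ?u y + 2 * \<eta>)"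
    proof -
      have "(1 + \<eta>) * (t / (1 + \<eta>)) = t" for t using \<eta> by simp
      then show ?thesis by (simp only: distrib_left right_diff_distrib mult.left_commute[of 2])
    qed
    finally show ?thesis by (simp add: k_def)
  qed
  ultimately show thesis by (rule that)
qed

lemma domain_dist_le_D_0_bound:
  assumes xy: "x \<in> \<Omega>" "y \<in> \<Omega>" and S: "\<And>u. u \<in> D_0 \<Omega> a \<Longrightarrow> u x - u y \<le> S"
  shows "domain_dist \<Omega> x y \<le> S"
proof -
  define \<eta> where "\<eta> n = 1 / real (Suc n)" for n
  have \<eta>: "0 < \<eta> n" for n by (simp add: \<eta>_def)
  have \<eta>0: "\<eta> \<longlonglongrightarrow> 0" unfolding \<eta>_def[abs_def] by (rule LIMSEQ_Suc[OF lim_1_over_n])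
  have "\<exists>T. (1 + \<eta> n)-lipschitz_on UNIV T \<and> (\<forall>x. dist (T x) x \<le> \<eta> n) \<and> (\<forall>x\<in>\<Omega>. T x \<in> D\<Omega>)" for n
    using push_into_interior[OF \<eta>[of n]] by metis
  then obtain T where T: "\<And>n. (1 + \<eta> n)-lipschitz_on UNIV (T n)" "\<And>n x. dist (T n x) x \<le> \<eta> n" "\<And>n x. x \<in> \<Omega> \<Longrightarrow> T n x \<in> D\<Omega>"
    by metis
  have R: "reachable \<Omega> (T n y) (T n x) ((1 + \<eta> n) * (S + 2 * \<eta> n))" for n
  proof -
    obtain u where u: "u \<in> D_0 \<Omega> a" "\<And>x. x \<in> \<Omega> \<Longrightarrow> domain_dist \<Omega> (T n y) (T n x) \<le> (1 + \<eta> n) * (u x - u y + 2 * \<eta> n)"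
      using near_distance_in_D_0[OF \<eta> xy(2) T(1) T(3), of n] by metis
    have "domain_dist \<Omega> (T n y) (T n x) \<le> (1 + \<eta> n) * (u x - u y + 2 * \<eta> n)" by (rule u(2)[OF xy(1)])
    also have "\<dots> \<le> (1 + \<eta> n) * (S + 2 * \<eta> n)" using S[OF u(1)] \<eta>[of n] by (intro mult_left_mono) auto
    finally have le: "domain_dist \<Omega> (T n y) (T n x) \<le> (1 + \<eta> n) * (S + 2 * \<eta> n)" .
    have "T n x \<in> \<Omega>" "T n y \<in> \<Omega>" using T(3) xy interior_subset by auto
    then have "reachable \<Omega> (T n y) (T n x) (domain_dist \<Omega> (T n y) (T n x))"
      using domain_reachable domain_dist_reachable(1)[OF compact_domain] by blast
    then show ?thesis using reachable_mono le by blast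
  qed
  have "(\<lambda>n. T n z) \<longlonglongrightarrow> z" for z
    by (rule metric_tendsto_imp_tendsto[OF \<eta>0]) (use T(2) \<eta> in \<open>auto intro!: always_eventually simp: less_imp_le\<close>)
  note lim = this
  have "(\<lambda>n. (1 + \<eta> n) * (S + 2 * \<eta> n)) \<longlonglongrightarrow> (1 + 0) * (S + 2 * 0)" by (intro tendsto_intros \<eta>0)
  then have "reachable \<Omega> y x S" using reachable_limit[OF compact_domain R _ lim lim] by simp
  then have "reachable \<Omega> x y S" by (rule reachable_sym)
  then show ?thesis using domain_dist_reachable(2)[OF compact_domain] by blast
qed

lemma intrinsic_dist_eq:
  assumes xy: "x \<in> \<Omega>" "y \<in> \<Omega>"
  shows "intrinsic_dist \<Omega> a x y = ereal (domain_dist \<Omega> x y)"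
proof (rule antisym)
  obtain L where L: "reachable \<Omega> x y L" using domain_reachable[OF xy] by blast
  show le: "intrinsic_dist \<Omega> a x y \<le> ereal (domain_dist \<Omega> x y)"
    unfolding intrinsic_dist_def
    by (rule SUP_least) (use D_0_le_reachable domain_dist_reachable(1)[OF compact_domain L] in auto)
  have up: "ereal (u x - u y) \<le> intrinsic_dist \<Omega> a x y" if "u \<in> D_0 \<Omega> a" for u
    unfolding intrinsic_dist_def by (rule SUP_upper[OF that])
  show "ereal (domain_dist \<Omega> x y) \<le> intrinsic_dist \<Omega> a x y"
  proof (rule ereal_le_real)
    fix S assume S: "intrinsic_dist \<Omega> a x y \<le> ereal S"
    have "domain_dist \<Omega> x y \<le> S"
    proof (rule domain_dist_le_D_0_bound[OF xy])
      fix u assume "u \<in> D_0 \<Omega> a"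
      from order_trans[OF up[OF this] S] show "u x - u y \<le> S" by simp
    qed
    then show "ereal (domain_dist \<Omega> x y) \<le> ereal S" by simp
  qed
qed

end

theorem proposition4p1:
  fixes \<Omega> :: "'a::euclidean_space set" and a :: real
  assumes "DIM('a) \<ge> 2"
    and "compact \<Omega>" and "connected \<Omega>" and "interior \<Omega> \<noteq> {}"
    and "smooth_boundary \<Omega>" and "connected (frontier \<Omega>)"
    and "0 < a" and "a \<le> 1"
  shows "\<forall>x\<in>\<Omega>. \<forall>y\<in>\<Omega>.
    intrinsic_dist \<Omega> a x y = ereal (domain_dist \<Omega> x y) \<and>
    (\<exists>X \<in> curves \<Omega> x y. curve_length X = domain_dist \<Omega> x y \<and>
       (\<forall>Y \<in> curves \<Omega> x y. curve_length X \<le> curve_length Y)) \<and>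
    (convex \<Omega> \<longrightarrow> domain_dist \<Omega> x y = dist x y)"
proof (intro ballI conjI impI)
  interpret dirichlet_domain \<Omega> a by unfold_locales (use assms in auto)
  fix x y assume xy: "x \<in> \<Omega>" "y \<in> \<Omega>"
  obtain L where L: "reachable \<Omega> x y L" using domain_reachable[OF xy] by blast
  note dd = domain_dist_reachable[OF compact_domain L]
  show "intrinsic_dist \<Omega> a x y = ereal (domain_dist \<Omega> x y)" by (rule intrinsic_dist_eq[OF xy])
  show "\<exists>X \<in> curves \<Omega> x y. curve_length X = domain_dist \<Omega> x y \<and>
       (\<forall>Y \<in> curves \<Omega> x y. curve_length X \<le> curve_length Y)"
    using dd(3,4) by fastforce
  show "domain_dist \<Omega> x y = dist x y" if "convex \<Omega>"
  proof (rule antisym)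
    show "domain_dist \<Omega> x y \<le> dist x y" by (rule dd(2)[OF reachable_segment[OF closed_segment_subset[OF xy that]]])
    show "dist x y \<le> domain_dist \<Omega> x y" by (rule reachable_dist_le[OF dd(1)])
  qed
qed

end
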